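(* Let $(R,{}^-)$ be a unital associative $\Bbbk$-superalgebra with superinvolution such that $R$ contains a homogeneous element $e$ with $\bar e=-e$, $e$ in the center of $R$, and $e$ a unit of $R$. Then the central extension $\psi':\widehat{\mathfrak{sto}}_{2|2}(R,{}^-)\to\mathfrak{sto}_{2|2}(R,{}^-)$ (the canonical projection) is universal.
   Context: **Base conventions.** $\Bbbk$ is a unital commutative associative ring in which $2$ is invertible; all modules and (super)algebras are over $\Bbbk$. Superalgebras are $\mathbb{Z}/2\mathbb{Z}$-graded, $|x|$ is the degree of a homogeneous $x$, and formulas involving degrees are for homogeneous elements, extended linearly. A Lie superalgebra has an even bilinear bracket with $[x,y]=-(-1)^{|x||y|}[y,x]$ and $(-1)^{|x||z|}[[x,y],z]+(-1)^{|y||x|}[[y,z],x]+(-1)^{|z||y|}[[z,x],y]=0$. A superinvolution on $R$ is a degree-preserving $\Bbbk$-linear map $a\mapsto\bar a$ with $\overline{ab}=(-1)^{|a||b|}\bar b\bar a$, $\bar{\bar a}=a$. In $R$, $[a,b]=ab-(-1)^{|a||b|}ba$. **$\mathfrak{sto}_{2|2}(R,{}^-)$** (Steinberg orthosymplectic Lie superalgebra with $m=2,n=1$): the Lie superalgebra generated by $\mathbf t_{12}(a),\mathbf t_{21}(a)$ of degree $|a|$ and $\mathbf f_{11}(a),\mathbf f_{21}(a),\mathbf g_{11}(a),\mathbf g_{12}(a)$ of degree $1+|a|$, $a\in R$ homogeneous, with relations: all generators are $\Bbbk$-linear in $a$; $\mathbf t_{ij}(a)=-\mathbf t_{ji}(\bar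 a)$; $[\mathbf t_{ij}(a),\mathbf f_{i'1}(b)]=\delta_{i'j}\mathbf f_{i1}(ab)-\delta_{i'i}\mathbf f_{j1}(\bar ab)$; $[\mathbf g_{1i'}(a),\mathbf t_{ij}(b)]=\delta_{i'i}\mathbf g_{1j}(ab)-\delta_{i'j}\mathbf g_{1i}(a\bar b)$; $[\mathbf f_{i1}(a),\mathbf f_{j1}(b)]=0$; $[\mathbf g_{1i}(a),\mathbf g_{1j}(b)]=0$; $[\mathbf f_{i1}(a),\mathbf g_{1j}(b)]=\mathbf t_{ij}(ab)$; where $i,j,i'\in\{1,2\}$ with $i\neq j$. Put $\mathbf h_{i1}(a,b)=[\mathbf f_{i1}(a),\mathbf g_{1i}(b)]$, $\mathbf v_1(a)=-[\mathbf g_{11}(a),\mathbf g_{11}(1)]$, $\mathbf w_1(a)=[\mathbf f_{11}(1),\mathbf f_{11}(a)]$. The set $\mathfrak B=\{\mathbf h_{i1}(a,b),\mathbf t_{12}(a),\mathbf v_1(a),\mathbf w_1(a),\mathbf f_{i1}(a),\mathbf g_{1i}(a): i=1,2,\ a,b\in R\}$ spans $\mathfrak{sto}_{2|2}(R,{}^-)$ as a $\Bbbk$-module. **$\widehat{\mathfrak{sto}}_{2|2}(R,{}^-)$.** Let $[R,R]R$ be the span of all $[a,b]c$, and $\boldsymbol\pi(a)$ the class of $a$ in $R/([R,R]R)$. There is a 2-cocycle (bilinear map) $\beta:\mathfrak{sto}_{2|2}(R,{}^-)\times\mathfrak{sto}_{2|2}(R,{}^-)\to R/([R,R]R)$ with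 $\beta(\mathbf f_{11}(a),\mathbf g_{12}(b))=-(-1)^{(1+|a|)(1+|b|)}\beta(\mathbf g_{12}(b),\mathbf f_{11}(a))=\boldsymbol\pi(a\bar b)$, $\beta(\mathbf f_{21}(a),\mathbf g_{11}(b))=-(-1)^{(1+|a|)(1+|b|)}\beta(\mathbf g_{11}(b),\mathbf f_{21}(a))=-\boldsymbol\pi(a\bar b)$, and $\beta(x,y)=0$ for all other pairs of elements of $\mathfrak B$. Then $\widehat{\mathfrak{sto}}_{2|2}(R,{}^-)=\mathfrak{sto}_{2|2}(R,{}^-)\oplus R/([R,R]R)$ with bracket $[x\oplus c,y\oplus c']=[x,y]\oplus\beta(x,y)$, and $\psi'(x\oplus c)=x$. **Central extensions.** A central extension is a surjective homomorphism of Lie superalgebras whose kernel lies in the center of the source. A central extension $\psi:\mathfrak g\to L$ is universal if for every central extension $\varphi:\mathfrak E\to L$ there is a unique homomorphism $\varphi':\mathfrak g\to\mathfrak E$ with $\varphi\circ\varphi'=\psi$. *)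

theory Defs
  imports "HOL-Algebra.Module" "HOL-Algebra.QuotRing" "HOL-Library.Z2"
begin

section \<open>Superalgebras\<close>

text \<open>
  Degrees live in the two-element field \<^typ>\<open>bit\<close>, so that \<open>p + q\<close> and \<open>p * q\<close> are computed
  modulo 2.  The field \<^const>\<open>mult\<close> carries the product of an arbitrary, possibly non-associative,
  superalgebra; for a Lie superalgebra it is the bracket, and \<^const>\<open>one\<close> is then meaningless.
\<close>

record ('a, 'b) superalgebra = "('a, 'b) module" +
  grade :: "bit \<Rightarrow> 'b set"

text \<open>\<open>ksign M p x\<close> is \<open>(-1)\<^sup>p x\<close>.\<close>

definition ksign :: "('a, 'm) ring_scheme \<Rightarrow> bit \<Rightarrow> 'a \<Rightarrow> 'a" where
  "ksign M p x = (if p = 1 then \<ominus>\<^bsub>M\<^esub> x else x)"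

definition homogeneous :: "('k, 'a, 'm) superalgebra_scheme \<Rightarrow> 'a set" where
  "homogeneous M = (\<Union>p. grade M p)"

locale supermodule = module K M
  for K :: "('k, 'n) ring_scheme" (structure)
    and M :: "('k, 'a, 'm) superalgebra_scheme" (structure) +
  assumes grade_submodule: "submodule (grade M p) K M"
    and grade_sum: "carrier M = grade M 0 <+>\<^bsub>M\<^esub> grade M 1"
    and grade_disjoint: "grade M 0 \<inter> grade M 1 = {\<zero>\<^bsub>M\<^esub>}"

locale superalgebra = supermodule K A
  for K :: "('k, 'n) ring_scheme" (structure)
    and A :: "('k, 'a, 'm) superalgebra_scheme" (structure) +
  assumes prod_closed: "\<lbrakk>x \<in> carrier A; y \<in> carrier A\<rbrakk> \<Longrightarrow> x \<otimes>\<^bsub>A\<^esub> y \<in> carrier A"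
    and prod_add_left: "\<lbrakk>x \<in> carrier A; y \<in> carrier A; z \<in> carrier A\<rbrakk> \<Longrightarrow>
      (x \<oplus>\<^bsub>A\<^esub> y) \<otimes>\<^bsub>A\<^esub> z = (x \<otimes>\<^bsub>A\<^esub> z) \<oplus>\<^bsub>A\<^esub> (y \<otimes>\<^bsub>A\<^esub> z)"
    and prod_add_right: "\<lbrakk>x \<in> carrier A; y \<in> carrier A; z \<in> carrier A\<rbrakk> \<Longrightarrow>
      z \<otimes>\<^bsub>A\<^esub> (x \<oplus>\<^bsub>A\<^esub> y) = (z \<otimes>\<^bsub>A\<^esub> x) \<oplus>\<^bsub>A\<^esub> (z \<otimes>\<^bsub>A\<^esub> y)"
    and prod_smult_left: "\<lbrakk>c \<in> carrier K; x \<in> carrier A; y \<in> carrier A\<rbrakk> \<Longrightarrow>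
      (c \<odot>\<^bsub>A\<^esub> x) \<otimes>\<^bsub>A\<^esub> y = c \<odot>\<^bsub>A\<^esub> (x \<otimes>\<^bsub>A\<^esub> y)"
    and prod_smult_right: "\<lbrakk>c \<in> carrier K; x \<in> carrier A; y \<in> carrier A\<rbrakk> \<Longrightarrow>
      x \<otimes>\<^bsub>A\<^esub> (c \<odot>\<^bsub>A\<^esub> y) = c \<odot>\<^bsub>A\<^esub> (x \<otimes>\<^bsub>A\<^esub> y)"
    and prod_grade: "\<lbrakk>x \<in> grade A p; y \<in> grade A q\<rbrakk> \<Longrightarrow> x \<otimes>\<^bsub>A\<^esub> y \<in> grade A (p + q)"

locale assoc_superalgebra = superalgebra K R + ring R
  for K :: "('k, 'n) ring_scheme" (structure)
    and R :: "('k, 'a, 'm) superalgebra_scheme" (structure)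

locale superinvolution = assoc_superalgebra K R
  for K :: "('k, 'n) ring_scheme" (structure)
    and R :: "('k, 'a, 'm) superalgebra_scheme" (structure)
    and bar :: "'a \<Rightarrow> 'a" +
  assumes bar_grade: "a \<in> grade R p \<Longrightarrow> bar a \<in> grade R p"
    and bar_add: "\<lbrakk>a \<in> carrier R; b \<in> carrier R\<rbrakk> \<Longrightarrow> bar (a \<oplus>\<^bsub>R\<^esub> b) = bar a \<oplus>\<^bsub>R\<^esub> bar b"
    and bar_smult: "\<lbrakk>c \<in> carrier K; a \<in> carrier R\<rbrakk> \<Longrightarrow> bar (c \<odot>\<^bsub>R\<^esub> a) = c \<odot>\<^bsub>R\<^esub> bar a"
    and bar_mult: "\<lbrakk>a \<in> grade R p; b \<in> grade R q\<rbrakk> \<Longrightarrow>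
      bar (a \<otimes>\<^bsub>R\<^esub> b) = ksign R (p * q) (bar b \<otimes>\<^bsub>R\<^esub> bar a)"
    and bar_bar: "a \<in> carrier R \<Longrightarrow> bar (bar a) = a"

locale lie_superalgebra = superalgebra K L
  for K :: "('k, 'n) ring_scheme" (structure)
    and L :: "('k, 'a, 'm) superalgebra_scheme" (structure) +
  assumes skew: "\<lbrakk>x \<in> grade L p; y \<in> grade L q\<rbrakk> \<Longrightarrow>
      x \<otimes>\<^bsub>L\<^esub> y = \<ominus>\<^bsub>L\<^esub> (ksign L (p * q) (y \<otimes>\<^bsub>L\<^esub> x))"
    and jacobi: "\<lbrakk>x \<in> grade L p; y \<in> grade L q; z \<in> grade L r\<rbrakk> \<Longrightarrow>
      ksign L (p * r) ((x \<otimes>\<^bsub>L\<^esub> y) \<otimes>\<^bsub>L\<^esub> z)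
      \<oplus>\<^bsub>L\<^esub> ksign L (q * p) ((y \<otimes>\<^bsub>L\<^esub> z) \<otimes>\<^bsub>L\<^esub> x)
      \<oplus>\<^bsub>L\<^esub> ksign L (r * q) ((z \<otimes>\<^bsub>L\<^esub> x) \<otimes>\<^bsub>L\<^esub> y) = \<zero>\<^bsub>L\<^esub>"

section \<open>Central extensions\<close>

definition lie_hom ::
    "('k, 'n) ring_scheme \<Rightarrow> ('k, 'a) superalgebra \<Rightarrow> ('k, 'b) superalgebra \<Rightarrow> ('a \<Rightarrow> 'b) set" where
  "lie_hom K L M = {f \<in> carrier L \<rightarrow> carrier M.
     (\<forall>x\<in>carrier L. \<forall>y\<in>carrier L. f (x \<oplus>\<^bsub>L\<^esub> y) = f x \<oplus>\<^bsub>M\<^esub> f y) \<and>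
     (\<forall>c\<in>carrier K. \<forall>x\<in>carrier L. f (c \<odot>\<^bsub>L\<^esub> x) = c \<odot>\<^bsub>M\<^esub> f x) \<and>
     (\<forall>x\<in>carrier L. \<forall>y\<in>carrier L. f (x \<otimes>\<^bsub>L\<^esub> y) = f x \<otimes>\<^bsub>M\<^esub> f y) \<and>
     (\<forall>p. \<forall>x\<in>grade L p. f x \<in> grade M p)}"

definition lie_center :: "('k, 'a) superalgebra \<Rightarrow> 'a set" where
  "lie_center L = {z \<in> carrier L. \<forall>x\<in>carrier L. z \<otimes>\<^bsub>L\<^esub> x = \<zero>\<^bsub>L\<^esub>}"

definition central_extension ::
    "('k, 'n) ring_scheme \<Rightarrow> ('k, 'a) superalgebra \<Rightarrow> ('k, 'b) superalgebra \<Rightarrow> ('a \<Rightarrow> 'b) \<Rightarrow> bool" where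
  "central_extension K E L \<phi> \<longleftrightarrow>
     lie_superalgebra K E \<and> lie_superalgebra K L \<and>
     \<phi> \<in> lie_hom K E L \<and> \<phi> ` carrier E = carrier L \<and>
     {x \<in> carrier E. \<phi> x = \<zero>\<^bsub>L\<^esub>} \<subseteq> lie_center E"

text \<open>
  The competing extensions range over all Lie superalgebras whose carrier is a subset of the type
  \<open>'e\<close>.  A theorem about \<open>universal_central_extension TYPE('e)\<close> with \<open>'e\<close> a type variable that
  occurs nowhere else therefore covers all central extensions.  Homomorphisms are compared on the
  carrier only, as their values elsewhere are irrelevant.
\<close>

definition universal_central_extension ::
    "'e itself \<Rightarrow> ('k, 'n) ring_scheme \<Rightarrow> ('k, 'a) superalgebra \<Rightarrow> ('k, 'b) superalgebra \<Rightarrow>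
     ('a \<Rightarrow> 'b) \<Rightarrow> bool" where
  "universal_central_extension T K G L \<psi> \<longleftrightarrow>
     central_extension K G L \<psi> \<and>
     (\<forall>(E :: ('k, 'e) superalgebra) \<phi>. central_extension K E L \<phi> \<longrightarrow>
        (\<exists>f \<in> lie_hom K G E. (\<forall>x\<in>carrier G. \<phi> (f x) = \<psi> x) \<and>
           (\<forall>f' \<in> lie_hom K G E. (\<forall>x\<in>carrier G. \<phi> (f' x) = \<psi> x) \<longrightarrow>
              (\<forall>x\<in>carrier G. f' x = f x))))"

text \<open>2-cocycles of \<open>L\<close> with values in the supermodule \<open>M\<close>, regarded as a trivial module.\<close>

definition super_2cocycle ::
    "('k, 'n) ring_scheme \<Rightarrow> ('k, 'a) superalgebra \<Rightarrow> ('k, 'c) superalgebra \<Rightarrow>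
     ('a \<Rightarrow> 'a \<Rightarrow> 'c) \<Rightarrow> bool" where
  "super_2cocycle K L M \<beta> \<longleftrightarrow>
     (\<forall>x\<in>carrier L. \<forall>y\<in>carrier L. \<beta> x y \<in> carrier M) \<and>
     (\<forall>x\<in>carrier L. \<forall>y\<in>carrier L. \<forall>z\<in>carrier L.
        \<beta> (x \<oplus>\<^bsub>L\<^esub> y) z = \<beta> x z \<oplus>\<^bsub>M\<^esub> \<beta> y z \<and> \<beta> z (x \<oplus>\<^bsub>L\<^esub> y) = \<beta> z x \<oplus>\<^bsub>M\<^esub> \<beta> z y) \<and>
     (\<forall>c\<in>carrier K. \<forall>x\<in>carrier L. \<forall>y\<in>carrier L.
        \<beta> (c \<odot>\<^bsub>L\<^esub> x) y = c \<odot>\<^bsub>M\<^esub> \<beta> x y \<and> \<beta> x (c \<odot>\<^bsub>L\<^esub> y) = c \<odot>\<^bsub>M\<^esub> \<beta> x y) \<and>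
     (\<forall>p q. \<forall>x\<in>grade L p. \<forall>y\<in>grade L q.
        \<beta> x y \<in> grade M (p + q) \<and> \<beta> x y = \<ominus>\<^bsub>M\<^esub> (ksign M (p * q) (\<beta> y x))) \<and>
     (\<forall>p q r. \<forall>x\<in>grade L p. \<forall>y\<in>grade L q. \<forall>z\<in>grade L r.
        ksign M (p * r) (\<beta> (x \<otimes>\<^bsub>L\<^esub> y) z)
        \<oplus>\<^bsub>M\<^esub> ksign M (q * p) (\<beta> (y \<otimes>\<^bsub>L\<^esub> z) x)
        \<oplus>\<^bsub>M\<^esub> ksign M (r * q) (\<beta> (z \<otimes>\<^bsub>L\<^esub> x) y) = \<zero>\<^bsub>M\<^esub>)"

definition cocycle_extension ::
    "('k, 'a) superalgebra \<Rightarrow> ('k, 'c) superalgebra \<Rightarrow> ('a \<Rightarrow> 'a \<Rightarrow> 'c) \<Rightarrow>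
     ('k, 'a \<times> 'c) superalgebra" where
  "cocycle_extension L M \<beta> =
     \<lparr>carrier = carrier L \<times> carrier M,
      mult = (\<lambda>(x, c) (y, c'). (x \<otimes>\<^bsub>L\<^esub> y, \<beta> x y)),
      one = (\<zero>\<^bsub>L\<^esub>, \<zero>\<^bsub>M\<^esub>),
      zero = (\<zero>\<^bsub>L\<^esub>, \<zero>\<^bsub>M\<^esub>),
      add = (\<lambda>(x, c) (y, c'). (x \<oplus>\<^bsub>L\<^esub> y, c \<oplus>\<^bsub>M\<^esub> c')),
      smult = (\<lambda>k (x, c). (k \<odot>\<^bsub>L\<^esub> x, k \<odot>\<^bsub>M\<^esub> c)),
      grade = (\<lambda>p. grade L p \<times> grade M p)\<rparr>"

section \<open>Lie superalgebras given by generators and relations\<close>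

text \<open>
  The generators of degree \<open>p\<close> are the elements of \<open>D p\<close>, and \<open>Rel\<close> is a set of pairs of terms to
  be identified.  The presented Lie superalgebra consists of the terms over the generators modulo
  the least congruence that contains \<open>Rel\<close> and makes all axioms of Lie superalgebras hold.
\<close>

datatype ('k, 'x) lie_term =
    LGen 'x
  | LZero
  | LAdd "('k, 'x) lie_term" "('k, 'x) lie_term"
  | LScale 'k "('k, 'x) lie_term"
  | LBr "('k, 'x) lie_term" "('k, 'x) lie_term"

definition LNeg :: "('k, 'n) ring_scheme \<Rightarrow> ('k, 'x) lie_term \<Rightarrow> ('k, 'x) lie_term" where
  "LNeg K t = LScale (\<ominus>\<^bsub>K\<^esub> \<one>\<^bsub>K\<^esub>) t"

definition LSign :: "('k, 'n) ring_scheme \<Rightarrow> bit \<Rightarrow> ('k, 'x) lie_term \<Rightarrow> ('k, 'x) lie_term" where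
  "LSign K p t = (if p = 1 then LNeg K t else t)"

inductive_set lie_terms ::
    "('k, 'n) ring_scheme \<Rightarrow> (bit \<Rightarrow> 'x set) \<Rightarrow> ('k, 'x) lie_term set"
  for K D where
  "x \<in> D p \<Longrightarrow> LGen x \<in> lie_terms K D"
| "LZero \<in> lie_terms K D"
| "\<lbrakk>s \<in> lie_terms K D; t \<in> lie_terms K D\<rbrakk> \<Longrightarrow> LAdd s t \<in> lie_terms K D"
| "\<lbrakk>c \<in> carrier K; t \<in> lie_terms K D\<rbrakk> \<Longrightarrow> LScale c t \<in> lie_terms K D"
| "\<lbrakk>s \<in> lie_terms K D; t \<in> lie_terms K D\<rbrakk> \<Longrightarrow> LBr s t \<in> lie_terms K D"

inductive lie_term_deg ::
    "('k, 'n) ring_scheme \<Rightarrow> (bit \<Rightarrow> 'x set) \<Rightarrow> ('k, 'x) lie_term \<Rightarrow> bit \<Rightarrow> bool"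
  for K D where
  "x \<in> D p \<Longrightarrow> lie_term_deg K D (LGen x) p"
| "lie_term_deg K D LZero p"
| "\<lbrakk>lie_term_deg K D s p; lie_term_deg K D t p\<rbrakk> \<Longrightarrow> lie_term_deg K D (LAdd s t) p"
| "\<lbrakk>c \<in> carrier K; lie_term_deg K D t p\<rbrakk> \<Longrightarrow> lie_term_deg K D (LScale c t) p"
| "\<lbrakk>lie_term_deg K D s p; lie_term_deg K D t q\<rbrakk> \<Longrightarrow> lie_term_deg K D (LBr s t) (p + q)"

inductive lie_cong ::
    "('k, 'n) ring_scheme \<Rightarrow> (bit \<Rightarrow> 'x set) \<Rightarrow> (('k, 'x) lie_term \<times> ('k, 'x) lie_term) set \<Rightarrow>
     ('k, 'x) lie_term \<Rightarrow> ('k, 'x) lie_term \<Rightarrow> bool"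
  for K D Rel where
  relation: "\<lbrakk>(s, t) \<in> Rel; s \<in> lie_terms K D; t \<in> lie_terms K D\<rbrakk> \<Longrightarrow> lie_cong K D Rel s t"
| refl: "s \<in> lie_terms K D \<Longrightarrow> lie_cong K D Rel s s"
| sym: "lie_cong K D Rel s t \<Longrightarrow> lie_cong K D Rel t s"
| trans: "\<lbrakk>lie_cong K D Rel s t; lie_cong K D Rel t u\<rbrakk> \<Longrightarrow> lie_cong K D Rel s u"
| cong_add: "\<lbrakk>lie_cong K D Rel s s'; lie_cong K D Rel t t'\<rbrakk> \<Longrightarrow>
    lie_cong K D Rel (LAdd s t) (LAdd s' t')"
| cong_scale: "\<lbrakk>c \<in> carrier K; lie_cong K D Rel t t'\<rbrakk> \<Longrightarrow>
    lie_cong K D Rel (LScale c t) (LScale c t')"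
| cong_br: "\<lbrakk>lie_cong K D Rel s s'; lie_cong K D Rel t t'\<rbrakk> \<Longrightarrow>
    lie_cong K D Rel (LBr s t) (LBr s' t')"
| add_assoc: "\<lbrakk>s \<in> lie_terms K D; t \<in> lie_terms K D; u \<in> lie_terms K D\<rbrakk> \<Longrightarrow>
    lie_cong K D Rel (LAdd (LAdd s t) u) (LAdd s (LAdd t u))"
| add_comm: "\<lbrakk>s \<in> lie_terms K D; t \<in> lie_terms K D\<rbrakk> \<Longrightarrow>
    lie_cong K D Rel (LAdd s t) (LAdd t s)"
| add_zero: "t \<in> lie_terms K D \<Longrightarrow> lie_cong K D Rel (LAdd LZero t) t"
| add_neg: "t \<in> lie_terms K D \<Longrightarrow> lie_cong K D Rel (LAdd (LNeg K t) t) LZero"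
| scale_l_distr: "\<lbrakk>c \<in> carrier K; d \<in> carrier K; t \<in> lie_terms K D\<rbrakk> \<Longrightarrow>
    lie_cong K D Rel (LScale (c \<oplus>\<^bsub>K\<^esub> d) t) (LAdd (LScale c t) (LScale d t))"
| scale_r_distr: "\<lbrakk>c \<in> carrier K; s \<in> lie_terms K D; t \<in> lie_terms K D\<rbrakk> \<Longrightarrow>
    lie_cong K D Rel (LScale c (LAdd s t)) (LAdd (LScale c s) (LScale c t))"
| scale_scale: "\<lbrakk>c \<in> carrier K; d \<in> carrier K; t \<in> lie_terms K D\<rbrakk> \<Longrightarrow>
    lie_cong K D Rel (LScale (c \<otimes>\<^bsub>K\<^esub> d) t) (LScale c (LScale d t))"
| scale_one: "t \<in> lie_terms K D \<Longrightarrow> lie_cong K D Rel (LScale \<one>\<^bsub>K\<^esub> t) t"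
| br_add_left: "\<lbrakk>s \<in> lie_terms K D; t \<in> lie_terms K D; u \<in> lie_terms K D\<rbrakk> \<Longrightarrow>
    lie_cong K D Rel (LBr (LAdd s t) u) (LAdd (LBr s u) (LBr t u))"
| br_add_right: "\<lbrakk>s \<in> lie_terms K D; t \<in> lie_terms K D; u \<in> lie_terms K D\<rbrakk> \<Longrightarrow>
    lie_cong K D Rel (LBr u (LAdd s t)) (LAdd (LBr u s) (LBr u t))"
| br_scale_left: "\<lbrakk>c \<in> carrier K; s \<in> lie_terms K D; t \<in> lie_terms K D\<rbrakk> \<Longrightarrow>
    lie_cong K D Rel (LBr (LScale c s) t) (LScale c (LBr s t))"
| br_scale_right: "\<lbrakk>c \<in> carrier K; s \<in> lie_terms K D; t \<in> lie_terms K D\<rbrakk> \<Longrightarrow>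
    lie_cong K D Rel (LBr s (LScale c t)) (LScale c (LBr s t))"
| skew: "\<lbrakk>lie_term_deg K D s p; lie_term_deg K D t q\<rbrakk> \<Longrightarrow>
    lie_cong K D Rel (LBr s t) (LNeg K (LSign K (p * q) (LBr t s)))"
| jacobi: "\<lbrakk>lie_term_deg K D s p; lie_term_deg K D t q; lie_term_deg K D u r\<rbrakk> \<Longrightarrow>
    lie_cong K D Rel
      (LAdd (LAdd (LSign K (p * r) (LBr (LBr s t) u))
                  (LSign K (q * p) (LBr (LBr t u) s)))
            (LSign K (r * q) (LBr (LBr u s) t)))
      LZero"

definition lie_class ::
    "('k, 'n) ring_scheme \<Rightarrow> (bit \<Rightarrow> 'x set) \<Rightarrow> (('k, 'x) lie_term \<times> ('k, 'x) lie_term) set \<Rightarrow>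
     ('k, 'x) lie_term \<Rightarrow> ('k, 'x) lie_term set" where
  "lie_class K D Rel t = {s. lie_cong K D Rel t s}"

definition presented_lie ::
    "('k, 'n) ring_scheme \<Rightarrow> (bit \<Rightarrow> 'x set) \<Rightarrow> (('k, 'x) lie_term \<times> ('k, 'x) lie_term) set \<Rightarrow>
     ('k, ('k, 'x) lie_term set) superalgebra" where
  "presented_lie K D Rel =
     \<lparr>carrier = lie_class K D Rel ` lie_terms K D,
      mult = (\<lambda>X Y. \<Union>s\<in>X. \<Union>t\<in>Y. lie_class K D Rel (LBr s t)),
      one = lie_class K D Rel LZero,
      zero = lie_class K D Rel LZero,
      add = (\<lambda>X Y. \<Union>s\<in>X. \<Union>t\<in>Y. lie_class K D Rel (LAdd s t)),
      smult = (\<lambda>c X. \<Union>t\<in>X. lie_class K D Rel (LScale c t)),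
      grade = (\<lambda>p. lie_class K D Rel ` {t. lie_term_deg K D t p})\<rparr>"

section \<open>The Steinberg orthosymplectic Lie superalgebra\<close>

datatype two = I1 | I2

text \<open>
  \<open>Tg i j a\<close>, \<open>Fg i a\<close> and \<open>Gg i a\<close> stand for \<open>t\<^sub>i\<^sub>j(a)\<close>, \<open>f\<^sub>i\<^sub>1(a)\<close> and \<open>g\<^sub>1\<^sub>i(a)\<close>.  A generator at
  \<open>a = 0\<close> has both degrees, which is harmless because linearity makes it zero.
\<close>

datatype 'r sto_gen = Tg two two 'r | Fg two 'r | Gg two 'r

definition sto_gens :: "('k, 'r, 'm) superalgebra_scheme \<Rightarrow> bit \<Rightarrow> 'r sto_gen set" where
  "sto_gens R p =
     {Tg i j a | i j a. i \<noteq> j \<and> a \<in> grade R p} \<union>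
     {Fg i a | i a. a \<in> grade R (1 + p)} \<union>
     {Gg i a | i a. a \<in> grade R (1 + p)}"

abbreviation delta :: "two \<Rightarrow> two \<Rightarrow> ('k, 'x) lie_term \<Rightarrow> ('k, 'x) lie_term" where
  "delta i j t \<equiv> (if i = j then t else LZero)"

inductive_set sto_rels ::
    "('k, 'n) ring_scheme \<Rightarrow> ('k, 'r, 'm) superalgebra_scheme \<Rightarrow> ('r \<Rightarrow> 'r) \<Rightarrow>
     (('k, 'r sto_gen) lie_term \<times> ('k, 'r sto_gen) lie_term) set"
  for K and R and bar where
  T_add: "\<lbrakk>i \<noteq> j; a \<in> grade R p; b \<in> grade R p\<rbrakk> \<Longrightarrow>
    (LGen (Tg i j (a \<oplus>\<^bsub>R\<^esub> b)), LAdd (LGen (Tg i j a)) (LGen (Tg i j b))) \<in> sto_rels K R bar"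
| F_add: "\<lbrakk>a \<in> grade R p; b \<in> grade R p\<rbrakk> \<Longrightarrow>
    (LGen (Fg i (a \<oplus>\<^bsub>R\<^esub> b)), LAdd (LGen (Fg i a)) (LGen (Fg i b))) \<in> sto_rels K R bar"
| G_add: "\<lbrakk>a \<in> grade R p; b \<in> grade R p\<rbrakk> \<Longrightarrow>
    (LGen (Gg i (a \<oplus>\<^bsub>R\<^esub> b)), LAdd (LGen (Gg i a)) (LGen (Gg i b))) \<in> sto_rels K R bar"
| T_smult: "\<lbrakk>i \<noteq> j; c \<in> carrier K; a \<in> homogeneous R\<rbrakk> \<Longrightarrow>
    (LGen (Tg i j (c \<odot>\<^bsub>R\<^esub> a)), LScale c (LGen (Tg i j a))) \<in> sto_rels K R bar"
| F_smult: "\<lbrakk>c \<in> carrier K; a \<in> homogeneous R\<rbrakk> \<Longrightarrow>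
    (LGen (Fg i (c \<odot>\<^bsub>R\<^esub> a)), LScale c (LGen (Fg i a))) \<in> sto_rels K R bar"
| G_smult: "\<lbrakk>c \<in> carrier K; a \<in> homogeneous R\<rbrakk> \<Longrightarrow>
    (LGen (Gg i (c \<odot>\<^bsub>R\<^esub> a)), LScale c (LGen (Gg i a))) \<in> sto_rels K R bar"
| T_bar: "\<lbrakk>i \<noteq> j; a \<in> homogeneous R\<rbrakk> \<Longrightarrow>
    (LGen (Tg i j a), LNeg K (LGen (Tg j i (bar a)))) \<in> sto_rels K R bar"
| T_F: "\<lbrakk>i \<noteq> j; a \<in> homogeneous R; b \<in> homogeneous R\<rbrakk> \<Longrightarrow>
    (LBr (LGen (Tg i j a)) (LGen (Fg i' b)),
     LAdd (delta i' j (LGen (Fg i (a \<otimes>\<^bsub>R\<^esub> b))))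
          (LNeg K (delta i' i (LGen (Fg j (bar a \<otimes>\<^bsub>R\<^esub> b)))))) \<in> sto_rels K R bar"
| G_T: "\<lbrakk>i \<noteq> j; a \<in> homogeneous R; b \<in> homogeneous R\<rbrakk> \<Longrightarrow>
    (LBr (LGen (Gg i' a)) (LGen (Tg i j b)),
     LAdd (delta i' i (LGen (Gg j (a \<otimes>\<^bsub>R\<^esub> b))))
          (LNeg K (delta i' j (LGen (Gg i (a \<otimes>\<^bsub>R\<^esub> bar b)))))) \<in> sto_rels K R bar"
| F_F: "\<lbrakk>i \<noteq> j; a \<in> homogeneous R; b \<in> homogeneous R\<rbrakk> \<Longrightarrow>
    (LBr (LGen (Fg i a)) (LGen (Fg j b)), LZero) \<in> sto_rels K R bar"
| G_G: "\<lbrakk>i \<noteq> j; a \<in> homogeneous R; b \<in> homogeneous R\<rbrakk> \<Longrightarrow>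
    (LBr (LGen (Gg i a)) (LGen (Gg j b)), LZero) \<in> sto_rels K R bar"
| F_G: "\<lbrakk>i \<noteq> j; a \<in> homogeneous R; b \<in> homogeneous R\<rbrakk> \<Longrightarrow>
    (LBr (LGen (Fg i a)) (LGen (Gg j b)), LGen (Tg i j (a \<otimes>\<^bsub>R\<^esub> b))) \<in> sto_rels K R bar"

definition sto ::
    "('k, 'n) ring_scheme \<Rightarrow> ('k, 'r, 'm) superalgebra_scheme \<Rightarrow> ('r \<Rightarrow> 'r) \<Rightarrow>
     ('k, ('k, 'r sto_gen) lie_term set) superalgebra" where
  "sto K R bar = presented_lie K (sto_gens R) (sto_rels K R bar)"

definition sto_gen_class ::
    "('k, 'n) ring_scheme \<Rightarrow> ('k, 'r, 'm) superalgebra_scheme \<Rightarrow> ('r \<Rightarrow> 'r) \<Rightarrow> 'r sto_gen \<Rightarrow>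
     ('k, 'r sto_gen) lie_term set" where
  "sto_gen_class K R bar x = lie_class K (sto_gens R) (sto_rels K R bar) (LGen x)"

abbreviation "sto_t K R bar i j a \<equiv> sto_gen_class K R bar (Tg i j a)"
abbreviation "sto_f K R bar i a \<equiv> sto_gen_class K R bar (Fg i a)"
abbreviation "sto_g K R bar i a \<equiv> sto_gen_class K R bar (Gg i a)"

definition "sto_h K R bar i a b = sto_f K R bar i a \<otimes>\<^bsub>sto K R bar\<^esub> sto_g K R bar i b"

definition "sto_v K R bar a =
  \<ominus>\<^bsub>sto K R bar\<^esub> (sto_g K R bar I1 a \<otimes>\<^bsub>sto K R bar\<^esub> sto_g K R bar I1 \<one>\<^bsub>R\<^esub>)"

definition "sto_w K R bar a = sto_f K R bar I1 \<one>\<^bsub>R\<^esub> \<otimes>\<^bsub>sto K R bar\<^esub> sto_f K R bar I1 a"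

text \<open>
  The spanning set \<open>\<BB>\<close>, split into the members other than \<open>f\<^sub>i\<^sub>1(a)\<close> and \<open>g\<^sub>1\<^sub>i(a)\<close>, and the rest.
\<close>

definition sto_B0 ::
    "('k, 'n) ring_scheme \<Rightarrow> ('k, 'r, 'm) superalgebra_scheme \<Rightarrow> ('r \<Rightarrow> 'r) \<Rightarrow>
     ('k, 'r sto_gen) lie_term set set" where
  "sto_B0 K R bar =
     {sto_h K R bar i a b | i a b. a \<in> homogeneous R \<and> b \<in> homogeneous R} \<union>
     (\<Union>a\<in>homogeneous R. {sto_t K R bar I1 I2 a, sto_v K R bar a, sto_w K R bar a})"

definition sto_B ::
    "('k, 'n) ring_scheme \<Rightarrow> ('k, 'r, 'm) superalgebra_scheme \<Rightarrow> ('r \<Rightarrow> 'r) \<Rightarrow>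
     ('k, 'r sto_gen) lie_term set set" where
  "sto_B K R bar = sto_B0 K R bar \<union>
     {sto_f K R bar i a | i a. a \<in> homogeneous R} \<union>
     {sto_g K R bar i a | i a. a \<in> homogeneous R}"

section \<open>The cocycle and the extension\<close>

definition module_span ::
    "('k, 'n) ring_scheme \<Rightarrow> ('k, 'a, 'm) superalgebra_scheme \<Rightarrow> 'a set \<Rightarrow> 'a set" where
  "module_span K M S = \<Inter>{N. submodule N K M \<and> S \<subseteq> N}"

text \<open>The span \<open>[R,R]R\<close> of all \<open>[a,b]c\<close>, with \<open>[a,b]\<close> the supercommutator.\<close>

definition comm_ideal ::
    "('k, 'n) ring_scheme \<Rightarrow> ('k, 'r, 'm) superalgebra_scheme \<Rightarrow> 'r set" where
  "comm_ideal K R = module_span K R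
     {((a \<otimes>\<^bsub>R\<^esub> b) \<ominus>\<^bsub>R\<^esub> ksign R (p * q) (b \<otimes>\<^bsub>R\<^esub> a)) \<otimes>\<^bsub>R\<^esub> c | a b c p q.
        a \<in> grade R p \<and> b \<in> grade R q \<and> c \<in> carrier R}"

definition quot_superalgebra ::
    "('k, 'a, 'm) superalgebra_scheme \<Rightarrow> 'a set \<Rightarrow> ('k, 'a set) superalgebra" where
  "quot_superalgebra M I =
     \<lparr>carrier = a_rcosets\<^bsub>M\<^esub> I, mult = rcoset_mult M I,
      one = I +>\<^bsub>M\<^esub> \<one>\<^bsub>M\<^esub>, zero = I, add = set_add M,
      smult = (\<lambda>c X. \<Union>x\<in>X. I +>\<^bsub>M\<^esub> (c \<odot>\<^bsub>M\<^esub> x)),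
      grade = (\<lambda>p. (\<lambda>x. I +>\<^bsub>M\<^esub> x) ` grade M p)\<rparr>"

definition comm_quot ::
    "('k, 'n) ring_scheme \<Rightarrow> ('k, 'r, 'm) superalgebra_scheme \<Rightarrow> ('k, 'r set) superalgebra" where
  "comm_quot K R = quot_superalgebra R (comm_ideal K R)"

definition comm_proj ::
    "('k, 'n) ring_scheme \<Rightarrow> ('k, 'r, 'm) superalgebra_scheme \<Rightarrow> 'r \<Rightarrow> 'r set" where
  "comm_proj K R a = comm_ideal K R +>\<^bsub>R\<^esub> a"

text \<open>
  In the second, third and fourth conjunct, the pairs of elements of \<open>\<BB>\<close> on which \<open>\<beta>\<close> is required
  to vanish are exactly those, up to order, that are not listed in the last two conjuncts.
\<close>

definition sto_cocycle ::
    "('k, 'n) ring_scheme \<Rightarrow> ('k, 'r, 'm) superalgebra_scheme \<Rightarrow> ('r \<Rightarrow> 'r) \<Rightarrow>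
     (('k, 'r sto_gen) lie_term set \<Rightarrow> ('k, 'r sto_gen) lie_term set \<Rightarrow> 'r set) \<Rightarrow> bool" where
  "sto_cocycle K R bar \<beta> \<longleftrightarrow>
     super_2cocycle K (sto K R bar) (comm_quot K R) \<beta> \<and>
     (\<forall>x\<in>sto_B0 K R bar. \<forall>y\<in>sto_B K R bar.
        \<beta> x y = \<zero>\<^bsub>comm_quot K R\<^esub> \<and> \<beta> y x = \<zero>\<^bsub>comm_quot K R\<^esub>) \<and>
     (\<forall>i j. \<forall>a\<in>homogeneous R. \<forall>b\<in>homogeneous R.
        \<beta> (sto_f K R bar i a) (sto_f K R bar j b) = \<zero>\<^bsub>comm_quot K R\<^esub> \<and>
        \<beta> (sto_g K R bar i a) (sto_g K R bar j b) = \<zero>\<^bsub>comm_quot K R\<^esub>) \<and>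
     (\<forall>i. \<forall>a\<in>homogeneous R. \<forall>b\<in>homogeneous R.
        \<beta> (sto_f K R bar i a) (sto_g K R bar i b) = \<zero>\<^bsub>comm_quot K R\<^esub> \<and>
        \<beta> (sto_g K R bar i b) (sto_f K R bar i a) = \<zero>\<^bsub>comm_quot K R\<^esub>) \<and>
     (\<forall>p q. \<forall>a\<in>grade R p. \<forall>b\<in>grade R q.
        \<beta> (sto_f K R bar I1 a) (sto_g K R bar I2 b) = comm_proj K R (a \<otimes>\<^bsub>R\<^esub> bar b) \<and>
        \<ominus>\<^bsub>comm_quot K R\<^esub> ksign (comm_quot K R) ((1 + p) * (1 + q))
            (\<beta> (sto_g K R bar I2 b) (sto_f K R bar I1 a)) = comm_proj K R (a \<otimes>\<^bsub>R\<^esub> bar b)) \<and>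
     (\<forall>p q. \<forall>a\<in>grade R p. \<forall>b\<in>grade R q.
        \<beta> (sto_f K R bar I2 a) (sto_g K R bar I1 b)
          = \<ominus>\<^bsub>comm_quot K R\<^esub> comm_proj K R (a \<otimes>\<^bsub>R\<^esub> bar b) \<and>
        \<ominus>\<^bsub>comm_quot K R\<^esub> ksign (comm_quot K R) ((1 + p) * (1 + q))
            (\<beta> (sto_g K R bar I1 b) (sto_f K R bar I2 a))
          = \<ominus>\<^bsub>comm_quot K R\<^esub> comm_proj K R (a \<otimes>\<^bsub>R\<^esub> bar b))"

text \<open>
  As \<open>\<BB>\<close> spans, the conditions determine \<open>\<beta>\<close> on the carrier, so the choice is immaterial.
\<close>

definition sto_beta ::
    "('k, 'n) ring_scheme \<Rightarrow> ('k, 'r, 'm) superalgebra_scheme \<Rightarrow> ('r \<Rightarrow> 'r) \<Rightarrow>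
     ('k, 'r sto_gen) lie_term set \<Rightarrow> ('k, 'r sto_gen) lie_term set \<Rightarrow> 'r set" where
  "sto_beta K R bar = (SOME \<beta>. sto_cocycle K R bar \<beta>)"

definition sto_hat ::
    "('k, 'n) ring_scheme \<Rightarrow> ('k, 'r, 'm) superalgebra_scheme \<Rightarrow> ('r \<Rightarrow> 'r) \<Rightarrow>
     ('k, ('k, 'r sto_gen) lie_term set \<times> 'r set) superalgebra" where
  "sto_hat K R bar = cocycle_extension (sto K R bar) (comm_quot K R) (sto_beta K R bar)"

definition sto_hat_proj ::
    "('k, 'r sto_gen) lie_term set \<times> 'r set \<Rightarrow> ('k, 'r sto_gen) lie_term set" where
  "sto_hat_proj = fst"

end

theory Submission
  imports Defs
begin

text \<open>
  Squaring \<open>e\<close> if necessary, one may assume that \<open>e\<close> is even.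

  The Steinberg algebra is represented by orthosymplectic $2|2$ supermatrices over \<open>R\<close>, and the
  cocycle $\beta$ is the polarized determinant of their upper right $2 \times 2$ block modulo
  $[R,R]R$.  It is invariant because the supertrace of these matrices vanishes modulo $[R,R]R$.

  Let \<open>B\<close> be the 2-cocycle $(x, y) \mapsto [\tilde x, \tilde y]$ of a central extension \<open>E\<close>.  By the
  Leibniz rule, $B(f_{11}(a), g_{12}(b))$ is a function $t$ of $ab$ plus a defect $d(a, b)$ that changes
  its sign when \<open>e\<close> moves from \<open>a\<close> to \<open>b\<close>.  Comparing with the action of $[f_{11}(x), g_{11}(y)]$ shows
  that $d$ vanishes on $[R,R]R$ and that $d(a, b) = d(a \bar b, 1)$, so $d$ is the image of $\beta$
  under $\pi(x) \mapsto d(x, 1)$.  The remaining lifts are normalized by bracketing with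
  $[f_{11}(1), g_{11}(1)]$, for which all $f_{i1}(a)$ and $g_{1i}(a)$ are eigenvectors with eigenvalues
  $-1$ and $1$.
\<close>

section \<open>Superalgebras\<close>

text \<open>No module is assumed projective, so \<open>st\<close> may have no linear section into
  \<open>E\<close>. Hence \<open>B\<close> takes values in all of \<open>E\<close>, not only in the
  kernel: brackets of lifts do not depend on the lifts, which makes \<open>B\<close> bilinear, and
  the Leibniz rule yields linear equations for it.

  The role of \<open>e\<close> is to separate two kinds of terms. A function of \<open>ab\<close> is
  unchanged when \<open>e\<close> moves from \<open>a\<close> to \<open>b\<close>; a defect that is
  also odd under this move is its own negative and vanishes, as 2 is invertible. The same element
  gives uniqueness: \<open>[f_11(e), g_12(x)]\<close> and \<open>[f_11(1), g_12(ex)]\<close> agree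
  in \<open>st\<close> but have opposite values of \<open>\<beta>\<close>, so half their difference
  in the extension can be any homogeneous kernel element.

  The extension itself has no presentation. Terms over the generators of \<open>st\<close> are
  therefore evaluated in the product of both extensions at once. Only the relation for
  \<open>[f_i1, g_1j]\<close> fails there, by a pair of central elements coming from one element of
  \<open>R\<close>; so evaluation is developed for relations that hold modulo a central
  submodule.\<close>

lemma ksign_0 [simp]: "ksign M 0 x = x"
  by (simp add: ksign_def)

lemma ksign_1 [simp]: "ksign M 1 x = \<ominus>\<^bsub>M\<^esub> x"
  by (simp add: ksign_def)

lemma bit_add_self [simp]: "p + p = 0" "p + (p + q) = q" for p q :: bit
  by (cases p; simp; cases q; simp)+

lemma bit_mult_self [simp]: "p * p = p" "p * (p * q) = p * q" for p q :: bit
  by (cases p; simp)+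

text \<open>By default sums and products of bits are rewritten to bitwise operations. Without these
  rules degrees stay ring expressions such as \<open>p + q\<close> and \<open>p * q\<close>, the
  form in which all grading and sign lemmas are stated.\<close>

declare add_bit_eq_xor [simp del] mult_bit_eq_and [simp del]

context abelian_group
begin

lemma ksign_closed [simp, intro]: "x \<in> carrier G \<Longrightarrow> ksign G p x \<in> carrier G"
  by (simp add: ksign_def)

lemma ksign_zero [simp]: "ksign G p \<zero>\<^bsub>G\<^esub> = \<zero>\<^bsub>G\<^esub>"
  by (simp add: ksign_def)

lemma ksign_ksign: "x \<in> carrier G \<Longrightarrow> ksign G p (ksign G q x) = ksign G (p + q) x"
  by (cases p; cases q) simp_all

lemma ksign_add:
  "\<lbrakk>x \<in> carrier G; y \<in> carrier G\<rbrakk> \<Longrightarrow> ksign G p (x \<oplus>\<^bsub>G\<^esub> y) = ksign G p x \<oplus>\<^bsub>G\<^esub> ksign G p y"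
  by (cases p) (simp_all add: minus_add)

lemma ksign_minus: "x \<in> carrier G \<Longrightarrow> ksign G p (\<ominus>\<^bsub>G\<^esub> x) = \<ominus>\<^bsub>G\<^esub> (ksign G p x)"
  by (cases p) simp_all

lemma four_swap:
  "\<lbrakk>x \<in> carrier G; y \<in> carrier G; z \<in> carrier G; w \<in> carrier G\<rbrakk> \<Longrightarrow>
    (x \<oplus>\<^bsub>G\<^esub> y) \<oplus>\<^bsub>G\<^esub> (z \<oplus>\<^bsub>G\<^esub> w) = (x \<oplus>\<^bsub>G\<^esub> z) \<oplus>\<^bsub>G\<^esub> (y \<oplus>\<^bsub>G\<^esub> w)"
  by (simp add: a_ac)

lemma diff_zero_eq: "\<lbrakk>x \<in> carrier G; y \<in> carrier G; x \<oplus>\<^bsub>G\<^esub> \<ominus>\<^bsub>G\<^esub> y = \<zero>\<^bsub>G\<^esub>\<rbrakk> \<Longrightarrow> x = y"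
  using minus_equality [of x "\<ominus>\<^bsub>G\<^esub> y"] by simp

end

lemma (in abelian_group) minus_zero': "\<ominus>\<^bsub>G\<^esub> \<zero>\<^bsub>G\<^esub> = \<zero>\<^bsub>G\<^esub>"
  using l_neg [of "\<zero>\<^bsub>G\<^esub>"] by simp

text \<open>Ordered rewriting for the additive group alone, so that the method
  \<open>algebra\<close> is usable in modules and in non-associative algebras, where no ring is at
  hand.\<close>

lemmas (in abelian_group) abelian_group_simprules
  [algebra abelian_group "zero G" "add G" "a_inv G" "a_minus G"] =
  a_closed zero_closed a_inv_closed minus_closed a_assoc l_zero l_neg a_comm minus_eq
  r_zero r_neg r_neg2 r_neg1 minus_add minus_minus minus_zero' a_lcomm

context module
begin

lemma ksign_smult:
  "\<lbrakk>c \<in> carrier R; x \<in> carrier M\<rbrakk> \<Longrightarrow> c \<odot>\<^bsub>M\<^esub> ksign M p x = ksign M p (c \<odot>\<^bsub>M\<^esub> x)"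
  by (cases p) (simp_all add: smult_r_minus)

lemma two_torsion_free:
  assumes "\<one> \<oplus> \<one> \<in> Units R" "x \<in> carrier M" "x \<oplus>\<^bsub>M\<^esub> x = \<zero>\<^bsub>M\<^esub>"
  shows "x = \<zero>\<^bsub>M\<^esub>"
proof -
  define u where "u = \<one> \<oplus> \<one>"
  have u: "u \<in> Units R" "u \<in> carrier R"
    using assms(1) by (simp_all add: u_def R.Units_closed)
  have "u \<odot>\<^bsub>M\<^esub> x = \<zero>\<^bsub>M\<^esub>"
    using assms(2,3) by (simp add: smult_l_distr u_def)
  then have "(inv u \<otimes> u) \<odot>\<^bsub>M\<^esub> x = \<zero>\<^bsub>M\<^esub>"
    using u assms(2) by (simp add: smult_assoc1 del: R.Units_l_inv)
  then show ?thesis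
    using u assms(2) by simp
qed

end

text \<open>Over bits \<open>p + 1\<close> is the other degree, so this is the projection onto
  degree \<open>p\<close>. The description by \<open>THE\<close> is justified because the sum of the
  two degrees is direct (\<open>decomposition_unique\<close>).\<close>

definition component :: "('k, 'a, 'm) superalgebra_scheme \<Rightarrow> bit \<Rightarrow> 'a \<Rightarrow> 'a" where
  "component M p x = (THE u. u \<in> grade M p \<and> (\<exists>v \<in> grade M (p + 1). x = u \<oplus>\<^bsub>M\<^esub> v))"

context supermodule
begin

lemma grade_closed: "x \<in> grade M p \<Longrightarrow> x \<in> carrier M"
  using submoduleE(1) [OF grade_submodule] by blast

lemma grade_zero [simp, intro]: "\<zero>\<^bsub>M\<^esub> \<in> grade M p"
  using submodule.axioms(1) [OF grade_submodule] subgroup.one_closed by fastforce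

lemma grade_add: "\<lbrakk>x \<in> grade M p; y \<in> grade M p\<rbrakk> \<Longrightarrow> x \<oplus>\<^bsub>M\<^esub> y \<in> grade M p"
  by (rule submoduleE(5) [OF grade_submodule])

lemma grade_minus: "x \<in> grade M p \<Longrightarrow> \<ominus>\<^bsub>M\<^esub> x \<in> grade M p"
  by (rule submoduleE(3) [OF grade_submodule])

lemma grade_smult: "\<lbrakk>c \<in> carrier K; x \<in> grade M p\<rbrakk> \<Longrightarrow> c \<odot>\<^bsub>M\<^esub> x \<in> grade M p"
  by (rule submoduleE(4) [OF grade_submodule])

lemma grade_ksign: "x \<in> grade M p \<Longrightarrow> ksign M q x \<in> grade M p"
  by (cases q) (simp_all add: grade_minus)

lemma grade_both: "\<lbrakk>x \<in> grade M p; x \<in> grade M q; p \<noteq> q\<rbrakk> \<Longrightarrow> x = \<zero>\<^bsub>M\<^esub>"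
  using grade_disjoint by (cases p; cases q) auto

lemma homogeneous_closed: "x \<in> homogeneous M \<Longrightarrow> x \<in> carrier M"
  by (auto simp: homogeneous_def grade_closed)

lemma decomposition:
  assumes "x \<in> carrier M"
  obtains u v where "u \<in> grade M p" "v \<in> grade M (p + 1)" "x = u \<oplus>\<^bsub>M\<^esub> v"
proof -
  obtain a b where ab: "a \<in> grade M 0" "b \<in> grade M 1" "x = a \<oplus>\<^bsub>M\<^esub> b"
    using assms grade_sum by (auto simp: set_add_def')
  show ?thesis
    using ab that [of a b] that [of b a] by (cases p) (simp_all add: M.a_comm grade_closed)
qed

lemma decomposition_unique:
  assumes "u \<in> grade M p" "v \<in> grade M (p + 1)" "u' \<in> grade M p" "v' \<in> grade M (p + 1)"
    and "u \<oplus>\<^bsub>M\<^esub> v = u' \<oplus>\<^bsub>M\<^esub> v'"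
  shows "u = u'"
proof -
  have c: "u \<in> carrier M" "v \<in> carrier M" "u' \<in> carrier M" "v' \<in> carrier M"
    using assms grade_closed by blast+
  have "u \<oplus>\<^bsub>M\<^esub> \<ominus>\<^bsub>M\<^esub> u' = (u \<oplus>\<^bsub>M\<^esub> v) \<oplus>\<^bsub>M\<^esub> \<ominus>\<^bsub>M\<^esub> u' \<oplus>\<^bsub>M\<^esub> \<ominus>\<^bsub>M\<^esub> v"
    using c by algebra
  also have "... = v' \<oplus>\<^bsub>M\<^esub> \<ominus>\<^bsub>M\<^esub> v"
    unfolding assms(5) using c by algebra
  finally have "u \<oplus>\<^bsub>M\<^esub> \<ominus>\<^bsub>M\<^esub> u' = v' \<oplus>\<^bsub>M\<^esub> \<ominus>\<^bsub>M\<^esub> v" .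
  moreover have "u \<oplus>\<^bsub>M\<^esub> \<ominus>\<^bsub>M\<^esub> u' \<in> grade M p" "v' \<oplus>\<^bsub>M\<^esub> \<ominus>\<^bsub>M\<^esub> v \<in> grade M (p + 1)"
    using assms by (simp_all add: grade_add grade_minus)
  moreover have "p \<noteq> p + 1"
    by simp
  ultimately have "u \<oplus>\<^bsub>M\<^esub> \<ominus>\<^bsub>M\<^esub> u' = \<zero>\<^bsub>M\<^esub>"
    using grade_both by metis
  then show ?thesis
    using c M.diff_zero_eq by blast
qed

lemma component_eqI:
  assumes "u \<in> grade M p" "v \<in> grade M (p + 1)" "x = u \<oplus>\<^bsub>M\<^esub> v"
  shows "component M p x = u"
  unfolding component_def
proof (rule the_equality)
  show "u \<in> grade M p \<and> (\<exists>v \<in> grade M (p + 1). x = u \<oplus>\<^bsub>M\<^esub> v)"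
    using assms by blast
  show "\<And>w. w \<in> grade M p \<and> (\<exists>v \<in> grade M (p + 1). x = w \<oplus>\<^bsub>M\<^esub> v) \<Longrightarrow> w = u"
    using assms decomposition_unique by blast
qed

lemma component_grade:
  assumes "x \<in> carrier M"
  shows "component M p x \<in> grade M p"
  using decomposition [OF assms, of p] component_eqI by metis

lemma component_closed [simp]: "x \<in> carrier M \<Longrightarrow> component M p x \<in> carrier M"
  using component_grade grade_closed by blast

lemma component_sum:
  assumes "x \<in> carrier M"
  shows "component M p x \<oplus>\<^bsub>M\<^esub> component M (p + 1) x = x"
proof -
  obtain u v where uv: "u \<in> grade M p" "v \<in> grade M (p + 1)" "x = u \<oplus>\<^bsub>M\<^esub> v"
    using decomposition [OF assms] by blast
  then have "x = v \<oplus>\<^bsub>M\<^esub> u"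
    by (simp add: M.a_comm grade_closed)
  then have "component M (p + 1) x = v"
    using component_eqI [of v "p + 1" u x] uv by (cases p) simp_all
  then show ?thesis
    using component_eqI uv by simp
qed

lemma component_sum01: "x \<in> carrier M \<Longrightarrow> component M 0 x \<oplus>\<^bsub>M\<^esub> component M 1 x = x"
  using component_sum [of x 0] by simp

lemma component_homogeneous: "x \<in> grade M p \<Longrightarrow> component M p x = x"
  by (rule component_eqI [of _ _ "\<zero>\<^bsub>M\<^esub>"]) (auto simp: grade_closed)

lemma component_other: "\<lbrakk>x \<in> grade M p; p \<noteq> q\<rbrakk> \<Longrightarrow> component M q x = \<zero>\<^bsub>M\<^esub>"
  by (rule component_eqI [of _ _ x]) (cases p; cases q; auto simp: grade_closed)+

lemma component_add:
  assumes "x \<in> carrier M" "y \<in> carrier M"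
  shows "component M p (x \<oplus>\<^bsub>M\<^esub> y) = component M p x \<oplus>\<^bsub>M\<^esub> component M p y"
proof (rule component_eqI)
  show "x \<oplus>\<^bsub>M\<^esub> y = (component M p x \<oplus>\<^bsub>M\<^esub> component M p y) \<oplus>\<^bsub>M\<^esub>
      (component M (p + 1) x \<oplus>\<^bsub>M\<^esub> component M (p + 1) y)"
    using component_sum assms M.four_swap component_closed by metis
qed (simp_all add: assms component_grade grade_add)

lemma component_smult:
  assumes "c \<in> carrier K" "x \<in> carrier M"
  shows "component M p (c \<odot>\<^bsub>M\<^esub> x) = c \<odot>\<^bsub>M\<^esub> component M p x"
proof (rule component_eqI)
  show "c \<odot>\<^bsub>M\<^esub> x = c \<odot>\<^bsub>M\<^esub> component M p x \<oplus>\<^bsub>M\<^esub> c \<odot>\<^bsub>M\<^esub> component M (p + 1) x"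
    using component_sum assms smult_r_distr component_closed by metis
qed (simp_all add: assms component_grade grade_smult)

text \<open>Signs and relations are only available for homogeneous elements; statements compatible
  with addition pass to the whole carrier by this rule.\<close>

lemma homogeneous_induct [consumes 1, case_names homogeneous add]:
  assumes "x \<in> carrier M"
    and "\<And>p x. x \<in> grade M p \<Longrightarrow> P x"
    and "\<And>x y. \<lbrakk>x \<in> carrier M; y \<in> carrier M; P x; P y\<rbrakk> \<Longrightarrow> P (x \<oplus>\<^bsub>M\<^esub> y)"
  shows "P x"
  using decomposition [OF assms(1)] assms grade_closed by metis

end

context superalgebra
begin

lemma prod_zero_left [simp]: "x \<in> carrier A \<Longrightarrow> \<zero>\<^bsub>A\<^esub> \<otimes>\<^bsub>A\<^esub> x = \<zero>\<^bsub>A\<^esub>"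
  using prod_smult_left [of "\<zero>\<^bsub>K\<^esub>" "\<zero>\<^bsub>A\<^esub>" x] by (simp add: prod_closed)

lemma prod_zero_right [simp]: "x \<in> carrier A \<Longrightarrow> x \<otimes>\<^bsub>A\<^esub> \<zero>\<^bsub>A\<^esub> = \<zero>\<^bsub>A\<^esub>"
  using prod_smult_right [of "\<zero>\<^bsub>K\<^esub>" x "\<zero>\<^bsub>A\<^esub>"] by (simp add: prod_closed)

lemma prod_minus_left:
  assumes "x \<in> carrier A" "y \<in> carrier A"
  shows "(\<ominus>\<^bsub>A\<^esub> x) \<otimes>\<^bsub>A\<^esub> y = \<ominus>\<^bsub>A\<^esub> (x \<otimes>\<^bsub>A\<^esub> y)"
  using prod_add_left [of "\<ominus>\<^bsub>A\<^esub> x" x y] assms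
  by (simp add: M.l_neg prod_closed M.minus_equality)

lemma prod_minus_right:
  assumes "x \<in> carrier A" "y \<in> carrier A"
  shows "x \<otimes>\<^bsub>A\<^esub> (\<ominus>\<^bsub>A\<^esub> y) = \<ominus>\<^bsub>A\<^esub> (x \<otimes>\<^bsub>A\<^esub> y)"
  using prod_add_right [of "\<ominus>\<^bsub>A\<^esub> y" y x] assms
  by (simp add: M.l_neg prod_closed M.minus_equality)

lemma prod_ksign_left:
  "\<lbrakk>x \<in> carrier A; y \<in> carrier A\<rbrakk> \<Longrightarrow> ksign A p x \<otimes>\<^bsub>A\<^esub> y = ksign A p (x \<otimes>\<^bsub>A\<^esub> y)"
  by (cases p) (simp_all add: prod_minus_left)

lemma prod_ksign_right:
  "\<lbrakk>x \<in> carrier A; y \<in> carrier A\<rbrakk> \<Longrightarrow> x \<otimes>\<^bsub>A\<^esub> ksign A p y = ksign A p (x \<otimes>\<^bsub>A\<^esub> y)"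
  by (cases p) (simp_all add: prod_minus_right)

lemmas superalgebra_simprules
  [algebra superalgebra "zero A" "add A" "a_inv A" "a_minus A" "mult A"] =
  M.abelian_group_simprules prod_closed prod_add_left prod_add_right prod_minus_left
  prod_minus_right prod_zero_left prod_zero_right

end

context lie_superalgebra
begin

lemma skew': "\<lbrakk>x \<in> grade L p; y \<in> grade L q\<rbrakk> \<Longrightarrow> x \<otimes>\<^bsub>L\<^esub> y = ksign L (1 + p * q) (y \<otimes>\<^bsub>L\<^esub> x)"
  using skew [of x p y q] by (cases p; cases q) (simp_all add: prod_closed grade_closed)

text \<open>The cyclic Jacobi identity solved for its second term. Skew symmetry turns the brackets
  of \<open>y z\<close> with \<open>x\<close>, of \<open>z x\<close> with \<open>y\<close>, and of
  \<open>z\<close> with \<open>x\<close> around.\<close>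

lemma leibniz:
  assumes "x \<in> grade L p" "y \<in> grade L q" "z \<in> grade L r"
  shows "x \<otimes>\<^bsub>L\<^esub> (y \<otimes>\<^bsub>L\<^esub> z) = (x \<otimes>\<^bsub>L\<^esub> y) \<otimes>\<^bsub>L\<^esub> z \<oplus>\<^bsub>L\<^esub> ksign L (p * q) (y \<otimes>\<^bsub>L\<^esub> (x \<otimes>\<^bsub>L\<^esub> z))"
proof -
  have c [simp]: "x \<in> carrier L" "y \<in> carrier L" "z \<in> carrier L"
    using assms grade_closed by blast+
  have "(y \<otimes>\<^bsub>L\<^esub> z) \<otimes>\<^bsub>L\<^esub> x = ksign L (1 + (q + r) * p) (x \<otimes>\<^bsub>L\<^esub> (y \<otimes>\<^bsub>L\<^esub> z))"
    using skew' assms prod_grade by blast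
  moreover have "(z \<otimes>\<^bsub>L\<^esub> x) \<otimes>\<^bsub>L\<^esub> y = ksign L (1 + (r + p) * q) (y \<otimes>\<^bsub>L\<^esub> (z \<otimes>\<^bsub>L\<^esub> x))"
    using skew' assms prod_grade by blast
  moreover have "z \<otimes>\<^bsub>L\<^esub> x = ksign L (1 + r * p) (x \<otimes>\<^bsub>L\<^esub> z)"
    using skew' assms by blast
  moreover define u v w where "u = (x \<otimes>\<^bsub>L\<^esub> y) \<otimes>\<^bsub>L\<^esub> z" and "v = x \<otimes>\<^bsub>L\<^esub> (y \<otimes>\<^bsub>L\<^esub> z)"
    and "w = y \<otimes>\<^bsub>L\<^esub> (x \<otimes>\<^bsub>L\<^esub> z)"
  moreover have cc [simp]: "u \<in> carrier L" "v \<in> carrier L" "w \<in> carrier L"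
    unfolding u_def v_def w_def by (simp_all add: prod_closed)
  ultimately have "ksign L (p * r) u
      \<oplus>\<^bsub>L\<^esub> ksign L (q * p) (ksign L (1 + (q + r) * p) v)
      \<oplus>\<^bsub>L\<^esub> ksign L (r * q) (ksign L (1 + (r + p) * q) (ksign L (1 + r * p) w)) = \<zero>\<^bsub>L\<^esub>"
    using jacobi [OF assms] by (simp add: prod_closed prod_ksign_right)
  \<comment> \<open>Clears the sign of the first summand. The sign \<open>(-1)^(pq)\<close> that
    remains on the third is confirmed degree by degree.\<close>
  then have "ksign L (p * r) (ksign L (p * r) u
      \<oplus>\<^bsub>L\<^esub> ksign L (q * p) (ksign L (1 + (q + r) * p) v)
      \<oplus>\<^bsub>L\<^esub> ksign L (r * q) (ksign L (1 + (r + p) * q) (ksign L (1 + r * p) w))) = \<zero>\<^bsub>L\<^esub>"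
    by simp
  then have "u \<oplus>\<^bsub>L\<^esub> \<ominus>\<^bsub>L\<^esub> v \<oplus>\<^bsub>L\<^esub> ksign L (p * q) w = \<zero>\<^bsub>L\<^esub>"
    by (cases p; cases q; cases r) (simp_all add: M.minus_add)
  moreover have "\<lbrakk>a \<in> carrier L; b \<in> carrier L; d \<in> carrier L; a \<oplus>\<^bsub>L\<^esub> \<ominus>\<^bsub>L\<^esub> b \<oplus>\<^bsub>L\<^esub> d = \<zero>\<^bsub>L\<^esub>\<rbrakk> \<Longrightarrow>
      a \<oplus>\<^bsub>L\<^esub> d = b" for a b d
    by (rule M.diff_zero_eq) (simp_all add: M.a_ac)
  ultimately have "u \<oplus>\<^bsub>L\<^esub> ksign L (p * q) w = v"
    using cc M.ksign_closed by blast
  then show ?thesis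
    by (simp add: u_def v_def w_def)
qed

end

text \<open>The bracket conditions of a Lie superalgebra without the directness of the grading, which for
  a presented algebra is only available after evaluating terms in it.\<close>

locale pre_lie_superalgebra = module K L
  for K :: "('k, 'n) ring_scheme" (structure)
    and L :: "('k, 'a, 'm) superalgebra_scheme" (structure) +
  assumes grade_submodule': "submodule (grade L p) K L"
    and pre_closed: "\<lbrakk>x \<in> carrier L; y \<in> carrier L\<rbrakk> \<Longrightarrow> x \<otimes>\<^bsub>L\<^esub> y \<in> carrier L"
    and pre_add_left: "\<lbrakk>x \<in> carrier L; y \<in> carrier L; z \<in> carrier L\<rbrakk> \<Longrightarrow>
      (x \<oplus>\<^bsub>L\<^esub> y) \<otimes>\<^bsub>L\<^esub> z = (x \<otimes>\<^bsub>L\<^esub> z) \<oplus>\<^bsub>L\<^esub> (y \<otimes>\<^bsub>L\<^esub> z)"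
    and pre_add_right: "\<lbrakk>x \<in> carrier L; y \<in> carrier L; z \<in> carrier L\<rbrakk> \<Longrightarrow>
      z \<otimes>\<^bsub>L\<^esub> (x \<oplus>\<^bsub>L\<^esub> y) = (z \<otimes>\<^bsub>L\<^esub> x) \<oplus>\<^bsub>L\<^esub> (z \<otimes>\<^bsub>L\<^esub> y)"
    and pre_smult_left: "\<lbrakk>c \<in> carrier K; x \<in> carrier L; y \<in> carrier L\<rbrakk> \<Longrightarrow>
      (c \<odot>\<^bsub>L\<^esub> x) \<otimes>\<^bsub>L\<^esub> y = c \<odot>\<^bsub>L\<^esub> (x \<otimes>\<^bsub>L\<^esub> y)"
    and pre_smult_right: "\<lbrakk>c \<in> carrier K; x \<in> carrier L; y \<in> carrier L\<rbrakk> \<Longrightarrow>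
      x \<otimes>\<^bsub>L\<^esub> (c \<odot>\<^bsub>L\<^esub> y) = c \<odot>\<^bsub>L\<^esub> (x \<otimes>\<^bsub>L\<^esub> y)"
    and pre_grade: "\<lbrakk>x \<in> grade L p; y \<in> grade L q\<rbrakk> \<Longrightarrow> x \<otimes>\<^bsub>L\<^esub> y \<in> grade L (p + q)"
    and pre_skew: "\<lbrakk>x \<in> grade L p; y \<in> grade L q\<rbrakk> \<Longrightarrow>
      x \<otimes>\<^bsub>L\<^esub> y = \<ominus>\<^bsub>L\<^esub> (ksign L (p * q) (y \<otimes>\<^bsub>L\<^esub> x))"
    and pre_jacobi: "\<lbrakk>x \<in> grade L p; y \<in> grade L q; z \<in> grade L r\<rbrakk> \<Longrightarrow>
      ksign L (p * r) ((x \<otimes>\<^bsub>L\<^esub> y) \<otimes>\<^bsub>L\<^esub> z)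
      \<oplus>\<^bsub>L\<^esub> ksign L (q * p) ((y \<otimes>\<^bsub>L\<^esub> z) \<otimes>\<^bsub>L\<^esub> x)
      \<oplus>\<^bsub>L\<^esub> ksign L (r * q) ((z \<otimes>\<^bsub>L\<^esub> x) \<otimes>\<^bsub>L\<^esub> y) = \<zero>\<^bsub>L\<^esub>"

lemma (in lie_superalgebra) pre_lie: "pre_lie_superalgebra K L"
  by (intro pre_lie_superalgebra.intro pre_lie_superalgebra_axioms.intro module_axioms)
    (fact grade_submodule prod_closed prod_add_left prod_add_right prod_smult_left
      prod_smult_right prod_grade skew jacobi)+

section \<open>Evaluation of Lie terms in an algebra\<close>

primrec eval_term :: "('k, 'a, 'm) superalgebra_scheme \<Rightarrow> ('x \<Rightarrow> 'a) \<Rightarrow> ('k, 'x) lie_term \<Rightarrow> 'a" where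
  "eval_term L g (LGen x) = g x"
| "eval_term L g LZero = \<zero>\<^bsub>L\<^esub>"
| "eval_term L g (LAdd s t) = eval_term L g s \<oplus>\<^bsub>L\<^esub> eval_term L g t"
| "eval_term L g (LScale c t) = c \<odot>\<^bsub>L\<^esub> eval_term L g t"
| "eval_term L g (LBr s t) = eval_term L g s \<otimes>\<^bsub>L\<^esub> eval_term L g t"

lemma lie_term_deg_in_terms: "lie_term_deg K D t p \<Longrightarrow> t \<in> lie_terms K D"
  by (induction rule: lie_term_deg.induct) (auto intro: lie_terms.intros)

context cring
begin

lemma LNeg_in_terms: "t \<in> lie_terms R D \<Longrightarrow> LNeg R t \<in> lie_terms R D"
  by (simp add: LNeg_def lie_terms.intros)

lemma LSign_in_terms: "t \<in> lie_terms R D \<Longrightarrow> LSign R p t \<in> lie_terms R D"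
  by (simp add: LSign_def LNeg_in_terms)

lemma LNeg_deg: "lie_term_deg R D t p \<Longrightarrow> lie_term_deg R D (LNeg R t) p"
  by (simp add: LNeg_def lie_term_deg.intros)

lemma lie_cong_in_terms:
  "lie_cong R D Rel s t \<Longrightarrow> s \<in> lie_terms R D \<and> t \<in> lie_terms R D"
  by (induction rule: lie_cong.induct)
    (auto intro!: lie_terms.intros LNeg_in_terms LSign_in_terms intro: lie_term_deg_in_terms)

end

context pre_lie_superalgebra
begin

lemma grade_closed': "x \<in> grade L p \<Longrightarrow> x \<in> carrier L"
  using submoduleE(1) [OF grade_submodule'] by blast

lemma eval_closed:
  assumes "\<And>x p. x \<in> D p \<Longrightarrow> g x \<in> grade L p"
  shows "t \<in> lie_terms K D \<Longrightarrow> eval_term L g t \<in> carrier L"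
  by (induction rule: lie_terms.induct) (auto simp: pre_closed intro: grade_closed' assms)

lemma eval_grade:
  assumes "\<And>x p. x \<in> D p \<Longrightarrow> g x \<in> grade L p"
  shows "lie_term_deg K D t p \<Longrightarrow> eval_term L g t \<in> grade L p"
proof (induction rule: lie_term_deg.induct)
  case (2 p)
  then show ?case
    using submodule.axioms(1) [OF grade_submodule'] subgroup.one_closed by fastforce
next
  case (3 s p t)
  then show ?case
    using submoduleE(5) [OF grade_submodule'] by simp
next
  case (4 c t p)
  then show ?case
    using submoduleE(4) [OF grade_submodule'] by simp
next
  case (5 s p t q)
  then show ?case
    by (simp only: eval_term.simps pre_grade)
qed (simp_all add: assms)

lemma eval_LNeg: "eval_term L g t \<in> carrier L \<Longrightarrow> eval_term L g (LNeg K t) = \<ominus>\<^bsub>L\<^esub> eval_term L g t"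
  by (simp add: LNeg_def smult_l_minus)

lemma eval_LSign:
  "eval_term L g t \<in> carrier L \<Longrightarrow> eval_term L g (LSign K p t) = ksign L p (eval_term L g t)"
  by (cases p) (simp_all add: LSign_def eval_LNeg)

text \<open>The axioms of Lie superalgebras hold exactly in \<open>L\<close>, and the relations need
  only hold modulo \<open>Z\<close>. The congruence rules preserve equality modulo \<open>Z\<close>
  because \<open>Z\<close> is a submodule and brackets do not see central summands. With a nonzero
  \<open>Z\<close> this is the tool for comparing central extensions.\<close>

lemma eval_cong:
  assumes gen: "\<And>x p. x \<in> D p \<Longrightarrow> g x \<in> grade L p"
    and Z: "submodule Z K L"
    and central: "\<And>z x. \<lbrakk>z \<in> Z; x \<in> carrier L\<rbrakk> \<Longrightarrow> z \<otimes>\<^bsub>L\<^esub> x = \<zero>\<^bsub>L\<^esub> \<and> x \<otimes>\<^bsub>L\<^esub> z = \<zero>\<^bsub>L\<^esub>"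
    and rel: "\<And>s t. \<lbrakk>(s, t) \<in> Rel; s \<in> lie_terms K D; t \<in> lie_terms K D\<rbrakk> \<Longrightarrow>
      \<exists>z\<in>Z. eval_term L g s = eval_term L g t \<oplus>\<^bsub>L\<^esub> z"
  shows "lie_cong K D Rel s t \<Longrightarrow> \<exists>z\<in>Z. eval_term L g s = eval_term L g t \<oplus>\<^bsub>L\<^esub> z"
proof (induction rule: lie_cong.induct)
  note ZE = submoduleE [OF Z]
  have Z0: "\<zero>\<^bsub>L\<^esub> \<in> Z"
    using submodule.axioms(1) [OF Z] subgroup.one_closed by fastforce
  have eqI: "\<exists>z\<in>Z. a = b \<oplus>\<^bsub>L\<^esub> z" if "a = b" "b \<in> carrier L" for a b
    using that Z0 by force
  have cl [simp]: "t \<in> lie_terms K D \<Longrightarrow> eval_term L g t \<in> carrier L" for t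
    by (rule eval_closed) (use gen in auto)
  have gr: "lie_term_deg K D t p \<Longrightarrow> eval_term L g t \<in> grade L p" for t p
    by (rule eval_grade) (use gen in auto)
  note tm = R.lie_cong_in_terms
  {
    case (relation s t)
    then show ?case by (rule rel)
  next
    case (refl s)
    then show ?case by (intro eqI) simp_all
  next
    case (sym s t)
    then obtain z where z: "z \<in> Z" "eval_term L g s = eval_term L g t \<oplus>\<^bsub>L\<^esub> z" by blast
    have "eval_term L g t \<in> carrier L" "z \<in> carrier L"
      using sym tm z ZE(1) cl by blast+
    then have "eval_term L g t = eval_term L g s \<oplus>\<^bsub>L\<^esub> \<ominus>\<^bsub>L\<^esub> z"
      unfolding z(2) by algebra
    then show ?case using z ZE(3) by blast
  next
    case (trans s t u)
    then obtain z w where z: "z \<in> Z" "eval_term L g s = eval_term L g t \<oplus>\<^bsub>L\<^esub> z"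
      "w \<in> Z" "eval_term L g t = eval_term L g u \<oplus>\<^bsub>L\<^esub> w" by blast
    have "eval_term L g u \<in> carrier L" "z \<in> carrier L" "w \<in> carrier L"
      using trans tm z ZE(1) cl by blast+
    then have "eval_term L g s = eval_term L g u \<oplus>\<^bsub>L\<^esub> (w \<oplus>\<^bsub>L\<^esub> z)"
      unfolding z(2) z(4) by algebra
    then show ?case using z ZE(5) by blast
  next
    case (cong_add s s' t t')
    then obtain z w where z: "z \<in> Z" "eval_term L g s = eval_term L g s' \<oplus>\<^bsub>L\<^esub> z"
      "w \<in> Z" "eval_term L g t = eval_term L g t' \<oplus>\<^bsub>L\<^esub> w" by blast
    have "eval_term L g s' \<in> carrier L" "eval_term L g t' \<in> carrier L"
      "z \<in> carrier L" "w \<in> carrier L"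
      using cong_add tm z ZE(1) cl by blast+
    then have "eval_term L g (LAdd s t) = eval_term L g (LAdd s' t') \<oplus>\<^bsub>L\<^esub> (z \<oplus>\<^bsub>L\<^esub> w)"
      by (simp add: z(2,4) four_swap)
    then show ?case using z ZE(5) by blast
  next
    case (cong_scale c t t')
    then obtain z where z: "z \<in> Z" "eval_term L g t = eval_term L g t' \<oplus>\<^bsub>L\<^esub> z" by blast
    have "eval_term L g t' \<in> carrier L" "z \<in> carrier L"
      using cong_scale tm z ZE(1) cl by blast+
    then have "eval_term L g (LScale c t) = eval_term L g (LScale c t') \<oplus>\<^bsub>L\<^esub> (c \<odot>\<^bsub>L\<^esub> z)"
      using cong_scale by (simp add: z(2) smult_r_distr)
    then show ?case using z cong_scale ZE(4) by blast
  next
    case (cong_br s s' t t')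
    then obtain z w where z: "z \<in> Z" "eval_term L g s = eval_term L g s' \<oplus>\<^bsub>L\<^esub> z"
      "w \<in> Z" "eval_term L g t = eval_term L g t' \<oplus>\<^bsub>L\<^esub> w" by blast
    have "eval_term L g s' \<in> carrier L" "eval_term L g t' \<in> carrier L"
      "z \<in> carrier L" "w \<in> carrier L"
      using cong_br tm z ZE(1) cl by blast+
    \<comment> \<open>The bracket forgets \<open>z\<close> and \<open>w\<close>, so equality is
      exact at this point.\<close>
    then have "eval_term L g (LBr s t) = eval_term L g (LBr s' t')"
      using central [OF z(1)] central [OF z(3)]
      by (simp add: z(2,4) pre_add_left pre_add_right pre_closed)
    moreover have "eval_term L g (LBr s' t') \<in> carrier L"
      using cong_br tm cl pre_closed by (metis eval_term.simps(5))
    ultimately show ?case by (rule eqI)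
  next
    case (add_assoc s t u)
    then show ?case by (intro eqI) (simp_all add: M.a_assoc)
  next
    case (add_comm s t)
    then show ?case by (intro eqI) (simp_all add: M.a_comm)
  next
    case (add_zero t)
    then show ?case by (intro eqI) simp_all
  next
    case (add_neg t)
    then show ?case by (intro eqI) (simp_all add: eval_LNeg M.l_neg)
  next
    case (scale_l_distr c d t)
    then show ?case by (intro eqI) (simp_all add: smult_l_distr)
  next
    case (scale_r_distr c s t)
    then show ?case by (intro eqI) (simp_all add: smult_r_distr)
  next
    case (scale_scale c d t)
    then show ?case by (intro eqI) (simp_all add: smult_assoc1)
  next
    case (scale_one t)
    then show ?case by (intro eqI) simp_all
  next
    case (br_add_left s t u)
    then show ?case by (intro eqI) (simp_all add: pre_closed pre_add_left)
  next
    case (br_add_right s t u)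
    then show ?case by (intro eqI) (simp_all add: pre_closed pre_add_right)
  next
    case (br_scale_left c s t)
    then show ?case by (intro eqI) (simp_all add: pre_closed pre_smult_left)
  next
    case (br_scale_right c s t)
    then show ?case by (intro eqI) (simp_all add: pre_closed pre_smult_right)
  next
    case (skew s p t q)
    then have "s \<in> lie_terms K D" "t \<in> lie_terms K D"
      by (auto intro: lie_term_deg_in_terms)
    then have c: "eval_term L g (LBr t s) \<in> carrier L" "eval_term L g (LBr s t) \<in> carrier L"
      using pre_closed cl by auto
    have "eval_term L g (LSign K (p * q) (LBr t s)) = ksign L (p * q) (eval_term L g (LBr t s))"
      by (rule eval_LSign [OF c(1)])
    then have r: "eval_term L g (LNeg K (LSign K (p * q) (LBr t s)))
        = \<ominus>\<^bsub>L\<^esub> (ksign L (p * q) (eval_term L g (LBr t s)))"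
      using eval_LNeg c(1) ksign_closed by metis
    have "eval_term L g (LBr s t) = eval_term L g (LNeg K (LSign K (p * q) (LBr t s)))"
      unfolding r eval_term.simps by (rule pre_skew [OF gr [OF skew(1)] gr [OF skew(2)]])
    moreover from this have "eval_term L g (LNeg K (LSign K (p * q) (LBr t s))) \<in> carrier L"
      using c(2) by (rule subst)
    ultimately show ?case by (rule eqI)
  next
    case (jacobi s p t q u r)
    then have "s \<in> lie_terms K D" "t \<in> lie_terms K D" "u \<in> lie_terms K D"
      by (auto intro: lie_term_deg_in_terms)
    then have "eval_term L g (LBr (LBr s t) u) \<in> carrier L"
      "eval_term L g (LBr (LBr t u) s) \<in> carrier L" "eval_term L g (LBr (LBr u s) t) \<in> carrier L"
      by (simp_all add: pre_closed)
    note r = this [THEN eval_LSign]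
    have "eval_term L g (LAdd (LAdd (LSign K (p * r) (LBr (LBr s t) u))
        (LSign K (q * p) (LBr (LBr t u) s))) (LSign K (r * q) (LBr (LBr u s) t)))
      = eval_term L g LZero"
      unfolding eval_term.simps(2,3) r unfolding eval_term.simps(5)
      by (rule pre_jacobi [OF gr [OF jacobi(1)] gr [OF jacobi(2)] gr [OF jacobi(3)]])
    then show ?case by (rule eqI) simp
  }
qed

text \<open>The case where the central submodule is zero: strict relations give a well-defined
  homomorphism on classes.\<close>

lemma eval_cong_eq:
  assumes "\<And>x p. x \<in> D p \<Longrightarrow> g x \<in> grade L p"
    and "\<And>s t. \<lbrakk>(s, t) \<in> Rel; s \<in> lie_terms K D; t \<in> lie_terms K D\<rbrakk> \<Longrightarrow>
      eval_term L g s = eval_term L g t"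
    and "lie_cong K D Rel s t"
  shows "eval_term L g s = eval_term L g t"
proof -
  have cl: "t \<in> lie_terms K D \<Longrightarrow> eval_term L g t \<in> carrier L" for t
    by (rule eval_closed) (use assms(1) in auto)
  have "\<exists>z\<in>{\<zero>\<^bsub>L\<^esub>}. eval_term L g s = eval_term L g t \<oplus>\<^bsub>L\<^esub> z"
  proof (rule eval_cong [of D g "{\<zero>\<^bsub>L\<^esub>}" Rel s t])
    show "submodule {\<zero>\<^bsub>L\<^esub>} K L"
      by (rule submoduleI) (auto simp: M.minus_zero')
    show "z \<otimes>\<^bsub>L\<^esub> x = \<zero>\<^bsub>L\<^esub> \<and> x \<otimes>\<^bsub>L\<^esub> z = \<zero>\<^bsub>L\<^esub>" if "z \<in> {\<zero>\<^bsub>L\<^esub>}" "x \<in> carrier L" for z x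
      using pre_smult_left [of "\<zero>\<^bsub>K\<^esub>" "\<zero>\<^bsub>L\<^esub>" x] pre_smult_right [of "\<zero>\<^bsub>K\<^esub>" x "\<zero>\<^bsub>L\<^esub>"] that
      by (simp add: pre_closed)
    show "\<exists>z\<in>{\<zero>\<^bsub>L\<^esub>}. eval_term L g s = eval_term L g t \<oplus>\<^bsub>L\<^esub> z"
      if "(s, t) \<in> Rel" "s \<in> lie_terms K D" "t \<in> lie_terms K D" for s t
      unfolding assms(2) [OF that] using cl [OF that(3)] by simp
  qed (rule assms(1), assumption, rule assms(3))
  then show ?thesis
    using cl [of t] R.lie_cong_in_terms [OF assms(3)] by (metis M.r_zero singletonD)
qed

end

section \<open>Lie superalgebras given by generators and relations\<close>

text \<open>Operations on classes are defined as unions over representatives; they collapse to one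
  class as soon as the result does not depend on the representatives.\<close>

lemma UN_UN_const:
  "\<lbrakk>\<And>x y. \<lbrakk>x \<in> A; y \<in> B\<rbrakk> \<Longrightarrow> f x y = c; a \<in> A; b \<in> B\<rbrakk> \<Longrightarrow> (\<Union>x\<in>A. \<Union>y\<in>B. f x y) = c"
  by blast

lemma UN_const: "\<lbrakk>\<And>x. x \<in> A \<Longrightarrow> f x = c; a \<in> A\<rbrakk> \<Longrightarrow> (\<Union>x\<in>A. f x) = c"
  by blast

locale lie_presentation = cring K
  for K :: "('k, 'n) ring_scheme" (structure)
    and D :: "bit \<Rightarrow> 'x set"
    and Rel :: "(('k, 'x) lie_term \<times> ('k, 'x) lie_term) set"
begin

abbreviation "cls \<equiv> lie_class K D Rel"
abbreviation "P \<equiv> presented_lie K D Rel"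
abbreviation "tms \<equiv> lie_terms K D"

lemma cls_eq_iff: "\<lbrakk>s \<in> tms; t \<in> tms\<rbrakk> \<Longrightarrow> cls s = cls t \<longleftrightarrow> lie_cong K D Rel s t"
  unfolding lie_class_def using lie_cong.refl lie_cong.sym lie_cong.trans by blast

lemma cls_eqI: "lie_cong K D Rel s t \<Longrightarrow> cls s = cls t"
  using cls_eq_iff lie_cong_in_terms by blast

lemma in_cls_iff: "s \<in> cls t \<longleftrightarrow> lie_cong K D Rel t s"
  by (simp add: lie_class_def)

lemma cls_add: "\<lbrakk>s \<in> tms; t \<in> tms\<rbrakk> \<Longrightarrow> cls s \<oplus>\<^bsub>P\<^esub> cls t = cls (LAdd s t)"
proof -
  assume st: "s \<in> tms" "t \<in> tms"
  have "cls (LAdd s' t') = cls (LAdd s t)" if "s' \<in> cls s" "t' \<in> cls t" for s' t'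
    using that lie_cong.cong_add lie_cong.sym cls_eqI unfolding in_cls_iff by metis
  moreover have "s \<in> cls s" "t \<in> cls t"
    using st by (auto simp: in_cls_iff lie_cong.refl)
  ultimately show ?thesis
    unfolding presented_lie_def ring.simps monoid.simps by (rule UN_UN_const)
qed

lemma cls_br: "\<lbrakk>s \<in> tms; t \<in> tms\<rbrakk> \<Longrightarrow> cls s \<otimes>\<^bsub>P\<^esub> cls t = cls (LBr s t)"
proof -
  assume st: "s \<in> tms" "t \<in> tms"
  have "cls (LBr s' t') = cls (LBr s t)" if "s' \<in> cls s" "t' \<in> cls t" for s' t'
    using that lie_cong.cong_br lie_cong.sym cls_eqI unfolding in_cls_iff by metis
  moreover have "s \<in> cls s" "t \<in> cls t"
    using st by (auto simp: in_cls_iff lie_cong.refl)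
  ultimately show ?thesis
    unfolding presented_lie_def ring.simps monoid.simps by (rule UN_UN_const)
qed

lemma cls_scale: "\<lbrakk>c \<in> carrier K; t \<in> tms\<rbrakk> \<Longrightarrow> c \<odot>\<^bsub>P\<^esub> cls t = cls (LScale c t)"
proof -
  assume st: "c \<in> carrier K" "t \<in> tms"
  have "cls (LScale c t') = cls (LScale c t)" if "t' \<in> cls t" for t'
    using that st lie_cong.cong_scale lie_cong.sym cls_eqI unfolding in_cls_iff by metis
  moreover have "t \<in> cls t"
    using st by (auto simp: in_cls_iff lie_cong.refl)
  ultimately show ?thesis
    unfolding presented_lie_def module.simps by (rule UN_const)
qed

lemma P_zero: "\<zero>\<^bsub>P\<^esub> = cls LZero"
  by (simp add: presented_lie_def)

lemma P_carrier: "carrier P = cls ` tms"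
  by (simp add: presented_lie_def)

lemma P_grade: "grade P p = cls ` {t. lie_term_deg K D t p}"
  by (simp add: presented_lie_def)

lemma cls_closed: "t \<in> tms \<Longrightarrow> cls t \<in> carrier P"
  by (simp add: P_carrier)

lemma cls_grade: "lie_term_deg K D t p \<Longrightarrow> cls t \<in> grade P p"
  by (auto simp: P_grade)

lemma P_cases:
  assumes "X \<in> carrier P"
  obtains t where "t \<in> tms" "X = cls t"
  using assms by (auto simp: P_carrier)

lemma P_grade_cases:
  assumes "X \<in> grade P p"
  obtains t where "lie_term_deg K D t p" "t \<in> tms" "X = cls t"
  using assms lie_term_deg_in_terms unfolding P_grade by blast

lemmas tms_intros = lie_terms.intros LNeg_in_terms LSign_in_terms

lemma P_abelian_group: "abelian_group P"
proof (rule abelian_groupI)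
  show "X \<oplus>\<^bsub>P\<^esub> Y \<in> carrier P" if "X \<in> carrier P" "Y \<in> carrier P" for X Y
    using that by (auto elim!: P_cases simp: cls_add intro!: cls_closed tms_intros)
  show "\<zero>\<^bsub>P\<^esub> \<in> carrier P"
    by (simp add: P_zero cls_closed tms_intros)
  show "X \<oplus>\<^bsub>P\<^esub> Y \<oplus>\<^bsub>P\<^esub> Z = X \<oplus>\<^bsub>P\<^esub> (Y \<oplus>\<^bsub>P\<^esub> Z)"
    if "X \<in> carrier P" "Y \<in> carrier P" "Z \<in> carrier P" for X Y Z
    using that
    by (elim P_cases) (simp add: cls_add tms_intros, rule cls_eqI, rule lie_cong.add_assoc, simp_all)
  show "X \<oplus>\<^bsub>P\<^esub> Y = Y \<oplus>\<^bsub>P\<^esub> X" if "X \<in> carrier P" "Y \<in> carrier P" for X Y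
    using that
    by (elim P_cases) (simp add: cls_add, rule cls_eqI, rule lie_cong.add_comm, simp_all)
  show "\<zero>\<^bsub>P\<^esub> \<oplus>\<^bsub>P\<^esub> X = X" if "X \<in> carrier P" for X
    using that
    by (elim P_cases) (simp add: cls_add P_zero tms_intros, rule cls_eqI, rule lie_cong.add_zero, simp_all)
  show "\<exists>Y \<in> carrier P. Y \<oplus>\<^bsub>P\<^esub> X = \<zero>\<^bsub>P\<^esub>" if X: "X \<in> carrier P" for X
  proof -
    obtain t where t: "t \<in> tms" "X = cls t"
      using X by (rule P_cases)
    then have "cls (LNeg K t) \<oplus>\<^bsub>P\<^esub> X = \<zero>\<^bsub>P\<^esub>"
      using cls_eqI [OF lie_cong.add_neg, of t] by (simp only: cls_add P_zero tms_intros)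
    then show ?thesis
      using cls_closed [OF LNeg_in_terms [OF t(1)]] by blast
  qed
qed

lemma P_module: "module K P"
proof (rule moduleI)
  show "cring K" ..
  show "abelian_group P" by (rule P_abelian_group)
  show "c \<odot>\<^bsub>P\<^esub> X \<in> carrier P" if "c \<in> carrier K" "X \<in> carrier P" for c X
    using that by (auto elim!: P_cases simp: cls_scale intro!: cls_closed tms_intros)
  show "(c \<oplus> d) \<odot>\<^bsub>P\<^esub> X = (c \<odot>\<^bsub>P\<^esub> X) \<oplus>\<^bsub>P\<^esub> (d \<odot>\<^bsub>P\<^esub> X)"
    if "c \<in> carrier K" "d \<in> carrier K" "X \<in> carrier P" for c d X
    using that
    by (elim P_cases) (simp add: cls_scale cls_add tms_intros, rule cls_eqI, rule lie_cong.scale_l_distr, simp_all)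
  show "c \<odot>\<^bsub>P\<^esub> (X \<oplus>\<^bsub>P\<^esub> Y) = (c \<odot>\<^bsub>P\<^esub> X) \<oplus>\<^bsub>P\<^esub> (c \<odot>\<^bsub>P\<^esub> Y)"
    if "c \<in> carrier K" "X \<in> carrier P" "Y \<in> carrier P" for c X Y
    using that
    by (elim P_cases) (simp add: cls_scale cls_add tms_intros, rule cls_eqI, rule lie_cong.scale_r_distr, simp_all)
  show "(c \<otimes> d) \<odot>\<^bsub>P\<^esub> X = c \<odot>\<^bsub>P\<^esub> (d \<odot>\<^bsub>P\<^esub> X)"
    if "c \<in> carrier K" "d \<in> carrier K" "X \<in> carrier P" for c d X
    using that
    by (elim P_cases) (simp add: cls_scale tms_intros, rule cls_eqI, rule lie_cong.scale_scale, simp_all)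
  show "\<one> \<odot>\<^bsub>P\<^esub> X = X" if "X \<in> carrier P" for X
    using that
    by (elim P_cases) (simp add: cls_scale tms_intros, rule cls_eqI, rule lie_cong.scale_one, simp_all)
qed

lemma cls_neg:
  assumes "t \<in> tms"
  shows "cls (LNeg K t) = \<ominus>\<^bsub>P\<^esub> (cls t)"
proof -
  interpret module K P by (rule P_module)
  have "(\<ominus> \<one>) \<odot>\<^bsub>P\<^esub> cls t = \<ominus>\<^bsub>P\<^esub> (cls t)"
    using assms by (simp add: smult_l_minus cls_closed)
  then show ?thesis
    using assms by (simp add: LNeg_def cls_scale)
qed

lemma cls_sign: "t \<in> tms \<Longrightarrow> cls (LSign K p t) = ksign P p (cls t)"
  by (cases p) (simp_all add: LSign_def cls_neg)

text \<open>Every axiom is a rule of the congruence. What this cannot give is the trivial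
  intersection of the two degrees: a class might contain an even and an odd term at once.\<close>

lemma P_pre_lie: "pre_lie_superalgebra K P"
proof (intro pre_lie_superalgebra.intro pre_lie_superalgebra_axioms.intro P_module)
  interpret M: module K P by (rule P_module)
  show "submodule (grade P p) K P" for p
  proof (rule M.submoduleI)
    show "grade P p \<subseteq> carrier P"
      by (auto simp: P_grade P_carrier intro: lie_term_deg_in_terms)
    show "\<zero>\<^bsub>P\<^esub> \<in> grade P p"
      by (auto simp: P_zero intro!: cls_grade intro: lie_term_deg.intros)
    show "\<ominus>\<^bsub>P\<^esub> X \<in> grade P p" if "X \<in> grade P p" for X
      using that by (auto elim!: P_grade_cases simp: cls_neg [symmetric] intro!: cls_grade LNeg_deg)
    show "X \<oplus>\<^bsub>P\<^esub> Y \<in> grade P p" if "X \<in> grade P p" "Y \<in> grade P p" for X Y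
      using that by (auto elim!: P_grade_cases simp: cls_add intro!: cls_grade intro: lie_term_deg.intros)
    show "c \<odot>\<^bsub>P\<^esub> X \<in> grade P p" if "c \<in> carrier K" "X \<in> grade P p" for c X
      using that by (auto elim!: P_grade_cases simp: cls_scale intro!: cls_grade intro: lie_term_deg.intros)
  qed
  show "X \<otimes>\<^bsub>P\<^esub> Y \<in> carrier P" if "X \<in> carrier P" "Y \<in> carrier P" for X Y
    using that by (auto elim!: P_cases simp: cls_br intro!: cls_closed tms_intros)
  show "(X \<oplus>\<^bsub>P\<^esub> Y) \<otimes>\<^bsub>P\<^esub> Z = (X \<otimes>\<^bsub>P\<^esub> Z) \<oplus>\<^bsub>P\<^esub> (Y \<otimes>\<^bsub>P\<^esub> Z)"
    if "X \<in> carrier P" "Y \<in> carrier P" "Z \<in> carrier P" for X Y Z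
    using that
    by (elim P_cases) (simp add: cls_br cls_add tms_intros, rule cls_eqI, rule lie_cong.br_add_left, simp_all)
  show "Z \<otimes>\<^bsub>P\<^esub> (X \<oplus>\<^bsub>P\<^esub> Y) = (Z \<otimes>\<^bsub>P\<^esub> X) \<oplus>\<^bsub>P\<^esub> (Z \<otimes>\<^bsub>P\<^esub> Y)"
    if "X \<in> carrier P" "Y \<in> carrier P" "Z \<in> carrier P" for X Y Z
    using that
    by (elim P_cases) (simp add: cls_br cls_add tms_intros, rule cls_eqI, rule lie_cong.br_add_right, simp_all)
  show "(c \<odot>\<^bsub>P\<^esub> X) \<otimes>\<^bsub>P\<^esub> Y = c \<odot>\<^bsub>P\<^esub> (X \<otimes>\<^bsub>P\<^esub> Y)"
    if "c \<in> carrier K" "X \<in> carrier P" "Y \<in> carrier P" for c X Y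
    using that
    by (elim P_cases) (simp add: cls_br cls_scale tms_intros, rule cls_eqI, rule lie_cong.br_scale_left, simp_all)
  show "X \<otimes>\<^bsub>P\<^esub> (c \<odot>\<^bsub>P\<^esub> Y) = c \<odot>\<^bsub>P\<^esub> (X \<otimes>\<^bsub>P\<^esub> Y)"
    if "c \<in> carrier K" "X \<in> carrier P" "Y \<in> carrier P" for c X Y
    using that
    by (elim P_cases) (simp add: cls_br cls_scale tms_intros, rule cls_eqI, rule lie_cong.br_scale_right, simp_all)
  show "X \<otimes>\<^bsub>P\<^esub> Y \<in> grade P (p + q)" if "X \<in> grade P p" "Y \<in> grade P q" for X Y p q
    using that
    by (elim P_grade_cases) (simp only: cls_br, intro cls_grade lie_term_deg.intros(5))
  show "X \<otimes>\<^bsub>P\<^esub> Y = \<ominus>\<^bsub>P\<^esub> (ksign P (p * q) (Y \<otimes>\<^bsub>P\<^esub> X))"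
    if XY: "X \<in> grade P p" "Y \<in> grade P q" for X Y p q
  proof -
    obtain s t where d: "lie_term_deg K D s p" "lie_term_deg K D t q"
      and "s \<in> tms" "X = cls s" "t \<in> tms" "Y = cls t"
      using XY by (auto elim!: P_grade_cases)
    then show ?thesis
      using cls_eqI [OF lie_cong.skew [OF d]]
      by (simp only: cls_br cls_neg cls_sign tms_intros)
  qed
  show "ksign P (p * r) ((X \<otimes>\<^bsub>P\<^esub> Y) \<otimes>\<^bsub>P\<^esub> Z) \<oplus>\<^bsub>P\<^esub> ksign P (q * p) ((Y \<otimes>\<^bsub>P\<^esub> Z) \<otimes>\<^bsub>P\<^esub> X)
      \<oplus>\<^bsub>P\<^esub> ksign P (r * q) ((Z \<otimes>\<^bsub>P\<^esub> X) \<otimes>\<^bsub>P\<^esub> Y) = \<zero>\<^bsub>P\<^esub>"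
    if XYZ: "X \<in> grade P p" "Y \<in> grade P q" "Z \<in> grade P r" for X Y Z p q r
  proof -
    obtain s t u where d: "lie_term_deg K D s p" "lie_term_deg K D t q" "lie_term_deg K D u r"
      and "s \<in> tms" "X = cls s" "t \<in> tms" "Y = cls t" "u \<in> tms" "Z = cls u"
      using XYZ by (auto elim!: P_grade_cases)
    then show ?thesis
      using cls_eqI [OF lie_cong.jacobi [OF d]]
      by (simp only: cls_br cls_sign [symmetric] cls_add P_zero tms_intros)
  qed
qed

text \<open>Induction on terms: generators are homogeneous, and for a bracket the four products of
  components are sorted by degree.\<close>

lemma P_grade_sum: "carrier P = grade P 0 <+>\<^bsub>P\<^esub> grade P 1"
proof -
  interpret pre_lie_superalgebra K P by (rule P_pre_lie)
  note E = submoduleE [OF grade_submodule']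
  have zero: "\<zero>\<^bsub>P\<^esub> \<in> grade P p" for p
    by (auto simp: P_zero intro!: cls_grade intro: lie_term_deg.intros)
  have "\<exists>a \<in> grade P 0. \<exists>b \<in> grade P 1. cls t = a \<oplus>\<^bsub>P\<^esub> b" if "t \<in> tms" for t
    using that
  proof (induction rule: lie_terms.induct)
    case (1 x p)
    then have "cls (LGen x) \<in> grade P p"
      by (auto intro!: cls_grade intro: lie_term_deg.intros)
    moreover from this have "cls (LGen x) = cls (LGen x) \<oplus>\<^bsub>P\<^esub> \<zero>\<^bsub>P\<^esub>"
      "cls (LGen x) = \<zero>\<^bsub>P\<^esub> \<oplus>\<^bsub>P\<^esub> cls (LGen x)"
      by (simp_all add: grade_closed')
    ultimately show ?case
      using zero by (cases p) blast+
  next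
    case 2
    then show ?case
      using zero P_zero by (metis M.l_zero M.zero_closed)
  next
    case (3 s t)
    then obtain a b c d where *: "a \<in> grade P 0" "b \<in> grade P 1" "cls s = a \<oplus>\<^bsub>P\<^esub> b"
      "c \<in> grade P 0" "d \<in> grade P 1" "cls t = c \<oplus>\<^bsub>P\<^esub> d" by blast
    then have "cls (LAdd s t) = (a \<oplus>\<^bsub>P\<^esub> c) \<oplus>\<^bsub>P\<^esub> (b \<oplus>\<^bsub>P\<^esub> d)"
      using 3 by (simp add: cls_add [symmetric] M.four_swap grade_closed')
    then show ?case using * E(5) by blast
  next
    case (4 c t)
    then obtain a b where *: "a \<in> grade P 0" "b \<in> grade P 1" "cls t = a \<oplus>\<^bsub>P\<^esub> b" by blast
    then have "cls (LScale c t) = (c \<odot>\<^bsub>P\<^esub> a) \<oplus>\<^bsub>P\<^esub> (c \<odot>\<^bsub>P\<^esub> b)"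
      using 4 by (simp add: cls_scale [symmetric] smult_r_distr grade_closed')
    then show ?case using * 4 E(4) by blast
  next
    case (5 s t)
    then obtain a b c d where *: "a \<in> grade P 0" "b \<in> grade P 1" "cls s = a \<oplus>\<^bsub>P\<^esub> b"
      "c \<in> grade P 0" "d \<in> grade P 1" "cls t = c \<oplus>\<^bsub>P\<^esub> d" by blast
    then have cl: "a \<in> carrier P" "b \<in> carrier P" "c \<in> carrier P" "d \<in> carrier P"
      using grade_closed' by blast+
    then have "cls (LBr s t) = (a \<otimes>\<^bsub>P\<^esub> c \<oplus>\<^bsub>P\<^esub> b \<otimes>\<^bsub>P\<^esub> d) \<oplus>\<^bsub>P\<^esub> (a \<otimes>\<^bsub>P\<^esub> d \<oplus>\<^bsub>P\<^esub> b \<otimes>\<^bsub>P\<^esub> c)"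
      using 5 * by (simp add: cls_br [symmetric] pre_add_left pre_add_right pre_closed M.a_ac)
    moreover have "a \<otimes>\<^bsub>P\<^esub> c \<in> grade P 0" "b \<otimes>\<^bsub>P\<^esub> d \<in> grade P 0" "a \<otimes>\<^bsub>P\<^esub> d \<in> grade P 1"
      "b \<otimes>\<^bsub>P\<^esub> c \<in> grade P 1"
      using pre_grade [of a 0 c 0] pre_grade [of b 1 d 1] pre_grade [of a 0 d 1]
        pre_grade [of b 1 c 0] * by simp_all
    ultimately show ?case using E(5) by blast
  qed
  then have "carrier P \<subseteq> grade P 0 <+>\<^bsub>P\<^esub> grade P 1"
    by (auto simp: P_carrier set_add_def')
  moreover have "grade P 0 <+>\<^bsub>P\<^esub> grade P 1 \<subseteq> carrier P"
    by (auto simp: set_add_def' grade_closed')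
  ultimately show ?thesis by blast
qed

text \<open>A parity automorphism separates the two degrees.\<close>

lemma P_lie_superalgebra:
  assumes two: "\<one> \<oplus> \<one> \<in> Units K"
    and par: "\<And>x p. x \<in> D p \<Longrightarrow> g x = ksign P p (cls (LGen x))"
    and rel: "\<And>s t. \<lbrakk>(s, t) \<in> Rel; s \<in> tms; t \<in> tms\<rbrakk> \<Longrightarrow>
      eval_term P g s = eval_term P g t"
  shows "lie_superalgebra K P"
proof -
  interpret pre_lie_superalgebra K P by (rule P_pre_lie)
  let ?ev = "eval_term P g"
  have gen: "g x \<in> grade P p" if "x \<in> D p" for x p
  proof -
    have "cls (LGen x) \<in> grade P p"
      using that by (auto intro!: cls_grade intro: lie_term_deg.intros)
    then show ?thesis
      using par [OF that] submoduleE(3) [OF grade_submodule'] by (cases p) simp_all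
  qed
  have ev: "?ev s = ?ev t" if "lie_cong K D Rel s t" for s t
    by (rule eval_cong_eq [of D _ Rel]) (fact gen rel that)+
  \<comment> \<open>Evaluation at the signed generators is the parity automorphism: it multiplies
    the class of a homogeneous term by the sign of its degree.\<close>
  have sign: "?ev t = ksign P p (cls t)" if "lie_term_deg K D t p" for t p
    using that
  proof (induction rule: lie_term_deg.induct)
    case (1 x p)
    then show ?case using par by simp
  next
    case (2 p)
    then show ?case by (simp add: P_zero [symmetric])
  next
    case (3 s p t)
    then have "s \<in> tms" "t \<in> tms" by (auto intro: lie_term_deg_in_terms)
    then show ?case
      using 3 by (simp add: cls_add [symmetric] M.ksign_add cls_closed)
  next
    case (4 c t p)
    then have "t \<in> tms" by (auto intro: lie_term_deg_in_terms)
    then show ?case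
      using 4 by (simp add: cls_scale [symmetric] ksign_smult cls_closed)
  next
    case (5 s p t q)
    then have st: "s \<in> tms" "t \<in> tms" by (auto intro: lie_term_deg_in_terms)
    have neg: "(\<ominus>\<^bsub>P\<^esub> x) \<otimes>\<^bsub>P\<^esub> y = \<ominus>\<^bsub>P\<^esub> (x \<otimes>\<^bsub>P\<^esub> y)" "x \<otimes>\<^bsub>P\<^esub> (\<ominus>\<^bsub>P\<^esub> y) = \<ominus>\<^bsub>P\<^esub> (x \<otimes>\<^bsub>P\<^esub> y)"
      if "x \<in> carrier P" "y \<in> carrier P" for x y
      using that pre_smult_left [of "\<ominus> \<one>" x y] pre_smult_right [of "\<ominus> \<one>" x y]
      by (simp_all add: smult_l_minus pre_closed)
    show ?case
      using 5 st
      by (cases p; cases q) (simp_all add: cls_br [symmetric] neg pre_closed cls_closed)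
  qed
  \<comment> \<open>An element of both degrees is fixed by the automorphism as an even element and
    negated as an odd one. So it equals its negative and vanishes by invertibility of 2.\<close>
  have disjoint: "X = \<zero>\<^bsub>P\<^esub>" if X: "X \<in> grade P 0" "X \<in> grade P 1" for X
  proof -
    obtain s where s: "lie_term_deg K D s 0" "s \<in> tms" "X = cls s"
      using X(1) by (rule P_grade_cases)
    obtain t where t: "lie_term_deg K D t 1" "t \<in> tms" "X = cls t"
      using X(2) by (rule P_grade_cases)
    have "lie_cong K D Rel s t"
      using s t cls_eq_iff by metis
    then have "X = \<ominus>\<^bsub>P\<^esub> X"
      using ev [of s t] sign [OF s(1)] sign [OF t(1)] s(3) t(3) by simp
    moreover have "X \<in> carrier P"
      using X grade_closed' by blast
    ultimately have "X \<oplus>\<^bsub>P\<^esub> X = \<zero>\<^bsub>P\<^esub>"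
      using M.r_neg by metis
    then show ?thesis
      using two_torsion_free two \<open>X \<in> carrier P\<close> by blast
  qed
  have "\<zero>\<^bsub>P\<^esub> \<in> grade P p" for p
    by (auto simp: P_zero intro!: cls_grade intro: lie_term_deg.intros)
  with disjoint have disjoint': "grade P 0 \<inter> grade P 1 = {\<zero>\<^bsub>P\<^esub>}"
    by auto
  show ?thesis
    by (intro lie_superalgebra.intro superalgebra.intro supermodule.intro P_module
        supermodule_axioms.intro superalgebra_axioms.intro lie_superalgebra_axioms.intro
        P_grade_sum)
      (fact grade_submodule' pre_closed pre_add_left pre_add_right pre_smult_left
        pre_smult_right pre_grade pre_skew pre_jacobi disjoint')+
qed

end

section \<open>Families satisfying the Steinberg relations\<close>

definition sto_gen_map ::
    "(two \<Rightarrow> two \<Rightarrow> 'r \<Rightarrow> 'l) \<Rightarrow> (two \<Rightarrow> 'r \<Rightarrow> 'l) \<Rightarrow> (two \<Rightarrow> 'r \<Rightarrow> 'l) \<Rightarrow> 'r sto_gen \<Rightarrow> 'l" where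
  "sto_gen_map T F G x = (case x of Tg i j a \<Rightarrow> T i j a | Fg i a \<Rightarrow> F i a | Gg i a \<Rightarrow> G i a)"

lemma sto_gen_map_simps [simp]:
  "sto_gen_map T F G (Tg i j a) = T i j a"
  "sto_gen_map T F G (Fg i a) = F i a"
  "sto_gen_map T F G (Gg i a) = G i a"
  by (simp_all add: sto_gen_map_def)

text \<open>All relations of the Steinberg algebra except the one for $[f_{i1}(a), g_{1j}(b)]$, which will
  be allowed to hold up to a central element.\<close>

locale sto_family = superinvolution K R bar + L: pre_lie_superalgebra K L
  for K :: "('k, 'n) ring_scheme" (structure)
    and R :: "('k, 'r, 'm) superalgebra_scheme" (structure)
    and bar :: "'r \<Rightarrow> 'r"
    and L :: "('k, 'l, 'o) superalgebra_scheme" (structure) +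
  fixes T :: "two \<Rightarrow> two \<Rightarrow> 'r \<Rightarrow> 'l" and F G :: "two \<Rightarrow> 'r \<Rightarrow> 'l"
  assumes T_grade: "\<lbrakk>i \<noteq> j; a \<in> grade R p\<rbrakk> \<Longrightarrow> T i j a \<in> grade L p"
    and F_grade: "a \<in> grade R p \<Longrightarrow> F i a \<in> grade L (1 + p)"
    and G_grade: "a \<in> grade R p \<Longrightarrow> G i a \<in> grade L (1 + p)"
    and T_add: "\<lbrakk>i \<noteq> j; a \<in> grade R p; b \<in> grade R p\<rbrakk> \<Longrightarrow>
      T i j (a \<oplus>\<^bsub>R\<^esub> b) = T i j a \<oplus>\<^bsub>L\<^esub> T i j b"
    and F_add: "\<lbrakk>a \<in> grade R p; b \<in> grade R p\<rbrakk> \<Longrightarrow> F i (a \<oplus>\<^bsub>R\<^esub> b) = F i a \<oplus>\<^bsub>L\<^esub> F i b"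
    and G_add: "\<lbrakk>a \<in> grade R p; b \<in> grade R p\<rbrakk> \<Longrightarrow> G i (a \<oplus>\<^bsub>R\<^esub> b) = G i a \<oplus>\<^bsub>L\<^esub> G i b"
    and T_smult: "\<lbrakk>i \<noteq> j; c \<in> carrier K; a \<in> grade R p\<rbrakk> \<Longrightarrow> T i j (c \<odot>\<^bsub>R\<^esub> a) = c \<odot>\<^bsub>L\<^esub> T i j a"
    and F_smult: "\<lbrakk>c \<in> carrier K; a \<in> grade R p\<rbrakk> \<Longrightarrow> F i (c \<odot>\<^bsub>R\<^esub> a) = c \<odot>\<^bsub>L\<^esub> F i a"
    and G_smult: "\<lbrakk>c \<in> carrier K; a \<in> grade R p\<rbrakk> \<Longrightarrow> G i (c \<odot>\<^bsub>R\<^esub> a) = c \<odot>\<^bsub>L\<^esub> G i a"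
    and T_bar: "\<lbrakk>i \<noteq> j; a \<in> grade R p\<rbrakk> \<Longrightarrow> T i j a = \<ominus>\<^bsub>L\<^esub> (T j i (bar a))"
    and T_F: "\<lbrakk>i \<noteq> j; a \<in> grade R p; b \<in> grade R q\<rbrakk> \<Longrightarrow> T i j a \<otimes>\<^bsub>L\<^esub> F j b = F i (a \<otimes>\<^bsub>R\<^esub> b)"
    and T_F': "\<lbrakk>i \<noteq> j; a \<in> grade R p; b \<in> grade R q\<rbrakk> \<Longrightarrow>
      T i j a \<otimes>\<^bsub>L\<^esub> F i b = \<ominus>\<^bsub>L\<^esub> (F j (bar a \<otimes>\<^bsub>R\<^esub> b))"
    and G_T: "\<lbrakk>i \<noteq> j; a \<in> grade R p; b \<in> grade R q\<rbrakk> \<Longrightarrow> G i a \<otimes>\<^bsub>L\<^esub> T i j b = G j (a \<otimes>\<^bsub>R\<^esub> b)"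
    and G_T': "\<lbrakk>i \<noteq> j; a \<in> grade R p; b \<in> grade R q\<rbrakk> \<Longrightarrow>
      G j a \<otimes>\<^bsub>L\<^esub> T i j b = \<ominus>\<^bsub>L\<^esub> (G i (a \<otimes>\<^bsub>R\<^esub> bar b))"
    and F_F: "\<lbrakk>i \<noteq> j; a \<in> grade R p; b \<in> grade R q\<rbrakk> \<Longrightarrow> F i a \<otimes>\<^bsub>L\<^esub> F j b = \<zero>\<^bsub>L\<^esub>"
    and G_G: "\<lbrakk>i \<noteq> j; a \<in> grade R p; b \<in> grade R q\<rbrakk> \<Longrightarrow> G i a \<otimes>\<^bsub>L\<^esub> G j b = \<zero>\<^bsub>L\<^esub>"
begin

abbreviation "gmap \<equiv> sto_gen_map T F G"

lemma gmap_grade: "x \<in> sto_gens R p \<Longrightarrow> gmap x \<in> grade L p"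
  by (auto simp: sto_gens_def T_grade dest: F_grade G_grade)

lemma T_closed: "\<lbrakk>i \<noteq> j; a \<in> grade R p\<rbrakk> \<Longrightarrow> T i j a \<in> carrier L"
  using T_grade L.grade_closed' by blast

lemma F_closed: "a \<in> grade R p \<Longrightarrow> F i a \<in> carrier L"
  using F_grade L.grade_closed' by blast

lemma G_closed: "a \<in> grade R p \<Longrightarrow> G i a \<in> carrier L"
  using G_grade L.grade_closed' by blast

lemma gmap_rels:
  assumes Z: "submodule Z K L"
    and F_G: "\<And>i j a b p q. \<lbrakk>i \<noteq> j; a \<in> grade R p; b \<in> grade R q\<rbrakk> \<Longrightarrow>
      \<exists>z\<in>Z. F i a \<otimes>\<^bsub>L\<^esub> G j b = T i j (a \<otimes>\<^bsub>R\<^esub> b) \<oplus>\<^bsub>L\<^esub> z"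
    and "(s, t) \<in> sto_rels K R bar"
  shows "\<exists>z\<in>Z. eval_term L gmap s = eval_term L gmap t \<oplus>\<^bsub>L\<^esub> z"
proof -
  have Z0: "\<zero>\<^bsub>L\<^esub> \<in> Z"
    using submodule.axioms(1) [OF Z] subgroup.one_closed by fastforce
  have eqI: "\<exists>z\<in>Z. a = b \<oplus>\<^bsub>L\<^esub> z" if "a = b" "b \<in> carrier L" for a b
    using that Z0 by force
  note cl = T_closed F_closed G_closed grade_add grade_smult prod_grade bar_grade
  note fam = T_add F_add G_add T_smult F_smult G_smult T_bar F_F G_G
  note fam' = T_F T_F' G_T G_T'
  show ?thesis
    using assms(3)
  proof cases
    case (T_add i j a p b)
    then show ?thesis
      using fam by (intro eqI) (auto intro: cl)
  next
    case (F_add a p b i)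
    then show ?thesis
      using fam by (intro eqI) (auto intro: cl)
  next
    case (G_add a p b i)
    then show ?thesis
      using fam by (intro eqI) (auto intro: cl)
  next
    case (T_smult i j c a)
    then obtain p where "a \<in> grade R p" by (auto simp: homogeneous_def)
    then show ?thesis
      using T_smult fam by (intro eqI) (auto intro: cl)
  next
    case (F_smult c a i)
    then obtain p where "a \<in> grade R p" by (auto simp: homogeneous_def)
    then show ?thesis
      using F_smult fam by (intro eqI) (auto intro: cl)
  next
    case (G_smult c a i)
    then obtain p where "a \<in> grade R p" by (auto simp: homogeneous_def)
    then show ?thesis
      using G_smult fam by (intro eqI) (auto intro: cl)
  next
    case (T_bar i j a)
    then obtain p where a: "a \<in> grade R p" by (auto simp: homogeneous_def)
    then have "T j i (bar a) \<in> carrier L"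
      using T_bar by (auto intro: cl)
    then show ?thesis
      using T_bar fam(7) [OF T_bar(3) a] by (intro eqI) (auto simp: L.eval_LNeg)
  next
    case (T_F i j a b i')
    then obtain p q where ab: "a \<in> grade R p" "b \<in> grade R q" by (auto simp: homogeneous_def)
    note c = prod_grade [OF ab] prod_grade [OF bar_grade [OF ab(1)] ab(2)]
    show ?thesis
    \<comment> \<open>With only two indices, \<open>i'\<close> equals exactly one of
      \<open>i\<close> and \<open>j\<close>, so one of the two Kronecker deltas always drops
      out.\<close>
    proof (cases "i' = j")
      case True
      then have "i' \<noteq> i" using T_F by auto
      then show ?thesis
        using T_F True fam'(1) [OF T_F(3) ab] F_closed [OF c(1)]
        by (intro eqI) (auto simp: L.eval_LNeg L.minus_zero')
    next
      case False
      then have "i' = i" using T_F(3) by (cases i; cases j; cases i') auto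
      then show ?thesis
        using T_F False fam'(2) [OF T_F(3) ab] F_closed [OF c(2)]
        by (intro eqI) (auto simp: L.eval_LNeg)
    qed
  next
    case (G_T i j a b i')
    then obtain p q where ab: "a \<in> grade R p" "b \<in> grade R q" by (auto simp: homogeneous_def)
    note c = prod_grade [OF ab] prod_grade [OF ab(1) bar_grade [OF ab(2)]]
    show ?thesis
    proof (cases "i' = i")
      case True
      then have "i' \<noteq> j" using G_T by auto
      then show ?thesis
        using G_T True fam'(3) [OF G_T(3) ab] G_closed [OF c(1)]
        by (intro eqI) (auto simp: L.eval_LNeg L.minus_zero')
    next
      case False
      then have "i' = j" using G_T(3) by (cases i; cases j; cases i') auto
      then show ?thesis
        using G_T False fam'(4) [OF G_T(3) ab] G_closed [OF c(2)]
        by (intro eqI) (auto simp: L.eval_LNeg)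
    qed
  next
    case (F_F i j a b)
    then show ?thesis
      using fam by (intro eqI) (auto simp: homogeneous_def)
  next
    case (G_G i j a b)
    then show ?thesis
      using fam by (intro eqI) (auto simp: homogeneous_def)
  next
    case (F_G i j a b)
    then show ?thesis
      using assms(2) by (auto simp: homogeneous_def)
  qed
qed

text \<open>The form used for central extensions: a family whose relation for \<open>F\<close> and
  \<open>G\<close> holds modulo a central \<open>Z\<close> gives a map out of the Steinberg algebra
  that is well defined modulo \<open>Z\<close>.\<close>

lemma eval_cong_sto:
  assumes Z: "submodule Z K L"
    and central: "\<And>z x. \<lbrakk>z \<in> Z; x \<in> carrier L\<rbrakk> \<Longrightarrow> z \<otimes>\<^bsub>L\<^esub> x = \<zero>\<^bsub>L\<^esub> \<and> x \<otimes>\<^bsub>L\<^esub> z = \<zero>\<^bsub>L\<^esub>"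
    and F_G: "\<And>i j a b p q. \<lbrakk>i \<noteq> j; a \<in> grade R p; b \<in> grade R q\<rbrakk> \<Longrightarrow>
      \<exists>z\<in>Z. F i a \<otimes>\<^bsub>L\<^esub> G j b = T i j (a \<otimes>\<^bsub>R\<^esub> b) \<oplus>\<^bsub>L\<^esub> z"
    and cong: "lie_cong K (sto_gens R) (sto_rels K R bar) s t"
  shows "\<exists>z\<in>Z. eval_term L gmap s = eval_term L gmap t \<oplus>\<^bsub>L\<^esub> z"
proof (rule L.eval_cong [OF _ Z _ _ cong])
  show "\<exists>z\<in>Z. eval_term L gmap s = eval_term L gmap t \<oplus>\<^bsub>L\<^esub> z"
    if "(s, t) \<in> sto_rels K R bar" for s t
    by (rule gmap_rels [OF Z F_G that])
qed (simp_all add: gmap_grade central)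

text \<open>Stated for a single relation instead of a congruence, because this is the hypothesis
  that \<open>P_lie_superalgebra\<close> asks for.\<close>

lemma eval_rel_sto:
  assumes "\<And>i j a b p q. \<lbrakk>i \<noteq> j; a \<in> grade R p; b \<in> grade R q\<rbrakk> \<Longrightarrow>
      F i a \<otimes>\<^bsub>L\<^esub> G j b = T i j (a \<otimes>\<^bsub>R\<^esub> b)"
    and "(s, t) \<in> sto_rels K R bar" "t \<in> lie_terms K (sto_gens R)"
  shows "eval_term L gmap s = eval_term L gmap t"
proof -
  have "submodule {\<zero>\<^bsub>L\<^esub>} K L"
    by (rule L.submoduleI) (auto simp: L.minus_zero')
  moreover have "\<exists>z\<in>{\<zero>\<^bsub>L\<^esub>}. F i a \<otimes>\<^bsub>L\<^esub> G j b = T i j (a \<otimes>\<^bsub>R\<^esub> b) \<oplus>\<^bsub>L\<^esub> z"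
    if "i \<noteq> j" "a \<in> grade R p" "b \<in> grade R q" for i j a b p q
    using assms(1) [OF that] T_closed [OF that(1) prod_grade [OF that(2,3)]] by simp
  ultimately have "\<exists>z\<in>{\<zero>\<^bsub>L\<^esub>}. eval_term L gmap s = eval_term L gmap t \<oplus>\<^bsub>L\<^esub> z"
    by (rule gmap_rels) (use assms(2) in auto)
  moreover have "eval_term L gmap t \<in> carrier L"
    by (rule L.eval_closed [OF gmap_grade assms(3)])
  ultimately show ?thesis by simp
qed

lemma eval_cong_sto_eq:
  assumes "\<And>i j a b p q. \<lbrakk>i \<noteq> j; a \<in> grade R p; b \<in> grade R q\<rbrakk> \<Longrightarrow>
      F i a \<otimes>\<^bsub>L\<^esub> G j b = T i j (a \<otimes>\<^bsub>R\<^esub> b)"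
    and "lie_cong K (sto_gens R) (sto_rels K R bar) s t"
  shows "eval_term L gmap s = eval_term L gmap t"
  by (rule L.eval_cong_eq [OF gmap_grade _ assms(2)]) (auto intro: eval_rel_sto [OF assms(1)])

end

section \<open>The generators of the Steinberg algebra as a family\<close>

context superinvolution
begin

abbreviation "st \<equiv> sto K R bar"
abbreviation "ct \<equiv> sto_t K R bar"
abbreviation "cf \<equiv> sto_f K R bar"
abbreviation "cg \<equiv> sto_g K R bar"

lemma sto_presentation: "lie_presentation K"
  by unfold_locales

sublocale sto: lie_presentation K "sto_gens R" "sto_rels K R bar"
  rewrites "presented_lie K (sto_gens R) (sto_rels K R bar) = st"
  by (simp_all add: sto_presentation sto_def)

lemma homI: "a \<in> grade R p \<Longrightarrow> a \<in> homogeneous R"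
  by (auto simp: homogeneous_def)

lemma gen_in_terms:
  "\<lbrakk>i \<noteq> j; a \<in> homogeneous R\<rbrakk> \<Longrightarrow> LGen (Tg i j a) \<in> sto.tms"
  "a \<in> homogeneous R \<Longrightarrow> LGen (Fg i a) \<in> sto.tms"
  "a \<in> homogeneous R \<Longrightarrow> LGen (Gg i a) \<in> sto.tms"
proof -
  show "LGen (Tg i j a) \<in> sto.tms" if "i \<noteq> j" "a \<in> homogeneous R"
    using that by (auto simp: homogeneous_def sto_gens_def intro: lie_terms.intros(1))
  have "a \<in> grade R p \<Longrightarrow> Fg i a \<in> sto_gens R (1 + p)" "a \<in> grade R p \<Longrightarrow> Gg i a \<in> sto_gens R (1 + p)"
    for p by (auto simp: sto_gens_def)
  then show "LGen (Fg i a) \<in> sto.tms" "LGen (Gg i a) \<in> sto.tms" if "a \<in> homogeneous R"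
    using that by (auto simp: homogeneous_def intro: lie_terms.intros(1))
qed

lemma gen_class_grade:
  "\<lbrakk>i \<noteq> j; a \<in> grade R p\<rbrakk> \<Longrightarrow> ct i j a \<in> grade st p"
  "a \<in> grade R p \<Longrightarrow> cf i a \<in> grade st (1 + p)"
  "a \<in> grade R p \<Longrightarrow> cg i a \<in> grade st (1 + p)"
  unfolding sto_gen_class_def
  by (auto simp: sto_gens_def intro!: sto.cls_grade lie_term_deg.intros(1))

lemma rel_cls:
  assumes "(s, t) \<in> sto_rels K R bar" "s \<in> sto.tms" "t \<in> sto.tms"
  shows "sto.cls s = sto.cls t"
  using assms by (intro sto.cls_eqI lie_cong.relation)

lemma bar_homogeneous: "a \<in> homogeneous R \<Longrightarrow> bar a \<in> homogeneous R"
  by (auto simp: homogeneous_def intro: bar_grade)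

lemma prod_homogeneous:
  "\<lbrakk>a \<in> homogeneous R; b \<in> homogeneous R\<rbrakk> \<Longrightarrow> a \<otimes>\<^bsub>R\<^esub> b \<in> homogeneous R"
  by (auto simp: homogeneous_def intro: prod_grade)

lemma smult_homogeneous:
  "\<lbrakk>c \<in> carrier K; b \<in> homogeneous R\<rbrakk> \<Longrightarrow> c \<odot>\<^bsub>R\<^esub> b \<in> homogeneous R"
  by (auto simp: homogeneous_def intro: grade_smult)

lemma sto_F_G:
  assumes "i \<noteq> j" "a \<in> grade R p" "b \<in> grade R q"
  shows "cf i a \<otimes>\<^bsub>st\<^esub> cg j b = ct i j (a \<otimes>\<^bsub>R\<^esub> b)"
  using rel_cls [OF sto_rels.F_G [OF assms(1) homI [OF assms(2)] homI [OF assms(3)]]] assms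
    homI [OF assms(2)] homI [OF assms(3)]
  unfolding sto_gen_class_def
  by (simp add: sto.cls_br gen_in_terms lie_terms.intros prod_homogeneous)

text \<open>The Steinberg algebra is its own first model: each relation becomes an equation between
  classes. Families live over \<open>pre_lie_superalgebra\<close> because directness of the grading
  is still unproved at this stage.\<close>

lemma sto_family_sto: "sto_family K R bar st ct cf cg"
proof (intro sto_family.intro sto_family_axioms.intro superinvolution_axioms sto.P_pre_lie)
  interpret L: pre_lie_superalgebra K st by (rule sto.P_pre_lie)
  note tm = gen_in_terms lie_terms.intros prod_homogeneous bar_homogeneous smult_homogeneous homI
    R.LNeg_in_terms
  note cls = sto.cls_add sto.cls_br sto.cls_scale sto.cls_neg sto.P_zero [symmetric]
  note [simp] = sto_gen_class_def
  show "ct i j (a \<oplus>\<^bsub>R\<^esub> b) = ct i j a \<oplus>\<^bsub>st\<^esub> ct i j b"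
    if "i \<noteq> j" "a \<in> grade R p" "b \<in> grade R p" for i j a b p
    using rel_cls [OF sto_rels.T_add [OF that]] homI [OF grade_add [OF that(2,3)]] that
    by (simp add: tm cls)
  show "cf i (a \<oplus>\<^bsub>R\<^esub> b) = cf i a \<oplus>\<^bsub>st\<^esub> cf i b"
    if "a \<in> grade R p" "b \<in> grade R p" for i a b p
    using rel_cls [OF sto_rels.F_add [OF that]] homI [OF grade_add [OF that]] that
    by (simp add: tm cls)
  show "cg i (a \<oplus>\<^bsub>R\<^esub> b) = cg i a \<oplus>\<^bsub>st\<^esub> cg i b"
    if "a \<in> grade R p" "b \<in> grade R p" for i a b p
    using rel_cls [OF sto_rels.G_add [OF that]] homI [OF grade_add [OF that]] that
    by (simp add: tm cls)
  show "ct i j (c \<odot>\<^bsub>R\<^esub> a) = c \<odot>\<^bsub>st\<^esub> ct i j a"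
    if "i \<noteq> j" "c \<in> carrier K" "a \<in> grade R p" for i j c a p
    using rel_cls [OF sto_rels.T_smult] that homI [OF that(3)] by (simp add: tm cls)
  show "cf i (c \<odot>\<^bsub>R\<^esub> a) = c \<odot>\<^bsub>st\<^esub> cf i a"
    if "c \<in> carrier K" "a \<in> grade R p" for i c a p
    using rel_cls [OF sto_rels.F_smult] that homI [OF that(2)] by (simp add: tm cls)
  show "cg i (c \<odot>\<^bsub>R\<^esub> a) = c \<odot>\<^bsub>st\<^esub> cg i a"
    if "c \<in> carrier K" "a \<in> grade R p" for i c a p
    using rel_cls [OF sto_rels.G_smult] that homI [OF that(2)] by (simp add: tm cls)
  show "ct i j a = \<ominus>\<^bsub>st\<^esub> (ct j i (bar a))" if "i \<noteq> j" "a \<in> grade R p" for i j a p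
    using rel_cls [OF sto_rels.T_bar [OF that(1) homI [OF that(2)]]] that homI [OF that(2)]
    by (simp add: tm cls)
  fix i j :: two and a b p q
  assume ij: "i \<noteq> j" and ab: "a \<in> grade R p" "b \<in> grade R q"
  note h = homI [OF ab(1)] homI [OF ab(2)]
  have [simp]: "sto.cls t \<in> carrier st" if "t \<in> sto.tms" for t
    using that by (rule sto.cls_closed)
  show "ct i j a \<otimes>\<^bsub>st\<^esub> cf j b = cf i (a \<otimes>\<^bsub>R\<^esub> b)"
    using rel_cls [OF sto_rels.T_F [where i' = j, OF ij h]] ij h
    by (simp add: tm cls sto.cls_add [symmetric] L.minus_zero')
  show "ct i j a \<otimes>\<^bsub>st\<^esub> cf i b = \<ominus>\<^bsub>st\<^esub> (cf j (bar a \<otimes>\<^bsub>R\<^esub> b))"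
    using rel_cls [OF sto_rels.T_F [where i' = i, OF ij h]] ij h
    by (simp add: tm cls sto.cls_add [symmetric])
  show "cg i a \<otimes>\<^bsub>st\<^esub> ct i j b = cg j (a \<otimes>\<^bsub>R\<^esub> b)"
    using rel_cls [OF sto_rels.G_T [where i' = i, OF ij h]] ij h
    by (simp add: tm cls sto.cls_add [symmetric] L.minus_zero')
  show "cg j a \<otimes>\<^bsub>st\<^esub> ct i j b = \<ominus>\<^bsub>st\<^esub> (cg i (a \<otimes>\<^bsub>R\<^esub> bar b))"
    using rel_cls [OF sto_rels.G_T [where i' = j, OF ij h]] ij h
    by (simp add: tm cls sto.cls_add [symmetric])
  show "cf i a \<otimes>\<^bsub>st\<^esub> cf j b = \<zero>\<^bsub>st\<^esub>"
    using rel_cls [OF sto_rels.F_F [OF ij h]] ij h by (simp add: tm cls)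
  show "cg i a \<otimes>\<^bsub>st\<^esub> cg j b = \<zero>\<^bsub>st\<^esub>"
    using rel_cls [OF sto_rels.G_G [OF ij h]] ij h by (simp add: tm cls)
qed (fact gen_class_grade)+

end

section \<open>Extensions by cocycles\<close>

context pre_lie_superalgebra
begin

lemma pre_minus:
  assumes "x \<in> carrier L" "y \<in> carrier L"
  shows "(\<ominus>\<^bsub>L\<^esub> x) \<otimes>\<^bsub>L\<^esub> y = \<ominus>\<^bsub>L\<^esub> (x \<otimes>\<^bsub>L\<^esub> y)" "x \<otimes>\<^bsub>L\<^esub> (\<ominus>\<^bsub>L\<^esub> y) = \<ominus>\<^bsub>L\<^esub> (x \<otimes>\<^bsub>L\<^esub> y)"
  using assms pre_smult_left [of "\<ominus> \<one>" x y] pre_smult_right [of "\<ominus> \<one>" x y]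
  by (simp_all add: smult_l_minus pre_closed)

lemma pre_ksign:
  assumes "x \<in> carrier L" "y \<in> carrier L"
  shows "ksign L p x \<otimes>\<^bsub>L\<^esub> ksign L q y = ksign L (p + q) (x \<otimes>\<^bsub>L\<^esub> y)"
  using assms by (cases p; cases q) (simp_all add: pre_minus pre_closed)

end

section \<open>The parity automorphism of the Steinberg algebra\<close>

context superinvolution
begin

text \<open>A choice of degree, with value 0 at zero, which lies in both degrees. Signs formed with
  it are correct as long as the signed expression vanishes at zero, which is the content of
  \<open>ksign_parity\<close>.\<close>

definition parity :: "'a \<Rightarrow> bit" where
  "parity a = (if a \<in> grade R 0 then 0 else 1)"

lemma ksign_parity:
  assumes "a \<in> grade R p" "f \<zero>\<^bsub>R\<^esub> = \<zero>\<^bsub>M\<^esub>" "abelian_group M"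
  shows "ksign M (q + parity a) (f a) = ksign M (q + p) (f a)"
proof (cases "parity a = p")
  case False
  then have "a \<in> grade R 0" "p = 1"
    using assms(1) by (cases p; auto simp: parity_def split: if_splits)+
  then have "a = \<zero>\<^bsub>R\<^esub>"
    using assms(1) grade_both [of a 0 1] by simp
  then show ?thesis
    by (simp add: assms(2) abelian_group.ksign_zero [OF assms(3)])
qed simp

text \<open>Each generator is multiplied by the sign of its degree. The signed generators satisfy
  the relations again because both sides of every relation have the same degree; this is the parity
  automorphism needed for \<open>P_lie_superalgebra\<close>.\<close>

theorem sto_lie_superalgebra:
  assumes two: "\<one>\<^bsub>K\<^esub> \<oplus>\<^bsub>K\<^esub> \<one>\<^bsub>K\<^esub> \<in> Units K"
  shows "lie_superalgebra K st"
proof -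
  interpret f: sto_family K R bar st ct cf cg by (rule sto_family_sto)
  \<comment> \<open>The generators \<open>f\<close> and \<open>g\<close> have degree
    \<open>1 + |a|\<close>, hence the summand 1 below. The summand 0 for \<open>t\<close> only fits
    the expression to \<open>ksign_parity\<close>.\<close>
  let ?T = "\<lambda>i j a. ksign st (0 + parity a) (ct i j a)"
  let ?F = "\<lambda>i a. ksign st (1 + parity a) (cf i a)"
  let ?G = "\<lambda>i a. ksign st (1 + parity a) (cg i a)"
  have zero: "ct i j \<zero>\<^bsub>R\<^esub> = \<zero>\<^bsub>st\<^esub>" "cf i \<zero>\<^bsub>R\<^esub> = \<zero>\<^bsub>st\<^esub>" "cg i \<zero>\<^bsub>R\<^esub> = \<zero>\<^bsub>st\<^esub>" if "i \<noteq> j" for i j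
    using f.T_smult [OF that, of "\<zero>\<^bsub>K\<^esub>" "\<zero>\<^bsub>R\<^esub>" 0] f.F_smult [of "\<zero>\<^bsub>K\<^esub>" "\<zero>\<^bsub>R\<^esub>" 0 i]
      f.G_smult [of "\<zero>\<^bsub>K\<^esub>" "\<zero>\<^bsub>R\<^esub>" 0 i] f.T_closed [OF that, of "\<zero>\<^bsub>R\<^esub>" 0]
      f.F_closed [of "\<zero>\<^bsub>R\<^esub>" 0 i] f.G_closed [of "\<zero>\<^bsub>R\<^esub>" 0 i] by simp_all
  have zero': "cf i \<zero>\<^bsub>R\<^esub> = \<zero>\<^bsub>st\<^esub>" "cg i \<zero>\<^bsub>R\<^esub> = \<zero>\<^bsub>st\<^esub>" for i
    using zero(2,3) [of i "if i = I1 then I2 else I1"] by (auto split: if_splits)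
  note ag = f.L.abelian_group_axioms
  have T: "?T i j a = ksign st p (ct i j a)" if "i \<noteq> j" "a \<in> grade R p" for i j a p
    using ksign_parity [OF that(2), of "ct i j" st 0] zero that ag by simp
  have F: "?F i a = ksign st (1 + p) (cf i a)" if "a \<in> grade R p" for i a p
    by (rule ksign_parity [OF that _ ag, where f = "cf i"]) (rule zero'(1))
  have G: "?G i a = ksign st (1 + p) (cg i a)" if "a \<in> grade R p" for i a p
    by (rule ksign_parity [OF that _ ag, where f = "cg i"]) (rule zero'(2))
  note cl = f.T_closed f.F_closed f.G_closed
  have grade_sign: "ksign st q x \<in> grade st p" if "x \<in> grade st p" for x p q
    using that f.L.submoduleE(3) [OF f.L.grade_submodule'] by (cases q) simp_all
  interpret g: sto_family K R bar st ?T ?F ?G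
  proof (intro sto_family.intro sto_family_axioms.intro superinvolution_axioms sto.P_pre_lie)
    fix i j :: two and a b p q c
    {
      assume "a \<in> grade R p"
      then show "?F i a \<in> grade st (1 + p)" "?G i a \<in> grade st (1 + p)"
        by (simp_all only: grade_sign f.F_grade f.G_grade)
      assume "i \<noteq> j"
      with \<open>a \<in> grade R p\<close> show "?T i j a \<in> grade st p"
        by (intro grade_sign f.T_grade)
    }
    {
      assume a: "a \<in> grade R p" and b: "b \<in> grade R p"
      note ab = grade_add [OF a b]
      show "?F i (a \<oplus>\<^bsub>R\<^esub> b) = ?F i a \<oplus>\<^bsub>st\<^esub> ?F i b"
        unfolding F [OF a] F [OF b] F [OF ab]
        using a b by (simp add: f.F_add f.L.ksign_add cl)
      show "?G i (a \<oplus>\<^bsub>R\<^esub> b) = ?G i a \<oplus>\<^bsub>st\<^esub> ?G i b"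
        unfolding G [OF a] G [OF b] G [OF ab]
        using a b by (simp add: f.G_add f.L.ksign_add cl)
      assume ij: "i \<noteq> j"
      show "?T i j (a \<oplus>\<^bsub>R\<^esub> b) = ?T i j a \<oplus>\<^bsub>st\<^esub> ?T i j b"
        unfolding T [OF ij a] T [OF ij b] T [OF ij ab]
        using a b ij by (simp add: f.T_add f.L.ksign_add cl)
    }
    {
      assume a: "a \<in> grade R p" and c: "c \<in> carrier K"
      note ab = grade_smult [OF c a]
      show "?F i (c \<odot>\<^bsub>R\<^esub> a) = c \<odot>\<^bsub>st\<^esub> ?F i a"
        unfolding F [OF a] F [OF ab]
        using a c by (simp add: f.F_smult f.L.ksign_smult cl)
      show "?G i (c \<odot>\<^bsub>R\<^esub> a) = c \<odot>\<^bsub>st\<^esub> ?G i a"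
        unfolding G [OF a] G [OF ab]
        using a c by (simp add: f.G_smult f.L.ksign_smult cl)
      assume ij: "i \<noteq> j"
      show "?T i j (c \<odot>\<^bsub>R\<^esub> a) = c \<odot>\<^bsub>st\<^esub> ?T i j a"
        unfolding T [OF ij a] T [OF ij ab]
        using a c ij by (simp add: f.T_smult f.L.ksign_smult cl)
    }
    {
      assume a: "a \<in> grade R p" and ij: "i \<noteq> j"
      note a' = bar_grade [OF a]
      have ji: "j \<noteq> i" using ij by simp
      have "ksign st p (ct i j a) = \<ominus>\<^bsub>st\<^esub> ksign st p (ct j i (bar a))"
        using f.T_bar [OF ij a] f.T_closed [OF ji a'] by (simp add: f.L.ksign_minus)
      then show "?T i j a = \<ominus>\<^bsub>st\<^esub> (?T j i (bar a))"
        unfolding T [OF ij a] T [OF ji a'] .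
    }
    assume ij: "i \<noteq> j" and a: "a \<in> grade R p" and b: "b \<in> grade R q"
    then have ji: "j \<noteq> i" by simp
    note ab = prod_grade [OF a b] prod_grade [OF bar_grade [OF a] b]
      prod_grade [OF a bar_grade [OF b]]
    show "?T i j a \<otimes>\<^bsub>st\<^esub> ?F j b = ?F i (a \<otimes>\<^bsub>R\<^esub> b)"
      unfolding T [OF ij a] F [OF b] F [OF ab(1)]
      using a b ij ab by (simp add: f.T_F f.L.pre_ksign cl ac_simps)
    show "?T i j a \<otimes>\<^bsub>st\<^esub> ?F i b = \<ominus>\<^bsub>st\<^esub> (?F j (bar a \<otimes>\<^bsub>R\<^esub> b))"
      unfolding T [OF ij a] F [OF b] F [OF ab(2)]
      using a b ij ab by (simp add: f.T_F' f.L.pre_ksign f.L.ksign_minus cl ac_simps)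
    show "?G i a \<otimes>\<^bsub>st\<^esub> ?T i j b = ?G j (a \<otimes>\<^bsub>R\<^esub> b)"
      unfolding T [OF ij b] G [OF a] G [OF ab(1)]
      using a b ij ab by (simp add: f.G_T f.L.pre_ksign cl ac_simps)
    show "?G j a \<otimes>\<^bsub>st\<^esub> ?T i j b = \<ominus>\<^bsub>st\<^esub> (?G i (a \<otimes>\<^bsub>R\<^esub> bar b))"
      unfolding T [OF ij b] G [OF a] G [OF ab(3)]
      using a b ij ab by (simp add: f.G_T' f.L.pre_ksign f.L.ksign_minus cl ac_simps)
    show "?F i a \<otimes>\<^bsub>st\<^esub> ?F j b = \<zero>\<^bsub>st\<^esub>"
      unfolding F [OF a] F [OF b] using a b ij by (simp add: f.F_F f.L.pre_ksign cl)
    show "?G i a \<otimes>\<^bsub>st\<^esub> ?G j b = \<zero>\<^bsub>st\<^esub>"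
      unfolding G [OF a] G [OF b] using a b ij by (simp add: f.G_G f.L.pre_ksign cl)
  qed
  have FG: "?F i a \<otimes>\<^bsub>st\<^esub> ?G j b = ?T i j (a \<otimes>\<^bsub>R\<^esub> b)"
    if ij: "i \<noteq> j" and a: "a \<in> grade R p" and b: "b \<in> grade R q" for i j a b p q
  proof -
    have "(1 + p) + (1 + q) = p + q"
      by (simp add: ac_simps)
    then show ?thesis
      unfolding F [OF a] G [OF b] T [OF ij prod_grade [OF a b]]
      using a b ij by (simp add: sto_F_G f.L.pre_ksign cl)
  qed
  show ?thesis
  proof (rule sto.P_lie_superalgebra [OF two])
    show "g.gmap x = ksign st p (sto.cls (LGen x))" if x: "x \<in> sto_gens R p" for x p
    proof -
      consider i j a where "x = Tg i j a" "i \<noteq> j" "a \<in> grade R p"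
        | i a where "x = Fg i a" "a \<in> grade R (1 + p)"
        | i a where "x = Gg i a" "a \<in> grade R (1 + p)"
        using x unfolding sto_gens_def by blast
      then show ?thesis
        using T [of _ _ _ p] F [of _ "1 + p"] G [of _ "1 + p"]
        by cases (simp_all add: sto_gen_class_def)
    qed
    show "eval_term st g.gmap s = eval_term st g.gmap t"
      if "(s, t) \<in> sto_rels K R bar" "t \<in> sto.tms" for s t
      by (rule g.eval_rel_sto [OF FG that])
  qed
qed

end

text \<open>Covers both extensions by a cocycle and products of algebras.\<close>

definition pair_algebra ::
    "('k, 'a) superalgebra \<Rightarrow> ('k, 'c) superalgebra \<Rightarrow> ('a \<times> 'c \<Rightarrow> 'a \<times> 'c \<Rightarrow> 'a \<times> 'c) \<Rightarrow>
     ('k, 'a \<times> 'c) superalgebra" where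
  "pair_algebra L M m =
     \<lparr>carrier = carrier L \<times> carrier M, mult = m,
      one = (\<zero>\<^bsub>L\<^esub>, \<zero>\<^bsub>M\<^esub>), zero = (\<zero>\<^bsub>L\<^esub>, \<zero>\<^bsub>M\<^esub>),
      add = (\<lambda>(x, c) (y, c'). (x \<oplus>\<^bsub>L\<^esub> y, c \<oplus>\<^bsub>M\<^esub> c')),
      smult = (\<lambda>k (x, c). (k \<odot>\<^bsub>L\<^esub> x, k \<odot>\<^bsub>M\<^esub> c)),
      grade = (\<lambda>p. grade L p \<times> grade M p)\<rparr>"

lemma cocycle_extension_eq:
  "cocycle_extension L M \<beta> = pair_algebra L M (\<lambda>(x, c) (y, c'). (x \<otimes>\<^bsub>L\<^esub> y, \<beta> x y))"
  by (simp add: cocycle_extension_def pair_algebra_def)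

lemma pair_algebra_simps [simp]:
  "carrier (pair_algebra L M m) = carrier L \<times> carrier M"
  "x \<otimes>\<^bsub>pair_algebra L M m\<^esub> y = m x y"
  "\<zero>\<^bsub>pair_algebra L M m\<^esub> = (\<zero>\<^bsub>L\<^esub>, \<zero>\<^bsub>M\<^esub>)"
  "(a, c) \<oplus>\<^bsub>pair_algebra L M m\<^esub> (b, d) = (a \<oplus>\<^bsub>L\<^esub> b, c \<oplus>\<^bsub>M\<^esub> d)"
  "k \<odot>\<^bsub>pair_algebra L M m\<^esub> (a, c) = (k \<odot>\<^bsub>L\<^esub> a, k \<odot>\<^bsub>M\<^esub> c)"
  "grade (pair_algebra L M m) p = grade L p \<times> grade M p"
  by (simp_all add: pair_algebra_def)

section \<open>Algebra structures on pairs\<close>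

locale supermodule_pair = L: supermodule K L + M: supermodule K M
  for K :: "('k, 'n) ring_scheme" (structure)
    and L :: "('k, 'a) superalgebra" (structure)
    and M :: "('k, 'c) superalgebra" (structure)
begin

lemma pair_abelian_group: "abelian_group (pair_algebra L M m)"
proof (rule abelian_groupI)
  show "\<exists>y\<in>carrier (pair_algebra L M m). y \<oplus>\<^bsub>pair_algebra L M m\<^esub> x =
      \<zero>\<^bsub>pair_algebra L M m\<^esub>" if "x \<in> carrier (pair_algebra L M m)" for x
  proof -
    have "x \<in> carrier L \<times> carrier M"
      using that by simp
    then obtain a c where "x = (a, c)" "a \<in> carrier L" "c \<in> carrier M"
      by blast
    then show ?thesis
      by (intro bexI [of _ "(\<ominus>\<^bsub>L\<^esub> a, \<ominus>\<^bsub>M\<^esub> c)"]) (simp_all add: L.M.l_neg M.M.l_neg)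
  qed
qed (auto simp: L.M.a_ac M.M.a_ac)

lemma pair_module: "module K (pair_algebra L M m)"
  by (rule moduleI)
    (auto simp: pair_abelian_group L.R.is_cring L.smult_l_distr M.smult_l_distr L.smult_r_distr
      M.smult_r_distr L.smult_assoc1 M.smult_assoc1)

lemma pair_minus:
  assumes "a \<in> carrier L" "c \<in> carrier M"
  shows "\<ominus>\<^bsub>pair_algebra L M m\<^esub> (a, c) = (\<ominus>\<^bsub>L\<^esub> a, \<ominus>\<^bsub>M\<^esub> c)"
proof -
  interpret P: abelian_group "pair_algebra L M m" by (rule pair_abelian_group)
  show ?thesis
    by (rule P.minus_equality) (use assms in \<open>simp_all add: L.M.l_neg M.M.l_neg\<close>)
qed

lemma pair_ksign:
  assumes "a \<in> carrier L" "c \<in> carrier M"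
  shows "ksign (pair_algebra L M m) p (a, c) = (ksign L p a, ksign M p c)"
  using assms by (cases p) (simp_all add: pair_minus)

lemma pair_supermodule: "supermodule K (pair_algebra L M m)"
proof (intro supermodule.intro supermodule_axioms.intro pair_module)
  interpret P: module K "pair_algebra L M m" by (rule pair_module)
  show "submodule (grade (pair_algebra L M m) p) K (pair_algebra L M m)" for p
    by (rule P.submoduleI)
      (auto simp: L.grade_add M.grade_add L.grade_smult M.grade_smult pair_minus
        L.grade_minus M.grade_minus L.grade_closed M.grade_closed)
  show "carrier (pair_algebra L M m) = grade (pair_algebra L M m) 0
      <+>\<^bsub>pair_algebra L M m\<^esub> grade (pair_algebra L M m) 1"
  proof (intro equalityI subsetI)
    fix x
    assume "x \<in> carrier (pair_algebra L M m)"
    then obtain a c where x: "x = (a, c)" and ac: "a \<in> carrier L" "c \<in> carrier M"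
      by (cases x) auto
    then have "x = (component L 0 a, component M 0 c) \<oplus>\<^bsub>pair_algebra L M m\<^esub>
        (component L 1 a, component M 1 c)"
      by (simp add: L.component_sum01 M.component_sum01)
    then show "x \<in> grade (pair_algebra L M m) 0
        <+>\<^bsub>pair_algebra L M m\<^esub> grade (pair_algebra L M m) 1"
      unfolding set_add_def'
      using L.component_grade [OF ac(1)] M.component_grade [OF ac(2)] by fastforce
  qed (auto simp: set_add_def' L.grade_closed M.grade_closed)
  show "grade (pair_algebra L M m) 0 \<inter> grade (pair_algebra L M m) 1 =
      {\<zero>\<^bsub>pair_algebra L M m\<^esub>}"
    using L.grade_disjoint M.grade_disjoint by auto
qed

lemma pair_superalgebra:
  assumes "\<And>x y. \<lbrakk>x \<in> carrier L \<times> carrier M; y \<in> carrier L \<times> carrier M\<rbrakk> \<Longrightarrow>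
      m x y \<in> carrier L \<times> carrier M"
  and "\<And>a c b d y. \<lbrakk>a \<in> carrier L; c \<in> carrier M; b \<in> carrier L; d \<in> carrier M;
      y \<in> carrier L \<times> carrier M\<rbrakk> \<Longrightarrow>
      m (a \<oplus>\<^bsub>L\<^esub> b, c \<oplus>\<^bsub>M\<^esub> d) y = (fst (m (a, c) y) \<oplus>\<^bsub>L\<^esub> fst (m (b, d) y),
        snd (m (a, c) y) \<oplus>\<^bsub>M\<^esub> snd (m (b, d) y)) \<and>
      m y (a \<oplus>\<^bsub>L\<^esub> b, c \<oplus>\<^bsub>M\<^esub> d) = (fst (m y (a, c)) \<oplus>\<^bsub>L\<^esub> fst (m y (b, d)),
        snd (m y (a, c)) \<oplus>\<^bsub>M\<^esub> snd (m y (b, d)))"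
  and "\<And>k a c y. \<lbrakk>k \<in> carrier K; a \<in> carrier L; c \<in> carrier M; y \<in> carrier L \<times> carrier M\<rbrakk> \<Longrightarrow>
      m (k \<odot>\<^bsub>L\<^esub> a, k \<odot>\<^bsub>M\<^esub> c) y = (k \<odot>\<^bsub>L\<^esub> fst (m (a, c) y), k \<odot>\<^bsub>M\<^esub> snd (m (a, c) y)) \<and>
      m y (k \<odot>\<^bsub>L\<^esub> a, k \<odot>\<^bsub>M\<^esub> c) = (k \<odot>\<^bsub>L\<^esub> fst (m y (a, c)), k \<odot>\<^bsub>M\<^esub> snd (m y (a, c)))"
  and "\<And>x y p q. \<lbrakk>x \<in> grade L p \<times> grade M p; y \<in> grade L q \<times> grade M q\<rbrakk> \<Longrightarrow>
      m x y \<in> grade L (p + q) \<times> grade M (p + q)"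
  shows "superalgebra K (pair_algebra L M m)"
proof (intro superalgebra.intro superalgebra_axioms.intro pair_supermodule)
  fix x y z k
  assume x: "x \<in> carrier (pair_algebra L M m)" and y: "y \<in> carrier (pair_algebra L M m)"
  then show "x \<otimes>\<^bsub>pair_algebra L M m\<^esub> y \<in> carrier (pair_algebra L M m)"
    using assms(1) by simp
  obtain a c b d where ab: "x = (a, c)" "y = (b, d)" "a \<in> carrier L" "c \<in> carrier M"
    "b \<in> carrier L" "d \<in> carrier M"
    using x y by (cases x; cases y) auto
  have eq: "(u, v) \<oplus>\<^bsub>pair_algebra L M m\<^esub> w = (u \<oplus>\<^bsub>L\<^esub> fst w, v \<oplus>\<^bsub>M\<^esub> snd w)"
    "k \<odot>\<^bsub>pair_algebra L M m\<^esub> w = (k \<odot>\<^bsub>L\<^esub> fst w, k \<odot>\<^bsub>M\<^esub> snd w)" for u v w k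
    by (cases w, simp)+
  have eq': "m x z \<oplus>\<^bsub>pair_algebra L M m\<^esub> w = (fst (m x z) \<oplus>\<^bsub>L\<^esub> fst w, snd (m x z) \<oplus>\<^bsub>M\<^esub> snd w)" 
    for x z w
    using eq(1) by (metis prod.collapse)
  {
    assume z: "z \<in> carrier (pair_algebra L M m)"
    show "(x \<oplus>\<^bsub>pair_algebra L M m\<^esub> y) \<otimes>\<^bsub>pair_algebra L M m\<^esub> z =
        x \<otimes>\<^bsub>pair_algebra L M m\<^esub> z \<oplus>\<^bsub>pair_algebra L M m\<^esub> y \<otimes>\<^bsub>pair_algebra L M m\<^esub> z"
      "z \<otimes>\<^bsub>pair_algebra L M m\<^esub> (x \<oplus>\<^bsub>pair_algebra L M m\<^esub> y) =
        z \<otimes>\<^bsub>pair_algebra L M m\<^esub> x \<oplus>\<^bsub>pair_algebra L M m\<^esub> z \<otimes>\<^bsub>pair_algebra L M m\<^esub> y"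
      using assms(2) [of a c b d z] ab z by (simp_all add: eq')
  }
  {
    assume "k \<in> carrier K"
    then show "(k \<odot>\<^bsub>pair_algebra L M m\<^esub> x) \<otimes>\<^bsub>pair_algebra L M m\<^esub> y =
        k \<odot>\<^bsub>pair_algebra L M m\<^esub> (x \<otimes>\<^bsub>pair_algebra L M m\<^esub> y)"
      using assms(3) [of k a c y] ab y by (simp add: eq(2))
  }
  {
    assume "k \<in> carrier K"
    then show "x \<otimes>\<^bsub>pair_algebra L M m\<^esub> (k \<odot>\<^bsub>pair_algebra L M m\<^esub> y) =
        k \<odot>\<^bsub>pair_algebra L M m\<^esub> (x \<otimes>\<^bsub>pair_algebra L M m\<^esub> y)"
      using assms(3) [of k b d x] ab x by (simp add: eq(2))
  }
next
  show "x \<otimes>\<^bsub>pair_algebra L M m\<^esub> y \<in> grade (pair_algebra L M m) (p + q)"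
    if "x \<in> grade (pair_algebra L M m) p" "y \<in> grade (pair_algebra L M m) q" for x y p q
    using assms(4) that by simp
qed

end

text \<open>The bracket ignores the \<open>M\<close>-components of its arguments. So in the
  \<open>M\<close>-component skew symmetry and the Jacobi identity are literally the conditions on
  \<open>\<beta>\<close>.\<close>

theorem cocycle_extension_lie:
  fixes L :: "('k, 'b) superalgebra" and M :: "('k, 'd) superalgebra"
  assumes L: "lie_superalgebra K L" and M: "supermodule K M" and c: "super_2cocycle K L M \<beta>"
  shows "lie_superalgebra K (cocycle_extension L M \<beta>)"
proof -
  interpret L: lie_superalgebra K L by (rule L)
  interpret M: supermodule K M by (rule M)
  interpret supermodule_pair K L M by unfold_locales
  have [simp]: "\<beta> x y \<in> carrier M" if "x \<in> carrier L" "y \<in> carrier L" for x y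
    using c that unfolding super_2cocycle_def by blast
  have add: "\<beta> (x \<oplus>\<^bsub>L\<^esub> y) z = \<beta> x z \<oplus>\<^bsub>M\<^esub> \<beta> y z" "\<beta> z (x \<oplus>\<^bsub>L\<^esub> y) = \<beta> z x \<oplus>\<^bsub>M\<^esub> \<beta> z y"
    if "x \<in> carrier L" "y \<in> carrier L" "z \<in> carrier L" for x y z
    using c that unfolding super_2cocycle_def by blast+
  have smult: "\<beta> (k \<odot>\<^bsub>L\<^esub> x) y = k \<odot>\<^bsub>M\<^esub> \<beta> x y" "\<beta> x (k \<odot>\<^bsub>L\<^esub> y) = k \<odot>\<^bsub>M\<^esub> \<beta> x y"
    if "k \<in> carrier K" "x \<in> carrier L" "y \<in> carrier L" for k x y
    using c that unfolding super_2cocycle_def by blast+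
  have grade: "\<beta> x y \<in> grade M (p + q)" and skew: "\<beta> x y = \<ominus>\<^bsub>M\<^esub> (ksign M (p * q) (\<beta> y x))"
    if "x \<in> grade L p" "y \<in> grade L q" for x y p q
    using c that unfolding super_2cocycle_def by blast+
  have jacobi: "ksign M (p * r) (\<beta> (x \<otimes>\<^bsub>L\<^esub> y) z)
        \<oplus>\<^bsub>M\<^esub> ksign M (q * p) (\<beta> (y \<otimes>\<^bsub>L\<^esub> z) x)
        \<oplus>\<^bsub>M\<^esub> ksign M (r * q) (\<beta> (z \<otimes>\<^bsub>L\<^esub> x) y) = \<zero>\<^bsub>M\<^esub>"
    if "x \<in> grade L p" "y \<in> grade L q" "z \<in> grade L r" for x y z p q r
    using c that unfolding super_2cocycle_def by blast
  define m :: "'b \<times> 'd \<Rightarrow> 'b \<times> 'd \<Rightarrow> 'b \<times> 'd"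
    where "m = (\<lambda>(x, c) (y, c'). (x \<otimes>\<^bsub>L\<^esub> y, \<beta> x y))"
  have m [simp]: "m (x, c) (y, c') = (x \<otimes>\<^bsub>L\<^esub> y, \<beta> x y)" for x c y c'
    by (simp add: m_def)
  let ?E = "pair_algebra L M m"
  have "superalgebra K ?E"
    by (rule pair_superalgebra)
      (auto simp: L.prod_closed L.prod_add_left L.prod_add_right L.prod_smult_left
        L.prod_smult_right add smult intro: grade L.prod_grade)
  then have "lie_superalgebra K ?E"
  proof (intro lie_superalgebra.intro lie_superalgebra_axioms.intro)
    fix x y z p q r
    assume "x \<in> grade ?E p" "y \<in> grade ?E q"
    then obtain a c b d where ab: "x = (a, c)" "y = (b, d)" "a \<in> grade L p" "c \<in> grade M p"
      "b \<in> grade L q" "d \<in> grade M q"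
      by (cases x; cases y) auto
    then have cl: "a \<in> carrier L" "b \<in> carrier L"
      by (auto intro: L.grade_closed)
    have "m x y = (\<ominus>\<^bsub>L\<^esub> (ksign L (p * q) (b \<otimes>\<^bsub>L\<^esub> a)), \<ominus>\<^bsub>M\<^esub> (ksign M (p * q) (\<beta> b a)))"
      using L.skew [OF ab(3,5)] skew [OF ab(3,5)] ab(1,2) by (simp only: m)
    also have "... = \<ominus>\<^bsub>?E\<^esub> (ksign ?E (p * q) (m y x))"
      using cl unfolding ab(1,2) by (simp add: pair_minus pair_ksign L.prod_closed)
    finally show "x \<otimes>\<^bsub>?E\<^esub> y = \<ominus>\<^bsub>?E\<^esub> (ksign ?E (p * q) (y \<otimes>\<^bsub>?E\<^esub> x))"
      by simp
    assume "z \<in> grade ?E r"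
    then obtain u v where uv: "z = (u, v)" "u \<in> grade L r"
      by (cases z) auto
    then have cl': "u \<in> carrier L"
      by (auto intro: L.grade_closed)
    show "ksign ?E (p * r) ((x \<otimes>\<^bsub>?E\<^esub> y) \<otimes>\<^bsub>?E\<^esub> z)
        \<oplus>\<^bsub>?E\<^esub> ksign ?E (q * p) ((y \<otimes>\<^bsub>?E\<^esub> z) \<otimes>\<^bsub>?E\<^esub> x)
        \<oplus>\<^bsub>?E\<^esub> ksign ?E (r * q) ((z \<otimes>\<^bsub>?E\<^esub> x) \<otimes>\<^bsub>?E\<^esub> y) = \<zero>\<^bsub>?E\<^esub>"
      unfolding ab(1,2) uv(1)
      using L.jacobi [OF ab(3,5) uv(2)] jacobi [OF ab(3,5) uv(2)] cl cl'
      by (simp add: pair_ksign L.prod_closed)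
  qed
  then show ?thesis
    by (simp add: cocycle_extension_eq m_def)
qed

text \<open>Needed for the product of two central extensions, inside which the lift between them
  will be constructed as a graph.\<close>

theorem product_lie:
  fixes L :: "('k, 'b) superalgebra" and M :: "('k, 'd) superalgebra"
  assumes L: "lie_superalgebra K L" and M: "lie_superalgebra K M"
  shows "lie_superalgebra K (pair_algebra L M (\<lambda>(x, c) (y, d). (x \<otimes>\<^bsub>L\<^esub> y, c \<otimes>\<^bsub>M\<^esub> d)))"
proof -
  interpret L: lie_superalgebra K L by (rule L)
  interpret M: lie_superalgebra K M by (rule M)
  interpret supermodule_pair K L M by unfold_locales
  define m :: "'b \<times> 'd \<Rightarrow> 'b \<times> 'd \<Rightarrow> 'b \<times> 'd"
    where "m = (\<lambda>(x, c) (y, d). (x \<otimes>\<^bsub>L\<^esub> y, c \<otimes>\<^bsub>M\<^esub> d))"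
  have m [simp]: "m (x, c) (y, d) = (x \<otimes>\<^bsub>L\<^esub> y, c \<otimes>\<^bsub>M\<^esub> d)" for x c y d
    by (simp add: m_def)
  let ?E = "pair_algebra L M m"
  have "superalgebra K ?E"
    by (rule pair_superalgebra)
      (auto simp: L.prod_closed L.prod_add_left L.prod_add_right L.prod_smult_left
        L.prod_smult_right M.prod_closed M.prod_add_left M.prod_add_right M.prod_smult_left
        M.prod_smult_right intro: L.prod_grade M.prod_grade)
  then have "lie_superalgebra K ?E"
  proof (intro lie_superalgebra.intro lie_superalgebra_axioms.intro)
    fix x y z p q r
    assume "x \<in> grade ?E p" "y \<in> grade ?E q"
    then obtain a c b d where ab: "x = (a, c)" "y = (b, d)" "a \<in> grade L p" "c \<in> grade M p"
      "b \<in> grade L q" "d \<in> grade M q"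
      by (cases x; cases y) auto
    then have cl: "a \<in> carrier L" "b \<in> carrier L" "c \<in> carrier M" "d \<in> carrier M"
      by (auto intro: L.grade_closed M.grade_closed)
    have "m x y = (\<ominus>\<^bsub>L\<^esub> (ksign L (p * q) (b \<otimes>\<^bsub>L\<^esub> a)), \<ominus>\<^bsub>M\<^esub> (ksign M (p * q) (d \<otimes>\<^bsub>M\<^esub> c)))"
      using L.skew [OF ab(3,5)] M.skew [OF ab(4,6)] ab(1,2) by (simp only: m)
    also have "... = \<ominus>\<^bsub>?E\<^esub> (ksign ?E (p * q) (m y x))"
      using cl unfolding ab(1,2) by (simp add: pair_minus pair_ksign L.prod_closed M.prod_closed)
    finally show "x \<otimes>\<^bsub>?E\<^esub> y = \<ominus>\<^bsub>?E\<^esub> (ksign ?E (p * q) (y \<otimes>\<^bsub>?E\<^esub> x))"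
      by simp
    assume "z \<in> grade ?E r"
    then obtain u v where uv: "z = (u, v)" "u \<in> grade L r" "v \<in> grade M r"
      by (cases z) auto
    then have cl': "u \<in> carrier L" "v \<in> carrier M"
      by (auto intro: L.grade_closed M.grade_closed)
    show "ksign ?E (p * r) ((x \<otimes>\<^bsub>?E\<^esub> y) \<otimes>\<^bsub>?E\<^esub> z)
        \<oplus>\<^bsub>?E\<^esub> ksign ?E (q * p) ((y \<otimes>\<^bsub>?E\<^esub> z) \<otimes>\<^bsub>?E\<^esub> x)
        \<oplus>\<^bsub>?E\<^esub> ksign ?E (r * q) ((z \<otimes>\<^bsub>?E\<^esub> x) \<otimes>\<^bsub>?E\<^esub> y) = \<zero>\<^bsub>?E\<^esub>"
      unfolding ab(1,2) uv(1)
      using L.jacobi [OF ab(3,5) uv(2)] M.jacobi [OF ab(4,6) uv(3)] cl cl'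
      by (simp add: pair_ksign L.prod_closed M.prod_closed)
  qed
  then show ?thesis
    by (simp add: m_def)
qed

section \<open>Graded quotients\<close>

text \<open>Closure of \<open>I\<close> under components is what keeps the quotient graded: without
  it an even and an odd class could coincide without being zero.\<close>

locale graded_quotient = supermodule K M
  for K :: "('k, 'n) ring_scheme" (structure)
    and M :: "('k, 'a, 'm) superalgebra_scheme" (structure) +
  fixes I :: "'a set"
  assumes sub: "submodule I K M"
    and graded: "x \<in> I \<Longrightarrow> component M p x \<in> I"
begin

abbreviation "Q \<equiv> quot_superalgebra M I"
abbreviation pr :: "'a \<Rightarrow> 'a set" where "pr x \<equiv> I +>\<^bsub>M\<^esub> x"

lemmas sub_closed = submoduleE [OF sub]

lemma sub_zero: "\<zero>\<^bsub>M\<^esub> \<in> I"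
  using submodule.axioms(1) [OF sub] subgroup.one_closed by fastforce

lemma abelian_subgroup_sub: "abelian_subgroup I M"
  by (intro abelian_subgroupI3 additive_subgroupI submodule.axioms(1) [OF sub]
      M.abelian_group_axioms)

lemma pr_eq_iff:
  assumes "x \<in> carrier M" "y \<in> carrier M"
  shows "pr x = pr y \<longleftrightarrow> (\<exists>z\<in>I. x = y \<oplus>\<^bsub>M\<^esub> z)"
proof
  assume "pr x = pr y"
  moreover have "x \<in> pr x"
    using sub_zero assms by (force simp: a_r_coset_def')
  ultimately obtain z where "z \<in> I" "x = z \<oplus>\<^bsub>M\<^esub> y"
    by (auto simp: a_r_coset_def')
  then show "\<exists>z\<in>I. x = y \<oplus>\<^bsub>M\<^esub> z"
    using assms sub_closed(1) M.a_comm by blast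
next
  assume "\<exists>z\<in>I. x = y \<oplus>\<^bsub>M\<^esub> z"
  then obtain z where z: "z \<in> I" "z \<in> carrier M" "x = y \<oplus>\<^bsub>M\<^esub> z"
    using sub_closed(1) by blast
  have "h \<oplus>\<^bsub>M\<^esub> x \<in> pr y" "h \<oplus>\<^bsub>M\<^esub> y \<in> pr x" if "h \<in> I" for h
  proof -
    have h: "h \<in> carrier M"
      using that sub_closed(1) by blast
    have "h \<oplus>\<^bsub>M\<^esub> x = (h \<oplus>\<^bsub>M\<^esub> z) \<oplus>\<^bsub>M\<^esub> y" "h \<oplus>\<^bsub>M\<^esub> y = (h \<oplus>\<^bsub>M\<^esub> \<ominus>\<^bsub>M\<^esub> z) \<oplus>\<^bsub>M\<^esub> x"
      using h z(2) assms(2) unfolding z(3) by algebra+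
    then show "h \<oplus>\<^bsub>M\<^esub> x \<in> pr y" "h \<oplus>\<^bsub>M\<^esub> y \<in> pr x"
      using that z sub_closed(3,5) by (auto simp: a_r_coset_def')
  qed
  then show "pr x = pr y"
    by (auto simp: a_r_coset_def')
qed

lemma pr_zero_iff:
  assumes "x \<in> carrier M"
  shows "pr x = pr \<zero>\<^bsub>M\<^esub> \<longleftrightarrow> x \<in> I"
proof -
  have "(\<exists>z\<in>I. x = \<zero>\<^bsub>M\<^esub> \<oplus>\<^bsub>M\<^esub> z) \<longleftrightarrow> x \<in> I"
    using sub_closed(1) by force
  then show ?thesis
    using pr_eq_iff [OF assms M.zero_closed] by (simp only:)
qed

lemma Q_carrier: "carrier Q = pr ` carrier M"
  by (auto simp: quot_superalgebra_def A_RCOSETS_def')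

lemma Q_cases:
  assumes "X \<in> carrier Q"
  obtains x where "x \<in> carrier M" "X = pr x"
  using assms by (auto simp only: Q_carrier)

lemma pr_closed: "x \<in> carrier M \<Longrightarrow> pr x \<in> carrier Q"
  by (simp add: Q_carrier)

lemma Q_zero: "\<zero>\<^bsub>Q\<^esub> = pr \<zero>\<^bsub>M\<^esub>"
  using sub_closed(1) by (simp add: quot_superalgebra_def)

lemma pr_add: "\<lbrakk>x \<in> carrier M; y \<in> carrier M\<rbrakk> \<Longrightarrow> pr x \<oplus>\<^bsub>Q\<^esub> pr y = pr (x \<oplus>\<^bsub>M\<^esub> y)"
  by (simp add: quot_superalgebra_def abelian_subgroup.a_rcos_sum [OF abelian_subgroup_sub])

lemma pr_smult:
  assumes "c \<in> carrier K" "x \<in> carrier M"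
  shows "c \<odot>\<^bsub>Q\<^esub> pr x = pr (c \<odot>\<^bsub>M\<^esub> x)"
proof -
  have "pr (c \<odot>\<^bsub>M\<^esub> y) = pr (c \<odot>\<^bsub>M\<^esub> x)" if y: "y \<in> pr x" for y
  proof -
    obtain h where h: "h \<in> I" "h \<in> carrier M" "y = h \<oplus>\<^bsub>M\<^esub> x"
      using y sub_closed(1) by (auto simp: a_r_coset_def')
    then have "c \<odot>\<^bsub>M\<^esub> y = c \<odot>\<^bsub>M\<^esub> x \<oplus>\<^bsub>M\<^esub> c \<odot>\<^bsub>M\<^esub> h"
      using assms by (simp add: smult_r_distr M.a_comm)
    then show ?thesis
      using h assms sub_closed(4) [OF assms(1) h(1)] by (subst pr_eq_iff) auto
  qed
  moreover have "x \<in> pr x"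
    using sub_zero assms by (force simp: a_r_coset_def')
  ultimately show ?thesis
    unfolding quot_superalgebra_def module.simps by (rule UN_const)
qed

lemma Q_grade: "grade Q p = pr ` grade M p"
  by (simp add: quot_superalgebra_def)

lemma pr_grade: "x \<in> grade M p \<Longrightarrow> pr x \<in> grade Q p"
  by (simp add: Q_grade)

lemma Q_abelian_group: "abelian_group Q"
proof (rule abelian_groupI)
  show "X \<oplus>\<^bsub>Q\<^esub> Y \<in> carrier Q" if "X \<in> carrier Q" "Y \<in> carrier Q" for X Y
    using that by (auto simp: Q_carrier pr_add)
  show "\<zero>\<^bsub>Q\<^esub> \<in> carrier Q"
    unfolding Q_zero by (rule pr_closed) simp
  show "X \<oplus>\<^bsub>Q\<^esub> Y \<oplus>\<^bsub>Q\<^esub> Z = X \<oplus>\<^bsub>Q\<^esub> (Y \<oplus>\<^bsub>Q\<^esub> Z)"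
    if "X \<in> carrier Q" "Y \<in> carrier Q" "Z \<in> carrier Q" for X Y Z
    using that by (elim Q_cases) (simp add: pr_add M.a_assoc)
  show "X \<oplus>\<^bsub>Q\<^esub> Y = Y \<oplus>\<^bsub>Q\<^esub> X" if "X \<in> carrier Q" "Y \<in> carrier Q" for X Y
    using that by (elim Q_cases) (simp add: pr_add M.a_comm)
  show "\<zero>\<^bsub>Q\<^esub> \<oplus>\<^bsub>Q\<^esub> X = X" if "X \<in> carrier Q" for X
    using that by (elim Q_cases) (simp add: pr_add Q_zero)
  show "\<exists>Y \<in> carrier Q. Y \<oplus>\<^bsub>Q\<^esub> X = \<zero>\<^bsub>Q\<^esub>" if X: "X \<in> carrier Q" for X
  proof -
    obtain x where x: "x \<in> carrier M" "X = pr x"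
      using X by (auto simp only: Q_carrier)
    then have "pr (\<ominus>\<^bsub>M\<^esub> x) \<oplus>\<^bsub>Q\<^esub> X = \<zero>\<^bsub>Q\<^esub>"
      by (simp only: pr_add Q_zero M.a_inv_closed M.l_neg)
    then show ?thesis
      using x(1) pr_closed M.a_inv_closed by blast
  qed
qed

lemma Q_module: "module K Q"
proof (rule moduleI)
  show "cring K" ..
  show "abelian_group Q" by (rule Q_abelian_group)
  show "c \<odot>\<^bsub>Q\<^esub> X \<in> carrier Q" if "c \<in> carrier K" "X \<in> carrier Q" for c X
    using that by (auto simp: Q_carrier pr_smult)
  show "(c \<oplus> d) \<odot>\<^bsub>Q\<^esub> X = (c \<odot>\<^bsub>Q\<^esub> X) \<oplus>\<^bsub>Q\<^esub> (d \<odot>\<^bsub>Q\<^esub> X)"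
    if "c \<in> carrier K" "d \<in> carrier K" "X \<in> carrier Q" for c d X
    using that
    by (elim Q_cases) (simp add: pr_smult pr_add smult_l_distr)
  show "c \<odot>\<^bsub>Q\<^esub> (X \<oplus>\<^bsub>Q\<^esub> Y) = (c \<odot>\<^bsub>Q\<^esub> X) \<oplus>\<^bsub>Q\<^esub> (c \<odot>\<^bsub>Q\<^esub> Y)"
    if "c \<in> carrier K" "X \<in> carrier Q" "Y \<in> carrier Q" for c X Y
    using that
    by (elim Q_cases) (simp add: pr_smult pr_add smult_r_distr)
  show "(c \<otimes> d) \<odot>\<^bsub>Q\<^esub> X = c \<odot>\<^bsub>Q\<^esub> (d \<odot>\<^bsub>Q\<^esub> X)"
    if "c \<in> carrier K" "d \<in> carrier K" "X \<in> carrier Q" for c d X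
    using that by (elim Q_cases) (simp add: pr_smult smult_assoc1)
  show "\<one> \<odot>\<^bsub>Q\<^esub> X = X" if "X \<in> carrier Q" for X
    using that by (elim Q_cases) (simp add: pr_smult)
qed

lemma pr_minus:
  assumes "x \<in> carrier M"
  shows "\<ominus>\<^bsub>Q\<^esub> pr x = pr (\<ominus>\<^bsub>M\<^esub> x)"
proof -
  interpret Q: abelian_group Q by (rule Q_abelian_group)
  show ?thesis
    by (rule Q.minus_equality) (use assms in \<open>simp_all add: pr_add pr_closed Q_zero M.l_neg\<close>)
qed

lemma pr_ksign: "x \<in> carrier M \<Longrightarrow> ksign Q p (pr x) = pr (ksign M p x)"
  by (cases p) (simp_all add: pr_minus)

lemma Q_supermodule: "supermodule K Q"
proof (intro supermodule.intro supermodule_axioms.intro Q_module)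
  interpret Q: module K Q by (rule Q_module)
  show "submodule (grade Q p) K Q" for p
  proof (rule Q.submoduleI)
    show "grade Q p \<subseteq> carrier Q"
      by (auto simp: Q_grade Q_carrier grade_closed)
    show "\<zero>\<^bsub>Q\<^esub> \<in> grade Q p"
      by (auto simp only: Q_zero intro: pr_grade)
    show "\<ominus>\<^bsub>Q\<^esub> X \<in> grade Q p" if "X \<in> grade Q p" for X
      using that by (auto simp: Q_grade pr_minus grade_closed grade_minus)
    show "X \<oplus>\<^bsub>Q\<^esub> Y \<in> grade Q p" if "X \<in> grade Q p" "Y \<in> grade Q p" for X Y
      using that by (auto simp: Q_grade pr_add grade_closed grade_add)
    show "c \<odot>\<^bsub>Q\<^esub> X \<in> grade Q p" if "c \<in> carrier K" "X \<in> grade Q p" for c X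
      using that by (auto simp: Q_grade pr_smult grade_closed grade_smult)
  qed
  show "carrier Q = grade Q 0 <+>\<^bsub>Q\<^esub> grade Q 1"
  proof (intro equalityI subsetI)
    fix X
    assume "X \<in> carrier Q"
    then obtain x where x: "x \<in> carrier M" "X = pr x"
      by (auto simp only: Q_carrier)
    then have "X = pr (component M 0 x) \<oplus>\<^bsub>Q\<^esub> pr (component M 1 x)"
      by (simp add: pr_add component_sum01)
    then show "X \<in> grade Q 0 <+>\<^bsub>Q\<^esub> grade Q 1"
      unfolding set_add_def'
      using pr_grade [OF component_grade [OF x(1)]] by blast
  qed (auto simp: set_add_def' Q_grade Q_carrier pr_add grade_closed)
  have "X = \<zero>\<^bsub>Q\<^esub>" if X: "X \<in> grade Q 0" "X \<in> grade Q 1" for X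
  proof -
    obtain x y where xy: "x \<in> grade M 0" "y \<in> grade M 1" "X = pr x" "X = pr y"
      using X by (auto simp only: Q_grade)
    then have cl: "x \<in> carrier M" "y \<in> carrier M"
      by (auto intro: grade_closed)
    have "\<exists>z\<in>I. x = y \<oplus>\<^bsub>M\<^esub> z"
      using HOL.trans [OF xy(3) [symmetric] xy(4)] pr_eq_iff [OF cl] by iprover
    then obtain z where z: "z \<in> I" "z \<in> carrier M" "x = y \<oplus>\<^bsub>M\<^esub> z"
      using sub_closed(1) by blast
    \<comment> \<open>Here \<open>x\<close> is even and \<open>y\<close> odd, so taking even
      components of \<open>x = y + z\<close> identifies \<open>x\<close> with the even component of
      \<open>z\<close>, which lies in \<open>I\<close>.\<close>
    have "component M 0 x = component M 0 y \<oplus>\<^bsub>M\<^esub> component M 0 z"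
      unfolding z(3) using cl z by (simp add: component_add)
    then have "x = component M 0 z"
      using xy z(2) by (simp add: component_homogeneous component_other [of y 1 0])
    then have "x \<in> I"
      using graded [OF z(1)] by simp
    then show ?thesis
      using cl(1) pr_zero_iff xy(3) Q_zero by simp
  qed
  moreover have "\<zero>\<^bsub>Q\<^esub> \<in> grade Q p" for p
    by (auto simp only: Q_zero intro: pr_grade)
  ultimately show "grade Q 0 \<inter> grade Q 1 = {\<zero>\<^bsub>Q\<^esub>}"
    by blast
qed

end

section \<open>The quotient of \<open>R\<close> by \<open>[R,R]R\<close>\<close>

context superinvolution
begin

abbreviation "CI \<equiv> comm_ideal K R"
abbreviation "CQ \<equiv> comm_quot K R"
abbreviation "cp \<equiv> comm_proj K R"

lemma comm_ideal_submodule: "submodule CI K R"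
proof -
  define S where "S = {((a \<otimes>\<^bsub>R\<^esub> b) \<ominus>\<^bsub>R\<^esub> ksign R (p * q) (b \<otimes>\<^bsub>R\<^esub> a)) \<otimes>\<^bsub>R\<^esub> c | a b c p q.
        a \<in> grade R p \<and> b \<in> grade R q \<and> c \<in> carrier R}"
  have S: "S \<subseteq> carrier R"
    by (auto simp: S_def grade_closed)
  have "submodule (\<Inter>{N. submodule N K R \<and> S \<subseteq> N}) K R"
  proof (rule submoduleI)
    show "\<Inter>{N. submodule N K R \<and> S \<subseteq> N} \<subseteq> carrier R"
      using carrier_is_submodule S by blast
    show "\<zero>\<^bsub>R\<^esub> \<in> \<Inter>{N. submodule N K R \<and> S \<subseteq> N}"
      using submodule.axioms(1) subgroup.one_closed by fastforce
    show "\<ominus>\<^bsub>R\<^esub> x \<in> \<Inter>{N. submodule N K R \<and> S \<subseteq> N}" if "x \<in> \<Inter>{N. submodule N K R \<and> S \<subseteq> N}" for x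
      using that submoduleE(3) by blast
    show "x \<oplus>\<^bsub>R\<^esub> y \<in> \<Inter>{N. submodule N K R \<and> S \<subseteq> N}"
      if "x \<in> \<Inter>{N. submodule N K R \<and> S \<subseteq> N}" "y \<in> \<Inter>{N. submodule N K R \<and> S \<subseteq> N}" for x y
      using that submoduleE(5) by blast
    show "c \<odot>\<^bsub>R\<^esub> x \<in> \<Inter>{N. submodule N K R \<and> S \<subseteq> N}"
      if "c \<in> carrier K" "x \<in> \<Inter>{N. submodule N K R \<and> S \<subseteq> N}" for c x
      using that submoduleE(4) by blast
  qed
  then show ?thesis
    by (simp add: comm_ideal_def module_span_def S_def)
qed

lemma comm_ideal_gen:
  assumes "a \<in> grade R p" "b \<in> grade R q" "c \<in> carrier R"
  shows "((a \<otimes>\<^bsub>R\<^esub> b) \<ominus>\<^bsub>R\<^esub> ksign R (p * q) (b \<otimes>\<^bsub>R\<^esub> a)) \<otimes>\<^bsub>R\<^esub> c \<in> CI"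
  unfolding comm_ideal_def module_span_def using assms by blast

lemma comm_ideal_induct:
  assumes "x \<in> CI" "submodule N K R"
    and "\<And>a b c p q. \<lbrakk>a \<in> grade R p; b \<in> grade R q; c \<in> carrier R\<rbrakk> \<Longrightarrow>
      ((a \<otimes>\<^bsub>R\<^esub> b) \<ominus>\<^bsub>R\<^esub> ksign R (p * q) (b \<otimes>\<^bsub>R\<^esub> a)) \<otimes>\<^bsub>R\<^esub> c \<in> N"
  shows "x \<in> N"
proof -
  have "CI \<subseteq> N"
    unfolding comm_ideal_def module_span_def by (rule Inter_lower) (use assms(2,3) in blast)
  then show ?thesis using assms(1) by blast
qed

lemma supercommutator_grade:
  assumes "a \<in> grade R p" "b \<in> grade R q"
  shows "(a \<otimes>\<^bsub>R\<^esub> b) \<ominus>\<^bsub>R\<^esub> ksign R (p * q) (b \<otimes>\<^bsub>R\<^esub> a) \<in> grade R (p + q)"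
proof -
  have "b \<otimes>\<^bsub>R\<^esub> a \<in> grade R (p + q)"
    using prod_grade [OF assms(2,1)] by (simp add: add.commute)
  then show ?thesis
    using prod_grade [OF assms] unfolding a_minus_def
    by (intro grade_add grade_minus grade_ksign)
qed

text \<open>Multiplication by \<open>u\<close> shifts degrees by \<open>p\<close>, and
  \<open>p + (p + q) = q\<close> over bits.\<close>

lemma component_prod:
  assumes "u \<in> grade R p" "c \<in> carrier R"
  shows "component R q (u \<otimes>\<^bsub>R\<^esub> c) = u \<otimes>\<^bsub>R\<^esub> component R (p + q) c"
proof (rule component_eqI)
  have "u \<otimes>\<^bsub>R\<^esub> component R (p + q) c \<in> grade R (p + (p + q))"
    "u \<otimes>\<^bsub>R\<^esub> component R (p + q + 1) c \<in> grade R (p + (p + q + 1))"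
    using assms prod_grade component_grade by blast+
  then show "u \<otimes>\<^bsub>R\<^esub> component R (p + q) c \<in> grade R q"
    "u \<otimes>\<^bsub>R\<^esub> component R (p + q + 1) c \<in> grade R (q + 1)"
    by (simp_all add: add.assoc)
  show "u \<otimes>\<^bsub>R\<^esub> c = u \<otimes>\<^bsub>R\<^esub> component R (p + q) c \<oplus>\<^bsub>R\<^esub> u \<otimes>\<^bsub>R\<^esub> component R (p + q + 1) c"
    using assms component_sum [OF assms(2), of "p + q"] prod_add_right [symmetric]
    by (simp add: grade_closed)
qed

sublocale CQ: graded_quotient K R CI
  rewrites "quot_superalgebra R CI = CQ" and "CI +>\<^bsub>R\<^esub> a = cp a"
proof -
  show "graded_quotient K R CI"
  proof (intro graded_quotient.intro graded_quotient_axioms.intro comm_ideal_submodule)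
    fix x p
    assume "x \<in> CI"
    note E = submoduleE [OF comm_ideal_submodule]
    have "x \<in> {x \<in> carrier R. \<forall>p. component R p x \<in> CI}"
      using \<open>x \<in> CI\<close>
    proof (rule comm_ideal_induct)
      have Z: "component R p \<zero>\<^bsub>R\<^esub> = \<zero>\<^bsub>R\<^esub>" for p
        by (rule component_homogeneous) simp
      show "submodule {x \<in> carrier R. \<forall>p. component R p x \<in> CI} K R"
      proof (rule submoduleI)
        show "\<ominus>\<^bsub>R\<^esub> x \<in> {x \<in> carrier R. \<forall>p. component R p x \<in> CI}"
          if "x \<in> {x \<in> carrier R. \<forall>p. component R p x \<in> CI}" for x
        proof -
          have "\<ominus>\<^bsub>R\<^esub> x = (\<ominus>\<^bsub>K\<^esub> \<one>\<^bsub>K\<^esub>) \<odot>\<^bsub>R\<^esub> x"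
            using that by (simp add: smult_l_minus)
          then show ?thesis
            using that E(4) by (simp add: component_smult del: smult_l_minus)
        qed
        show "\<zero>\<^bsub>R\<^esub> \<in> {x \<in> carrier R. \<forall>p. component R p x \<in> CI}"
          using E(1,2,3,5) M.r_neg Z by auto (metis all_not_in_conv subsetD)
      qed (auto simp: component_add component_smult E)
      \<comment> \<open>The third factor of a generator is arbitrary, so both components of
        \<open>[a,b]c\<close>, namely \<open>[a,b]\<close> times a component of \<open>c\<close>,
        are generators again.\<close>
      show "((a \<otimes>\<^bsub>R\<^esub> b) \<ominus>\<^bsub>R\<^esub> ksign R (p * q) (b \<otimes>\<^bsub>R\<^esub> a)) \<otimes>\<^bsub>R\<^esub> c
          \<in> {x \<in> carrier R. \<forall>p. component R p x \<in> CI}"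
        if "a \<in> grade R p" "b \<in> grade R q" "c \<in> carrier R" for a b c p q
        using component_prod [OF supercommutator_grade [OF that(1,2)] that(3)]
          comm_ideal_gen [OF that(1,2)] that(3) grade_closed [OF supercommutator_grade [OF that(1,2)]]
        by (simp add: prod_closed)
    qed
    then show "component R p x \<in> CI" by simp
  qed (rule supermodule_axioms)
qed (simp_all add: comm_quot_def comm_proj_def)

end

section \<open>Supermatrices\<close>

lemma assoc_superalgebraI:
  assumes "supermodule K A" "ring A"
    and "\<And>c x y. \<lbrakk>c \<in> carrier K; x \<in> carrier A; y \<in> carrier A\<rbrakk> \<Longrightarrow>
      (c \<odot>\<^bsub>A\<^esub> x) \<otimes>\<^bsub>A\<^esub> y = c \<odot>\<^bsub>A\<^esub> (x \<otimes>\<^bsub>A\<^esub> y)"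
    and "\<And>c x y. \<lbrakk>c \<in> carrier K; x \<in> carrier A; y \<in> carrier A\<rbrakk> \<Longrightarrow>
      x \<otimes>\<^bsub>A\<^esub> (c \<odot>\<^bsub>A\<^esub> y) = c \<odot>\<^bsub>A\<^esub> (x \<otimes>\<^bsub>A\<^esub> y)"
    and "\<And>x y p q. \<lbrakk>x \<in> grade A p; y \<in> grade A q\<rbrakk> \<Longrightarrow> x \<otimes>\<^bsub>A\<^esub> y \<in> grade A (p + q)"
  shows "assoc_superalgebra K A"
proof -
  interpret ring A by (rule assms(2))
  show ?thesis
    by (intro assoc_superalgebra.intro superalgebra.intro superalgebra_axioms.intro assms)
      (auto simp: l_distr r_distr)
qed

text \<open>The off-diagonal entries are shifted in degree by \<open>s\<close>.  Iterating the construction with \<open>s = 0\<close> and then \<open>s = 1\<close> gives $M_{2|2}$.\<close>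

definition mat2 ::
    "bit \<Rightarrow> ('k, 'a, 'm) superalgebra_scheme \<Rightarrow> ('k, 'a \<times> 'a \<times> 'a \<times> 'a) superalgebra" where
  "mat2 s A =
     \<lparr>carrier = carrier A \<times> carrier A \<times> carrier A \<times> carrier A,
      mult = (\<lambda>(a, b, c, d) (a', b', c', d').
        ((a \<otimes>\<^bsub>A\<^esub> a') \<oplus>\<^bsub>A\<^esub> (b \<otimes>\<^bsub>A\<^esub> c'), (a \<otimes>\<^bsub>A\<^esub> b') \<oplus>\<^bsub>A\<^esub> (b \<otimes>\<^bsub>A\<^esub> d'),
         (c \<otimes>\<^bsub>A\<^esub> a') \<oplus>\<^bsub>A\<^esub> (d \<otimes>\<^bsub>A\<^esub> c'), (c \<otimes>\<^bsub>A\<^esub> b') \<oplus>\<^bsub>A\<^esub> (d \<otimes>\<^bsub>A\<^esub> d'))),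
      one = (\<one>\<^bsub>A\<^esub>, \<zero>\<^bsub>A\<^esub>, \<zero>\<^bsub>A\<^esub>, \<one>\<^bsub>A\<^esub>), zero = (\<zero>\<^bsub>A\<^esub>, \<zero>\<^bsub>A\<^esub>, \<zero>\<^bsub>A\<^esub>, \<zero>\<^bsub>A\<^esub>),
      add = (\<lambda>(a, b, c, d) (a', b', c', d'). (a \<oplus>\<^bsub>A\<^esub> a', b \<oplus>\<^bsub>A\<^esub> b', c \<oplus>\<^bsub>A\<^esub> c', d \<oplus>\<^bsub>A\<^esub> d')),
      smult = (\<lambda>k (a, b, c, d). (k \<odot>\<^bsub>A\<^esub> a, k \<odot>\<^bsub>A\<^esub> b, k \<odot>\<^bsub>A\<^esub> c, k \<odot>\<^bsub>A\<^esub> d)),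
      grade = (\<lambda>p. grade A p \<times> grade A (p + s) \<times> grade A (p + s) \<times> grade A p)\<rparr>"

lemma mat2_simps [simp]:
  "carrier (mat2 s A) = carrier A \<times> carrier A \<times> carrier A \<times> carrier A"
  "(a, b, c, d) \<otimes>\<^bsub>mat2 s A\<^esub> (a', b', c', d') =
     ((a \<otimes>\<^bsub>A\<^esub> a') \<oplus>\<^bsub>A\<^esub> (b \<otimes>\<^bsub>A\<^esub> c'), (a \<otimes>\<^bsub>A\<^esub> b') \<oplus>\<^bsub>A\<^esub> (b \<otimes>\<^bsub>A\<^esub> d'),
      (c \<otimes>\<^bsub>A\<^esub> a') \<oplus>\<^bsub>A\<^esub> (d \<otimes>\<^bsub>A\<^esub> c'), (c \<otimes>\<^bsub>A\<^esub> b') \<oplus>\<^bsub>A\<^esub> (d \<otimes>\<^bsub>A\<^esub> d'))"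
  "\<zero>\<^bsub>mat2 s A\<^esub> = (\<zero>\<^bsub>A\<^esub>, \<zero>\<^bsub>A\<^esub>, \<zero>\<^bsub>A\<^esub>, \<zero>\<^bsub>A\<^esub>)"
  "\<one>\<^bsub>mat2 s A\<^esub> = (\<one>\<^bsub>A\<^esub>, \<zero>\<^bsub>A\<^esub>, \<zero>\<^bsub>A\<^esub>, \<one>\<^bsub>A\<^esub>)"
  "(a, b, c, d) \<oplus>\<^bsub>mat2 s A\<^esub> (a', b', c', d') = (a \<oplus>\<^bsub>A\<^esub> a', b \<oplus>\<^bsub>A\<^esub> b', c \<oplus>\<^bsub>A\<^esub> c', d \<oplus>\<^bsub>A\<^esub> d')"
  "k \<odot>\<^bsub>mat2 s A\<^esub> (a, b, c, d) = (k \<odot>\<^bsub>A\<^esub> a, k \<odot>\<^bsub>A\<^esub> b, k \<odot>\<^bsub>A\<^esub> c, k \<odot>\<^bsub>A\<^esub> d)"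
  "grade (mat2 s A) p = grade A p \<times> grade A (p + s) \<times> grade A (p + s) \<times> grade A p"
  by (simp_all add: mat2_def)

lemma tuple4_cases:
  assumes "x \<in> A \<times> B \<times> C \<times> D"
  obtains a b c d where "x = (a, b, c, d)" "a \<in> A" "b \<in> B" "c \<in> C" "d \<in> D"
  using assms by auto

context assoc_superalgebra
begin

lemma mat2_abelian_group: "abelian_group (mat2 s R)"
proof (rule abelian_groupI)
  show "\<exists>y\<in>carrier (mat2 s R). y \<oplus>\<^bsub>mat2 s R\<^esub> x = \<zero>\<^bsub>mat2 s R\<^esub>"
    if x: "x \<in> carrier (mat2 s R)" for x
  proof -
    obtain a b c d where "x = (a, b, c, d)" "a \<in> carrier R" "b \<in> carrier R" "c \<in> carrier R"
      "d \<in> carrier R"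
      using x unfolding mat2_simps by (rule tuple4_cases)
    then show ?thesis
      by (intro bexI [of _ "(\<ominus>\<^bsub>R\<^esub> a, \<ominus>\<^bsub>R\<^esub> b, \<ominus>\<^bsub>R\<^esub> c, \<ominus>\<^bsub>R\<^esub> d)"]) (simp_all add: M.l_neg)
  qed
qed (auto simp: M.a_ac)

lemma mat2_module: "module K (mat2 s R)"
  by (rule moduleI)
    (auto simp: mat2_abelian_group R.is_cring smult_l_distr smult_r_distr smult_assoc1)

lemma mat2_minus:
  assumes "a \<in> carrier R" "b \<in> carrier R" "c \<in> carrier R" "d \<in> carrier R"
  shows "\<ominus>\<^bsub>mat2 s R\<^esub> (a, b, c, d) = (\<ominus>\<^bsub>R\<^esub> a, \<ominus>\<^bsub>R\<^esub> b, \<ominus>\<^bsub>R\<^esub> c, \<ominus>\<^bsub>R\<^esub> d)"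
proof -
  interpret P: abelian_group "mat2 s R" by (rule mat2_abelian_group)
  show ?thesis
    by (rule P.minus_equality) (use assms in \<open>simp_all add: M.l_neg\<close>)
qed

lemma mat2_ksign:
  assumes "a \<in> carrier R" "b \<in> carrier R" "c \<in> carrier R" "d \<in> carrier R"
  shows "ksign (mat2 s R) p (a, b, c, d) = (ksign R p a, ksign R p b, ksign R p c, ksign R p d)"
  using assms by (cases p) (simp_all add: mat2_minus)

lemma mat2_supermodule: "supermodule K (mat2 s R)"
proof (intro supermodule.intro supermodule_axioms.intro mat2_module)
  interpret P: module K "mat2 s R" by (rule mat2_module)
  show "submodule (grade (mat2 s R) p) K (mat2 s R)" for p
    by (rule P.submoduleI)
      (auto simp: grade_add grade_smult mat2_minus grade_minus grade_closed)
  show "carrier (mat2 s R) = grade (mat2 s R) 0 <+>\<^bsub>mat2 s R\<^esub> grade (mat2 s R) 1"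
  proof (intro equalityI subsetI)
    fix x
    assume "x \<in> carrier (mat2 s R)"
    then obtain a b c d where x: "x = (a, b, c, d)" and cl: "a \<in> carrier R" "b \<in> carrier R"
      "c \<in> carrier R" "d \<in> carrier R"
      unfolding mat2_simps by (rule tuple4_cases)
    have s: "component R (0 + s) u \<oplus>\<^bsub>R\<^esub> component R (1 + s) u = u" if "u \<in> carrier R" for u
      using component_sum [OF that, of s] by (simp add: add.commute)
    have "x = (component R 0 a, component R (0 + s) b, component R (0 + s) c, component R 0 d)
        \<oplus>\<^bsub>mat2 s R\<^esub>
        (component R 1 a, component R (1 + s) b, component R (1 + s) c, component R 1 d)"
      unfolding x mat2_simps by (simp only: component_sum01 s cl)
    moreover have "(component R p a, component R (p + s) b, component R (p + s) c,
        component R p d) \<in> grade (mat2 s R) p" for p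
      using cl by (simp add: component_grade)
    ultimately show "x \<in> grade (mat2 s R) 0 <+>\<^bsub>mat2 s R\<^esub> grade (mat2 s R) 1"
      unfolding set_add_def' by blast
  qed (auto simp: set_add_def' grade_closed)
  have "x = \<zero>\<^bsub>R\<^esub>" if "x \<in> grade R (0 + s)" "x \<in> grade R (1 + s)" for x
    using grade_both [OF that] by simp
  moreover have "x = \<zero>\<^bsub>R\<^esub>" if "x \<in> grade R 0" "x \<in> grade R 1" for x
    using grade_both [OF that] by simp
  ultimately show "grade (mat2 s R) 0 \<inter> grade (mat2 s R) 1 = {\<zero>\<^bsub>mat2 s R\<^esub>}"
    by auto
qed

text \<open>For homogeneous \<open>u\<close> the product of \<open>u\<close> with the odd component
  of 1 is a component of \<open>u 1 = u\<close> in the wrong degree, hence zero. Summing over the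
  two components of 1 in place of \<open>u\<close> shows that the odd component of 1
  vanishes.\<close>

lemma one_grade: "\<one>\<^bsub>R\<^esub> \<in> grade R 0"
proof -
  have *: "u \<otimes>\<^bsub>R\<^esub> component R 1 \<one>\<^bsub>R\<^esub> = \<zero>\<^bsub>R\<^esub>" if "u \<in> grade R p" for u p
  proof -
    have "component R (p + 1) (u \<otimes>\<^bsub>R\<^esub> \<one>\<^bsub>R\<^esub>) = u \<otimes>\<^bsub>R\<^esub> component R (p + (p + 1)) \<one>\<^bsub>R\<^esub>"
    proof (rule component_eqI)
      have "u \<otimes>\<^bsub>R\<^esub> component R (p + (p + 1)) \<one>\<^bsub>R\<^esub> \<in> grade R (p + (p + (p + 1)))"
        "u \<otimes>\<^bsub>R\<^esub> component R (p + (p + 1) + 1) \<one>\<^bsub>R\<^esub> \<in> grade R (p + (p + (p + 1) + 1))"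
        using that prod_grade component_grade by blast+
      then show "u \<otimes>\<^bsub>R\<^esub> component R (p + (p + 1)) \<one>\<^bsub>R\<^esub> \<in> grade R (p + 1)"
        "u \<otimes>\<^bsub>R\<^esub> component R (p + (p + 1) + 1) \<one>\<^bsub>R\<^esub> \<in> grade R (p + 1 + 1)"
        by (simp_all add: add.assoc)
      show "u \<otimes>\<^bsub>R\<^esub> \<one>\<^bsub>R\<^esub> = u \<otimes>\<^bsub>R\<^esub> component R (p + (p + 1)) \<one>\<^bsub>R\<^esub> \<oplus>\<^bsub>R\<^esub>
          u \<otimes>\<^bsub>R\<^esub> component R (p + (p + 1) + 1) \<one>\<^bsub>R\<^esub>"
        using that component_sum [of "\<one>\<^bsub>R\<^esub>" "p + (p + 1)"] prod_add_right [symmetric]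
        by (simp add: grade_closed)
    qed
    then show ?thesis
      using component_other [OF that, of "p + 1"] that by (simp add: grade_closed)
  qed
  have "\<one>\<^bsub>R\<^esub> \<otimes>\<^bsub>R\<^esub> component R 1 \<one>\<^bsub>R\<^esub> = \<zero>\<^bsub>R\<^esub>"
  proof -
    have "\<one>\<^bsub>R\<^esub> \<otimes>\<^bsub>R\<^esub> component R 1 \<one>\<^bsub>R\<^esub> =
        (component R 0 \<one>\<^bsub>R\<^esub> \<oplus>\<^bsub>R\<^esub> component R 1 \<one>\<^bsub>R\<^esub>) \<otimes>\<^bsub>R\<^esub> component R 1 \<one>\<^bsub>R\<^esub>"
      by (simp only: component_sum01 one_closed)
    also have "... = \<zero>\<^bsub>R\<^esub>"
      using * [OF component_grade [OF one_closed]] by (simp add: prod_add_left)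
    finally show ?thesis .
  qed
  then have "component R 1 \<one>\<^bsub>R\<^esub> = \<zero>\<^bsub>R\<^esub>"
    by simp
  then show ?thesis
    using component_sum01 [of "\<one>\<^bsub>R\<^esub>"] component_grade [of "\<one>\<^bsub>R\<^esub>" 0] by simp
qed

theorem mat2_assoc_superalgebra: "assoc_superalgebra K (mat2 s R)"
proof (rule assoc_superalgebraI [OF mat2_supermodule])
  show "ring (mat2 s R)"
  proof (intro ringI mat2_abelian_group monoidI)
    fix x y z
    assume "x \<in> carrier (mat2 s R)" "y \<in> carrier (mat2 s R)" "z \<in> carrier (mat2 s R)"
    then obtain a b c d a' b' c' d' a2 b2 c2 d2 where
      *: "x = (a, b, c, d)" "y = (a', b', c', d')" "z = (a2, b2, c2, d2)" and
      [simp]: "a \<in> carrier R" "b \<in> carrier R" "c \<in> carrier R" "d \<in> carrier R"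
      "a' \<in> carrier R" "b' \<in> carrier R" "c' \<in> carrier R" "d' \<in> carrier R"
      "a2 \<in> carrier R" "b2 \<in> carrier R" "c2 \<in> carrier R" "d2 \<in> carrier R"
      by (auto elim!: tuple4_cases simp only: mat2_simps)
    show "(x \<oplus>\<^bsub>mat2 s R\<^esub> y) \<otimes>\<^bsub>mat2 s R\<^esub> z =
        x \<otimes>\<^bsub>mat2 s R\<^esub> z \<oplus>\<^bsub>mat2 s R\<^esub> y \<otimes>\<^bsub>mat2 s R\<^esub> z"
      "z \<otimes>\<^bsub>mat2 s R\<^esub> (x \<oplus>\<^bsub>mat2 s R\<^esub> y) =
        z \<otimes>\<^bsub>mat2 s R\<^esub> x \<oplus>\<^bsub>mat2 s R\<^esub> z \<otimes>\<^bsub>mat2 s R\<^esub> y"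
      "x \<otimes>\<^bsub>mat2 s R\<^esub> y \<otimes>\<^bsub>mat2 s R\<^esub> z = x \<otimes>\<^bsub>mat2 s R\<^esub> (y \<otimes>\<^bsub>mat2 s R\<^esub> z)"
      unfolding * by (simp_all add: l_distr r_distr m_assoc M.a_ac)
  qed (auto simp: mat2_def)
  show "x \<otimes>\<^bsub>mat2 s R\<^esub> y \<in> grade (mat2 s R) (p + q)"
    if xy: "x \<in> grade (mat2 s R) p" "y \<in> grade (mat2 s R) q" for x y p q
  proof -
    obtain a b c d a' b' c' d' where
      *: "x = (a, b, c, d)" "y = (a', b', c', d')" and g:
      "a \<in> grade R p" "b \<in> grade R (p + s)" "c \<in> grade R (p + s)" "d \<in> grade R p"
      "a' \<in> grade R q" "b' \<in> grade R (q + s)" "c' \<in> grade R (q + s)" "d' \<in> grade R q"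
      using xy by (auto elim!: tuple4_cases simp only: mat2_simps)
    have eq: "(p + s) + (q + s) = p + q" "p + (q + s) = p + q + s" "p + s + q = p + q + s"
      by (simp_all add: ac_simps)
    have "\<lbrakk>u \<in> grade R (p + s); v \<in> grade R (q + s)\<rbrakk> \<Longrightarrow> u \<otimes>\<^bsub>R\<^esub> v \<in> grade R (p + q)"
      "\<lbrakk>u \<in> grade R p; v \<in> grade R (q + s)\<rbrakk> \<Longrightarrow> u \<otimes>\<^bsub>R\<^esub> v \<in> grade R (p + q + s)"
      "\<lbrakk>u \<in> grade R (p + s); v \<in> grade R q\<rbrakk> \<Longrightarrow> u \<otimes>\<^bsub>R\<^esub> v \<in> grade R (p + q + s)" for u v
      using prod_grade eq by metis+
    then show ?thesis
      unfolding * using g by (simp add: grade_add prod_grade)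
  qed
qed (auto simp: prod_smult_left prod_smult_right smult_r_distr)

end

text \<open>The supercommutator $xy - \sum_{p,q} (-1)^{pq} y_q x_p$ of not necessarily homogeneous elements.\<close>

definition supercomm :: "('k, 'a, 'm) superalgebra_scheme \<Rightarrow> 'a \<Rightarrow> 'a \<Rightarrow> 'a" where
  "supercomm A x y = x \<otimes>\<^bsub>A\<^esub> y \<oplus>\<^bsub>A\<^esub>
     \<ominus>\<^bsub>A\<^esub> ((component A 0 y \<otimes>\<^bsub>A\<^esub> x) \<oplus>\<^bsub>A\<^esub> (component A 1 y \<otimes>\<^bsub>A\<^esub>
       (component A 0 x \<oplus>\<^bsub>A\<^esub> \<ominus>\<^bsub>A\<^esub> component A 1 x)))"

definition commutator_algebra :: "('k, 'a) superalgebra \<Rightarrow> ('k, 'a) superalgebra" where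
  "commutator_algebra A = A\<lparr>mult := supercomm A\<rparr>"

lemma commutator_algebra_simps [simp]:
  "carrier (commutator_algebra A) = carrier A"
  "add (commutator_algebra A) = add A"
  "zero (commutator_algebra A) = zero A"
  "smult (commutator_algebra A) = smult A"
  "grade (commutator_algebra A) = grade A"
  "mult (commutator_algebra A) = supercomm A"
  "a_inv (commutator_algebra A) = a_inv A"
  "ksign (commutator_algebra A) = ksign A"
  by (simp_all add: commutator_algebra_def a_inv_def ksign_def fun_eq_iff)

context assoc_superalgebra
begin

lemma supercomm_homogeneous:
  assumes "x \<in> grade R p" "y \<in> grade R q"
  shows "supercomm R x y = x \<otimes>\<^bsub>R\<^esub> y \<oplus>\<^bsub>R\<^esub> \<ominus>\<^bsub>R\<^esub> ksign R (p * q) (y \<otimes>\<^bsub>R\<^esub> x)"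
  using assms component_homogeneous component_other
  by (cases p; cases q)
    (simp_all add: supercomm_def grade_closed prod_closed r_minus component_homogeneous
      component_other [of _ 0 1] component_other [of _ 1 0] M.minus_zero')

lemma commutator_supermodule:
  fixes A :: "('k, 'x) superalgebra"
  assumes "supermodule K' A"
  shows "supermodule K' (commutator_algebra A)"
proof -
  have "add_monoid (commutator_algebra A) = add_monoid A"
    by simp
  then show ?thesis
    using assms
    unfolding supermodule_def supermodule_axioms_def module_def module_axioms_def
      abelian_group_def abelian_group_axioms_def abelian_monoid_def submodule_def
      submodule_axioms_def set_add_def commutator_algebra_simps
    by simp
qed

end

theorem commutator_lie:
  fixes A :: "('k, 'x) superalgebra"
  assumes "assoc_superalgebra K A"
  shows "lie_superalgebra K (commutator_algebra A)"
proof -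
  interpret A: assoc_superalgebra K A by (rule assms)
  have hom: "supercomm A x y = x \<otimes>\<^bsub>A\<^esub> y \<oplus>\<^bsub>A\<^esub> \<ominus>\<^bsub>A\<^esub> ksign A (p * q) (y \<otimes>\<^bsub>A\<^esub> x)"
    if "x \<in> grade A p" "y \<in> grade A q" for x y p q
    by (rule A.supercomm_homogeneous [OF that])
  have grade: "supercomm A x y \<in> grade A (p + q)"
    if "x \<in> grade A p" "y \<in> grade A q" for x y p q
    using A.prod_grade [OF that] A.prod_grade [OF that(2,1)]
    unfolding hom [OF that]
    by (intro A.grade_add A.grade_minus A.grade_ksign) (simp_all add: add.commute)
  note [simp] = A.component_add A.component_smult A.prod_closed
  show ?thesis
  proof (intro lie_superalgebra.intro superalgebra.intro superalgebra_axioms.intro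
      lie_superalgebra_axioms.intro A.commutator_supermodule A.supermodule_axioms;
      unfold commutator_algebra_simps)
    fix x y
    assume x: "x \<in> carrier A" and y: "y \<in> carrier A"
    then show "supercomm A x y \<in> carrier A"
      by (simp add: supercomm_def)
    {
      fix z assume z: "z \<in> carrier A"
      have cl: "component A p u \<in> carrier A" if "u \<in> carrier A" for u p
        using that by simp
      note c = x y z cl [OF x] cl [OF y] cl [OF z]
      show "supercomm A (x \<oplus>\<^bsub>A\<^esub> y) z = supercomm A x z \<oplus>\<^bsub>A\<^esub> supercomm A y z"
        using c unfolding supercomm_def A.component_add [OF x y] by algebra
      show "supercomm A z (x \<oplus>\<^bsub>A\<^esub> y) = supercomm A z x \<oplus>\<^bsub>A\<^esub> supercomm A z y"
        using c unfolding supercomm_def A.component_add [OF x y] by algebra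
    }
    {
      fix k assume k: "k \<in> carrier K"
      show "supercomm A (k \<odot>\<^bsub>A\<^esub> x) y = k \<odot>\<^bsub>A\<^esub> supercomm A x y"
        "supercomm A x (k \<odot>\<^bsub>A\<^esub> y) = k \<odot>\<^bsub>A\<^esub> supercomm A x y"
        using x y k unfolding supercomm_def
        by (simp_all add: A.smult_r_distr A.prod_smult_left A.prod_smult_right A.smult_r_minus)
          (simp_all add: A.smult_r_distr [symmetric] A.smult_r_minus [symmetric] A.prod_smult_left
            A.prod_smult_right)
    }
  next
    fix x y z p q r
    assume x: "x \<in> grade A p" and y: "y \<in> grade A q"
    then have c: "x \<in> carrier A" "y \<in> carrier A"
      by (auto intro: A.grade_closed)
    show "supercomm A x y \<in> grade A (p + q)"
      by (rule grade [OF x y])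
    show "supercomm A x y = \<ominus>\<^bsub>A\<^esub> (ksign A (p * q) (supercomm A y x))"
      unfolding hom [OF x y] hom [OF y x] using c
      by (cases p; cases q) (simp_all add: A.M.minus_add A.M.a_comm)
    assume z: "z \<in> grade A r"
    then have c: "x \<in> carrier A" "y \<in> carrier A" "z \<in> carrier A"
      using c by (auto intro: A.grade_closed)
    have [simp]: "a_inv A (ksign A u v) = ksign A u (a_inv A v)" if "v \<in> carrier A" for u v
      using that by (simp add: A.M.ksign_minus)
    show "ksign A (p * r) (supercomm A (supercomm A x y) z)
        \<oplus>\<^bsub>A\<^esub> ksign A (q * p) (supercomm A (supercomm A y z) x)
        \<oplus>\<^bsub>A\<^esub> ksign A (r * q) (supercomm A (supercomm A z x) y) = \<zero>\<^bsub>A\<^esub>"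
      unfolding hom [OF grade [OF x y] z] hom [OF grade [OF y z] x] hom [OF grade [OF z x] y]
      unfolding hom [OF x y] hom [OF y z] hom [OF z x]
      using c
      \<comment> \<open>Once the three degrees are fixed all signs are constants, and the Jacobi
        identity becomes an identity in an associative ring.\<close>
      by (cases p; cases q; cases r; simp only: ksign_0 ksign_1 mult_zero_left mult_zero_right
          mult_1_left add_0_left add_0_right bit_add_self; algebra)
  qed
qed

section \<open>Computation modulo \<open>[R,R]R\<close>\<close>

context superinvolution
begin

text \<open>The last factor of a generator \<open>[a,b]c\<close> absorbs \<open>d\<close>.
  Congruences of traces modulo \<open>[R,R]R\<close> may therefore be multiplied from the right, as
  in \<open>ptrip_trace\<close>.\<close>

lemma comm_ideal_right:
  assumes "z \<in> CI" "d \<in> carrier R"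
  shows "z \<otimes>\<^bsub>R\<^esub> d \<in> CI"
proof -
  note E = submoduleE [OF comm_ideal_submodule]
  have "z \<in> {z \<in> carrier R. z \<otimes>\<^bsub>R\<^esub> d \<in> CI}"
    using assms(1)
  proof (rule comm_ideal_induct)
    show "submodule {z \<in> carrier R. z \<otimes>\<^bsub>R\<^esub> d \<in> CI} K R"
    proof (rule submoduleI)
      show "x \<oplus>\<^bsub>R\<^esub> y \<in> {z \<in> carrier R. z \<otimes>\<^bsub>R\<^esub> d \<in> CI}"
        if "x \<in> {z \<in> carrier R. z \<otimes>\<^bsub>R\<^esub> d \<in> CI}" "y \<in> {z \<in> carrier R. z \<otimes>\<^bsub>R\<^esub> d \<in> CI}" for x y
        using that assms(2) E(5) by (simp add: prod_add_left)
      show "\<ominus>\<^bsub>R\<^esub> x \<in> {z \<in> carrier R. z \<otimes>\<^bsub>R\<^esub> d \<in> CI}"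
        if "x \<in> {z \<in> carrier R. z \<otimes>\<^bsub>R\<^esub> d \<in> CI}" for x
        using that assms(2) E(3) by (simp add: prod_minus_left)
      show "c \<odot>\<^bsub>R\<^esub> x \<in> {z \<in> carrier R. z \<otimes>\<^bsub>R\<^esub> d \<in> CI}"
        if "c \<in> carrier K" "x \<in> {z \<in> carrier R. z \<otimes>\<^bsub>R\<^esub> d \<in> CI}" for c x
        using that assms(2) E(4) by (simp add: prod_smult_left)
    qed (use assms(2) CQ.sub_zero in auto)
    show "((a \<otimes>\<^bsub>R\<^esub> b) \<ominus>\<^bsub>R\<^esub> ksign R (p * q) (b \<otimes>\<^bsub>R\<^esub> a)) \<otimes>\<^bsub>R\<^esub> c
        \<in> {z \<in> carrier R. z \<otimes>\<^bsub>R\<^esub> d \<in> CI}"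
      if "a \<in> grade R p" "b \<in> grade R q" "c \<in> carrier R" for a b c p q
    proof -
      have "(a \<otimes>\<^bsub>R\<^esub> b) \<ominus>\<^bsub>R\<^esub> ksign R (p * q) (b \<otimes>\<^bsub>R\<^esub> a) \<in> carrier R"
        by (rule grade_closed [OF supercommutator_grade [OF that(1,2)]])
      moreover have "((a \<otimes>\<^bsub>R\<^esub> b) \<ominus>\<^bsub>R\<^esub> ksign R (p * q) (b \<otimes>\<^bsub>R\<^esub> a)) \<otimes>\<^bsub>R\<^esub> (c \<otimes>\<^bsub>R\<^esub> d) \<in> CI"
        by (rule comm_ideal_gen [OF that(1,2)]) (simp add: that(3) assms(2))
      ultimately show ?thesis
        using that(3) assms(2) by (simp add: m_assoc)
    qed
  qed
  then show ?thesis by simp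
qed

lemma cp_swap12:
  assumes "a \<in> grade R p" "b \<in> grade R q" "c \<in> carrier R"
  shows "cp (a \<otimes>\<^bsub>R\<^esub> b \<otimes>\<^bsub>R\<^esub> c) = ksign CQ (p * q) (cp (b \<otimes>\<^bsub>R\<^esub> a \<otimes>\<^bsub>R\<^esub> c))"
proof -
  have cl: "a \<in> carrier R" "b \<in> carrier R"
    using assms grade_closed by blast+
  let ?z = "((a \<otimes>\<^bsub>R\<^esub> b) \<ominus>\<^bsub>R\<^esub> ksign R (p * q) (b \<otimes>\<^bsub>R\<^esub> a)) \<otimes>\<^bsub>R\<^esub> c"
  have "a \<otimes>\<^bsub>R\<^esub> b \<otimes>\<^bsub>R\<^esub> c = ksign R (p * q) (b \<otimes>\<^bsub>R\<^esub> a \<otimes>\<^bsub>R\<^esub> c) \<oplus>\<^bsub>R\<^esub> ?z"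
  proof -
    have "u \<otimes>\<^bsub>R\<^esub> c = v \<otimes>\<^bsub>R\<^esub> c \<oplus>\<^bsub>R\<^esub> (u \<ominus>\<^bsub>R\<^esub> v) \<otimes>\<^bsub>R\<^esub> c" if "u \<in> carrier R" "v \<in> carrier R" for u v
      using that assms(3) by algebra
    from this [of "a \<otimes>\<^bsub>R\<^esub> b" "ksign R (p * q) (b \<otimes>\<^bsub>R\<^esub> a)"] show ?thesis
      using cl assms(3) by (simp add: prod_ksign_left)
  qed
  then have "cp (a \<otimes>\<^bsub>R\<^esub> b \<otimes>\<^bsub>R\<^esub> c) = cp (ksign R (p * q) (b \<otimes>\<^bsub>R\<^esub> a \<otimes>\<^bsub>R\<^esub> c))"
    using comm_ideal_gen [OF assms] cl assms(3) by (intro CQ.pr_eq_iff [THEN iffD2]) auto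
  then show ?thesis
    using cl assms(3) by (simp add: CQ.pr_ksign)
qed

lemma cp_comm:
  assumes "a \<in> grade R p" "b \<in> grade R q"
  shows "cp (a \<otimes>\<^bsub>R\<^esub> b) = ksign CQ (p * q) (cp (b \<otimes>\<^bsub>R\<^esub> a))"
  using cp_swap12 [OF assms one_closed] assms grade_closed by simp

lemma cp_closed: "x \<in> carrier R \<Longrightarrow> cp x \<in> carrier CQ"
  by (rule CQ.pr_closed)

sublocale CQ: supermodule K CQ
  by (rule CQ.Q_supermodule)

text \<open>Rotate \<open>a\<close> to the end, interchange the factors that are now in front, and
  rotate back. The two rotations contribute the same sign, which cancels.\<close>

lemma cp_swap23:
  assumes "a \<in> grade R p" "b \<in> grade R q" "c \<in> grade R r"
  shows "cp (a \<otimes>\<^bsub>R\<^esub> b \<otimes>\<^bsub>R\<^esub> c) = ksign CQ (q * r) (cp (a \<otimes>\<^bsub>R\<^esub> c \<otimes>\<^bsub>R\<^esub> b))"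
proof -
  have cl: "a \<in> carrier R" "b \<in> carrier R" "c \<in> carrier R"
    using assms grade_closed by blast+
  have "cp (a \<otimes>\<^bsub>R\<^esub> b \<otimes>\<^bsub>R\<^esub> c) = ksign CQ (p * (q + r)) (cp (b \<otimes>\<^bsub>R\<^esub> c \<otimes>\<^bsub>R\<^esub> a))"
    using cp_comm [OF assms(1) prod_grade [OF assms(2,3)]] cl by (simp add: m_assoc)
  also have "cp (b \<otimes>\<^bsub>R\<^esub> c \<otimes>\<^bsub>R\<^esub> a) = ksign CQ (q * r) (cp (c \<otimes>\<^bsub>R\<^esub> b \<otimes>\<^bsub>R\<^esub> a))"
    by (rule cp_swap12 [OF assms(2,3) cl(1)])
  also have "cp (c \<otimes>\<^bsub>R\<^esub> b \<otimes>\<^bsub>R\<^esub> a) = ksign CQ ((r + q) * p) (cp (a \<otimes>\<^bsub>R\<^esub> c \<otimes>\<^bsub>R\<^esub> b))"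
    using cp_comm [OF prod_grade [OF assms(3,2)] assms(1)] cl by (simp add: m_assoc)
  finally show ?thesis
    using cl by (cases p; cases q; cases r) (simp_all add: cp_closed)
qed

text \<open>The parity automorphism of \<open>R\<close>, that is \<open>(-1)^|a| a\<close> extended
  linearly. It allows the signs in the matrices below to be written for entries that are not
  homogeneous.\<close>

definition sgn_part :: "'a \<Rightarrow> 'a" where
  "sgn_part a = component R 0 a \<oplus>\<^bsub>R\<^esub> \<ominus>\<^bsub>R\<^esub> component R 1 a"

lemma sgn_part_homogeneous: "a \<in> grade R p \<Longrightarrow> sgn_part a = ksign R p a"
  by (cases p) (simp_all add: sgn_part_def component_homogeneous component_other [of a 0 1]
      component_other [of a 1 0] M.minus_zero' grade_closed)

lemma sgn_part_closed [simp]: "a \<in> carrier R \<Longrightarrow> sgn_part a \<in> carrier R"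
  by (simp add: sgn_part_def)

lemma sgn_part_add:
  assumes "a \<in> carrier R" "b \<in> carrier R"
  shows "sgn_part (a \<oplus>\<^bsub>R\<^esub> b) = sgn_part a \<oplus>\<^bsub>R\<^esub> sgn_part b"
  using assms by (simp add: sgn_part_def component_add M.minus_add M.a_ac)

lemma sgn_part_smult:
  assumes "c \<in> carrier K" "b \<in> carrier R"
  shows "sgn_part (c \<odot>\<^bsub>R\<^esub> b) = c \<odot>\<^bsub>R\<^esub> sgn_part b"
  using assms by (simp add: sgn_part_def component_smult smult_r_distr smult_r_minus)

section \<open>The matrix representation of the Steinberg algebra\<close>

abbreviation "zm \<equiv> (\<zero>\<^bsub>R\<^esub>, \<zero>\<^bsub>R\<^esub>, \<zero>\<^bsub>R\<^esub>, \<zero>\<^bsub>R\<^esub>)"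

text \<open>The orthosymplectic matrices $t_{ij}(a) = e_{ij}(a) - e_{ji}(\bar a)$,
  $f_{i1}(a) = e_{i3}(a) + (-1)^{|a|} e_{4i}(\bar a)$ and
  $g_{1i}(a) = e_{3i}(a) - (-1)^{|a|} e_{i4}(\bar a)$, given by their four blocks.\<close>

definition mt :: "two \<Rightarrow> two \<Rightarrow> 'a \<Rightarrow> ('a \<times> 'a \<times> 'a \<times> 'a) \<times> ('a \<times> 'a \<times> 'a \<times> 'a) \<times>
    ('a \<times> 'a \<times> 'a \<times> 'a) \<times> ('a \<times> 'a \<times> 'a \<times> 'a)" where
  "mt i j a = (if i = I1 then (\<zero>\<^bsub>R\<^esub>, a, \<ominus>\<^bsub>R\<^esub> bar a, \<zero>\<^bsub>R\<^esub>) else (\<zero>\<^bsub>R\<^esub>, \<ominus>\<^bsub>R\<^esub> bar a, a, \<zero>\<^bsub>R\<^esub>), zm, zm, zm)"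

definition mf :: "two \<Rightarrow> 'a \<Rightarrow> ('a \<times> 'a \<times> 'a \<times> 'a) \<times> ('a \<times> 'a \<times> 'a \<times> 'a) \<times>
    ('a \<times> 'a \<times> 'a \<times> 'a) \<times> ('a \<times> 'a \<times> 'a \<times> 'a)" where
  "mf i a = (zm, if i = I1 then (a, \<zero>\<^bsub>R\<^esub>, \<zero>\<^bsub>R\<^esub>, \<zero>\<^bsub>R\<^esub>) else (\<zero>\<^bsub>R\<^esub>, \<zero>\<^bsub>R\<^esub>, a, \<zero>\<^bsub>R\<^esub>),
     if i = I1 then (\<zero>\<^bsub>R\<^esub>, \<zero>\<^bsub>R\<^esub>, sgn_part (bar a), \<zero>\<^bsub>R\<^esub>) else (\<zero>\<^bsub>R\<^esub>, \<zero>\<^bsub>R\<^esub>, \<zero>\<^bsub>R\<^esub>, sgn_part (bar a)), zm)"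

definition mg :: "two \<Rightarrow> 'a \<Rightarrow> ('a \<times> 'a \<times> 'a \<times> 'a) \<times> ('a \<times> 'a \<times> 'a \<times> 'a) \<times>
    ('a \<times> 'a \<times> 'a \<times> 'a) \<times> ('a \<times> 'a \<times> 'a \<times> 'a)" where
  "mg i a = (zm, if i = I1 then (\<zero>\<^bsub>R\<^esub>, \<ominus>\<^bsub>R\<^esub> sgn_part (bar a), \<zero>\<^bsub>R\<^esub>, \<zero>\<^bsub>R\<^esub>)
       else (\<zero>\<^bsub>R\<^esub>, \<zero>\<^bsub>R\<^esub>, \<zero>\<^bsub>R\<^esub>, \<ominus>\<^bsub>R\<^esub> sgn_part (bar a)),
     if i = I1 then (a, \<zero>\<^bsub>R\<^esub>, \<zero>\<^bsub>R\<^esub>, \<zero>\<^bsub>R\<^esub>) else (\<zero>\<^bsub>R\<^esub>, a, \<zero>\<^bsub>R\<^esub>, \<zero>\<^bsub>R\<^esub>), zm)"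

abbreviation "M2 \<equiv> mat2 0 R"
abbreviation "M4 \<equiv> mat2 1 M2"
abbreviation "GL \<equiv> commutator_algebra M4"

lemma M2_assoc: "assoc_superalgebra K M2"
  by (rule mat2_assoc_superalgebra)

lemma M4_assoc: "assoc_superalgebra K M4"
  by (rule assoc_superalgebra.mat2_assoc_superalgebra [OF M2_assoc])

lemma GL_lie: "lie_superalgebra K GL"
  by (rule commutator_lie [OF M4_assoc])

lemma bar_closed [simp]: "a \<in> carrier R \<Longrightarrow> bar a \<in> carrier R"
proof (induction rule: homogeneous_induct)
  case (homogeneous p x)
  then show ?case by (blast intro: bar_grade grade_closed)
next
  case (add x y)
  then show ?case by (simp add: bar_add)
qed

lemma bar_minus: "a \<in> carrier R \<Longrightarrow> bar (\<ominus>\<^bsub>R\<^esub> a) = \<ominus>\<^bsub>R\<^esub> bar a"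
  using bar_smult [of "\<ominus>\<^bsub>K\<^esub> \<one>\<^bsub>K\<^esub>" a] by (simp add: smult_l_minus)

lemma sto_family_GL: "sto_family K R bar GL mt mf mg"
proof (intro sto_family.intro sto_family_axioms.intro superinvolution_axioms
    lie_superalgebra.pre_lie [OF GL_lie])
  interpret M2: assoc_superalgebra K M2 by (rule M2_assoc)
  interpret M4: assoc_superalgebra K M4 by (rule M4_assoc)
  have sgb: "sgn_part (bar a) = ksign R p (bar a)" if "a \<in> grade R p" for a p
    by (rule sgn_part_homogeneous [OF bar_grade [OF that]])
  have fg_grade: "mf i a \<in> grade GL (1 + p)" "mg i a \<in> grade GL (1 + p)"
    if "a \<in> grade R p" for i a p
    using that bar_grade [OF that]
    by (simp_all add: mf_def mg_def sgb [OF that] grade_ksign grade_minus add.commute)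
  have t_grade: "mt i j a \<in> grade GL p" if "a \<in> grade R p" for i j a p
    using that bar_grade [OF that] by (simp add: mt_def grade_minus)
  fix i j :: two and a b p q c
  {
    assume a: "a \<in> grade R p"
    show "mf i a \<in> grade GL (1 + p)" "mg i a \<in> grade GL (1 + p)"
      using fg_grade [OF a] by simp_all
    show "mt i j a \<in> grade GL p"
      using t_grade [OF a] by simp
  }
  {
    assume a: "a \<in> grade R p" and b: "b \<in> grade R p"
    then have cl: "a \<in> carrier R" "b \<in> carrier R"
      by (auto intro: grade_closed)
    show "mf i (a \<oplus>\<^bsub>R\<^esub> b) = mf i a \<oplus>\<^bsub>GL\<^esub> mf i b" "mg i (a \<oplus>\<^bsub>R\<^esub> b) = mg i a \<oplus>\<^bsub>GL\<^esub> mg i b"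
      "mt i j (a \<oplus>\<^bsub>R\<^esub> b) = mt i j a \<oplus>\<^bsub>GL\<^esub> mt i j b"
      using cl by (simp_all add: mf_def mg_def mt_def bar_add sgn_part_add M.minus_add)
  }
  {
    assume a: "a \<in> grade R p" and c: "c \<in> carrier K"
    then have cl: "a \<in> carrier R"
      by (auto intro: grade_closed)
    show "mf i (c \<odot>\<^bsub>R\<^esub> a) = c \<odot>\<^bsub>GL\<^esub> mf i a" "mg i (c \<odot>\<^bsub>R\<^esub> a) = c \<odot>\<^bsub>GL\<^esub> mg i a"
      "mt i j (c \<odot>\<^bsub>R\<^esub> a) = c \<odot>\<^bsub>GL\<^esub> mt i j a"
      using cl c
      by (simp_all add: mf_def mg_def mt_def bar_smult sgn_part_smult smult_r_minus)
  }
  assume ij: "i \<noteq> j"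
  then have ij': "i = I1 \<and> j = I2 \<or> i = I2 \<and> j = I1"
    by (cases i; cases j) auto
  {
    assume a: "a \<in> grade R p"
    then have cl: "a \<in> carrier R"
      by (auto intro: grade_closed)
    show "mt i j a = \<ominus>\<^bsub>GL\<^esub> (mt j i (bar a))"
      using cl ij' by (auto simp: mt_def bar_bar M2.mat2_minus mat2_minus M.minus_zero')
  }
  assume a: "a \<in> grade R p" and b: "b \<in> grade R q"
  then have cl: "a \<in> carrier R" "b \<in> carrier R"
    by (auto intro: grade_closed)
  note ab = prod_grade [OF a b] prod_grade [OF bar_grade [OF a] b]
    prod_grade [OF a bar_grade [OF b]]
  have hom: "x \<otimes>\<^bsub>GL\<^esub> y = x \<otimes>\<^bsub>M4\<^esub> y \<oplus>\<^bsub>M4\<^esub> \<ominus>\<^bsub>M4\<^esub> ksign M4 (u * v) (y \<otimes>\<^bsub>M4\<^esub> x)"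
    if "x \<in> grade GL u" "y \<in> grade GL v" for x y u v
    using M4.supercomm_homogeneous that by simp
  \<comment> \<open>The exponent \<open>p + q\<close> is the degree of the product, from
    \<open>sgn_part\<close>; the exponent \<open>p * q\<close> comes from \<open>bar\<close>
    reversing the product.\<close>
  have sg: "sgn_part (bar (a \<otimes>\<^bsub>R\<^esub> b)) = ksign R (p + q + p * q) (bar b \<otimes>\<^bsub>R\<^esub> bar a)"
    "sgn_part (bar (bar a \<otimes>\<^bsub>R\<^esub> b)) = ksign R (p + q + p * q) (bar b \<otimes>\<^bsub>R\<^esub> a)"
    "sgn_part (bar (a \<otimes>\<^bsub>R\<^esub> bar b)) = ksign R (p + q + p * q) (b \<otimes>\<^bsub>R\<^esub> bar a)"
    unfolding sgb [OF ab(1)] sgb [OF ab(2)] sgb [OF ab(3)]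
    unfolding bar_mult [OF a b] bar_mult [OF bar_grade [OF a] b] bar_mult [OF a bar_grade [OF b]]
    using cl by (simp_all add: M.ksign_ksign bar_bar)
  note S = M2.mat2_minus mat2_minus M2.mat2_ksign mat2_ksign M.minus_zero'
    l_minus r_minus M.l_neg M.r_neg prod_ksign_left prod_ksign_right cl
  \<comment> \<open>Keeps the computation on explicit tuples by withdrawing the abstract zero laws
    of the matrix rings.\<close>
  note [simp del] = M2.l_zero M2.r_zero M4.l_zero M4.r_zero
  show "mt i j a \<otimes>\<^bsub>GL\<^esub> mf j b = mf i (a \<otimes>\<^bsub>R\<^esub> b)"
    unfolding hom [OF t_grade [OF a] fg_grade(1) [OF b]]
    unfolding mt_def mf_def sg sgb [OF b]
    using ij' by (elim disjE conjE; simp add: S; cases p; cases q; simp add: S)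
  show "mt i j a \<otimes>\<^bsub>GL\<^esub> mf i b = \<ominus>\<^bsub>GL\<^esub> (mf j (bar a \<otimes>\<^bsub>R\<^esub> b))"
    unfolding hom [OF t_grade [OF a] fg_grade(1) [OF b]]
    unfolding mt_def mf_def sg sgb [OF b]
    using ij' by (elim disjE conjE; simp add: S; cases p; cases q; simp add: S)
  show "mg i a \<otimes>\<^bsub>GL\<^esub> mt i j b = mg j (a \<otimes>\<^bsub>R\<^esub> b)"
    unfolding hom [OF fg_grade(2) [OF a] t_grade [OF b]]
    unfolding mt_def mg_def sg sgb [OF a]
    using ij' by (elim disjE conjE; simp add: S; cases p; cases q; simp add: S)
  show "mg j a \<otimes>\<^bsub>GL\<^esub> mt i j b = \<ominus>\<^bsub>GL\<^esub> (mg i (a \<otimes>\<^bsub>R\<^esub> bar b))"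
    unfolding hom [OF fg_grade(2) [OF a] t_grade [OF b]]
    unfolding mt_def mg_def sg sgb [OF a]
    using ij' by (elim disjE conjE; simp add: S; cases p; cases q; simp add: S)
  show "mf i a \<otimes>\<^bsub>GL\<^esub> mf j b = \<zero>\<^bsub>GL\<^esub>"
    unfolding hom [OF fg_grade(1) [OF a] fg_grade(1) [OF b]]
    unfolding mf_def sgb [OF a] sgb [OF b]
    using ij' by (elim disjE conjE; simp add: S; cases p; cases q; simp add: S)
  show "mg i a \<otimes>\<^bsub>GL\<^esub> mg j b = \<zero>\<^bsub>GL\<^esub>"
    unfolding hom [OF fg_grade(2) [OF a] fg_grade(2) [OF b]]
    unfolding mg_def sgb [OF a] sgb [OF b]
    using ij' by (elim disjE conjE; simp add: S; cases p; cases q; simp add: S)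
qed

lemma GL_bracket:
  assumes "x \<in> grade GL p" "y \<in> grade GL q"
  shows "x \<otimes>\<^bsub>GL\<^esub> y = x \<otimes>\<^bsub>M4\<^esub> y \<oplus>\<^bsub>M4\<^esub> \<ominus>\<^bsub>M4\<^esub> ksign M4 (p * q) (y \<otimes>\<^bsub>M4\<^esub> x)"
proof -
  interpret M4: assoc_superalgebra K M4 by (rule M4_assoc)
  show ?thesis
    using M4.supercomm_homogeneous assms by simp
qed

text \<open>The relation that a family leaves open holds strictly for the matrices, so they give a
  true representation of the Steinberg algebra.\<close>

lemma GL_F_G:
  assumes ij: "i \<noteq> j" and a: "a \<in> grade R p" and b: "b \<in> grade R q"
  shows "mf i a \<otimes>\<^bsub>GL\<^esub> mg j b = mt i j (a \<otimes>\<^bsub>R\<^esub> b)"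
proof -
  interpret M2: assoc_superalgebra K M2 by (rule M2_assoc)
  interpret GL: sto_family K R bar GL mt mf mg by (rule sto_family_GL)
  have ij': "i = I1 \<and> j = I2 \<or> i = I2 \<and> j = I1"
    using ij by (cases i; cases j) auto
  have cl: "a \<in> carrier R" "b \<in> carrier R"
    using a b grade_closed by blast+
  have sgb: "sgn_part (bar a) = ksign R p (bar a)" if "a \<in> grade R p" for a p
    by (rule sgn_part_homogeneous [OF bar_grade [OF that]])
  note S = M2.mat2_minus mat2_minus M2.mat2_ksign mat2_ksign M.minus_zero'
    l_minus r_minus M.l_neg M.r_neg prod_ksign_left prod_ksign_right cl
  show ?thesis
    unfolding GL_bracket [OF GL.F_grade [OF a] GL.G_grade [OF b]]
    unfolding mt_def mf_def mg_def sgb [OF a] sgb [OF b] bar_mult [OF a b]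
    using ij' by (elim disjE conjE; simp add: S; cases p; cases q; simp add: S)
qed

abbreviation "gM \<equiv> sto_gen_map mt mf mg"

text \<open>The representation on classes, by way of a chosen representing term;
  \<open>Phi_cls\<close> shows that the choice does not matter.\<close>

definition Phi :: "('k, 'a sto_gen) lie_term set \<Rightarrow> ('a \<times> 'a \<times> 'a \<times> 'a) \<times> ('a \<times> 'a \<times> 'a \<times> 'a) \<times>
    ('a \<times> 'a \<times> 'a \<times> 'a) \<times> ('a \<times> 'a \<times> 'a \<times> 'a)" where
  "Phi X = eval_term GL gM (SOME t. t \<in> sto.tms \<and> X = sto.cls t)"

lemma Phi_cls:
  assumes "t \<in> sto.tms"
  shows "Phi (sto.cls t) = eval_term GL gM t"
proof -
  interpret GL: sto_family K R bar GL mt mf mg by (rule sto_family_GL)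
  define s where "s = (SOME s. s \<in> sto.tms \<and> sto.cls t = sto.cls s)"
  have "s \<in> sto.tms \<and> sto.cls t = sto.cls s"
    unfolding s_def by (rule someI [of _ t]) (use assms in simp)
  then have c: "lie_cong K (sto_gens R) (sto_rels K R bar) s t"
    using sto.cls_eq_iff assms by metis
  have "eval_term GL gM s = eval_term GL gM t"
    by (rule GL.eval_cong_sto_eq [OF _ c], rule GL_F_G)
  then show ?thesis
    by (simp add: Phi_def s_def)
qed

lemma Phi_grade: "X \<in> grade st p \<Longrightarrow> Phi X \<in> grade GL p"
proof -
  interpret GL: sto_family K R bar GL mt mf mg by (rule sto_family_GL)
  assume "X \<in> grade st p"
  then obtain t where t: "lie_term_deg K (sto_gens R) t p" "t \<in> sto.tms" "X = sto.cls t"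
    by (rule sto.P_grade_cases)
  have "eval_term GL gM t \<in> grade GL p"
    by (rule GL.L.eval_grade [OF GL.gmap_grade t(1)])
  then show ?thesis
    using t Phi_cls by (simp only:)
qed

lemma Phi_closed: "X \<in> carrier st \<Longrightarrow> Phi X \<in> carrier GL"
proof -
  interpret GL: sto_family K R bar GL mt mf mg by (rule sto_family_GL)
  assume "X \<in> carrier st"
  then obtain t where t: "t \<in> sto.tms" "X = sto.cls t"
    by (rule sto.P_cases)
  have "eval_term GL gM t \<in> carrier GL"
    by (rule GL.L.eval_closed [OF GL.gmap_grade t(1)])
  then show ?thesis
    using t Phi_cls by (simp only:)
qed

lemma Phi_hom:
  assumes "X \<in> carrier st" "Y \<in> carrier st"
  shows "Phi (X \<oplus>\<^bsub>st\<^esub> Y) = Phi X \<oplus>\<^bsub>GL\<^esub> Phi Y" "Phi (X \<otimes>\<^bsub>st\<^esub> Y) = Phi X \<otimes>\<^bsub>GL\<^esub> Phi Y"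
    "c \<in> carrier K \<Longrightarrow> Phi (c \<odot>\<^bsub>st\<^esub> X) = c \<odot>\<^bsub>GL\<^esub> Phi X"
proof -
  obtain s t where st: "s \<in> sto.tms" "X = sto.cls s" "t \<in> sto.tms" "Y = sto.cls t"
    using assms by (auto elim!: sto.P_cases)
  show "Phi (X \<oplus>\<^bsub>st\<^esub> Y) = Phi X \<oplus>\<^bsub>GL\<^esub> Phi Y" "Phi (X \<otimes>\<^bsub>st\<^esub> Y) = Phi X \<otimes>\<^bsub>GL\<^esub> Phi Y"
    "c \<in> carrier K \<Longrightarrow> Phi (c \<odot>\<^bsub>st\<^esub> X) = c \<odot>\<^bsub>GL\<^esub> Phi X"
    using st by (simp_all only: sto.cls_add sto.cls_br sto.cls_scale Phi_cls lie_terms.intros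
        eval_term.simps)
qed

lemma Phi_gens:
  "\<lbrakk>i \<noteq> j; a \<in> homogeneous R\<rbrakk> \<Longrightarrow> Phi (ct i j a) = mt i j a"
  "a \<in> homogeneous R \<Longrightarrow> Phi (cf i a) = mf i a"
  "a \<in> homogeneous R \<Longrightarrow> Phi (cg i a) = mg i a"
  unfolding sto_gen_class_def by (simp_all add: Phi_cls gen_in_terms)

section \<open>Traces and supertraces modulo \<open>[R,R]R\<close>\<close>

lemma cp_hom:
  "\<lbrakk>x \<in> carrier R; y \<in> carrier R\<rbrakk> \<Longrightarrow> cp (x \<oplus>\<^bsub>R\<^esub> y) = cp x \<oplus>\<^bsub>CQ\<^esub> cp y"
  "x \<in> carrier R \<Longrightarrow> cp (\<ominus>\<^bsub>R\<^esub> x) = \<ominus>\<^bsub>CQ\<^esub> cp x"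
  "x \<in> carrier R \<Longrightarrow> cp (ksign R p x) = ksign CQ p (cp x)"
  by (simp_all add: CQ.pr_add CQ.pr_minus CQ.pr_ksign)

text \<open>The trace of a 2 by 2 matrix. Reduced modulo \<open>[R,R]R\<close> it satisfies the
  usual rule for the trace of a product, up to the super sign (\<open>tau_comm\<close>).\<close>

definition tau :: "'a \<times> 'a \<times> 'a \<times> 'a \<Rightarrow> 'a set" where
  "tau = (\<lambda>(a1, a2, a3, a4). cp (a1 \<oplus>\<^bsub>R\<^esub> a4))"

lemma M2_cases:
  assumes "X \<in> carrier M2"
  obtains a1 a2 a3 a4 where "X = (a1, a2, a3, a4)" "a1 \<in> carrier R" "a2 \<in> carrier R"
    "a3 \<in> carrier R" "a4 \<in> carrier R"
  using assms unfolding mat2_simps by (rule tuple4_cases)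

lemma M2_grade_cases:
  assumes "X \<in> grade M2 p"
  obtains a1 a2 a3 a4 where "X = (a1, a2, a3, a4)" "a1 \<in> grade R p" "a2 \<in> grade R p"
    "a3 \<in> grade R p" "a4 \<in> grade R p"
  using assms unfolding mat2_simps add_0_right by (rule tuple4_cases)

lemma tau_closed: "X \<in> carrier M2 \<Longrightarrow> tau X \<in> carrier CQ"
  by (erule M2_cases) (simp add: tau_def cp_closed)

lemma tau_add:
  assumes "X \<in> carrier M2" "Y \<in> carrier M2"
  shows "tau (X \<oplus>\<^bsub>M2\<^esub> Y) = tau X \<oplus>\<^bsub>CQ\<^esub> tau Y"
  using assms by (elim M2_cases) (simp add: tau_def cp_hom(1) [symmetric] M.a_ac)

lemma tau_ksign:
  assumes "X \<in> carrier M2"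
  shows "tau (ksign M2 p X) = ksign CQ p (tau X)"
  using assms
  by (elim M2_cases) (simp add: tau_def mat2_ksign cp_hom(3) [symmetric] M.ksign_add)

lemma tau_minus:
  assumes "X \<in> carrier M2"
  shows "tau (\<ominus>\<^bsub>M2\<^esub> X) = \<ominus>\<^bsub>CQ\<^esub> tau X"
  using tau_ksign [OF assms, of 1] by simp

lemma tau_comm:
  assumes "X \<in> grade M2 p" "Y \<in> grade M2 q"
  shows "tau (X \<otimes>\<^bsub>M2\<^esub> Y) = ksign CQ (p * q) (tau (Y \<otimes>\<^bsub>M2\<^esub> X))"
proof -
  obtain a1 a2 a3 a4 where X: "X = (a1, a2, a3, a4)" "a1 \<in> grade R p" "a2 \<in> grade R p"
    "a3 \<in> grade R p" "a4 \<in> grade R p"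
    using assms(1) by (rule M2_grade_cases)
  obtain b1 b2 b3 b4 where Y: "Y = (b1, b2, b3, b4)" "b1 \<in> grade R q" "b2 \<in> grade R q"
    "b3 \<in> grade R q" "b4 \<in> grade R q"
    using assms(2) by (rule M2_grade_cases)
  have cl: "a1 \<in> carrier R" "a2 \<in> carrier R" "a3 \<in> carrier R" "a4 \<in> carrier R"
    "b1 \<in> carrier R" "b2 \<in> carrier R" "b3 \<in> carrier R" "b4 \<in> carrier R"
    using X Y grade_closed by blast+
  have "tau (X \<otimes>\<^bsub>M2\<^esub> Y) = cp (a1 \<otimes>\<^bsub>R\<^esub> b1) \<oplus>\<^bsub>CQ\<^esub> cp (a2 \<otimes>\<^bsub>R\<^esub> b3) \<oplus>\<^bsub>CQ\<^esub> cp (a3 \<otimes>\<^bsub>R\<^esub> b2) \<oplus>\<^bsub>CQ\<^esub> cp (a4 \<otimes>\<^bsub>R\<^esub> b4)"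
    using cl by (simp add: X Y tau_def cp_hom cp_closed CQ.M.a_ac)
  also have "... = ksign CQ (p * q) (cp (b1 \<otimes>\<^bsub>R\<^esub> a1) \<oplus>\<^bsub>CQ\<^esub> cp (b3 \<otimes>\<^bsub>R\<^esub> a2) \<oplus>\<^bsub>CQ\<^esub> cp (b2 \<otimes>\<^bsub>R\<^esub> a3) \<oplus>\<^bsub>CQ\<^esub>
      cp (b4 \<otimes>\<^bsub>R\<^esub> a4))"
    using cl X(2-) Y(2-)
    by (simp add: CQ.M.ksign_add cp_closed cp_comm [of _ p _ q])
  also have "cp (b1 \<otimes>\<^bsub>R\<^esub> a1) \<oplus>\<^bsub>CQ\<^esub> cp (b3 \<otimes>\<^bsub>R\<^esub> a2) \<oplus>\<^bsub>CQ\<^esub> cp (b2 \<otimes>\<^bsub>R\<^esub> a3) \<oplus>\<^bsub>CQ\<^esub> cp (b4 \<otimes>\<^bsub>R\<^esub> a4)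
      = tau (Y \<otimes>\<^bsub>M2\<^esub> X)"
    using cl by (simp add: X Y tau_def cp_hom cp_closed CQ.M.a_ac)
  finally show ?thesis .
qed

text \<open>\<open>str0 p x\<close> says that the supertrace of \<open>x\<close>, a matrix of degree \<open>p\<close>, lies in $[R,R]R$.\<close>

definition str0 :: "bit \<Rightarrow> ('a \<times> 'a \<times> 'a \<times> 'a) \<times> ('a \<times> 'a \<times> 'a \<times> 'a) \<times>
    ('a \<times> 'a \<times> 'a \<times> 'a) \<times> ('a \<times> 'a \<times> 'a \<times> 'a) \<Rightarrow> bool" where
  "str0 p = (\<lambda>(A, B, C, D). tau A = ksign CQ p (tau D))"

lemma GL_block_bracket:
  assumes "(A, B, C, D) \<in> grade GL p" "(A', B', C', D') \<in> grade GL q"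
  shows "(A, B, C, D) \<otimes>\<^bsub>GL\<^esub> (A', B', C', D') =
    (A \<otimes>\<^bsub>M2\<^esub> A' \<oplus>\<^bsub>M2\<^esub> B \<otimes>\<^bsub>M2\<^esub> C' \<oplus>\<^bsub>M2\<^esub> \<ominus>\<^bsub>M2\<^esub> ksign M2 (p * q) (A' \<otimes>\<^bsub>M2\<^esub> A \<oplus>\<^bsub>M2\<^esub> B' \<otimes>\<^bsub>M2\<^esub> C),
     A \<otimes>\<^bsub>M2\<^esub> B' \<oplus>\<^bsub>M2\<^esub> B \<otimes>\<^bsub>M2\<^esub> D' \<oplus>\<^bsub>M2\<^esub> \<ominus>\<^bsub>M2\<^esub> ksign M2 (p * q) (A' \<otimes>\<^bsub>M2\<^esub> B \<oplus>\<^bsub>M2\<^esub> B' \<otimes>\<^bsub>M2\<^esub> D),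
     C \<otimes>\<^bsub>M2\<^esub> A' \<oplus>\<^bsub>M2\<^esub> D \<otimes>\<^bsub>M2\<^esub> C' \<oplus>\<^bsub>M2\<^esub> \<ominus>\<^bsub>M2\<^esub> ksign M2 (p * q) (C' \<otimes>\<^bsub>M2\<^esub> A \<oplus>\<^bsub>M2\<^esub> D' \<otimes>\<^bsub>M2\<^esub> C),
     C \<otimes>\<^bsub>M2\<^esub> B' \<oplus>\<^bsub>M2\<^esub> D \<otimes>\<^bsub>M2\<^esub> D' \<oplus>\<^bsub>M2\<^esub> \<ominus>\<^bsub>M2\<^esub> ksign M2 (p * q) (C' \<otimes>\<^bsub>M2\<^esub> B \<oplus>\<^bsub>M2\<^esub> D' \<otimes>\<^bsub>M2\<^esub> D))"
proof -
  interpret M2: assoc_superalgebra K M2 by (rule M2_assoc)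
  have cl: "A \<in> carrier M2" "B \<in> carrier M2" "C \<in> carrier M2" "D \<in> carrier M2"
    "A' \<in> carrier M2" "B' \<in> carrier M2" "C' \<in> carrier M2" "D' \<in> carrier M2"
    using assms unfolding commutator_algebra_simps mat2_simps(7) [of 1 M2]
    by (blast intro: M2.grade_closed)+
  note mat2_simps(1,2,3,4,5,6,7) [of 0 R, simp del]
  note m = mat2_simps(1,2,5) [of _ M2]
  show ?thesis
    unfolding GL_bracket [OF assms] m
    by (subst M2.mat2_ksign, (intro M2.a_closed M2.m_closed cl)+,
        subst M2.mat2_minus, (intro M2.M.ksign_closed M2.a_closed M2.m_closed cl)+,
        rule m(3))
qed

lemma GL_blocks:
  assumes "x \<in> grade GL p"
  obtains A B C D where "x = (A, B, C, D)" "A \<in> grade M2 p" "B \<in> grade M2 (p + 1)"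
    "C \<in> grade M2 (p + 1)" "D \<in> grade M2 p"
  using assms unfolding commutator_algebra_simps mat2_simps(7) [of 1 M2] by (rule tuple4_cases)

text \<open>The supertrace of a supercommutator vanishes. By \<open>tau_comm\<close> the terms with
  \<open>A A'\<close> and with \<open>D D'\<close> cancel within their blocks. The products of the
  blocks \<open>B\<close> and \<open>C\<close>, which are shifted in degree, cancel between the two
  diagonal blocks, since \<open>(p + 1)(q + 1) = pq + p + q + 1\<close> matches the sign
  \<open>(-1)^(p+q)\<close> of the supertrace up to the minus sign of the commutator.\<close>

lemma str0_bracket:
  assumes "x \<in> grade GL p" "y \<in> grade GL q"
  shows "str0 (p + q) (x \<otimes>\<^bsub>GL\<^esub> y)"
proof -
  interpret M2: assoc_superalgebra K M2 by (rule M2_assoc)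
  obtain A B C D where x: "x = (A, B, C, D)" and g: "A \<in> grade M2 p" "B \<in> grade M2 (p + 1)"
    "C \<in> grade M2 (p + 1)" "D \<in> grade M2 p"
    using assms(1) by (rule GL_blocks)
  obtain A' B' C' D' where y: "y = (A', B', C', D')" and g': "A' \<in> grade M2 q"
    "B' \<in> grade M2 (q + 1)" "C' \<in> grade M2 (q + 1)" "D' \<in> grade M2 q"
    using assms(2) by (rule GL_blocks)
  note cl = g [THEN M2.grade_closed] g' [THEN M2.grade_closed]
  note tc = tau_closed
  note tau_hom = tau_add tau_minus tau_ksign M2.a_closed M2.m_closed M2.M.ksign_closed
    M2.a_inv_closed cl
  note comm = tau_comm [OF g(1) g'(1)] tau_comm [OF g(2) g'(3)] tau_comm [OF g(3) g'(2)]
    tau_comm [OF g(4) g'(4)]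
  have t: "tau (A' \<otimes>\<^bsub>M2\<^esub> A) \<in> carrier CQ" "tau (C' \<otimes>\<^bsub>M2\<^esub> B) \<in> carrier CQ"
    "tau (B' \<otimes>\<^bsub>M2\<^esub> C) \<in> carrier CQ" "tau (D' \<otimes>\<^bsub>M2\<^esub> D) \<in> carrier CQ"
    by (intro tc M2.m_closed cl)+
  have "tau (A \<otimes>\<^bsub>M2\<^esub> A' \<oplus>\<^bsub>M2\<^esub> B \<otimes>\<^bsub>M2\<^esub> C' \<oplus>\<^bsub>M2\<^esub> \<ominus>\<^bsub>M2\<^esub> ksign M2 (p * q) (A' \<otimes>\<^bsub>M2\<^esub> A \<oplus>\<^bsub>M2\<^esub> B' \<otimes>\<^bsub>M2\<^esub> C)) =
    ksign CQ (p + q) (tau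
      (C \<otimes>\<^bsub>M2\<^esub> B' \<oplus>\<^bsub>M2\<^esub> D \<otimes>\<^bsub>M2\<^esub> D' \<oplus>\<^bsub>M2\<^esub> \<ominus>\<^bsub>M2\<^esub> ksign M2 (p * q) (C' \<otimes>\<^bsub>M2\<^esub> B \<oplus>\<^bsub>M2\<^esub> D' \<otimes>\<^bsub>M2\<^esub> D)))"
    by (simp only: tau_hom comm)
      (insert t; cases p; cases q; simp only: ksign_0 ksign_1 mult_zero_left mult_zero_right
        mult_1_left add_0_left add_0_right bit_add_self; algebra)
  then show ?thesis
    unfolding x y GL_block_bracket [OF assms [unfolded x y]] str0_def by simp
qed

end

section \<open>The determinant cocycle\<close>

context superinvolution
begin

text \<open>For a generator the lower right block is zero and the upper left one has zero diagonal.
  Linear operations preserve the condition, and a bracket satisfies it whatever its arguments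
  are.\<close>

lemma str0_eval:
  assumes "lie_term_deg K (sto_gens R) t p"
  shows "str0 p (eval_term GL gM t)"
proof -
  interpret GL: sto_family K R bar GL mt mf mg by (rule sto_family_GL)
  interpret M2: assoc_superalgebra K M2 by (rule M2_assoc)
  have ev: "eval_term GL gM t \<in> grade GL p" if "lie_term_deg K (sto_gens R) t p" for t p
    by (rule GL.L.eval_grade [OF GL.gmap_grade that])
  have zero: "tau zm = \<zero>\<^bsub>CQ\<^esub>"
    by (simp add: tau_def CQ.Q_zero)
  show ?thesis
    using assms
  proof (induction rule: lie_term_deg.induct)
    case (1 x p)
    then have "\<exists>B C b c. gM x = ((\<zero>\<^bsub>R\<^esub>, b, c, \<zero>\<^bsub>R\<^esub>), B, C, zm)"
      by (auto simp: sto_gens_def mt_def mf_def mg_def)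
    then show ?case
      by (auto simp: str0_def zero) (auto simp: tau_def CQ.Q_zero)
  next
    case (2 p)
    then show ?case
      by (simp add: str0_def zero)
  next
    case (3 s p t)
    obtain A B C D where x: "eval_term GL gM s = (A, B, C, D)" "A \<in> grade M2 p"
      "B \<in> grade M2 (p + 1)" "C \<in> grade M2 (p + 1)" "D \<in> grade M2 p"
      using ev [OF 3(1)] by (rule GL_blocks)
    obtain A' B' C' D' where y: "eval_term GL gM t = (A', B', C', D')" "A' \<in> grade M2 p"
      "B' \<in> grade M2 (p + 1)" "C' \<in> grade M2 (p + 1)" "D' \<in> grade M2 p"
      using ev [OF 3(2)] by (rule GL_blocks)
    have cl: "A \<in> carrier M2" "D \<in> carrier M2" "A' \<in> carrier M2" "D' \<in> carrier M2"
      using x y M2.grade_closed by blast+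
    show ?case
      using 3(3,4) unfolding eval_term.simps x(1) y(1) commutator_algebra_simps
        mat2_simps(5) [of _ M2] str0_def
      by (simp only: prod.case tau_add cl CQ.M.ksign_add tau_closed)
  next
    case (4 c t p)
    obtain A B C D where x: "eval_term GL gM t = (A, B, C, D)" "A \<in> grade M2 p"
      "B \<in> grade M2 (p + 1)" "C \<in> grade M2 (p + 1)" "D \<in> grade M2 p"
      using ev [OF 4(2)] by (rule GL_blocks)
    have cl: "A \<in> carrier M2" "D \<in> carrier M2"
      using x M2.grade_closed by blast+
    have sm: "tau (c \<odot>\<^bsub>M2\<^esub> X) = c \<odot>\<^bsub>CQ\<^esub> tau X" if "X \<in> carrier M2" for X
      using that 4(1)
      by (elim M2_cases) (simp add: tau_def smult_r_distr [symmetric] CQ.pr_smult)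
    show ?case
      using 4(1,3) unfolding eval_term.simps x(1) commutator_algebra_simps
        mat2_simps(6) [of _ M2] str0_def
      by (simp only: prod.case sm cl CQ.ksign_smult [symmetric] tau_closed)
  next
    case (5 s p t q)
    then show ?case
      using str0_bracket [OF ev ev] by simp
  qed
qed

lemma str0_Phi: "X \<in> grade st p \<Longrightarrow> str0 p (Phi X)"
proof -
  assume "X \<in> grade st p"
  then obtain t where t: "lie_term_deg K (sto_gens R) t p" "t \<in> sto.tms" "X = sto.cls t"
    by (rule sto.P_grade_cases)
  then show ?thesis
    using str0_eval Phi_cls by simp
qed

text \<open>The cocycle is the polarized determinant of the upper right block, built from the
  determinant of a pair of columns.\<close>

definition det2 :: "'a \<times> 'a \<Rightarrow> 'a \<times> 'a \<Rightarrow> 'a set" where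
  "det2 = (\<lambda>(u1, u2) (v1, v2). cp (u1 \<otimes>\<^bsub>R\<^esub> v2) \<oplus>\<^bsub>CQ\<^esub> \<ominus>\<^bsub>CQ\<^esub> cp (u2 \<otimes>\<^bsub>R\<^esub> v1))"

definition act2 :: "'a \<times> 'a \<times> 'a \<times> 'a \<Rightarrow> 'a \<times> 'a \<Rightarrow> 'a \<times> 'a" where
  "act2 = (\<lambda>(a1, a2, a3, a4) (u1, u2). (a1 \<otimes>\<^bsub>R\<^esub> u1 \<oplus>\<^bsub>R\<^esub> a2 \<otimes>\<^bsub>R\<^esub> u2, a3 \<otimes>\<^bsub>R\<^esub> u1 \<oplus>\<^bsub>R\<^esub> a4 \<otimes>\<^bsub>R\<^esub> u2))"

lemma det2_closed:
  "\<lbrakk>u \<in> carrier R \<times> carrier R; v \<in> carrier R \<times> carrier R\<rbrakk> \<Longrightarrow> det2 u v \<in> carrier CQ"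
  by (auto simp: det2_def cp_closed)

lemma cp_swap23':
  "\<lbrakk>a \<in> grade R p; b \<in> grade R q; c \<in> grade R r\<rbrakk> \<Longrightarrow>
    cp (a \<otimes>\<^bsub>R\<^esub> (b \<otimes>\<^bsub>R\<^esub> c)) = ksign CQ (q * r) (cp (a \<otimes>\<^bsub>R\<^esub> (c \<otimes>\<^bsub>R\<^esub> b)))"
  using cp_swap23 [of a p b q c r] by (simp add: m_assoc grade_closed)

text \<open>The super form of \<open>det(Au, v) + det(u, Av) = tr(A) det(u, v)\<close>. The second
  summand is written through \<open>det(Av, u)\<close>, which avoids the sign of moving
  \<open>A\<close> past \<open>u\<close>. The off-diagonal entries of \<open>A\<close> cancel
  because the last two factors of a triple product may be interchanged modulo
  \<open>[R,R]R\<close>.\<close>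

lemma det2_act2:
  assumes A: "a1 \<in> grade R p" "a2 \<in> grade R p" "a3 \<in> grade R p" "a4 \<in> grade R p"
    and u: "u1 \<in> grade R q" "u2 \<in> grade R q" and v: "v1 \<in> grade R r" "v2 \<in> grade R r"
  shows "det2 (act2 (a1, a2, a3, a4) (u1, u2)) (v1, v2) \<oplus>\<^bsub>CQ\<^esub>
      \<ominus>\<^bsub>CQ\<^esub> ksign CQ (q * r) (det2 (act2 (a1, a2, a3, a4) (v1, v2)) (u1, u2)) =
    cp ((a1 \<oplus>\<^bsub>R\<^esub> a4) \<otimes>\<^bsub>R\<^esub> (u1 \<otimes>\<^bsub>R\<^esub> v2)) \<oplus>\<^bsub>CQ\<^esub> \<ominus>\<^bsub>CQ\<^esub> cp ((a1 \<oplus>\<^bsub>R\<^esub> a4) \<otimes>\<^bsub>R\<^esub> (u2 \<otimes>\<^bsub>R\<^esub> v1))"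
proof -
  have cl: "a1 \<in> carrier R" "a2 \<in> carrier R" "a3 \<in> carrier R" "a4 \<in> carrier R"
    "u1 \<in> carrier R" "u2 \<in> carrier R" "v1 \<in> carrier R" "v2 \<in> carrier R"
    using A u v grade_closed by blast+
  define N where "N a b c = cp (a \<otimes>\<^bsub>R\<^esub> (b \<otimes>\<^bsub>R\<^esub> c))" for a b c
  have N: "N a b c \<in> carrier CQ" if "a \<in> carrier R" "b \<in> carrier R" "c \<in> carrier R" for a b c
    using that by (simp add: N_def cp_closed)
  have sw: "N a v' u' = ksign CQ (q * r) (N a u' v')"
    if "a \<in> grade R p" "u' \<in> grade R q" "v' \<in> grade R r" for a u' v'
    unfolding N_def using cp_swap23' [OF that(1,3,2)] by (simp add: mult.commute)
  have *: "cp ((a \<otimes>\<^bsub>R\<^esub> b \<oplus>\<^bsub>R\<^esub> a' \<otimes>\<^bsub>R\<^esub> b') \<otimes>\<^bsub>R\<^esub> c) = N a b c \<oplus>\<^bsub>CQ\<^esub> N a' b' c"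
    if "a \<in> carrier R" "b \<in> carrier R" "c \<in> carrier R" "a' \<in> carrier R" "b' \<in> carrier R"
    for a b c a' b'
    using that by (simp add: N_def l_distr m_assoc cp_hom)
  have **: "cp ((a1 \<oplus>\<^bsub>R\<^esub> a4) \<otimes>\<^bsub>R\<^esub> (b \<otimes>\<^bsub>R\<^esub> c)) = N a1 b c \<oplus>\<^bsub>CQ\<^esub> N a4 b c"
    if "b \<in> carrier R" "c \<in> carrier R" for b c
    using that cl by (simp add: N_def l_distr cp_hom)
  have c: "N a1 u1 v2 \<in> carrier CQ" "N a2 u2 v2 \<in> carrier CQ" "N a3 u1 v1 \<in> carrier CQ"
    "N a4 u2 v1 \<in> carrier CQ" "N a4 u1 v2 \<in> carrier CQ" "N a1 u2 v1 \<in> carrier CQ"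
    by (intro N cl)+
  have kk: "ksign CQ (q * r) (ksign CQ (q * r) x \<oplus>\<^bsub>CQ\<^esub> ksign CQ (q * r) y \<oplus>\<^bsub>CQ\<^esub>
      \<ominus>\<^bsub>CQ\<^esub> (ksign CQ (q * r) z \<oplus>\<^bsub>CQ\<^esub> ksign CQ (q * r) w)) =
      x \<oplus>\<^bsub>CQ\<^esub> y \<oplus>\<^bsub>CQ\<^esub> \<ominus>\<^bsub>CQ\<^esub> (z \<oplus>\<^bsub>CQ\<^esub> w)"
    if "x \<in> carrier CQ" "y \<in> carrier CQ" "z \<in> carrier CQ" "w \<in> carrier CQ" for x y z w
    using that by (cases q; cases r) (simp_all add: CQ.M.minus_add)
  show ?thesis
    unfolding det2_def act2_def prod.case
    unfolding * [OF cl(1) cl(5) cl(8) cl(2) cl(6)] * [OF cl(3) cl(5) cl(7) cl(4) cl(6)]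
      * [OF cl(1) cl(7) cl(6) cl(2) cl(8)] * [OF cl(3) cl(7) cl(5) cl(4) cl(8)]
      ** [OF cl(5) cl(8)] ** [OF cl(6) cl(7)]
    unfolding sw [OF A(1) u(2) v(1)] sw [OF A(2) u(2) v(2)] sw [OF A(3) u(1) v(1)]
      sw [OF A(4) u(1) v(2)]
    unfolding kk [OF c(6) c(2) c(3) c(5)]
    using c by algebra
qed

section \<open>Invariance of the polarized determinant\<close>

definition pdet :: "'a \<times> 'a \<times> 'a \<times> 'a \<Rightarrow> 'a \<times> 'a \<times> 'a \<times> 'a \<Rightarrow> 'a set" where
  "pdet = (\<lambda>(b1, b2, b3, b4) (c1, c2, c3, c4).
     det2 (b1, b3) (c2, c4) \<oplus>\<^bsub>CQ\<^esub> \<ominus>\<^bsub>CQ\<^esub> det2 (b2, b4) (c1, c3))"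

text \<open>The polarized determinant with a weight \<open>x\<close> multiplied in from the left
  before reduction modulo \<open>[R,R]R\<close>. The weight will be the trace of a diagonal
  block.\<close>

definition ptrip :: "'a \<Rightarrow> 'a \<times> 'a \<times> 'a \<times> 'a \<Rightarrow> 'a \<times> 'a \<times> 'a \<times> 'a \<Rightarrow> 'a set" where
  "ptrip x = (\<lambda>(b1, b2, b3, b4) (c1, c2, c3, c4).
     (cp (x \<otimes>\<^bsub>R\<^esub> (b1 \<otimes>\<^bsub>R\<^esub> c4)) \<oplus>\<^bsub>CQ\<^esub> \<ominus>\<^bsub>CQ\<^esub> cp (x \<otimes>\<^bsub>R\<^esub> (b3 \<otimes>\<^bsub>R\<^esub> c2))) \<oplus>\<^bsub>CQ\<^esub>
     \<ominus>\<^bsub>CQ\<^esub> (cp (x \<otimes>\<^bsub>R\<^esub> (b2 \<otimes>\<^bsub>R\<^esub> c3)) \<oplus>\<^bsub>CQ\<^esub> \<ominus>\<^bsub>CQ\<^esub> cp (x \<otimes>\<^bsub>R\<^esub> (b4 \<otimes>\<^bsub>R\<^esub> c1))))"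

lemma pdet_closed: "\<lbrakk>b \<in> carrier M2; c \<in> carrier M2\<rbrakk> \<Longrightarrow> pdet b c \<in> carrier CQ"
  by (elim M2_cases) (simp add: pdet_def det2_closed)

lemma ptrip_closed: "\<lbrakk>x \<in> carrier R; b \<in> carrier M2; c \<in> carrier M2\<rbrakk> \<Longrightarrow> ptrip x b c \<in> carrier CQ"
  by (elim M2_cases) (simp add: ptrip_def cp_closed)

text \<open>Left multiplication acts on columns. \<open>det2_act2\<close> applies to the two pairs
  of columns that make up the polarization.\<close>

lemma pdet_left:
  assumes A: "(a1, a2, a3, a4) \<in> grade M2 p" and b: "b \<in> grade M2 q" and c: "c \<in> grade M2 r"
  shows "pdet ((a1, a2, a3, a4) \<otimes>\<^bsub>M2\<^esub> b) c \<oplus>\<^bsub>CQ\<^esub>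
      ksign CQ (q * r) (pdet ((a1, a2, a3, a4) \<otimes>\<^bsub>M2\<^esub> c) b) = ptrip (a1 \<oplus>\<^bsub>R\<^esub> a4) b c"
proof -
  have a: "a1 \<in> grade R p" "a2 \<in> grade R p" "a3 \<in> grade R p" "a4 \<in> grade R p"
    using A by simp_all
  obtain b1 b2 b3 b4 where B: "b = (b1, b2, b3, b4)" "b1 \<in> grade R q" "b2 \<in> grade R q"
    "b3 \<in> grade R q" "b4 \<in> grade R q"
    using b by (rule M2_grade_cases)
  obtain c1 c2 c3 c4 where C: "c = (c1, c2, c3, c4)" "c1 \<in> grade R r" "c2 \<in> grade R r"
    "c3 \<in> grade R r" "c4 \<in> grade R r"
    using c by (rule M2_grade_cases)
  note cl = a [THEN grade_closed] B(2-) [THEN grade_closed] C(2-) [THEN grade_closed]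
  let ?A = "(a1, a2, a3, a4)"
  have mul: "pdet (?A \<otimes>\<^bsub>M2\<^esub> (x1, x2, x3, x4)) (y1, y2, y3, y4) =
      det2 (act2 ?A (x1, x3)) (y2, y4) \<oplus>\<^bsub>CQ\<^esub> \<ominus>\<^bsub>CQ\<^esub> det2 (act2 ?A (x2, x4)) (y1, y3)"
    for x1 x2 x3 x4 y1 y2 y3 y4
    by (simp add: pdet_def act2_def)
  have e: "det2 (act2 ?A (x, y)) (z, w) \<in> carrier CQ"
    if "x \<in> carrier R" "y \<in> carrier R" "z \<in> carrier R" "w \<in> carrier R" for x y z w
    by (rule det2_closed) (use that cl in \<open>auto simp: act2_def\<close>)
  define k where "k = ksign CQ (q * r)"
  have k: "k x \<in> carrier CQ" "k (x \<oplus>\<^bsub>CQ\<^esub> \<ominus>\<^bsub>CQ\<^esub> y) = k x \<oplus>\<^bsub>CQ\<^esub> \<ominus>\<^bsub>CQ\<^esub> k y"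
    if "x \<in> carrier CQ" "y \<in> carrier CQ" for x y
    using that by (simp_all add: k_def CQ.M.ksign_add CQ.M.ksign_minus)
  have "pdet (?A \<otimes>\<^bsub>M2\<^esub> b) c \<oplus>\<^bsub>CQ\<^esub> k (pdet (?A \<otimes>\<^bsub>M2\<^esub> c) b) =
    (det2 (act2 ?A (b1, b3)) (c2, c4) \<oplus>\<^bsub>CQ\<^esub> \<ominus>\<^bsub>CQ\<^esub> k (det2 (act2 ?A (c2, c4)) (b1, b3))) \<oplus>\<^bsub>CQ\<^esub>
    \<ominus>\<^bsub>CQ\<^esub> (det2 (act2 ?A (b2, b4)) (c1, c3) \<oplus>\<^bsub>CQ\<^esub> \<ominus>\<^bsub>CQ\<^esub> k (det2 (act2 ?A (c1, c3)) (b2, b4)))"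
    unfolding B(1) C(1) mul
    using e [OF cl(5,7,10,12)] e [OF cl(6,8,9,11)] e [OF cl(10,12,5,7)] e [OF cl(9,11,6,8)]
    by (simp add: k CQ.M.minus_add CQ.M.a_ac)
  also have "... = ptrip (a1 \<oplus>\<^bsub>R\<^esub> a4) b c"
    unfolding k_def det2_act2 [OF a B(2) B(4) C(3) C(5)] det2_act2 [OF a B(3) B(5) C(2) C(4)]
    by (simp add: ptrip_def B(1) C(1))
  finally show ?thesis
    by (simp add: k_def)
qed

text \<open>The same form expanded along rows, as needed for right multiplication, which acts on
  rows.\<close>

lemma pdet_rows:
  assumes "b1 \<in> carrier R" "b2 \<in> carrier R" "b3 \<in> carrier R" "b4 \<in> carrier R"
    "c1 \<in> carrier R" "c2 \<in> carrier R" "c3 \<in> carrier R" "c4 \<in> carrier R"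
  shows "pdet (b1, b2, b3, b4) (c1, c2, c3, c4) =
    det2 (b1, b2) (c3, c4) \<oplus>\<^bsub>CQ\<^esub> \<ominus>\<^bsub>CQ\<^esub> det2 (b3, b4) (c1, c2)"
  using assms by (simp add: pdet_def det2_def cp_closed CQ.M.minus_add CQ.M.a_ac)

text \<open>Modulo \<open>[R,R]R\<close> the entries of the right factor can be moved to the front
  at the cost of \<open>(-1)^(pq)\<close>. Right multiplication thereby becomes a left action on
  rows, and \<open>det2_act2\<close> applies again.\<close>

lemma pdet_right:
  assumes A: "(d1, d2, d3, d4) \<in> grade M2 p" and b: "b \<in> grade M2 q" and c: "c \<in> grade M2 r"
  shows "ksign CQ (p * q) (pdet (b \<otimes>\<^bsub>M2\<^esub> (d1, d2, d3, d4)) c) \<oplus>\<^bsub>CQ\<^esub>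
      ksign CQ (q * r) (ksign CQ (p * r) (pdet (c \<otimes>\<^bsub>M2\<^esub> (d1, d2, d3, d4)) b)) =
      ptrip (d1 \<oplus>\<^bsub>R\<^esub> d4) b c"
proof -
  have d: "d1 \<in> grade R p" "d3 \<in> grade R p" "d2 \<in> grade R p" "d4 \<in> grade R p"
    using A by simp_all
  obtain b1 b2 b3 b4 where B: "b = (b1, b2, b3, b4)" "b1 \<in> grade R q" "b2 \<in> grade R q"
    "b3 \<in> grade R q" "b4 \<in> grade R q"
    using b by (rule M2_grade_cases)
  obtain c1 c2 c3 c4 where C: "c = (c1, c2, c3, c4)" "c1 \<in> grade R r" "c2 \<in> grade R r"
    "c3 \<in> grade R r" "c4 \<in> grade R r"
    using c by (rule M2_grade_cases)
  note cl = d [THEN grade_closed] B(2-) [THEN grade_closed] C(2-) [THEN grade_closed]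
  \<comment> \<open>The transpose, since multiplying a row by a matrix on the right lets the
    transpose act on that row.\<close>
  let ?D = "(d1, d3, d2, d4)"
  have sw: "ksign CQ (p * q) (cp ((x \<otimes>\<^bsub>R\<^esub> d \<oplus>\<^bsub>R\<^esub> y \<otimes>\<^bsub>R\<^esub> d') \<otimes>\<^bsub>R\<^esub> z)) =
      cp ((d \<otimes>\<^bsub>R\<^esub> x \<oplus>\<^bsub>R\<^esub> d' \<otimes>\<^bsub>R\<^esub> y) \<otimes>\<^bsub>R\<^esub> z)"
    if "x \<in> grade R q" "y \<in> grade R q" "d \<in> grade R p" "d' \<in> grade R p" "z \<in> carrier R"
    for x y z d d' q
    using cp_swap12 [OF that(3,1,5)] cp_swap12 [OF that(4,2,5)] that
    by (simp add: l_distr grade_closed cp_hom CQ.M.ksign_add cp_closed)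
  have mul: "ksign CQ (p * q) (pdet ((x1, x2, x3, x4) \<otimes>\<^bsub>M2\<^esub> (d1, d2, d3, d4)) (y1, y2, y3, y4)) =
      det2 (act2 ?D (x1, x2)) (y3, y4) \<oplus>\<^bsub>CQ\<^esub> \<ominus>\<^bsub>CQ\<^esub> det2 (act2 ?D (x3, x4)) (y1, y2)"
    if x: "x1 \<in> grade R q" "x2 \<in> grade R q" "x3 \<in> grade R q" "x4 \<in> grade R q"
      and y: "y1 \<in> carrier R" "y2 \<in> carrier R" "y3 \<in> carrier R" "y4 \<in> carrier R"
    for x1 x2 x3 x4 y1 y2 y3 y4 q
  proof -
    note xc = x [THEN grade_closed]
    have "(x1, x2, x3, x4) \<otimes>\<^bsub>M2\<^esub> (d1, d2, d3, d4) = (x1 \<otimes>\<^bsub>R\<^esub> d1 \<oplus>\<^bsub>R\<^esub> x2 \<otimes>\<^bsub>R\<^esub> d3,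
        x1 \<otimes>\<^bsub>R\<^esub> d2 \<oplus>\<^bsub>R\<^esub> x2 \<otimes>\<^bsub>R\<^esub> d4, x3 \<otimes>\<^bsub>R\<^esub> d1 \<oplus>\<^bsub>R\<^esub> x4 \<otimes>\<^bsub>R\<^esub> d3, x3 \<otimes>\<^bsub>R\<^esub> d2 \<oplus>\<^bsub>R\<^esub> x4 \<otimes>\<^bsub>R\<^esub> d4)"
      by simp
    then have "pdet ((x1, x2, x3, x4) \<otimes>\<^bsub>M2\<^esub> (d1, d2, d3, d4)) (y1, y2, y3, y4) =
      det2 (x1 \<otimes>\<^bsub>R\<^esub> d1 \<oplus>\<^bsub>R\<^esub> x2 \<otimes>\<^bsub>R\<^esub> d3, x1 \<otimes>\<^bsub>R\<^esub> d2 \<oplus>\<^bsub>R\<^esub> x2 \<otimes>\<^bsub>R\<^esub> d4) (y3, y4) \<oplus>\<^bsub>CQ\<^esub>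
      \<ominus>\<^bsub>CQ\<^esub> det2 (x3 \<otimes>\<^bsub>R\<^esub> d1 \<oplus>\<^bsub>R\<^esub> x4 \<otimes>\<^bsub>R\<^esub> d3, x3 \<otimes>\<^bsub>R\<^esub> d2 \<oplus>\<^bsub>R\<^esub> x4 \<otimes>\<^bsub>R\<^esub> d4) (y1, y2)"
      using xc y cl by (simp only: pdet_rows M.a_closed m_closed)
    then show ?thesis
      unfolding det2_def act2_def prod.case
      unfolding sw [OF x(1,2) d(1,2) y(4), symmetric] sw [OF x(1,2) d(3,4) y(3), symmetric]
        sw [OF x(3,4) d(1,2) y(2), symmetric] sw [OF x(3,4) d(3,4) y(1), symmetric]
      using xc y cl by (simp add: CQ.M.ksign_add CQ.M.ksign_minus cp_closed)
  qed
  have e: "det2 (act2 ?D (x, y)) (z, w) \<in> carrier CQ"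
    if "x \<in> carrier R" "y \<in> carrier R" "z \<in> carrier R" "w \<in> carrier R" for x y z w
    by (rule det2_closed) (use that cl in \<open>auto simp: act2_def\<close>)
  define k where "k = ksign CQ (q * r)"
  have k: "k x \<in> carrier CQ" "k (x \<oplus>\<^bsub>CQ\<^esub> \<ominus>\<^bsub>CQ\<^esub> y) = k x \<oplus>\<^bsub>CQ\<^esub> \<ominus>\<^bsub>CQ\<^esub> k y"
    if "x \<in> carrier CQ" "y \<in> carrier CQ" for x y
    using that by (simp_all add: k_def CQ.M.ksign_add CQ.M.ksign_minus)
  have "ksign CQ (p * q) (pdet (b \<otimes>\<^bsub>M2\<^esub> (d1, d2, d3, d4)) c) \<oplus>\<^bsub>CQ\<^esub>
      k (ksign CQ (p * r) (pdet (c \<otimes>\<^bsub>M2\<^esub> (d1, d2, d3, d4)) b)) =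
    (det2 (act2 ?D (b1, b2)) (c3, c4) \<oplus>\<^bsub>CQ\<^esub> \<ominus>\<^bsub>CQ\<^esub> k (det2 (act2 ?D (c3, c4)) (b1, b2))) \<oplus>\<^bsub>CQ\<^esub>
    \<ominus>\<^bsub>CQ\<^esub> (det2 (act2 ?D (b3, b4)) (c1, c2) \<oplus>\<^bsub>CQ\<^esub> \<ominus>\<^bsub>CQ\<^esub> k (det2 (act2 ?D (c1, c2)) (b3, b4)))"
    unfolding B(1) C(1) mul [OF B(2-) cl(9-12)] mul [OF C(2-) cl(5-8)]
    using e [OF cl(5,6,11,12)] e [OF cl(7,8,9,10)] e [OF cl(11,12,5,6)] e [OF cl(9,10,7,8)]
    by (simp add: k CQ.M.minus_add CQ.M.a_ac)
  also have "... = ptrip (d1 \<oplus>\<^bsub>R\<^esub> d4) b c"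
    unfolding k_def det2_act2 [OF d B(2) B(3) C(4) C(5)] det2_act2 [OF d B(4) B(5) C(2) C(3)]
    using cl by (simp add: ptrip_def B(1) C(1) cp_closed CQ.M.minus_add CQ.M.a_ac)
  finally show ?thesis
    by (simp add: k_def)
qed

text \<open>The weight enters only modulo \<open>[R,R]R\<close> because this submodule is stable
  under right multiplication. So an equation between classes of traces may be used inside triple
  products.\<close>

lemma ptrip_trace:
  assumes "cp x = ksign CQ p (cp y)" "x \<in> carrier R" "y \<in> carrier R"
    and "b \<in> carrier M2" "c \<in> carrier M2"
  shows "ptrip x b c = ksign CQ p (ptrip y b c)"
proof -
  have "cp x = cp (ksign R p y)"
    using assms by (simp add: cp_hom)
  then obtain z where z: "z \<in> CI" "x = ksign R p y \<oplus>\<^bsub>R\<^esub> z"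
    using CQ.pr_eq_iff assms(2,3) by (metis M.ksign_closed)
  have zc: "z \<in> carrier R"
    using z(1) CQ.sub_closed(1) by blast
  have *: "cp (x \<otimes>\<^bsub>R\<^esub> d) = ksign CQ p (cp (y \<otimes>\<^bsub>R\<^esub> d))" if "d \<in> carrier R" for d
  proof -
    have "x \<otimes>\<^bsub>R\<^esub> d = ksign R p (y \<otimes>\<^bsub>R\<^esub> d) \<oplus>\<^bsub>R\<^esub> z \<otimes>\<^bsub>R\<^esub> d"
      using that zc assms(3) by (simp add: z(2) l_distr prod_ksign_left)
    then have "cp (x \<otimes>\<^bsub>R\<^esub> d) = cp (ksign R p (y \<otimes>\<^bsub>R\<^esub> d))"
      using that zc assms(2,3) comm_ideal_right [OF z(1) that]
      by (intro CQ.pr_eq_iff [THEN iffD2]) auto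
    then show ?thesis
      using that assms(3) by (simp add: cp_hom)
  qed
  show ?thesis
    using assms(4,5,3)
    by (elim M2_cases) (simp add: ptrip_def * CQ.M.ksign_add CQ.M.ksign_minus cp_closed)
qed

text \<open>The part of the Jacobi sum in which the diagonal blocks \<open>A\<close>,
  \<open>D\<close> of one argument act on the blocks \<open>b\<close>, \<open>c\<close> of the other
  two. The terms with \<open>A\<close> add up to a multiple of the trace of \<open>A\<close>, those
  with \<open>D\<close> to a multiple of the trace of \<open>D\<close>, and vanishing supertrace
  makes these equal. Degrees are shifted by 1 because \<open>b\<close> and \<open>c\<close> are
  off-diagonal blocks.\<close>

lemma pdet_invariant:
  assumes A: "A \<in> grade M2 p" and D: "D \<in> grade M2 p"
    and b: "b \<in> grade M2 (q + 1)" and c: "c \<in> grade M2 (r + 1)"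
    and tr: "tau A = ksign CQ p (tau D)"
  shows "ksign CQ (p * r + r) (pdet (A \<otimes>\<^bsub>M2\<^esub> b) c \<oplus>\<^bsub>CQ\<^esub> \<ominus>\<^bsub>CQ\<^esub> ksign CQ (p * q) (pdet (b \<otimes>\<^bsub>M2\<^esub> D) c))
    \<oplus>\<^bsub>CQ\<^esub> ksign CQ (r * q + q) (pdet (c \<otimes>\<^bsub>M2\<^esub> D) b \<oplus>\<^bsub>CQ\<^esub> \<ominus>\<^bsub>CQ\<^esub> ksign CQ (r * p) (pdet (A \<otimes>\<^bsub>M2\<^esub> c) b))
    = \<zero>\<^bsub>CQ\<^esub>"
proof -
  interpret M2: assoc_superalgebra K M2 by (rule M2_assoc)
  obtain a1 a2 a3 a4 where a: "A = (a1, a2, a3, a4)" "a1 \<in> grade R p" "a2 \<in> grade R p"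
    "a3 \<in> grade R p" "a4 \<in> grade R p"
    using A by (rule M2_grade_cases)
  obtain d1 d2 d3 d4 where d: "D = (d1, d2, d3, d4)" "d1 \<in> grade R p" "d2 \<in> grade R p"
    "d3 \<in> grade R p" "d4 \<in> grade R p"
    using D by (rule M2_grade_cases)
  have cl: "A \<in> carrier M2" "D \<in> carrier M2" "b \<in> carrier M2" "c \<in> carrier M2"
    using A D b c M2.grade_closed by blast+
  have cl': "a1 \<oplus>\<^bsub>R\<^esub> a4 \<in> carrier R" "d1 \<oplus>\<^bsub>R\<^esub> d4 \<in> carrier R"
    using a d grade_closed by blast+
  have L: "pdet (A \<otimes>\<^bsub>M2\<^esub> b) c \<oplus>\<^bsub>CQ\<^esub> ksign CQ ((q + 1) * (r + 1)) (pdet (A \<otimes>\<^bsub>M2\<^esub> c) b) =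
      ptrip (a1 \<oplus>\<^bsub>R\<^esub> a4) b c"
    using pdet_left [OF A [unfolded a(1)] b c] by (simp only: a(1))
  have R': "ksign CQ (p * (q + 1)) (pdet (b \<otimes>\<^bsub>M2\<^esub> D) c) \<oplus>\<^bsub>CQ\<^esub>
      ksign CQ ((q + 1) * (r + 1)) (ksign CQ (p * (r + 1)) (pdet (c \<otimes>\<^bsub>M2\<^esub> D) b)) =
      ptrip (d1 \<oplus>\<^bsub>R\<^esub> d4) b c"
    using pdet_right [OF D [unfolded d(1)] b c] by (simp only: d(1))
  have T: "ptrip (a1 \<oplus>\<^bsub>R\<^esub> a4) b c = ksign CQ p (ptrip (d1 \<oplus>\<^bsub>R\<^esub> d4) b c)"
    using tr a d grade_closed cl cl' by (intro ptrip_trace) (auto simp: tau_def)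
  define W1 W2 W3 W4 where "W1 = pdet (A \<otimes>\<^bsub>M2\<^esub> b) c" and "W2 = pdet (A \<otimes>\<^bsub>M2\<^esub> c) b"
    and "W3 = pdet (b \<otimes>\<^bsub>M2\<^esub> D) c" and "W4 = pdet (c \<otimes>\<^bsub>M2\<^esub> D) b"
  have W: "W1 \<in> carrier CQ" "W2 \<in> carrier CQ" "W3 \<in> carrier CQ" "W4 \<in> carrier CQ"
    unfolding W1_def W2_def W3_def W4_def by (intro pdet_closed M2.m_closed cl)+
  have H: "ptrip (d1 \<oplus>\<^bsub>R\<^esub> d4) b c \<in> carrier CQ"
    by (intro ptrip_closed cl cl')
  \<comment> \<open>Sorts the four terms into the left sides of \<open>L\<close> and
    \<open>R'\<close>. The trace condition \<open>T\<close> then makes the two groups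
    cancel.\<close>
  have "ksign CQ (p * r + r) (W1 \<oplus>\<^bsub>CQ\<^esub> \<ominus>\<^bsub>CQ\<^esub> ksign CQ (p * q) W3)
    \<oplus>\<^bsub>CQ\<^esub> ksign CQ (r * q + q) (W4 \<oplus>\<^bsub>CQ\<^esub> \<ominus>\<^bsub>CQ\<^esub> ksign CQ (r * p) W2) =
    ksign CQ (p * r + r) ((W1 \<oplus>\<^bsub>CQ\<^esub> ksign CQ ((q + 1) * (r + 1)) W2) \<oplus>\<^bsub>CQ\<^esub>
      \<ominus>\<^bsub>CQ\<^esub> ksign CQ p (ksign CQ (p * (q + 1)) W3 \<oplus>\<^bsub>CQ\<^esub>
      ksign CQ ((q + 1) * (r + 1)) (ksign CQ (p * (r + 1)) W4)))"
    using W by (cases p; cases q; cases r) (simp_all add: CQ.M.minus_add CQ.M.a_ac)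
  also have "... = \<zero>\<^bsub>CQ\<^esub>"
    unfolding W1_def W2_def W3_def W4_def L R' T using H by (simp add: CQ.M.r_neg)
  finally show ?thesis
    unfolding W1_def W2_def W3_def W4_def .
qed

lemma det2_add:
  assumes "u1 \<in> carrier R" "u2 \<in> carrier R" "v1 \<in> carrier R" "v2 \<in> carrier R"
    "w1 \<in> carrier R" "w2 \<in> carrier R"
  shows "det2 (u1 \<oplus>\<^bsub>R\<^esub> v1, u2 \<oplus>\<^bsub>R\<^esub> v2) (w1, w2) = det2 (u1, u2) (w1, w2) \<oplus>\<^bsub>CQ\<^esub> det2 (v1, v2) (w1, w2)"
    "det2 (w1, w2) (u1 \<oplus>\<^bsub>R\<^esub> v1, u2 \<oplus>\<^bsub>R\<^esub> v2) = det2 (w1, w2) (u1, u2) \<oplus>\<^bsub>CQ\<^esub> det2 (w1, w2) (v1, v2)"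
  using assms
  by (simp_all add: det2_def l_distr r_distr cp_hom cp_closed CQ.M.minus_add CQ.M.a_ac)

lemma det2_smult:
  assumes "u1 \<in> carrier R" "u2 \<in> carrier R" "w1 \<in> carrier R" "w2 \<in> carrier R" "k \<in> carrier K"
  shows "det2 (k \<odot>\<^bsub>R\<^esub> u1, k \<odot>\<^bsub>R\<^esub> u2) (w1, w2) = k \<odot>\<^bsub>CQ\<^esub> det2 (u1, u2) (w1, w2)"
    "det2 (w1, w2) (k \<odot>\<^bsub>R\<^esub> u1, k \<odot>\<^bsub>R\<^esub> u2) = k \<odot>\<^bsub>CQ\<^esub> det2 (w1, w2) (u1, u2)"
  using assms
  by (simp_all add: det2_def cp_closed prod_smult_left prod_smult_right CQ.smult_r_distr
      CQ.smult_r_minus CQ.pr_smult)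

lemma pdet_bilinear:
  assumes "b \<in> carrier M2" "c \<in> carrier M2" "d \<in> carrier M2"
  shows "pdet (b \<oplus>\<^bsub>M2\<^esub> c) d = pdet b d \<oplus>\<^bsub>CQ\<^esub> pdet c d"
    "pdet d (b \<oplus>\<^bsub>M2\<^esub> c) = pdet d b \<oplus>\<^bsub>CQ\<^esub> pdet d c"
proof -
  obtain b1 b2 b3 b4 where B: "b = (b1, b2, b3, b4)" "b1 \<in> carrier R" "b2 \<in> carrier R"
    "b3 \<in> carrier R" "b4 \<in> carrier R"
    using assms(1) by (rule M2_cases)
  obtain c1 c2 c3 c4 where C: "c = (c1, c2, c3, c4)" "c1 \<in> carrier R" "c2 \<in> carrier R"
    "c3 \<in> carrier R" "c4 \<in> carrier R"
    using assms(2) by (rule M2_cases)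
  obtain d1 d2 d3 d4 where D: "d = (d1, d2, d3, d4)" "d1 \<in> carrier R" "d2 \<in> carrier R"
    "d3 \<in> carrier R" "d4 \<in> carrier R"
    using assms(3) by (rule M2_cases)
  have e: "det2 (x, y) (z, w) \<in> carrier CQ"
    if "x \<in> carrier R" "y \<in> carrier R" "z \<in> carrier R" "w \<in> carrier R" for x y z w
    using that by (simp add: det2_closed)
  show "pdet (b \<oplus>\<^bsub>M2\<^esub> c) d = pdet b d \<oplus>\<^bsub>CQ\<^esub> pdet c d"
    "pdet d (b \<oplus>\<^bsub>M2\<^esub> c) = pdet d b \<oplus>\<^bsub>CQ\<^esub> pdet d c"
    using B(2-) C(2-) D(2-) unfolding B(1) C(1) D(1) mat2_simps(5) pdet_def prod.case
    by (simp_all only: det2_add) (simp_all add: e CQ.M.minus_add CQ.M.a_ac)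
qed

lemma pdet_smult:
  assumes "k \<in> carrier K" "b \<in> carrier M2" "d \<in> carrier M2"
  shows "pdet (k \<odot>\<^bsub>M2\<^esub> b) d = k \<odot>\<^bsub>CQ\<^esub> pdet b d" "pdet d (k \<odot>\<^bsub>M2\<^esub> b) = k \<odot>\<^bsub>CQ\<^esub> pdet d b"
proof -
  obtain b1 b2 b3 b4 where B: "b = (b1, b2, b3, b4)" "b1 \<in> carrier R" "b2 \<in> carrier R"
    "b3 \<in> carrier R" "b4 \<in> carrier R"
    using assms(2) by (rule M2_cases)
  obtain d1 d2 d3 d4 where D: "d = (d1, d2, d3, d4)" "d1 \<in> carrier R" "d2 \<in> carrier R"
    "d3 \<in> carrier R" "d4 \<in> carrier R"
    using assms(3) by (rule M2_cases)
  show "pdet (k \<odot>\<^bsub>M2\<^esub> b) d = k \<odot>\<^bsub>CQ\<^esub> pdet b d" "pdet d (k \<odot>\<^bsub>M2\<^esub> b) = k \<odot>\<^bsub>CQ\<^esub> pdet d b"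
    using B(2-) D(2-) assms(1) unfolding B(1) D(1) mat2_simps(6) pdet_def prod.case
    by (simp_all add: det2_smult det2_closed CQ.smult_r_distr CQ.smult_r_minus)
qed

lemma pdet_ksign:
  assumes "b \<in> carrier M2" "d \<in> carrier M2"
  shows "pdet (ksign M2 p b) d = ksign CQ p (pdet b d)" "pdet d (ksign M2 p b) = ksign CQ p (pdet d b)"
proof -
  interpret M2: assoc_superalgebra K M2 by (rule M2_assoc)
  have "ksign M2 p b = (if p = 1 then (\<ominus>\<^bsub>K\<^esub> \<one>\<^bsub>K\<^esub>) \<odot>\<^bsub>M2\<^esub> b else b)"
    using assms by (simp add: ksign_def M2.smult_l_minus del: mat2_simps)
  moreover have "ksign CQ p x = (if p = 1 then (\<ominus>\<^bsub>K\<^esub> \<one>\<^bsub>K\<^esub>) \<odot>\<^bsub>CQ\<^esub> x else x)" if "x \<in> carrier CQ" for x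
    using that by (simp add: ksign_def CQ.smult_l_minus)
  ultimately show "pdet (ksign M2 p b) d = ksign CQ p (pdet b d)"
    "pdet d (ksign M2 p b) = ksign CQ p (pdet d b)"
    using pdet_smult [of "\<ominus>\<^bsub>K\<^esub> \<one>\<^bsub>K\<^esub>" b d] assms pdet_closed by (simp_all del: mat2_simps)
qed

lemma pdet_minus:
  assumes "b \<in> carrier M2" "d \<in> carrier M2"
  shows "pdet (\<ominus>\<^bsub>M2\<^esub> b) d = \<ominus>\<^bsub>CQ\<^esub> pdet b d"
  using pdet_ksign(1) [OF assms, of 1] by (simp only: ksign_1)

lemma pdet_swap:
  assumes "b \<in> grade M2 q" "c \<in> grade M2 r"
  shows "pdet c b = ksign CQ (q * r) (pdet b c)"
proof -
  obtain b1 b2 b3 b4 where B: "b = (b1, b2, b3, b4)" "b1 \<in> grade R q" "b2 \<in> grade R q"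
    "b3 \<in> grade R q" "b4 \<in> grade R q"
    using assms(1) by (rule M2_grade_cases)
  obtain c1 c2 c3 c4 where C: "c = (c1, c2, c3, c4)" "c1 \<in> grade R r" "c2 \<in> grade R r"
    "c3 \<in> grade R r" "c4 \<in> grade R r"
    using assms(2) by (rule M2_grade_cases)
  note cl = B(2-) [THEN grade_closed] C(2-) [THEN grade_closed]
  have sw: "cp (y \<otimes>\<^bsub>R\<^esub> x) = ksign CQ (q * r) (cp (x \<otimes>\<^bsub>R\<^esub> y))"
    if "x \<in> grade R q" "y \<in> grade R r" for x y
    using cp_comm [OF that(2,1)] by (simp add: mult.commute)
  show ?thesis
    unfolding B(1) C(1) pdet_def det2_def prod.case
    unfolding sw [OF B(5) C(2)] sw [OF B(3) C(4)] sw [OF B(4) C(3)] sw [OF B(2) C(5)]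
    using cl by (simp add: CQ.M.ksign_add CQ.M.ksign_minus cp_closed CQ.M.minus_add CQ.M.a_ac)
qed

lemma pdet_grade:
  assumes "b \<in> grade M2 q" "c \<in> grade M2 r"
  shows "pdet b c \<in> grade CQ (q + r)"
proof -
  have "det2 (u1, u2) (v1, v2) \<in> grade CQ (q + r)"
    if "u1 \<in> grade R q" "u2 \<in> grade R q" "v1 \<in> grade R r" "v2 \<in> grade R r" for u1 u2 v1 v2
    unfolding det2_def prod.case
    by (intro CQ.grade_add CQ.grade_minus CQ.pr_grade prod_grade that)
  then show ?thesis
    using assms by (elim M2_grade_cases) (simp add: pdet_def CQ.grade_add CQ.grade_minus)
qed

lemma pdet_zero:
  assumes "b \<in> carrier M2"
  shows "pdet zm b = \<zero>\<^bsub>CQ\<^esub>" "pdet b zm = \<zero>\<^bsub>CQ\<^esub>"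
  using pdet_smult [of "\<zero>\<^bsub>K\<^esub>" zm b] pdet_closed assms by simp_all

text \<open>On the upper right block of an element of degree \<open>q\<close>, whose entries have
  degree \<open>q + 1\<close>, this is multiplication by \<open>(-1)^q\<close>. The twist turns the
  symmetry of \<open>pdet\<close> with respect to shifted degrees into the skew symmetry demanded of
  a cocycle.\<close>

definition msgn :: "'a \<times> 'a \<times> 'a \<times> 'a \<Rightarrow> 'a \<times> 'a \<times> 'a \<times> 'a" where
  "msgn = (\<lambda>(b1, b2, b3, b4).
     (\<ominus>\<^bsub>R\<^esub> sgn_part b1, \<ominus>\<^bsub>R\<^esub> sgn_part b2, \<ominus>\<^bsub>R\<^esub> sgn_part b3, \<ominus>\<^bsub>R\<^esub> sgn_part b4))"

lemma msgn_closed: "b \<in> carrier M2 \<Longrightarrow> msgn b \<in> carrier M2"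
  by (elim M2_cases) (simp add: msgn_def)

lemma msgn_homogeneous:
  assumes "b \<in> grade M2 (q + 1)"
  shows "msgn b = ksign M2 q b"
proof -
  have "\<ominus>\<^bsub>R\<^esub> sgn_part x = ksign R q x" if "x \<in> grade R (q + 1)" for x
    using sgn_part_homogeneous [OF that] grade_closed [OF that] by (cases q) simp_all
  then show ?thesis
    using assms by (elim M2_grade_cases) (simp add: msgn_def mat2_ksign grade_closed)
qed

definition upper :: "('k, 'a sto_gen) lie_term set \<Rightarrow> 'a \<times> 'a \<times> 'a \<times> 'a" where
  "upper X = fst (snd (Phi X))"

definition beta_mat :: "('k, 'a sto_gen) lie_term set \<Rightarrow> ('k, 'a sto_gen) lie_term set \<Rightarrow> 'a set" where
  "beta_mat X Y = pdet (upper X) (msgn (upper Y))"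

lemma upper_closed: "X \<in> carrier st \<Longrightarrow> upper X \<in> carrier M2"
  using Phi_closed [of X] unfolding commutator_algebra_simps mat2_simps(1) [of 1 M2] upper_def
  by (auto simp del: mat2_simps)

lemma upper_grade: "X \<in> grade st p \<Longrightarrow> upper X \<in> grade M2 (p + 1)"
  using Phi_grade [of X p] unfolding commutator_algebra_simps mat2_simps(7) [of 1 M2] upper_def
  by (auto simp del: mat2_simps)

lemma upper_add:
  assumes "X \<in> carrier st" "Y \<in> carrier st"
  shows "upper (X \<oplus>\<^bsub>st\<^esub> Y) = upper X \<oplus>\<^bsub>M2\<^esub> upper Y"
  unfolding upper_def Phi_hom(1) [OF assms]
  by (cases "Phi X"; cases "Phi Y") (simp del: mat2_simps add: mat2_simps(5) [of 1 M2])

lemma upper_smult: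
  assumes "c \<in> carrier K" "X \<in> carrier st"
  shows "upper (c \<odot>\<^bsub>st\<^esub> X) = c \<odot>\<^bsub>M2\<^esub> upper X"
  unfolding upper_def Phi_hom(3) [OF assms(2,2,1)]
  by (cases "Phi X") (simp del: mat2_simps add: mat2_simps(6) [of 1 M2])

lemma beta_mat_homogeneous:
  assumes "X \<in> carrier st" "Y \<in> grade st q"
  shows "beta_mat X Y = ksign CQ q (pdet (upper X) (upper Y))"
proof -
  interpret M2: assoc_superalgebra K M2 by (rule M2_assoc)
  have "upper Y \<in> carrier M2"
    using upper_grade [OF assms(2)] M2.grade_closed by blast
  then show ?thesis
    using upper_closed [OF assms(1)]
    by (simp add: beta_mat_def msgn_homogeneous [OF upper_grade [OF assms(2)]] pdet_ksign
        del: mat2_simps)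
qed

lemma msgn_linear:
  assumes "b \<in> carrier M2" "c \<in> carrier M2" "k \<in> carrier K"
  shows "msgn (b \<oplus>\<^bsub>M2\<^esub> c) = msgn b \<oplus>\<^bsub>M2\<^esub> msgn c" "msgn (k \<odot>\<^bsub>M2\<^esub> b) = k \<odot>\<^bsub>M2\<^esub> msgn b"
  using assms
  by (elim M2_cases; simp add: msgn_def sgn_part_add sgn_part_smult M.minus_add smult_r_minus)+

text \<open>Each of the three brackets contributes four terms to the form. Sorted by the matrix
  whose diagonal blocks occur in them, the twelve terms fall into three groups, each of which
  vanishes by \<open>pdet_invariant\<close>.\<close>

lemma beta_mat_jacobi:
  assumes X: "X \<in> grade st p" and Y: "Y \<in> grade st q" and Z: "Z \<in> grade st r"
  shows "ksign CQ (p * r) (beta_mat (X \<otimes>\<^bsub>st\<^esub> Y) Z) \<oplus>\<^bsub>CQ\<^esub> ksign CQ (q * p) (beta_mat (Y \<otimes>\<^bsub>st\<^esub> Z) X)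
    \<oplus>\<^bsub>CQ\<^esub> ksign CQ (r * q) (beta_mat (Z \<otimes>\<^bsub>st\<^esub> X) Y) = \<zero>\<^bsub>CQ\<^esub>"
proof -
  interpret M2: assoc_superalgebra K M2 by (rule M2_assoc)
  interpret L: pre_lie_superalgebra K st by (rule sto.P_pre_lie)
  obtain A B C D where x: "Phi X = (A, B, C, D)" "A \<in> grade M2 p" "B \<in> grade M2 (p + 1)"
    "C \<in> grade M2 (p + 1)" "D \<in> grade M2 p"
    using Phi_grade [OF X] by (rule GL_blocks)
  obtain A' B' C' D' where y: "Phi Y = (A', B', C', D')" "A' \<in> grade M2 q"
    "B' \<in> grade M2 (q + 1)" "C' \<in> grade M2 (q + 1)" "D' \<in> grade M2 q"
    using Phi_grade [OF Y] by (rule GL_blocks)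
  obtain A2 B2 C2 D2 where z: "Phi Z = (A2, B2, C2, D2)" "A2 \<in> grade M2 r"
    "B2 \<in> grade M2 (r + 1)" "C2 \<in> grade M2 (r + 1)" "D2 \<in> grade M2 r"
    using Phi_grade [OF Z] by (rule GL_blocks)
  note cl = x(2-) [THEN M2.grade_closed] y(2-) [THEN M2.grade_closed]
    z(2-) [THEN M2.grade_closed]
  note stc = X [THEN L.grade_closed'] Y [THEN L.grade_closed'] Z [THEN L.grade_closed']
  have up: "upper X = B" "upper Y = B'" "upper Z = B2"
    by (simp_all add: upper_def x(1) y(1) z(1))
  have br: "beta_mat (U \<otimes>\<^bsub>st\<^esub> V) W = ksign CQ w
      (pdet (Au \<otimes>\<^bsub>M2\<^esub> Bv) Bw \<oplus>\<^bsub>CQ\<^esub> pdet (Bu \<otimes>\<^bsub>M2\<^esub> Dv) Bw \<oplus>\<^bsub>CQ\<^esub>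
       \<ominus>\<^bsub>CQ\<^esub> ksign CQ (u * v) (pdet (Av \<otimes>\<^bsub>M2\<^esub> Bu) Bw \<oplus>\<^bsub>CQ\<^esub> pdet (Bv \<otimes>\<^bsub>M2\<^esub> Du) Bw))"
    if U: "U \<in> grade st u" "Phi U = (Au, Bu, Cu, Du)" and V: "V \<in> grade st v"
      "Phi V = (Av, Bv, Cv, Dv)" and W: "W \<in> grade st w" "Phi W = (Aw, Bw, Cw, Dw)"
      and c: "Au \<in> carrier M2" "Bu \<in> carrier M2" "Du \<in> carrier M2" "Av \<in> carrier M2"
        "Bv \<in> carrier M2" "Dv \<in> carrier M2" "Bw \<in> carrier M2"
    for U V W u v w Au Bu Cu Du Av Bv Cv Dv Aw Bw Cw Dw
  proof -
    note uv = U(1) [THEN L.grade_closed'] V(1) [THEN L.grade_closed']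
    have "upper (U \<otimes>\<^bsub>st\<^esub> V) = Au \<otimes>\<^bsub>M2\<^esub> Bv \<oplus>\<^bsub>M2\<^esub> Bu \<otimes>\<^bsub>M2\<^esub> Dv \<oplus>\<^bsub>M2\<^esub>
        \<ominus>\<^bsub>M2\<^esub> ksign M2 (u * v) (Av \<otimes>\<^bsub>M2\<^esub> Bu \<oplus>\<^bsub>M2\<^esub> Bv \<otimes>\<^bsub>M2\<^esub> Du)"
      unfolding upper_def Phi_hom(2) [OF uv] U(2) V(2)
        GL_block_bracket [OF Phi_grade [OF U(1), unfolded U(2)] Phi_grade [OF V(1), unfolded V(2)]]
      by (simp del: mat2_simps)
    then show ?thesis
      unfolding beta_mat_homogeneous [OF L.pre_closed [OF uv] W(1)]
      using c by (simp only: upper_def W(2) fst_conv snd_conv pdet_bilinear pdet_ksign pdet_minus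
          M2.a_closed M2.m_closed M2.M.ksign_closed M2.a_inv_closed)
  qed
  note S0 = br [OF X x(1) Y y(1) Z z(1) cl(1,2,4,5,6,8,10)]
    br [OF Y y(1) Z z(1) X x(1) cl(5,6,8,9,10,12,2)]
    br [OF Z z(1) X x(1) Y y(1) cl(9,10,12,1,2,4,6)]
  note tr = str0_Phi [OF X] str0_Phi [OF Y] str0_Phi [OF Z]
  have tr: "tau A = ksign CQ p (tau D)" "tau A' = ksign CQ q (tau D')"
    "tau A2 = ksign CQ r (tau D2)"
    using tr by (simp_all add: x(1) y(1) z(1) str0_def)
  note I1 = pdet_invariant [OF x(2,5) y(3) z(3) tr(1)]
  note I2 = pdet_invariant [OF y(2,5) z(3) x(3) tr(2)]
  note I3 = pdet_invariant [OF z(2,5) x(3) y(3) tr(3)]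
  \<comment> \<open>The letters \<open>W\<close>, \<open>V\<close>, \<open>U\<close> collect the
    terms with diagonal blocks of \<open>Phi X\<close>, \<open>Phi Y\<close>, \<open>Phi Z\<close>
    respectively.\<close>
  define W1 W2 W3 W4 where W: "W1 = pdet (A \<otimes>\<^bsub>M2\<^esub> B') B2" "W2 = pdet (A \<otimes>\<^bsub>M2\<^esub> B2) B'"
    "W3 = pdet (B' \<otimes>\<^bsub>M2\<^esub> D) B2" "W4 = pdet (B2 \<otimes>\<^bsub>M2\<^esub> D) B'"
  define V1 V2 V3 V4 where V: "V1 = pdet (A' \<otimes>\<^bsub>M2\<^esub> B2) B" "V2 = pdet (A' \<otimes>\<^bsub>M2\<^esub> B) B2"
    "V3 = pdet (B2 \<otimes>\<^bsub>M2\<^esub> D') B" "V4 = pdet (B \<otimes>\<^bsub>M2\<^esub> D') B2"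
  define U1 U2 U3 U4 where U: "U1 = pdet (A2 \<otimes>\<^bsub>M2\<^esub> B) B'" "U2 = pdet (A2 \<otimes>\<^bsub>M2\<^esub> B') B"
    "U3 = pdet (B \<otimes>\<^bsub>M2\<^esub> D2) B'" "U4 = pdet (B' \<otimes>\<^bsub>M2\<^esub> D2) B"
  have WVU: "W1 \<in> carrier CQ" "W2 \<in> carrier CQ" "W3 \<in> carrier CQ" "W4 \<in> carrier CQ"
    "V1 \<in> carrier CQ" "V2 \<in> carrier CQ" "V3 \<in> carrier CQ" "V4 \<in> carrier CQ"
    "U1 \<in> carrier CQ" "U2 \<in> carrier CQ" "U3 \<in> carrier CQ" "U4 \<in> carrier CQ"
    unfolding W V U by (intro pdet_closed M2.m_closed cl)+
  \<comment> \<open>Regrouping by letters; only the signs have to be compared, over the eight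
    choices of degrees.\<close>
  have sum: "ksign CQ (p * r) (ksign CQ r (W1 \<oplus>\<^bsub>CQ\<^esub> V4 \<oplus>\<^bsub>CQ\<^esub> \<ominus>\<^bsub>CQ\<^esub> ksign CQ (p * q) (V2 \<oplus>\<^bsub>CQ\<^esub> W3))) \<oplus>\<^bsub>CQ\<^esub>
    ksign CQ (q * p) (ksign CQ p (V1 \<oplus>\<^bsub>CQ\<^esub> U4 \<oplus>\<^bsub>CQ\<^esub> \<ominus>\<^bsub>CQ\<^esub> ksign CQ (q * r) (U2 \<oplus>\<^bsub>CQ\<^esub> V3))) \<oplus>\<^bsub>CQ\<^esub>
    ksign CQ (r * q) (ksign CQ q (U1 \<oplus>\<^bsub>CQ\<^esub> W4 \<oplus>\<^bsub>CQ\<^esub> \<ominus>\<^bsub>CQ\<^esub> ksign CQ (r * p) (W2 \<oplus>\<^bsub>CQ\<^esub> U3))) =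
    (ksign CQ (p * r + r) (W1 \<oplus>\<^bsub>CQ\<^esub> \<ominus>\<^bsub>CQ\<^esub> ksign CQ (p * q) W3)
      \<oplus>\<^bsub>CQ\<^esub> ksign CQ (r * q + q) (W4 \<oplus>\<^bsub>CQ\<^esub> \<ominus>\<^bsub>CQ\<^esub> ksign CQ (r * p) W2)) \<oplus>\<^bsub>CQ\<^esub>
    (ksign CQ (q * p + p) (V1 \<oplus>\<^bsub>CQ\<^esub> \<ominus>\<^bsub>CQ\<^esub> ksign CQ (q * r) V3)
      \<oplus>\<^bsub>CQ\<^esub> ksign CQ (p * r + r) (V4 \<oplus>\<^bsub>CQ\<^esub> \<ominus>\<^bsub>CQ\<^esub> ksign CQ (p * q) V2)) \<oplus>\<^bsub>CQ\<^esub>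
    (ksign CQ (r * q + q) (U1 \<oplus>\<^bsub>CQ\<^esub> \<ominus>\<^bsub>CQ\<^esub> ksign CQ (r * p) U3)
      \<oplus>\<^bsub>CQ\<^esub> ksign CQ (q * p + p) (U4 \<oplus>\<^bsub>CQ\<^esub> \<ominus>\<^bsub>CQ\<^esub> ksign CQ (q * r) U2))"
    using WVU by (cases p; cases q; cases r) (simp_all add: CQ.M.minus_add CQ.M.a_ac)
  show ?thesis
    unfolding S0 unfolding W [symmetric] V [symmetric] U [symmetric] unfolding sum
    unfolding W V U I1 I2 I3 by simp
qed

lemma beta_mat_cocycle: "super_2cocycle K st CQ beta_mat"
proof -
  interpret M2: assoc_superalgebra K M2 by (rule M2_assoc)
  interpret L: pre_lie_superalgebra K st by (rule sto.P_pre_lie)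
  note uc = upper_closed msgn_closed
  show ?thesis
    unfolding super_2cocycle_def
  proof (intro conjI ballI allI)
    fix X Y Z p q r c
    {
      assume XY: "X \<in> carrier st" "Y \<in> carrier st"
      show "beta_mat X Y \<in> carrier CQ"
        unfolding beta_mat_def by (intro pdet_closed uc XY)
      {
        assume Z: "Z \<in> carrier st"
        show "beta_mat (X \<oplus>\<^bsub>st\<^esub> Y) Z = beta_mat X Z \<oplus>\<^bsub>CQ\<^esub> beta_mat Y Z"
          "beta_mat Z (X \<oplus>\<^bsub>st\<^esub> Y) = beta_mat Z X \<oplus>\<^bsub>CQ\<^esub> beta_mat Z Y"
          unfolding beta_mat_def upper_add [OF XY]
            msgn_linear(1) [OF upper_closed [OF XY(1)] upper_closed [OF XY(2)] R.one_closed]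
          by (intro pdet_bilinear uc XY Z)+
      }
      {
        assume c: "c \<in> carrier K"
        show "beta_mat (c \<odot>\<^bsub>st\<^esub> X) Y = c \<odot>\<^bsub>CQ\<^esub> beta_mat X Y"
          "beta_mat X (c \<odot>\<^bsub>st\<^esub> Y) = c \<odot>\<^bsub>CQ\<^esub> beta_mat X Y"
          unfolding beta_mat_def upper_smult [OF c XY(1)] upper_smult [OF c XY(2)]
            msgn_linear(2) [OF upper_closed [OF XY(2)] upper_closed [OF XY(2)] c]
          by (intro pdet_smult uc XY c)+
      }
    }
    assume X: "X \<in> grade st p" and Y: "Y \<in> grade st q"
    note cl = X [THEN L.grade_closed'] Y [THEN L.grade_closed']
    have "pdet (upper X) (upper Y) \<in> grade CQ ((p + 1) + (q + 1))"
      by (intro pdet_grade upper_grade X Y)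
    moreover have "(p + 1) + (q + 1) = p + q"
      by (simp add: ac_simps)
    ultimately show "beta_mat X Y \<in> grade CQ (p + q)"
      unfolding beta_mat_homogeneous [OF cl(1) Y] by (simp add: CQ.grade_ksign)
    have pc: "pdet (upper X) (upper Y) \<in> carrier CQ"
      by (intro pdet_closed uc cl)
    show "beta_mat X Y = \<ominus>\<^bsub>CQ\<^esub> (ksign CQ (p * q) (beta_mat Y X))"
      unfolding beta_mat_homogeneous [OF cl(1) Y] beta_mat_homogeneous [OF cl(2) X]
        pdet_swap [OF upper_grade [OF X] upper_grade [OF Y]]
      using pc by (cases p; cases q) simp_all
    assume Z: "Z \<in> grade st r"
    show "ksign CQ (p * r) (beta_mat (X \<otimes>\<^bsub>st\<^esub> Y) Z) \<oplus>\<^bsub>CQ\<^esub> ksign CQ (q * p) (beta_mat (Y \<otimes>\<^bsub>st\<^esub> Z) X)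
        \<oplus>\<^bsub>CQ\<^esub> ksign CQ (r * q) (beta_mat (Z \<otimes>\<^bsub>st\<^esub> X) Y) = \<zero>\<^bsub>CQ\<^esub>"
      by (rule beta_mat_jacobi [OF X Y Z])
  qed
qed

lemma upper_gens:
  assumes "a \<in> homogeneous R"
  shows "i \<noteq> j \<Longrightarrow> upper (ct i j a) = zm"
    "upper (cf i a) = (if i = I1 then (a, \<zero>\<^bsub>R\<^esub>, \<zero>\<^bsub>R\<^esub>, \<zero>\<^bsub>R\<^esub>) else (\<zero>\<^bsub>R\<^esub>, \<zero>\<^bsub>R\<^esub>, a, \<zero>\<^bsub>R\<^esub>))"
    "upper (cg i a) = (if i = I1 then (\<zero>\<^bsub>R\<^esub>, \<ominus>\<^bsub>R\<^esub> sgn_part (bar a), \<zero>\<^bsub>R\<^esub>, \<zero>\<^bsub>R\<^esub>)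
       else (\<zero>\<^bsub>R\<^esub>, \<zero>\<^bsub>R\<^esub>, \<zero>\<^bsub>R\<^esub>, \<ominus>\<^bsub>R\<^esub> sgn_part (bar a)))"
  using assms by (simp_all add: upper_def Phi_gens mt_def mf_def mg_def)

lemma gen_class_closed:
  "\<lbrakk>i \<noteq> j; a \<in> homogeneous R\<rbrakk> \<Longrightarrow> ct i j a \<in> carrier st"
  "a \<in> homogeneous R \<Longrightarrow> cf i a \<in> carrier st"
  "a \<in> homogeneous R \<Longrightarrow> cg i a \<in> carrier st"
proof -
  interpret L: pre_lie_superalgebra K st by (rule sto.P_pre_lie)
  show "\<lbrakk>i \<noteq> j; a \<in> homogeneous R\<rbrakk> \<Longrightarrow> ct i j a \<in> carrier st"
    "a \<in> homogeneous R \<Longrightarrow> cf i a \<in> carrier st"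
    "a \<in> homogeneous R \<Longrightarrow> cg i a \<in> carrier st"
    using gen_class_grade L.grade_closed' unfolding homogeneous_def by blast+
qed

text \<open>Products of matrices with vanishing diagonal blocks are block diagonal. This is why
  brackets of the generators \<open>f\<close> and \<open>g\<close> are invisible to the
  cocycle.\<close>

lemma upper_odd_bracket:
  assumes X: "X \<in> grade st p" "Phi X = (zm, B, C, zm)" and Y: "Y \<in> grade st q" "Phi Y = (zm, B', C', zm)"
  shows "upper (X \<otimes>\<^bsub>st\<^esub> Y) = zm"
proof -
  interpret M2: assoc_superalgebra K M2 by (rule M2_assoc)
  interpret L: pre_lie_superalgebra K st by (rule sto.P_pre_lie)
  note XY = X(1) [THEN L.grade_closed'] Y(1) [THEN L.grade_closed']
  have cl: "B \<in> carrier M2" "B' \<in> carrier M2"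
    using upper_closed [OF XY(1)] upper_closed [OF XY(2)] by (simp_all add: upper_def X Y)
  have z: "zm = \<zero>\<^bsub>M2\<^esub>"
    by simp
  show ?thesis
    unfolding upper_def Phi_hom(2) [OF XY] X(2) Y(2)
      GL_block_bracket [OF Phi_grade [OF X(1), unfolded X(2)] Phi_grade [OF Y(1), unfolded Y(2)]]
      fst_conv snd_conv
    unfolding z using cl by (simp del: mat2_simps add: M2.M.minus_zero')
qed

text \<open>The matrix of \<open>t_12(a)\<close> is block diagonal, and all other members of
  \<open>sto_B0\<close> are, up to sign, brackets of two generators \<open>f\<close> or
  \<open>g\<close>.\<close>

lemma sto_B0_props:
  assumes "x \<in> sto_B0 K R bar"
  shows "x \<in> carrier st \<and> upper x = zm"
proof -
  interpret L: pre_lie_superalgebra K st by (rule sto.P_pre_lie)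
  interpret M2: assoc_superalgebra K M2 by (rule M2_assoc)
  note one = homI [OF one_grade]
  have f: "\<exists>B C. Phi (cf i a) = (zm, B, C, zm)" "\<exists>B C. Phi (cg i a) = (zm, B, C, zm)"
    if "a \<in> homogeneous R" for i a
    using that by (simp_all add: Phi_gens mf_def mg_def)
  have ff: "upper (cf i a \<otimes>\<^bsub>st\<^esub> cf j b) = zm" "upper (cf i a \<otimes>\<^bsub>st\<^esub> cg j b) = zm"
    "upper (cg i a \<otimes>\<^bsub>st\<^esub> cg j b) = zm"
    if ab: "a \<in> homogeneous R" "b \<in> homogeneous R" for i j a b
  proof -
    obtain p q where "a \<in> grade R p" "b \<in> grade R q"
      using ab by (auto simp: homogeneous_def)
    note g = gen_class_grade(2,3) [OF this(1)] gen_class_grade(2,3) [OF this(2)]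
    show "upper (cf i a \<otimes>\<^bsub>st\<^esub> cf j b) = zm" "upper (cf i a \<otimes>\<^bsub>st\<^esub> cg j b) = zm"
      "upper (cg i a \<otimes>\<^bsub>st\<^esub> cg j b) = zm"
      using f [OF ab(1)] f [OF ab(2)] upper_odd_bracket g by blast+
  qed
  note cl = gen_class_closed L.pre_closed
  have minus: "upper (\<ominus>\<^bsub>st\<^esub> X) = zm" if "X \<in> carrier st" "upper X = zm" for X
    using upper_smult [of "\<ominus>\<^bsub>K\<^esub> \<one>\<^bsub>K\<^esub>" X] that by (simp add: L.smult_l_minus M.minus_zero')
  consider i a b where "x = cf i a \<otimes>\<^bsub>st\<^esub> cg i b" "a \<in> homogeneous R" "b \<in> homogeneous R"
    | a where "x = ct I1 I2 a" "a \<in> homogeneous R"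
    | a where "x = \<ominus>\<^bsub>st\<^esub> (cg I1 a \<otimes>\<^bsub>st\<^esub> cg I1 \<one>\<^bsub>R\<^esub>)" "a \<in> homogeneous R"
    | a where "x = cf I1 \<one>\<^bsub>R\<^esub> \<otimes>\<^bsub>st\<^esub> cf I1 a" "a \<in> homogeneous R"
    using assms unfolding sto_B0_def sto_h_def sto_v_def sto_w_def by blast
  then show ?thesis
  proof cases
    case 1
    then show ?thesis using ff cl by simp
  next
    case 2
    then show ?thesis using upper_gens(1) [of a I1 I2] cl(1) by simp
  next
    case 3
    then show ?thesis
      using minus ff(3) [OF 3(2) one] cl(3) [OF 3(2)] cl(3) [OF one] L.pre_closed by simp
  next
    case 4
    then show ?thesis using ff one cl by simp
  qed
qed

lemma sgn_part_sgn_part: "a \<in> homogeneous R \<Longrightarrow> sgn_part (\<ominus>\<^bsub>R\<^esub> sgn_part a) = \<ominus>\<^bsub>R\<^esub> a"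
proof -
  assume "a \<in> homogeneous R"
  then obtain p where a: "a \<in> grade R p" by (auto simp: homogeneous_def)
  then have "\<ominus>\<^bsub>R\<^esub> sgn_part a \<in> grade R p" "\<ominus>\<^bsub>R\<^esub> sgn_part a = \<ominus>\<^bsub>R\<^esub> ksign R p a"
    by (simp_all add: sgn_part_homogeneous grade_minus grade_ksign)
  then show ?thesis
    using sgn_part_homogeneous [of "\<ominus>\<^bsub>R\<^esub> sgn_part a" p] grade_closed [OF a]
    by (cases p) simp_all
qed

text \<open>In the upper right block \<open>f_11\<close> and \<open>f_21\<close> fill the two places
  of the first column, \<open>g_11\<close> and \<open>g_12\<close> those of the second. The
  determinant pairs only opposite corners: \<open>f_11\<close> with \<open>g_12\<close>, and
  \<open>f_21\<close> with \<open>g_11\<close> with a minus sign. All remaining pairs give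
  zero.\<close>

theorem beta_mat_sto_cocycle: "sto_cocycle K R bar beta_mat"
proof -
  note z = sto_B0_props
  have B: "x \<in> carrier st" if "x \<in> sto_B K R bar" for x
    using that z gen_class_closed unfolding sto_B_def by blast
  have mz: "msgn zm = zm"
    using msgn_homogeneous [of zm 0] by simp
  have c0: "beta_mat x y = \<zero>\<^bsub>CQ\<^esub> \<and> beta_mat y x = \<zero>\<^bsub>CQ\<^esub>"
    if "x \<in> sto_B0 K R bar" "y \<in> sto_B K R bar" for x y
    using z [OF that(1)] B [OF that(2)] upper_closed msgn_closed
    by (simp add: beta_mat_def mz pdet_zero del: mat2_simps)
  have sk: "\<ominus>\<^bsub>CQ\<^esub> ksign CQ ((1 + p) * (1 + q)) (beta_mat (cg j b) (cf i a)) = beta_mat (cf i a) (cg j b)"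
    if "a \<in> grade R p" "b \<in> grade R q" for i j a b p q
    using beta_mat_cocycle gen_class_grade(2) [OF that(1)] gen_class_grade(3) [OF that(2)]
    unfolding super_2cocycle_def by metis
  have sg0: "sgn_part \<zero>\<^bsub>R\<^esub> = \<zero>\<^bsub>R\<^esub>"
    using sgn_part_homogeneous [of "\<zero>\<^bsub>R\<^esub>" 0] by simp
  have cp0: "cp \<zero>\<^bsub>R\<^esub> = \<zero>\<^bsub>CQ\<^esub>"
    by (simp add: CQ.Q_zero)
  note ev = beta_mat_def upper_gens msgn_def pdet_def det2_def sg0 M.minus_zero' cp0 CQ.M.minus_zero'
    sgn_part_sgn_part bar_homogeneous homogeneous_closed cp_closed cp_hom
  have fg: "beta_mat (cf i a) (cf j b) = \<zero>\<^bsub>CQ\<^esub>" "beta_mat (cg i a) (cg j b) = \<zero>\<^bsub>CQ\<^esub>"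
    "beta_mat (cf i a) (cg i b) = \<zero>\<^bsub>CQ\<^esub>" "beta_mat (cg i b) (cf i a) = \<zero>\<^bsub>CQ\<^esub>"
    "beta_mat (cf I1 a) (cg I2 b) = cp (a \<otimes>\<^bsub>R\<^esub> bar b)"
    "beta_mat (cf I2 a) (cg I1 b) = \<ominus>\<^bsub>CQ\<^esub> cp (a \<otimes>\<^bsub>R\<^esub> bar b)"
    if "a \<in> homogeneous R" "b \<in> homogeneous R" for i j a b
    using that by (simp_all add: ev)
  show ?thesis
    unfolding sto_cocycle_def
    using beta_mat_cocycle c0 fg sk homI by auto
qed

text \<open>The matrix cocycle is the witness that entitles the choice in \<open>sto_beta\<close> to
  its defining property.\<close>

lemma sto_beta_cocycle: "sto_cocycle K R bar (sto_beta K R bar)"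
  using someI [of "sto_cocycle K R bar" beta_mat] beta_mat_sto_cocycle by (simp add: sto_beta_def)

end

section \<open>Cocycles on the Steinberg algebra\<close>

lemma (in lie_superalgebra) leibniz_left:
  assumes "x \<in> grade L p" "y \<in> grade L q" "z \<in> grade L r"
  shows "(x \<otimes>\<^bsub>L\<^esub> y) \<otimes>\<^bsub>L\<^esub> z = x \<otimes>\<^bsub>L\<^esub> (y \<otimes>\<^bsub>L\<^esub> z) \<oplus>\<^bsub>L\<^esub> \<ominus>\<^bsub>L\<^esub> ksign L (p * q) (y \<otimes>\<^bsub>L\<^esub> (x \<otimes>\<^bsub>L\<^esub> z))"
proof -
  have "x \<in> carrier L" "y \<in> carrier L" "z \<in> carrier L"
    using assms grade_closed by blast+
  then have "(x \<otimes>\<^bsub>L\<^esub> y) \<otimes>\<^bsub>L\<^esub> z \<in> carrier L" "ksign L (p * q) (y \<otimes>\<^bsub>L\<^esub> (x \<otimes>\<^bsub>L\<^esub> z)) \<in> carrier L"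
    by (simp_all add: prod_closed)
  then show ?thesis
    unfolding leibniz [OF assms] by algebra
qed

section \<open>The action of \<open>h_11(x, y)\<close> on the generators\<close>

locale skew_unit = superinvolution K R bar
  for K :: "('k, 'n) ring_scheme" (structure)
    and R :: "('k, 'r, 'm) superalgebra_scheme" (structure)
    and bar :: "'r \<Rightarrow> 'r" +
  fixes e :: 'r
  assumes two: "\<one>\<^bsub>K\<^esub> \<oplus>\<^bsub>K\<^esub> \<one>\<^bsub>K\<^esub> \<in> Units K"
    and e_even: "e \<in> grade R 0"
    and e_skew: "bar e = \<ominus>\<^bsub>R\<^esub> e"
    and e_comm: "a \<in> carrier R \<Longrightarrow> e \<otimes>\<^bsub>R\<^esub> a = a \<otimes>\<^bsub>R\<^esub> e"
    and e_unit: "e \<in> Units R"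
begin

sublocale st: lie_superalgebra K st
  by (rule sto_lie_superalgebra [OF two])

sublocale fam: sto_family K R bar st ct cf cg
  by (rule sto_family_sto)

lemma bar_one: "bar \<one>\<^bsub>R\<^esub> = \<one>\<^bsub>R\<^esub>"
proof -
  have "bar (\<one>\<^bsub>R\<^esub> \<otimes>\<^bsub>R\<^esub> bar \<one>\<^bsub>R\<^esub>) = bar (bar \<one>\<^bsub>R\<^esub>) \<otimes>\<^bsub>R\<^esub> bar \<one>\<^bsub>R\<^esub>"
    using bar_mult [OF one_grade bar_grade [OF one_grade]] by simp
  then show ?thesis
    by (simp add: bar_bar)
qed

lemma fam_minus:
  assumes "a \<in> grade R p"
  shows "i \<noteq> j \<Longrightarrow> ct i j (\<ominus>\<^bsub>R\<^esub> a) = \<ominus>\<^bsub>st\<^esub> ct i j a" "cf i (\<ominus>\<^bsub>R\<^esub> a) = \<ominus>\<^bsub>st\<^esub> cf i a"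
    "cg i (\<ominus>\<^bsub>R\<^esub> a) = \<ominus>\<^bsub>st\<^esub> cg i a"
  using fam.T_smult [of i j "\<ominus>\<^bsub>K\<^esub> \<one>\<^bsub>K\<^esub>" a p] fam.F_smult [of "\<ominus>\<^bsub>K\<^esub> \<one>\<^bsub>K\<^esub>" a p i]
    fam.G_smult [of "\<ominus>\<^bsub>K\<^esub> \<one>\<^bsub>K\<^esub>" a p i] assms fam.T_closed fam.F_closed fam.G_closed
  by (simp_all add: smult_l_minus st.smult_l_minus grade_closed)

text \<open>Twice the skew part of \<open>u\<close>: the coefficient through which
  \<open>h_11(x, y)\<close> acts on \<open>t_12\<close>, with \<open>u = xy\<close>
  (\<open>hh_t\<close>).\<close>

definition theta :: "'r \<Rightarrow> 'r" where
  "theta u = u \<oplus>\<^bsub>R\<^esub> \<ominus>\<^bsub>R\<^esub> bar u"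

lemma theta_grade: "u \<in> grade R p \<Longrightarrow> theta u \<in> grade R p"
  by (simp add: theta_def grade_add grade_minus bar_grade)

text \<open>This is \<open>h_11(x, y)\<close>. Its action on the other generators, fed into the
  Leibniz rule, supplies the equations that determine a cocycle.\<close>

definition hh :: "'r \<Rightarrow> 'r \<Rightarrow> ('k, 'r sto_gen) lie_term set" where
  "hh x y = cf I1 x \<otimes>\<^bsub>st\<^esub> cg I1 y"

context
  fixes x y c :: 'r and p q r :: bit
  assumes x: "x \<in> grade R p" and y: "y \<in> grade R q" and c: "c \<in> grade R r"
begin

lemma hh_grade: "hh x y \<in> grade st (p + q)"
proof -
  have "(1 + p) + (1 + q) = p + q"
    by (simp add: ac_simps)
  then show ?thesis
    using st.prod_grade [OF fam.F_grade [OF x] fam.G_grade [OF y]] by (simp add: hh_def)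
qed

private lemma cl: "x \<in> carrier R" "y \<in> carrier R" "c \<in> carrier R"
  using x y c grade_closed by blast+

private lemmas skewFT = st.skew' [OF fam.F_grade fam.T_grade]
private lemmas skewGF = st.skew' [OF fam.G_grade fam.F_grade]

text \<open>Of the two Leibniz terms, the one that brackets with \<open>g\<close> first gives
  \<open>xyc\<close> directly. The other passes through \<open>f_21\<close> and ends in
  \<open>t_21\<close>; rewriting it as \<open>t_12\<close> applies \<open>bar\<close> and produces
  \<open>bar(xy) c\<close>.\<close>

lemma hh_t: "hh x y \<otimes>\<^bsub>st\<^esub> ct I1 I2 c = ct I1 I2 (theta (x \<otimes>\<^bsub>R\<^esub> y) \<otimes>\<^bsub>R\<^esub> c)"
proof -
  have ne: "I1 \<noteq> I2" "I2 \<noteq> I1" by simp_all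
  have xy: "x \<otimes>\<^bsub>R\<^esub> y \<in> grade R (p + q)" by (rule prod_grade [OF x y])
  have g: "x \<otimes>\<^bsub>R\<^esub> y \<otimes>\<^bsub>R\<^esub> c \<in> grade R (p + q + r)" "bar (x \<otimes>\<^bsub>R\<^esub> y) \<otimes>\<^bsub>R\<^esub> c \<in> grade R (p + q + r)"
    by (intro prod_grade xy bar_grade c)+
  have w: "bar c \<otimes>\<^bsub>R\<^esub> x \<in> grade R (r + p)"
    by (intro prod_grade x bar_grade c)
  have wy: "bar c \<otimes>\<^bsub>R\<^esub> x \<otimes>\<^bsub>R\<^esub> y \<in> grade R (r + p + q)"
    by (intro prod_grade w y)
  have "bar (bar c \<otimes>\<^bsub>R\<^esub> (x \<otimes>\<^bsub>R\<^esub> y)) = ksign R (r * (p + q)) (bar (x \<otimes>\<^bsub>R\<^esub> y) \<otimes>\<^bsub>R\<^esub> c)"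
    using bar_mult [OF bar_grade [OF c] xy] cl by (simp add: bar_bar)
  then have b: "bar (bar c \<otimes>\<^bsub>R\<^esub> x \<otimes>\<^bsub>R\<^esub> y) = ksign R (r * (p + q)) (bar (x \<otimes>\<^bsub>R\<^esub> y) \<otimes>\<^bsub>R\<^esub> c)"
    using cl by (simp add: m_assoc)
  have 1: "cg I1 y \<otimes>\<^bsub>st\<^esub> ct I1 I2 c = cg I2 (y \<otimes>\<^bsub>R\<^esub> c)"
    by (rule fam.G_T [OF ne(1) y c])
  have 2: "cf I1 x \<otimes>\<^bsub>st\<^esub> cg I2 (y \<otimes>\<^bsub>R\<^esub> c) = ct I1 I2 (x \<otimes>\<^bsub>R\<^esub> y \<otimes>\<^bsub>R\<^esub> c)"
    using sto_F_G [OF ne(1) x prod_grade [OF y c]] cl by (simp add: m_assoc)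
  have 3: "cf I1 x \<otimes>\<^bsub>st\<^esub> ct I1 I2 c = ksign st (1 + (1 + p) * r) (\<ominus>\<^bsub>st\<^esub> cf I2 (bar c \<otimes>\<^bsub>R\<^esub> x))"
    unfolding skewFT [OF x ne(1) c] fam.T_F' [OF ne(1) c x] ..
  have 4: "cg I1 y \<otimes>\<^bsub>st\<^esub> cf I2 (bar c \<otimes>\<^bsub>R\<^esub> x) =
      ksign st (1 + (1 + q) * (1 + (r + p))) (\<ominus>\<^bsub>st\<^esub> ct I1 I2 (bar (bar c \<otimes>\<^bsub>R\<^esub> x \<otimes>\<^bsub>R\<^esub> y)))"
    unfolding skewGF [OF y w] sto_F_G [OF ne(2) w y] fam.T_bar [OF ne(2) wy] ..
  have f2: "cf I2 (bar c \<otimes>\<^bsub>R\<^esub> x) \<in> carrier st" and gy: "cg I1 y \<in> carrier st"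
    by (rule fam.F_closed [OF w], rule fam.G_closed [OF y])
  have t: "ct I1 I2 (bar (x \<otimes>\<^bsub>R\<^esub> y) \<otimes>\<^bsub>R\<^esub> c) \<in> carrier st" "ct I1 I2 (x \<otimes>\<^bsub>R\<^esub> y \<otimes>\<^bsub>R\<^esub> c) \<in> carrier st"
    by (rule fam.T_closed [OF ne(1) g(2)], rule fam.T_closed [OF ne(1) g(1)])
  have "hh x y \<otimes>\<^bsub>st\<^esub> ct I1 I2 c = ct I1 I2 (x \<otimes>\<^bsub>R\<^esub> y \<otimes>\<^bsub>R\<^esub> c) \<oplus>\<^bsub>st\<^esub>
      \<ominus>\<^bsub>st\<^esub> ksign st ((1 + p) * (1 + q)) (cg I1 y \<otimes>\<^bsub>st\<^esub>
        ksign st (1 + (1 + p) * r) (\<ominus>\<^bsub>st\<^esub> cf I2 (bar c \<otimes>\<^bsub>R\<^esub> x)))"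
    unfolding hh_def st.leibniz_left [OF fam.F_grade [OF x] fam.G_grade [OF y] fam.T_grade [OF ne(1) c]]
      1 2 3 ..
  also have "... = ct I1 I2 (x \<otimes>\<^bsub>R\<^esub> y \<otimes>\<^bsub>R\<^esub> c) \<oplus>\<^bsub>st\<^esub> \<ominus>\<^bsub>st\<^esub> ct I1 I2 (bar (x \<otimes>\<^bsub>R\<^esub> y) \<otimes>\<^bsub>R\<^esub> c)"
    using f2 gy t
    by (cases p; cases q; cases r)
      (simp_all add: st.prod_minus_right 4 b fam_minus [OF g(2)] st.prod_closed)
  also have "... = ct I1 I2 (theta (x \<otimes>\<^bsub>R\<^esub> y) \<otimes>\<^bsub>R\<^esub> c)"
    using fam.T_add [OF ne(1) g(1) grade_minus [OF g(2)]] fam_minus(1) [OF g(2) ne(1)] cl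
    by (simp add: theta_def l_distr l_minus)
  finally show ?thesis .
qed

text \<open>One Leibniz term vanishes because \<open>f_11\<close> and \<open>f_21\<close> commute;
  the other passes through \<open>t_21\<close>.\<close>

lemma hh_f2: "hh x y \<otimes>\<^bsub>st\<^esub> cf I2 c = ksign st (1 + r * (p + q) + p * q) (cf I2 (c \<otimes>\<^bsub>R\<^esub> (y \<otimes>\<^bsub>R\<^esub> x)))"
proof -
  have ne: "I1 \<noteq> I2" "I2 \<noteq> I1" by simp_all
  note cy = prod_grade [OF c y]
  have g: "c \<otimes>\<^bsub>R\<^esub> (y \<otimes>\<^bsub>R\<^esub> x) \<in> grade R (r + (q + p))"
    by (intro prod_grade c y x)
  have 1: "cf I1 x \<otimes>\<^bsub>st\<^esub> cf I2 c = \<zero>\<^bsub>st\<^esub>"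
    by (rule fam.F_F [OF ne(1) x c])
  have 2: "cg I1 y \<otimes>\<^bsub>st\<^esub> cf I2 c = ksign st (1 + (1 + q) * (1 + r)) (ct I2 I1 (c \<otimes>\<^bsub>R\<^esub> y))"
    unfolding skewGF [OF y c] sto_F_G [OF ne(2) c y] ..
  have 3: "cf I1 x \<otimes>\<^bsub>st\<^esub> ct I2 I1 (c \<otimes>\<^bsub>R\<^esub> y) =
      ksign st (1 + (1 + p) * (r + q)) (cf I2 (c \<otimes>\<^bsub>R\<^esub> (y \<otimes>\<^bsub>R\<^esub> x)))"
    unfolding skewFT [OF x ne(2) cy] fam.T_F [OF ne(2) cy x] using cl by (simp add: m_assoc)
  have t: "ct I2 I1 (c \<otimes>\<^bsub>R\<^esub> y) \<in> carrier st" "cf I1 x \<in> carrier st" "cg I1 y \<in> carrier st"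
    "cf I2 (c \<otimes>\<^bsub>R\<^esub> (y \<otimes>\<^bsub>R\<^esub> x)) \<in> carrier st"
    by (rule fam.T_closed [OF ne(2) cy], rule fam.F_closed [OF x], rule fam.G_closed [OF y],
        rule fam.F_closed [OF g])
  have "hh x y \<otimes>\<^bsub>st\<^esub> cf I2 c = cf I1 x \<otimes>\<^bsub>st\<^esub>
      ksign st (1 + (1 + q) * (1 + r)) (ct I2 I1 (c \<otimes>\<^bsub>R\<^esub> y))"
    unfolding hh_def st.leibniz_left [OF fam.F_grade [OF x] fam.G_grade [OF y] fam.F_grade [OF c]]
      1 2 using t by (simp add: st.prod_closed st.M.minus_zero')
  also have "... = ksign st (1 + (1 + q) * (1 + r)) (ksign st (1 + (1 + p) * (r + q))
      (cf I2 (c \<otimes>\<^bsub>R\<^esub> (y \<otimes>\<^bsub>R\<^esub> x))))"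
    using t by (simp add: st.prod_ksign_right 3)
  also have "... = ksign st (1 + r * (p + q) + p * q) (cf I2 (c \<otimes>\<^bsub>R\<^esub> (y \<otimes>\<^bsub>R\<^esub> x)))"
    using t by (cases p; cases q; cases r) simp_all
  finally show ?thesis .
qed

lemma hh_g2: "hh x y \<otimes>\<^bsub>st\<^esub> cg I2 c = ksign st (p + q + p * q) (cg I2 (y \<otimes>\<^bsub>R\<^esub> x \<otimes>\<^bsub>R\<^esub> c))"
proof -
  have ne: "I1 \<noteq> I2" "I2 \<noteq> I1" by simp_all
  note xc = prod_grade [OF x c]
  have g: "y \<otimes>\<^bsub>R\<^esub> x \<otimes>\<^bsub>R\<^esub> c \<in> grade R (q + p + r)"
    by (intro prod_grade c y x)
  have 1: "cg I1 y \<otimes>\<^bsub>st\<^esub> cg I2 c = \<zero>\<^bsub>st\<^esub>"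
    by (rule fam.G_G [OF ne(1) y c])
  have 2: "cf I1 x \<otimes>\<^bsub>st\<^esub> cg I2 c = ct I1 I2 (x \<otimes>\<^bsub>R\<^esub> c)"
    by (rule sto_F_G [OF ne(1) x c])
  have 3: "cg I1 y \<otimes>\<^bsub>st\<^esub> ct I1 I2 (x \<otimes>\<^bsub>R\<^esub> c) = cg I2 (y \<otimes>\<^bsub>R\<^esub> x \<otimes>\<^bsub>R\<^esub> c)"
    using fam.G_T [OF ne(1) y xc] cl by (simp add: m_assoc)
  have t: "cf I1 x \<in> carrier st" "cg I2 (y \<otimes>\<^bsub>R\<^esub> x \<otimes>\<^bsub>R\<^esub> c) \<in> carrier st"
    by (rule fam.F_closed [OF x], rule fam.G_closed [OF g])
  show ?thesis
    unfolding hh_def st.leibniz_left [OF fam.F_grade [OF x] fam.G_grade [OF y] fam.G_grade [OF c]]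
      1 2 3 using t by (cases p; cases q) simp_all
qed

end

text \<open>No relation describes \<open>[f_11, f_11]\<close>. Writing \<open>f_11(c)\<close> as
  \<open>[t_12(c), f_21(1)]\<close> reduces the claim to the actions on \<open>t_12\<close> and
  \<open>f_21\<close>.\<close>

lemma hh_f1:
  assumes x: "x \<in> grade R p" and y: "y \<in> grade R q" and c: "c \<in> grade R r"
  shows "hh x y \<otimes>\<^bsub>st\<^esub> cf I1 c = cf I1 (theta (x \<otimes>\<^bsub>R\<^esub> y) \<otimes>\<^bsub>R\<^esub> c) \<oplus>\<^bsub>st\<^esub>
    \<ominus>\<^bsub>st\<^esub> ksign st (r * (p + q) + p * q) (cf I1 (c \<otimes>\<^bsub>R\<^esub> (y \<otimes>\<^bsub>R\<^esub> x)))"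
proof -
  have ne: "I1 \<noteq> I2" by simp
  note xy = theta_grade [OF prod_grade [OF x y]]
  have cl: "x \<in> carrier R" "y \<in> carrier R" "c \<in> carrier R" "theta (x \<otimes>\<^bsub>R\<^esub> y) \<in> carrier R"
    using x y c xy grade_closed by blast+
  have yx: "y \<otimes>\<^bsub>R\<^esub> x \<in> grade R (q + p)"
    by (rule prod_grade [OF y x])
  have f: "cf I1 c = ct I1 I2 c \<otimes>\<^bsub>st\<^esub> cf I2 \<one>\<^bsub>R\<^esub>"
    using fam.T_F [OF ne c one_grade] cl by simp
  have 1: "ct I1 I2 (theta (x \<otimes>\<^bsub>R\<^esub> y) \<otimes>\<^bsub>R\<^esub> c) \<otimes>\<^bsub>st\<^esub> cf I2 \<one>\<^bsub>R\<^esub> = cf I1 (theta (x \<otimes>\<^bsub>R\<^esub> y) \<otimes>\<^bsub>R\<^esub> c)"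
    using fam.T_F [OF ne prod_grade [OF xy c] one_grade] cl by simp
  have 2: "hh x y \<otimes>\<^bsub>st\<^esub> cf I2 \<one>\<^bsub>R\<^esub> = ksign st (1 + p * q) (cf I2 (y \<otimes>\<^bsub>R\<^esub> x))"
    using hh_f2 [OF x y one_grade] cl by simp
  have 3: "ct I1 I2 c \<otimes>\<^bsub>st\<^esub> cf I2 (y \<otimes>\<^bsub>R\<^esub> x) = cf I1 (c \<otimes>\<^bsub>R\<^esub> (y \<otimes>\<^bsub>R\<^esub> x))"
    by (rule fam.T_F [OF ne c yx])
  have t: "ct I1 I2 c \<in> carrier st" "cf I2 (y \<otimes>\<^bsub>R\<^esub> x) \<in> carrier st"
    "cf I1 (c \<otimes>\<^bsub>R\<^esub> (y \<otimes>\<^bsub>R\<^esub> x)) \<in> carrier st"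
    by (rule fam.T_closed [OF ne c], rule fam.F_closed [OF yx],
        rule fam.F_closed [OF prod_grade [OF c yx]])
  show ?thesis
    unfolding f st.leibniz [OF hh_grade [OF x y c] fam.T_grade [OF ne c] fam.F_grade [OF one_grade]]
      hh_t [OF x y c] 1 2
    using t by (cases p; cases q; cases r) (simp_all add: st.prod_minus_right 3)
qed

end

section \<open>Equations satisfied by an arbitrary 2-cocycle\<close>

lemma (in module) inv_two_double:
  assumes "\<one> \<oplus> \<one> \<in> Units R" "x \<in> carrier M"
  shows "inv (\<one> \<oplus> \<one>) \<odot>\<^bsub>M\<^esub> (x \<oplus>\<^bsub>M\<^esub> x) = x"
proof -
  define u where "u = \<one> \<oplus> \<one>"
  have u: "u \<in> Units R" "u \<in> carrier R"
    using assms(1) by (simp_all add: u_def R.Units_closed)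
  have "x \<oplus>\<^bsub>M\<^esub> x = u \<odot>\<^bsub>M\<^esub> x"
    using assms(2) by (simp add: u_def smult_l_distr)
  then have "inv u \<odot>\<^bsub>M\<^esub> (x \<oplus>\<^bsub>M\<^esub> x) = (inv u \<otimes> u) \<odot>\<^bsub>M\<^esub> x"
    using u assms(2) by (simp add: smult_assoc1 del: R.Units_l_inv)
  then show ?thesis
    using u assms(2) by (simp add: u_def)
qed

text \<open>Instantiated twice: with the coefficient module of \<open>sto_beta\<close>, and with the
  source of an arbitrary central extension. Only the graded module structure of \<open>E\<close>
  enters.\<close>

locale sto_2cocycle = skew_unit K R bar e + E: supermodule K E
  for K :: "('k, 'n) ring_scheme" (structure)
    and R :: "('k, 'r, 'm) superalgebra_scheme" (structure)
    and bar :: "'r \<Rightarrow> 'r" and e :: 'r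
    and E :: "('k, 'e) superalgebra" (structure) +
  fixes B :: "('k, 'r sto_gen) lie_term set \<Rightarrow> ('k, 'r sto_gen) lie_term set \<Rightarrow> 'e"
  assumes cocycle: "super_2cocycle K st E B"
begin

lemma B_closed [simp]: "\<lbrakk>x \<in> carrier st; y \<in> carrier st\<rbrakk> \<Longrightarrow> B x y \<in> carrier E"
  using cocycle unfolding super_2cocycle_def by blast

lemma B_add:
  assumes "x \<in> carrier st" "y \<in> carrier st" "z \<in> carrier st"
  shows "B (x \<oplus>\<^bsub>st\<^esub> y) z = B x z \<oplus>\<^bsub>E\<^esub> B y z" "B z (x \<oplus>\<^bsub>st\<^esub> y) = B z x \<oplus>\<^bsub>E\<^esub> B z y"
  using cocycle assms unfolding super_2cocycle_def by blast+

lemma B_smult: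
  assumes "c \<in> carrier K" "x \<in> carrier st" "y \<in> carrier st"
  shows "B (c \<odot>\<^bsub>st\<^esub> x) y = c \<odot>\<^bsub>E\<^esub> B x y" "B x (c \<odot>\<^bsub>st\<^esub> y) = c \<odot>\<^bsub>E\<^esub> B x y"
  using cocycle assms unfolding super_2cocycle_def by blast+

lemma B_grade: "\<lbrakk>x \<in> grade st p; y \<in> grade st q\<rbrakk> \<Longrightarrow> B x y \<in> grade E (p + q)"
  using cocycle unfolding super_2cocycle_def by blast

lemma B_minus:
  assumes "x \<in> carrier st" "y \<in> carrier st"
  shows "B (\<ominus>\<^bsub>st\<^esub> x) y = \<ominus>\<^bsub>E\<^esub> B x y" "B x (\<ominus>\<^bsub>st\<^esub> y) = \<ominus>\<^bsub>E\<^esub> B x y"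
  using B_smult [of "\<ominus>\<^bsub>K\<^esub> \<one>\<^bsub>K\<^esub>" x y] assms by (simp_all add: st.smult_l_minus E.smult_l_minus)

lemma B_zero:
  assumes "x \<in> carrier st"
  shows "B \<zero>\<^bsub>st\<^esub> x = \<zero>\<^bsub>E\<^esub>" "B x \<zero>\<^bsub>st\<^esub> = \<zero>\<^bsub>E\<^esub>"
  using B_smult [of "\<zero>\<^bsub>K\<^esub>" "\<zero>\<^bsub>st\<^esub>" x] B_smult [of "\<zero>\<^bsub>K\<^esub>" x "\<zero>\<^bsub>st\<^esub>"] assms by simp_all

lemma B_skew:
  assumes "x \<in> grade st p" "y \<in> grade st q"
  shows "B x y = ksign E (1 + p * q) (B y x)"
proof -
  have "B y x \<in> carrier E"
    using assms st.grade_closed by simp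
  moreover have "B x y = \<ominus>\<^bsub>E\<^esub> (ksign E (p * q) (B y x))"
    using cocycle assms unfolding super_2cocycle_def by blast
  ultimately show ?thesis
    by (cases p; cases q) simp_all
qed

text \<open>The Leibniz rule for \<open>B\<close> is the second component of the one in the extension it defines.\<close>

lemma B_leibniz:
  assumes x: "x \<in> grade st p" and y: "y \<in> grade st q" and z: "z \<in> grade st r"
  shows "B x (y \<otimes>\<^bsub>st\<^esub> z) = B (x \<otimes>\<^bsub>st\<^esub> y) z \<oplus>\<^bsub>E\<^esub> ksign E (p * q) (B y (x \<otimes>\<^bsub>st\<^esub> z))"
proof -
  interpret P: supermodule_pair K st E ..
  let ?X = "pair_algebra st E (\<lambda>(x, c) (y, c'). (x \<otimes>\<^bsub>st\<^esub> y, B x y))"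
  interpret X: lie_superalgebra K ?X
    using cocycle_extension_lie [OF st.lie_superalgebra_axioms E.supermodule_axioms cocycle]
    by (simp only: cocycle_extension_eq)
  have "(x, \<zero>\<^bsub>E\<^esub>) \<in> grade ?X p" "(y, \<zero>\<^bsub>E\<^esub>) \<in> grade ?X q" "(z, \<zero>\<^bsub>E\<^esub>) \<in> grade ?X r"
    using x y z by simp_all
  from X.leibniz [OF this]
  show ?thesis
    using x y z by (simp add: P.pair_ksign st.prod_closed st.grade_closed)
qed

abbreviation "bb a b \<equiv> B (cf I1 a) (cg I2 b)"

lemma bb_closed: "\<lbrakk>a \<in> grade R p; b \<in> grade R q\<rbrakk> \<Longrightarrow> bb a b \<in> carrier E"
  by (intro B_closed fam.F_closed fam.G_closed)

lemma bb_add: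
  "\<lbrakk>a \<in> grade R p; b \<in> grade R p; c \<in> grade R q\<rbrakk> \<Longrightarrow> bb (a \<oplus>\<^bsub>R\<^esub> b) c = bb a c \<oplus>\<^bsub>E\<^esub> bb b c"
  "\<lbrakk>a \<in> grade R p; b \<in> grade R p; c \<in> grade R q\<rbrakk> \<Longrightarrow> bb c (a \<oplus>\<^bsub>R\<^esub> b) = bb c a \<oplus>\<^bsub>E\<^esub> bb c b"
  by (simp_all add: fam.F_add fam.G_add B_add fam.F_closed fam.G_closed)

lemma bb_smult:
  "\<lbrakk>k \<in> carrier K; a \<in> grade R p; c \<in> grade R q\<rbrakk> \<Longrightarrow> bb (k \<odot>\<^bsub>R\<^esub> a) c = k \<odot>\<^bsub>E\<^esub> bb a c"
  "\<lbrakk>k \<in> carrier K; a \<in> grade R p; c \<in> grade R q\<rbrakk> \<Longrightarrow> bb c (k \<odot>\<^bsub>R\<^esub> a) = k \<odot>\<^bsub>E\<^esub> bb c a"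
  by (simp_all add: fam.F_smult fam.G_smult B_smult fam.F_closed fam.G_closed)

text \<open>The left side depends on \<open>a\<close> and \<open>b\<close> only through their
  product, because \<open>t_12(ab) = [f_11(a), g_12(b)]\<close>. The right side is its Leibniz
  expansion. Comparing different factorizations of one product yields the equations for
  \<open>bb\<close>.\<close>

lemma B_hh:
  assumes x: "x \<in> grade R p" and y: "y \<in> grade R q" and a: "a \<in> grade R r" and b: "b \<in> grade R s"
  shows "B (hh x y) (ct I1 I2 (a \<otimes>\<^bsub>R\<^esub> b)) = bb (theta (x \<otimes>\<^bsub>R\<^esub> y) \<otimes>\<^bsub>R\<^esub> a) b \<oplus>\<^bsub>E\<^esub>
    \<ominus>\<^bsub>E\<^esub> ksign E (r * (p + q) + p * q)
      (bb (a \<otimes>\<^bsub>R\<^esub> (y \<otimes>\<^bsub>R\<^esub> x)) b \<oplus>\<^bsub>E\<^esub> \<ominus>\<^bsub>E\<^esub> bb a (y \<otimes>\<^bsub>R\<^esub> x \<otimes>\<^bsub>R\<^esub> b))"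
proof -
  have ne: "I1 \<noteq> I2" by simp
  note th = prod_grade [OF theta_grade [OF prod_grade [OF x y]] a]
  note ayx = prod_grade [OF a prod_grade [OF y x]]
  note yxb = prod_grade [OF prod_grade [OF y x] b]
  have c: "cf I1 (theta (x \<otimes>\<^bsub>R\<^esub> y) \<otimes>\<^bsub>R\<^esub> a) \<in> carrier st" "cf I1 (a \<otimes>\<^bsub>R\<^esub> (y \<otimes>\<^bsub>R\<^esub> x)) \<in> carrier st"
    "cg I2 (y \<otimes>\<^bsub>R\<^esub> x \<otimes>\<^bsub>R\<^esub> b) \<in> carrier st" "cf I1 a \<in> carrier st" "cg I2 b \<in> carrier st"
    by (rule fam.F_closed [OF th], rule fam.F_closed [OF ayx], rule fam.G_closed [OF yxb],
        rule fam.F_closed [OF a], rule fam.G_closed [OF b])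
  have "B (hh x y) (ct I1 I2 (a \<otimes>\<^bsub>R\<^esub> b)) = B (hh x y) (cf I1 a \<otimes>\<^bsub>st\<^esub> cg I2 b)"
    by (simp only: sto_F_G [OF ne a b])
  also have "... = bb (theta (x \<otimes>\<^bsub>R\<^esub> y) \<otimes>\<^bsub>R\<^esub> a) b \<oplus>\<^bsub>E\<^esub>
    \<ominus>\<^bsub>E\<^esub> ksign E (r * (p + q) + p * q)
      (bb (a \<otimes>\<^bsub>R\<^esub> (y \<otimes>\<^bsub>R\<^esub> x)) b \<oplus>\<^bsub>E\<^esub> \<ominus>\<^bsub>E\<^esub> bb a (y \<otimes>\<^bsub>R\<^esub> x \<otimes>\<^bsub>R\<^esub> b))"
    unfolding B_leibniz [OF hh_grade [OF x y a] fam.F_grade [OF a] fam.G_grade [OF b]]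
      hh_f1 [OF x y a] hh_g2 [OF x y b]
    using c by (cases p; cases q; cases r)
      (simp_all add: B_add B_minus E.M.minus_add E.M.a_assoc)
  finally show ?thesis .
qed

definition half :: 'k where
  "half = inv\<^bsub>K\<^esub> (\<one>\<^bsub>K\<^esub> \<oplus>\<^bsub>K\<^esub> \<one>\<^bsub>K\<^esub>)"

lemma half_closed: "half \<in> carrier K"
  using two by (simp add: half_def)

lemma half_double: "x \<in> carrier E \<Longrightarrow> half \<odot>\<^bsub>E\<^esub> (x \<oplus>\<^bsub>E\<^esub> x) = x"
  unfolding half_def by (rule E.inv_two_double [OF two])

definition e' :: 'r where
  "e' = inv\<^bsub>R\<^esub> e"

lemma e_closed: "e \<in> carrier R"
  by (rule grade_closed [OF e_even])

lemma e'_closed: "e' \<in> carrier R"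
  using e_unit by (simp add: e'_def)

lemma e_e': "e \<otimes>\<^bsub>R\<^esub> e' = \<one>\<^bsub>R\<^esub>" "e' \<otimes>\<^bsub>R\<^esub> e = \<one>\<^bsub>R\<^esub>"
  using e_unit by (simp_all add: e'_def)

lemma e_e'_mult: "a \<in> carrier R \<Longrightarrow> e \<otimes>\<^bsub>R\<^esub> (e' \<otimes>\<^bsub>R\<^esub> a) = a" "a \<in> carrier R \<Longrightarrow> e' \<otimes>\<^bsub>R\<^esub> (e \<otimes>\<^bsub>R\<^esub> a) = a"
  using e_closed e'_closed by (simp_all add: m_assoc [symmetric] e_e')

text \<open>The product of \<open>e\<close> with the odd component of its inverse is the odd
  component of 1, hence zero, and \<open>e\<close> can be cancelled.\<close>

lemma e'_even: "e' \<in> grade R 0"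
proof -
  have "component R 1 (e \<otimes>\<^bsub>R\<^esub> e') = e \<otimes>\<^bsub>R\<^esub> component R 1 e'"
    using component_prod [OF e_even e'_closed, of 1] by simp
  then have "e \<otimes>\<^bsub>R\<^esub> component R 1 e' = \<zero>\<^bsub>R\<^esub>"
    using component_other [OF one_grade, of 1] by (simp add: e_e')
  then have "component R 1 e' = \<zero>\<^bsub>R\<^esub>"
    using e_e'_mult(2) [of "component R 1 e'"] e'_closed by simp
  then show ?thesis
    using component_sum01 [OF e'_closed] component_grade [OF e'_closed, of 0] e'_closed by simp
qed

lemma e_mult_grade: "a \<in> grade R p \<Longrightarrow> e \<otimes>\<^bsub>R\<^esub> a \<in> grade R p" "a \<in> grade R p \<Longrightarrow> e' \<otimes>\<^bsub>R\<^esub> a \<in> grade R p"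
  using prod_grade [OF e_even, of a p] prod_grade [OF e'_even, of a p] by simp_all

text \<open>The candidate for the lift of $t_{12}(z)$.  Averaging over the two decompositions of \<open>z\<close> makes
  the defect \<open>dd\<close> below change its sign when \<open>e\<close> moves from one argument to the other.\<close>

definition tt :: "'r \<Rightarrow> 'e" where
  "tt z = half \<odot>\<^bsub>E\<^esub> (bb \<one>\<^bsub>R\<^esub> z \<oplus>\<^bsub>E\<^esub> bb e (e' \<otimes>\<^bsub>R\<^esub> z))"

lemma tt_closed: "z \<in> grade R p \<Longrightarrow> tt z \<in> carrier E"
  unfolding tt_def
  by (intro E.smult_closed half_closed E.M.a_closed bb_closed [OF one_grade] bb_closed [OF e_even] e_mult_grade)

lemma tt_add:
  assumes "a \<in> grade R p" "b \<in> grade R p"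
  shows "tt (a \<oplus>\<^bsub>R\<^esub> b) = tt a \<oplus>\<^bsub>E\<^esub> tt b"
proof -
  have cl: "a \<in> carrier R" "b \<in> carrier R"
    using assms grade_closed by blast+
  have c: "bb \<one>\<^bsub>R\<^esub> a \<in> carrier E" "bb e (e' \<otimes>\<^bsub>R\<^esub> a) \<in> carrier E" "bb \<one>\<^bsub>R\<^esub> b \<in> carrier E"
    "bb e (e' \<otimes>\<^bsub>R\<^esub> b) \<in> carrier E"
    using bb_closed [OF one_grade] bb_closed [OF e_even] e_mult_grade assms by blast+
  show ?thesis
    unfolding tt_def r_distr [OF cl e'_closed] bb_add(2) [OF assms one_grade]
      bb_add(2) [OF e_mult_grade(2) [OF assms(1)] e_mult_grade(2) [OF assms(2)] e_even]
    using c half_closed by (simp add: E.smult_r_distr E.M.a_ac)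
qed

lemma tt_smult:
  assumes "k \<in> carrier K" "a \<in> grade R p"
  shows "tt (k \<odot>\<^bsub>R\<^esub> a) = k \<odot>\<^bsub>E\<^esub> tt a"
proof -
  have cl: "a \<in> carrier R"
    using assms grade_closed by blast+
  have c: "bb \<one>\<^bsub>R\<^esub> a \<in> carrier E" "bb e (e' \<otimes>\<^bsub>R\<^esub> a) \<in> carrier E"
    using bb_closed [OF one_grade] bb_closed [OF e_even] e_mult_grade assms by blast+
  have ek: "e' \<otimes>\<^bsub>R\<^esub> (k \<odot>\<^bsub>R\<^esub> a) = k \<odot>\<^bsub>R\<^esub> (e' \<otimes>\<^bsub>R\<^esub> a)"
    by (rule prod_smult_right [OF assms(1) e'_closed cl])
  show ?thesis
    unfolding tt_def ek bb_smult(2) [OF assms one_grade]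
      bb_smult(2) [OF assms(1) e_mult_grade(2) [OF assms(2)] e_even]
    using c half_closed assms(1)
    by (simp add: E.smult_r_distr E.smult_assoc1 [symmetric] R.m_comm)
qed

lemma tt_minus: "a \<in> grade R p \<Longrightarrow> tt (\<ominus>\<^bsub>R\<^esub> a) = \<ominus>\<^bsub>E\<^esub> tt a"
  using tt_smult [of "\<ominus>\<^bsub>K\<^esub> \<one>\<^bsub>K\<^esub>" a p] tt_closed [of a p]
  by (simp add: smult_l_minus E.smult_l_minus grade_closed)

text \<open>In \<open>B_hh\<close> put \<open>x = 1\<close> and \<open>y = e\<close>. Since
  \<open>theta e = 2e\<close>, the sum on the left is a value of \<open>B\<close> that depends on
  \<open>ab\<close> only; so it may be computed at the pair \<open>(1, ab)\<close>, where it is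
  twice \<open>tt\<close> by construction.\<close>

lemma bb_e:
  assumes a: "a \<in> grade R p" and b: "b \<in> grade R q"
  shows "bb (e \<otimes>\<^bsub>R\<^esub> a) b \<oplus>\<^bsub>E\<^esub> bb a (e \<otimes>\<^bsub>R\<^esub> b) = tt (e \<otimes>\<^bsub>R\<^esub> a \<otimes>\<^bsub>R\<^esub> b) \<oplus>\<^bsub>E\<^esub> tt (e \<otimes>\<^bsub>R\<^esub> a \<otimes>\<^bsub>R\<^esub> b)"
proof -
  have D: "B (hh \<one>\<^bsub>R\<^esub> e) (ct I1 I2 (a \<otimes>\<^bsub>R\<^esub> b)) = bb (e \<otimes>\<^bsub>R\<^esub> a) b \<oplus>\<^bsub>E\<^esub> bb a (e \<otimes>\<^bsub>R\<^esub> b)"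
    if a: "a \<in> grade R p" and b: "b \<in> grade R q" for a b p q
  proof -
    have cl: "a \<in> carrier R" "b \<in> carrier R"
      using a b grade_closed by blast+
    have th: "theta (\<one>\<^bsub>R\<^esub> \<otimes>\<^bsub>R\<^esub> e) \<otimes>\<^bsub>R\<^esub> a = e \<otimes>\<^bsub>R\<^esub> a \<oplus>\<^bsub>R\<^esub> e \<otimes>\<^bsub>R\<^esub> a"
      using cl e_closed by (simp add: theta_def e_skew l_distr)
    have c: "bb (e \<otimes>\<^bsub>R\<^esub> a) b \<in> carrier E" "bb a (e \<otimes>\<^bsub>R\<^esub> b) \<in> carrier E"
      using bb_closed a b e_mult_grade by blast+
    have ae: "a \<otimes>\<^bsub>R\<^esub> (e \<otimes>\<^bsub>R\<^esub> \<one>\<^bsub>R\<^esub>) = e \<otimes>\<^bsub>R\<^esub> a"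
      using cl e_closed by (simp add: e_comm)
    have eb: "e \<otimes>\<^bsub>R\<^esub> \<one>\<^bsub>R\<^esub> \<otimes>\<^bsub>R\<^esub> b = e \<otimes>\<^bsub>R\<^esub> b"
      using e_closed by simp
    show ?thesis
      unfolding B_hh [OF one_grade e_even a b] th ae eb
        bb_add(1) [OF e_mult_grade(1) [OF a] e_mult_grade(1) [OF a] b]
      using c by (simp, algebra)
  qed
  have cl: "a \<in> carrier R" "b \<in> carrier R"
    using a b grade_closed by blast+
  note ab = prod_grade [OF a b]
  have "bb (e \<otimes>\<^bsub>R\<^esub> a) b \<oplus>\<^bsub>E\<^esub> bb a (e \<otimes>\<^bsub>R\<^esub> b) =
      bb (e \<otimes>\<^bsub>R\<^esub> \<one>\<^bsub>R\<^esub>) (a \<otimes>\<^bsub>R\<^esub> b) \<oplus>\<^bsub>E\<^esub> bb \<one>\<^bsub>R\<^esub> (e \<otimes>\<^bsub>R\<^esub> (a \<otimes>\<^bsub>R\<^esub> b))"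
    using D [OF a b] D [OF one_grade ab] cl by simp
  also have "... = tt (e \<otimes>\<^bsub>R\<^esub> a \<otimes>\<^bsub>R\<^esub> b) \<oplus>\<^bsub>E\<^esub> tt (e \<otimes>\<^bsub>R\<^esub> a \<otimes>\<^bsub>R\<^esub> b)"
  proof -
    have c: "bb e (a \<otimes>\<^bsub>R\<^esub> b) \<in> carrier E" "bb \<one>\<^bsub>R\<^esub> (e \<otimes>\<^bsub>R\<^esub> (a \<otimes>\<^bsub>R\<^esub> b)) \<in> carrier E"
      using bb_closed one_grade e_even ab e_mult_grade by blast+
    have "tt (e \<otimes>\<^bsub>R\<^esub> a \<otimes>\<^bsub>R\<^esub> b) \<oplus>\<^bsub>E\<^esub> tt (e \<otimes>\<^bsub>R\<^esub> a \<otimes>\<^bsub>R\<^esub> b) =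
        half \<odot>\<^bsub>E\<^esub> ((bb \<one>\<^bsub>R\<^esub> (e \<otimes>\<^bsub>R\<^esub> (a \<otimes>\<^bsub>R\<^esub> b)) \<oplus>\<^bsub>E\<^esub> bb e (a \<otimes>\<^bsub>R\<^esub> b)) \<oplus>\<^bsub>E\<^esub>
          (bb \<one>\<^bsub>R\<^esub> (e \<otimes>\<^bsub>R\<^esub> (a \<otimes>\<^bsub>R\<^esub> b)) \<oplus>\<^bsub>E\<^esub> bb e (a \<otimes>\<^bsub>R\<^esub> b)))"
      using cl e_closed c half_closed by (simp add: tt_def m_assoc e_e'_mult E.smult_r_distr)
    also have "... = bb \<one>\<^bsub>R\<^esub> (e \<otimes>\<^bsub>R\<^esub> (a \<otimes>\<^bsub>R\<^esub> b)) \<oplus>\<^bsub>E\<^esub> bb e (a \<otimes>\<^bsub>R\<^esub> b)"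
      using c by (intro half_double) simp
    finally show ?thesis
      using c e_closed by (simp add: E.M.a_comm)
  qed
  finally show ?thesis .
qed

definition dd :: "'r \<Rightarrow> 'r \<Rightarrow> 'e" where
  "dd a b = bb a b \<oplus>\<^bsub>E\<^esub> \<ominus>\<^bsub>E\<^esub> tt (a \<otimes>\<^bsub>R\<^esub> b)"

lemma dd_closed:
  assumes "a \<in> grade R p" "b \<in> grade R q"
  shows "dd a b \<in> carrier E"
  unfolding dd_def
  by (intro E.M.a_closed E.M.a_inv_closed bb_closed [OF assms] tt_closed [OF prod_grade [OF assms]])

lemma bb_dd:
  assumes "a \<in> grade R p" "b \<in> grade R q"
  shows "bb a b = dd a b \<oplus>\<^bsub>E\<^esub> tt (a \<otimes>\<^bsub>R\<^esub> b)"
  using bb_closed [OF assms] tt_closed [OF prod_grade [OF assms]] unfolding dd_def by algebra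

lemma dd_add:
  assumes "a \<in> grade R p" "b \<in> grade R p" "c \<in> grade R q"
  shows "dd (a \<oplus>\<^bsub>R\<^esub> b) c = dd a c \<oplus>\<^bsub>E\<^esub> dd b c"
proof -
  have cl: "a \<in> carrier R" "b \<in> carrier R" "c \<in> carrier R"
    using assms grade_closed by blast+
  note ac = prod_grade [OF assms(1,3)] and bc = prod_grade [OF assms(2,3)]
  show ?thesis
    unfolding dd_def l_distr [OF cl] tt_add [OF ac bc] bb_add(1) [OF assms]
    using tt_closed [OF ac] tt_closed [OF bc] bb_closed [OF assms(1,3)] bb_closed [OF assms(2,3)]
    by algebra
qed

lemma dd_smult:
  assumes "k \<in> carrier K" "a \<in> grade R p" "c \<in> grade R q"
  shows "dd (k \<odot>\<^bsub>R\<^esub> a) c = k \<odot>\<^bsub>E\<^esub> dd a c"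
proof -
  have cl: "a \<in> carrier R" "c \<in> carrier R"
    using assms grade_closed by blast+
  note ac = prod_grade [OF assms(2,3)]
  show ?thesis
    unfolding dd_def prod_smult_left [OF assms(1) cl] tt_smult [OF assms(1) ac] bb_smult(1) [OF assms]
    using tt_closed [OF ac] bb_closed [OF assms(2,3)] assms(1)
    by (simp add: E.smult_r_distr E.smult_r_minus)
qed

lemma dd_minus: "\<lbrakk>a \<in> grade R p; c \<in> grade R q\<rbrakk> \<Longrightarrow> dd (\<ominus>\<^bsub>R\<^esub> a) c = \<ominus>\<^bsub>E\<^esub> dd a c"
  using dd_smult [of "\<ominus>\<^bsub>K\<^esub> \<one>\<^bsub>K\<^esub>" a p c q] dd_closed [of a p c q]
  by (simp add: smult_l_minus E.smult_l_minus grade_closed)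

lemma dd_ksign: "\<lbrakk>a \<in> grade R p; c \<in> grade R q\<rbrakk> \<Longrightarrow> dd (ksign R r a) c = ksign E r (dd a c)"
  by (cases r) (simp_all add: dd_minus)

text \<open>By \<open>bb_e\<close> the sum of the two defects is twice \<open>tt (e a b)\<close>
  minus the same.\<close>

lemma dd_e:
  assumes a: "a \<in> grade R p" and b: "b \<in> grade R q"
  shows "dd (e \<otimes>\<^bsub>R\<^esub> a) b = \<ominus>\<^bsub>E\<^esub> dd a (e \<otimes>\<^bsub>R\<^esub> b)"
proof -
  have cl: "a \<in> carrier R" "b \<in> carrier R"
    using a b grade_closed by blast+
  have ae: "a \<otimes>\<^bsub>R\<^esub> (e \<otimes>\<^bsub>R\<^esub> b) = e \<otimes>\<^bsub>R\<^esub> a \<otimes>\<^bsub>R\<^esub> b"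
    using cl e_closed by (simp add: e_comm [of a] m_assoc)
  note ea = e_mult_grade(1) [OF a] and eb = e_mult_grade(1) [OF b]
  have c: "bb (e \<otimes>\<^bsub>R\<^esub> a) b \<in> carrier E" "bb a (e \<otimes>\<^bsub>R\<^esub> b) \<in> carrier E" "tt (e \<otimes>\<^bsub>R\<^esub> a \<otimes>\<^bsub>R\<^esub> b) \<in> carrier E"
    by (rule bb_closed [OF ea b], rule bb_closed [OF a eb], rule tt_closed [OF prod_grade [OF ea b]])
  have "dd (e \<otimes>\<^bsub>R\<^esub> a) b \<oplus>\<^bsub>E\<^esub> dd a (e \<otimes>\<^bsub>R\<^esub> b) =
      (bb (e \<otimes>\<^bsub>R\<^esub> a) b \<oplus>\<^bsub>E\<^esub> bb a (e \<otimes>\<^bsub>R\<^esub> b)) \<oplus>\<^bsub>E\<^esub> \<ominus>\<^bsub>E\<^esub> (tt (e \<otimes>\<^bsub>R\<^esub> a \<otimes>\<^bsub>R\<^esub> b) \<oplus>\<^bsub>E\<^esub> tt (e \<otimes>\<^bsub>R\<^esub> a \<otimes>\<^bsub>R\<^esub> b))"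
    unfolding dd_def ae using c by algebra
  also have "... = \<zero>\<^bsub>E\<^esub>"
    unfolding bb_e [OF a b] using c by (simp add: E.M.r_neg)
  finally show ?thesis
    using dd_closed [OF ea b] dd_closed [OF a eb] E.M.minus_equality [of "dd (e \<otimes>\<^bsub>R\<^esub> a) b" "dd a (e \<otimes>\<^bsub>R\<^esub> b)"]
    by simp
qed

lemma double_zero: "\<lbrakk>x \<in> carrier E; x = \<ominus>\<^bsub>E\<^esub> x\<rbrakk> \<Longrightarrow> x = \<zero>\<^bsub>E\<^esub>"
  using E.two_torsion_free [OF two, of x] E.M.r_neg [of x] by simp

text \<open>Rewrites \<open>B_hh\<close> through the defect. The last two summands belong to the
  same product \<open>a y x b\<close>, so their \<open>tt\<close> parts cancel and a single
  \<open>tt\<close> term is left.\<close>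

lemma B_hh_dd:
  assumes x: "x \<in> grade R p" and y: "y \<in> grade R q" and a: "a \<in> grade R r" and b: "b \<in> grade R s"
  shows "B (hh x y) (ct I1 I2 (a \<otimes>\<^bsub>R\<^esub> b)) = (dd (theta (x \<otimes>\<^bsub>R\<^esub> y) \<otimes>\<^bsub>R\<^esub> a) b \<oplus>\<^bsub>E\<^esub>
    \<ominus>\<^bsub>E\<^esub> ksign E (r * (p + q) + p * q) (dd (a \<otimes>\<^bsub>R\<^esub> (y \<otimes>\<^bsub>R\<^esub> x)) b \<oplus>\<^bsub>E\<^esub> \<ominus>\<^bsub>E\<^esub> dd a (y \<otimes>\<^bsub>R\<^esub> x \<otimes>\<^bsub>R\<^esub> b)))
    \<oplus>\<^bsub>E\<^esub> tt (theta (x \<otimes>\<^bsub>R\<^esub> y) \<otimes>\<^bsub>R\<^esub> a \<otimes>\<^bsub>R\<^esub> b)"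
proof -
  have cl: "a \<in> carrier R" "b \<in> carrier R" "x \<in> carrier R" "y \<in> carrier R"
    using a b x y grade_closed by blast+
  note yx = prod_grade [OF y x]
  note tha = prod_grade [OF theta_grade [OF prod_grade [OF x y]] a]
  note ayx = prod_grade [OF a yx] and yxb = prod_grade [OF yx b]
  have eq: "a \<otimes>\<^bsub>R\<^esub> (y \<otimes>\<^bsub>R\<^esub> x \<otimes>\<^bsub>R\<^esub> b) = a \<otimes>\<^bsub>R\<^esub> (y \<otimes>\<^bsub>R\<^esub> x) \<otimes>\<^bsub>R\<^esub> b"
    using cl by (simp add: m_assoc)
  have c: "dd (theta (x \<otimes>\<^bsub>R\<^esub> y) \<otimes>\<^bsub>R\<^esub> a) b \<in> carrier E" "dd (a \<otimes>\<^bsub>R\<^esub> (y \<otimes>\<^bsub>R\<^esub> x)) b \<in> carrier E"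
    "dd a (y \<otimes>\<^bsub>R\<^esub> x \<otimes>\<^bsub>R\<^esub> b) \<in> carrier E" "tt (theta (x \<otimes>\<^bsub>R\<^esub> y) \<otimes>\<^bsub>R\<^esub> a \<otimes>\<^bsub>R\<^esub> b) \<in> carrier E"
    "tt (a \<otimes>\<^bsub>R\<^esub> (y \<otimes>\<^bsub>R\<^esub> x) \<otimes>\<^bsub>R\<^esub> b) \<in> carrier E"
    by (rule dd_closed [OF tha b], rule dd_closed [OF ayx b], rule dd_closed [OF a yxb],
        rule tt_closed [OF prod_grade [OF tha b]], rule tt_closed [OF prod_grade [OF ayx b]])
  have cancel: "(u \<oplus>\<^bsub>E\<^esub> w) \<oplus>\<^bsub>E\<^esub> \<ominus>\<^bsub>E\<^esub> (v \<oplus>\<^bsub>E\<^esub> w) = u \<oplus>\<^bsub>E\<^esub> \<ominus>\<^bsub>E\<^esub> v"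
    if "u \<in> carrier E" "v \<in> carrier E" "w \<in> carrier E" for u v w
    using that by algebra
  show ?thesis
    unfolding B_hh [OF x y a b] bb_dd [OF tha b] bb_dd [OF ayx b] bb_dd [OF a yxb] eq
      cancel [OF c(2,3,5)]
    using c by (simp add: E.M.a_ac)
qed

text \<open>Up to a function of \<open>ab\<close>, the difference of the two sides is a value of \<open>B\<close> at a pair that
  depends on \<open>ab\<close> only.  So it is both invariant and odd under moving \<open>e\<close>, hence zero.\<close>

lemma dd_hh:
  assumes x: "x \<in> grade R p" and y: "y \<in> grade R q" and a: "a \<in> grade R r" and b: "b \<in> grade R s"
  shows "dd (theta (x \<otimes>\<^bsub>R\<^esub> y) \<otimes>\<^bsub>R\<^esub> a) b =
    ksign E (r * (p + q) + p * q) (dd (a \<otimes>\<^bsub>R\<^esub> (y \<otimes>\<^bsub>R\<^esub> x)) b \<oplus>\<^bsub>E\<^esub> \<ominus>\<^bsub>E\<^esub> dd a (y \<otimes>\<^bsub>R\<^esub> x \<otimes>\<^bsub>R\<^esub> b))"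
proof -
  define ga where "ga a b = dd (theta (x \<otimes>\<^bsub>R\<^esub> y) \<otimes>\<^bsub>R\<^esub> a) b \<oplus>\<^bsub>E\<^esub>
    \<ominus>\<^bsub>E\<^esub> ksign E (r * (p + q) + p * q) (dd (a \<otimes>\<^bsub>R\<^esub> (y \<otimes>\<^bsub>R\<^esub> x)) b \<oplus>\<^bsub>E\<^esub> \<ominus>\<^bsub>E\<^esub> dd a (y \<otimes>\<^bsub>R\<^esub> x \<otimes>\<^bsub>R\<^esub> b))"
    for a b
  note yx = prod_grade [OF y x]
  note th = theta_grade [OF prod_grade [OF x y]]
  have xyc: "x \<in> carrier R" "y \<in> carrier R" "theta (x \<otimes>\<^bsub>R\<^esub> y) \<in> carrier R"
    using x y th grade_closed by blast+
  have ga_closed: "ga a b \<in> carrier E" if "a \<in> grade R r" "b \<in> grade R s" for a b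
    unfolding ga_def
    by (intro E.M.a_closed E.M.a_inv_closed E.M.ksign_closed dd_closed [OF prod_grade [OF th that(1)] that(2)]
        dd_closed [OF prod_grade [OF that(1) yx] that(2)] dd_closed [OF that(1) prod_grade [OF yx that(2)]])
  have B: "B (hh x y) (ct I1 I2 (a \<otimes>\<^bsub>R\<^esub> b)) = ga a b \<oplus>\<^bsub>E\<^esub> tt (theta (x \<otimes>\<^bsub>R\<^esub> y) \<otimes>\<^bsub>R\<^esub> (a \<otimes>\<^bsub>R\<^esub> b))"
    if "a \<in> grade R r" "b \<in> grade R s" for a b
    using B_hh_dd [OF x y that] that xyc by (simp add: ga_def m_assoc grade_closed)
  \<comment> \<open>Centrality of \<open>e\<close> lets it be pulled to the front in all three
    terms, where \<open>dd_e\<close> applies.\<close>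
  have neg: "ga (e \<otimes>\<^bsub>R\<^esub> a) b = \<ominus>\<^bsub>E\<^esub> ga a (e \<otimes>\<^bsub>R\<^esub> b)" if a: "a \<in> grade R r" and b: "b \<in> grade R s" for a b
  proof -
    have cl: "a \<in> carrier R" "b \<in> carrier R"
      using a b grade_closed by blast+
    note eb = e_mult_grade(1) [OF b]
    have 1: "theta (x \<otimes>\<^bsub>R\<^esub> y) \<otimes>\<^bsub>R\<^esub> (e \<otimes>\<^bsub>R\<^esub> a) = e \<otimes>\<^bsub>R\<^esub> (theta (x \<otimes>\<^bsub>R\<^esub> y) \<otimes>\<^bsub>R\<^esub> a)"
      "e \<otimes>\<^bsub>R\<^esub> a \<otimes>\<^bsub>R\<^esub> (y \<otimes>\<^bsub>R\<^esub> x) = e \<otimes>\<^bsub>R\<^esub> (a \<otimes>\<^bsub>R\<^esub> (y \<otimes>\<^bsub>R\<^esub> x))"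
      "y \<otimes>\<^bsub>R\<^esub> x \<otimes>\<^bsub>R\<^esub> (e \<otimes>\<^bsub>R\<^esub> b) = e \<otimes>\<^bsub>R\<^esub> (y \<otimes>\<^bsub>R\<^esub> x \<otimes>\<^bsub>R\<^esub> b)"
      using cl xyc e_closed e_comm [of "theta (x \<otimes>\<^bsub>R\<^esub> y)"] e_comm [of "y \<otimes>\<^bsub>R\<^esub> x"]
      by (simp_all add: m_assoc [symmetric])
    have c: "dd (theta (x \<otimes>\<^bsub>R\<^esub> y) \<otimes>\<^bsub>R\<^esub> a) (e \<otimes>\<^bsub>R\<^esub> b) \<in> carrier E"
      "dd (a \<otimes>\<^bsub>R\<^esub> (y \<otimes>\<^bsub>R\<^esub> x)) (e \<otimes>\<^bsub>R\<^esub> b) \<in> carrier E"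
      "dd a (e \<otimes>\<^bsub>R\<^esub> (y \<otimes>\<^bsub>R\<^esub> x \<otimes>\<^bsub>R\<^esub> b)) \<in> carrier E"
      by (rule dd_closed [OF prod_grade [OF th a] eb], rule dd_closed [OF prod_grade [OF a yx] eb],
          rule dd_closed [OF a e_mult_grade(1) [OF prod_grade [OF yx b]]])
    show ?thesis
      unfolding ga_def 1 dd_e [OF prod_grade [OF th a] b] dd_e [OF prod_grade [OF a yx] b]
        dd_e [OF a prod_grade [OF yx b]]
      using c by (cases "r * (p + q) + p * q") (simp_all add: E.M.minus_add E.M.a_ac)
  qed
  \<comment> \<open>The pairs \<open>(e a, b)\<close> and \<open>(a, e b)\<close> have the same
    product, so the value of \<open>B\<close> and the \<open>tt\<close> term agree for both and only
    \<open>ga\<close> can be compared.\<close>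
  have sym: "ga (e \<otimes>\<^bsub>R\<^esub> a) b = ga a (e \<otimes>\<^bsub>R\<^esub> b)" if a: "a \<in> grade R r" and b: "b \<in> grade R s" for a b
  proof -
    have cl: "a \<in> carrier R" "b \<in> carrier R"
      using a b grade_closed by blast+
    note ea = e_mult_grade(1) [OF a] and eb = e_mult_grade(1) [OF b]
    have "a \<otimes>\<^bsub>R\<^esub> (e \<otimes>\<^bsub>R\<^esub> b) = e \<otimes>\<^bsub>R\<^esub> a \<otimes>\<^bsub>R\<^esub> b"
      using cl e_closed by (simp add: e_comm [of a] m_assoc)
    then have "ga (e \<otimes>\<^bsub>R\<^esub> a) b \<oplus>\<^bsub>E\<^esub> tt (theta (x \<otimes>\<^bsub>R\<^esub> y) \<otimes>\<^bsub>R\<^esub> (e \<otimes>\<^bsub>R\<^esub> a \<otimes>\<^bsub>R\<^esub> b)) =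
        ga a (e \<otimes>\<^bsub>R\<^esub> b) \<oplus>\<^bsub>E\<^esub> tt (theta (x \<otimes>\<^bsub>R\<^esub> y) \<otimes>\<^bsub>R\<^esub> (e \<otimes>\<^bsub>R\<^esub> a \<otimes>\<^bsub>R\<^esub> b))"
      using B [OF ea b] B [OF a eb] by simp
    moreover have "tt (theta (x \<otimes>\<^bsub>R\<^esub> y) \<otimes>\<^bsub>R\<^esub> (e \<otimes>\<^bsub>R\<^esub> a \<otimes>\<^bsub>R\<^esub> b)) \<in> carrier E"
      by (rule tt_closed [OF prod_grade [OF th prod_grade [OF ea b]]])
    ultimately show ?thesis
      using ga_closed [OF ea b] ga_closed [OF a eb] by simp
  qed
  have zero: "ga (e \<otimes>\<^bsub>R\<^esub> a) b = \<zero>\<^bsub>E\<^esub>" if a: "a \<in> grade R r" and b: "b \<in> grade R s" for a b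
    using neg [OF a b] sym [OF a b] ga_closed [OF e_mult_grade(1) [OF a] b]
    by (intro double_zero) simp_all
  \<comment> \<open>Every \<open>a\<close> has the form \<open>e (e' a)\<close>, so vanishing at
    multiples of \<open>e\<close> is enough.\<close>
  have "ga a b = \<zero>\<^bsub>E\<^esub>"
    using zero [OF e_mult_grade(2) [OF a] b] e_e'_mult(1) [of a] a grade_closed by simp
  then show ?thesis
    unfolding ga_def
  proof (rule E.M.diff_zero_eq [rotated 2])
    show "dd (theta (x \<otimes>\<^bsub>R\<^esub> y) \<otimes>\<^bsub>R\<^esub> a) b \<in> carrier E"
      by (rule dd_closed [OF prod_grade [OF th a] b])
  qed (intro E.M.ksign_closed E.M.a_closed E.M.a_inv_closed
      dd_closed [OF prod_grade [OF a yx] b] dd_closed [OF a prod_grade [OF yx b]])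
qed

text \<open>Take \<open>b = 1\<close> in \<open>B_hh_dd\<close>; by \<open>dd_hh\<close> the defect
  terms cancel.\<close>

lemma B_hh_tt:
  assumes x: "x \<in> grade R p" and y: "y \<in> grade R q" and a: "a \<in> grade R r"
  shows "B (hh x y) (ct I1 I2 a) = tt (theta (x \<otimes>\<^bsub>R\<^esub> y) \<otimes>\<^bsub>R\<^esub> a)"
proof -
  note tha = prod_grade [OF theta_grade [OF prod_grade [OF x y]] a]
  have cl: "a \<in> carrier R" "theta (x \<otimes>\<^bsub>R\<^esub> y) \<in> carrier R"
    using a theta_grade [OF prod_grade [OF x y]] grade_closed by blast+
  have "dd (theta (x \<otimes>\<^bsub>R\<^esub> y) \<otimes>\<^bsub>R\<^esub> a) \<one>\<^bsub>R\<^esub> \<in> carrier E" "tt (theta (x \<otimes>\<^bsub>R\<^esub> y) \<otimes>\<^bsub>R\<^esub> a) \<in> carrier E"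
    by (rule dd_closed [OF tha one_grade], rule tt_closed [OF tha])
  then show ?thesis
    using B_hh_dd [OF x y a one_grade] cl
    unfolding dd_hh [OF x y a one_grade, symmetric] by (simp add: E.M.r_neg)
qed

lemma theta_closed: "u \<in> carrier R \<Longrightarrow> theta u \<in> carrier R"
  by (simp add: theta_def)

lemma theta_add:
  "\<lbrakk>u \<in> carrier R; v \<in> carrier R\<rbrakk> \<Longrightarrow> theta (u \<oplus>\<^bsub>R\<^esub> v) = theta u \<oplus>\<^bsub>R\<^esub> theta v"
  by (simp add: theta_def bar_add M.minus_add M.a_ac)

lemma theta_minus: "u \<in> carrier R \<Longrightarrow> theta (\<ominus>\<^bsub>R\<^esub> u) = \<ominus>\<^bsub>R\<^esub> theta u"
  by (simp add: theta_def bar_minus M.minus_add)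

lemma theta_ksign: "u \<in> carrier R \<Longrightarrow> theta (ksign R p u) = ksign R p (theta u)"
  by (cases p) (simp_all add: theta_minus)

text \<open>Up to sign the right side of \<open>dd_hh\<close> depends on \<open>x\<close> and
  \<open>y\<close> only through \<open>yx\<close>. Comparing the pairs \<open>(x, y)\<close> and
  \<open>(1, yx)\<close> shows that the defect kills \<open>theta u\<close> for the commutator
  \<open>u\<close>. Replacing \<open>x\<close> by \<open>e x\<close> and \<open>a\<close> by
  \<open>e' a\<close> shows that it kills \<open>u + bar u\<close> as well; the two statements add
  up to twice the claim.\<close>

lemma dd_commutator:
  assumes x: "x \<in> grade R p" and y: "y \<in> grade R q" and a: "a \<in> grade R r" and b: "b \<in> grade R s"
  shows "dd ((x \<otimes>\<^bsub>R\<^esub> y \<oplus>\<^bsub>R\<^esub> \<ominus>\<^bsub>R\<^esub> ksign R (p * q) (y \<otimes>\<^bsub>R\<^esub> x)) \<otimes>\<^bsub>R\<^esub> a) b = \<zero>\<^bsub>E\<^esub>"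
proof -
  \<comment> \<open>Stated for varying \<open>x\<close>, \<open>u\<close> and \<open>a\<close>,
    because it is used for \<open>x\<close> itself and for \<open>e x\<close> together with
    \<open>e' a\<close>.\<close>
  have skew: "dd (theta u \<otimes>\<^bsub>R\<^esub> a) b = \<zero>\<^bsub>E\<^esub>"
    if x: "x \<in> grade R p" and u: "u = x \<otimes>\<^bsub>R\<^esub> y \<oplus>\<^bsub>R\<^esub> \<ominus>\<^bsub>R\<^esub> ksign R (p * q) (y \<otimes>\<^bsub>R\<^esub> x)"
      and a: "a \<in> grade R r" for x u a
  proof -
    have cl: "x \<in> carrier R" "y \<in> carrier R" "a \<in> carrier R"
      using x y a grade_closed by blast+
    note yx = prod_grade [OF y x] and xy = prod_grade [OF x y]
    note c = dd_closed [OF prod_grade [OF a yx] b] dd_closed [OF a prod_grade [OF yx b]]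
    have "dd (theta (x \<otimes>\<^bsub>R\<^esub> y) \<otimes>\<^bsub>R\<^esub> a) b = ksign E (p * q) (dd (theta (y \<otimes>\<^bsub>R\<^esub> x) \<otimes>\<^bsub>R\<^esub> a) b)"
      using dd_hh [OF x y a b] dd_hh [OF one_grade yx a b] c cl
      by (simp add: E.M.ksign_ksign ac_simps)
    moreover have "theta u \<otimes>\<^bsub>R\<^esub> a = theta (x \<otimes>\<^bsub>R\<^esub> y) \<otimes>\<^bsub>R\<^esub> a \<oplus>\<^bsub>R\<^esub>
        \<ominus>\<^bsub>R\<^esub> ksign R (p * q) (theta (y \<otimes>\<^bsub>R\<^esub> x) \<otimes>\<^bsub>R\<^esub> a)"
      using cl theta_closed
      by (simp add: u theta_add theta_minus theta_ksign l_distr l_minus prod_ksign_left)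
    moreover have "theta (x \<otimes>\<^bsub>R\<^esub> y) \<otimes>\<^bsub>R\<^esub> a \<in> grade R (p + q + r)"
      "theta (y \<otimes>\<^bsub>R\<^esub> x) \<otimes>\<^bsub>R\<^esub> a \<in> grade R (p + q + r)"
      using prod_grade [OF theta_grade [OF xy] a] prod_grade [OF theta_grade [OF yx] a]
      by (simp_all add: ac_simps)
    ultimately show ?thesis
      using dd_closed [OF _ b] b
      by (simp add: dd_add [OF _ grade_minus [OF grade_ksign] b] dd_minus [OF grade_ksign]
          dd_ksign E.M.r_neg)
  qed
  define u where "u = x \<otimes>\<^bsub>R\<^esub> y \<oplus>\<^bsub>R\<^esub> \<ominus>\<^bsub>R\<^esub> ksign R (p * q) (y \<otimes>\<^bsub>R\<^esub> x)"
  have u: "u \<in> grade R (p + q)"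
    using supercommutator_grade [OF x y] by (simp add: u_def a_minus_def)
  have cl: "x \<in> carrier R" "y \<in> carrier R" "a \<in> carrier R" "u \<in> carrier R"
    using x y a u grade_closed by blast+
  note ua = prod_grade [OF u a] and bua = prod_grade [OF bar_grade [OF u] a]
  have 1: "dd (theta u \<otimes>\<^bsub>R\<^esub> a) b = \<zero>\<^bsub>E\<^esub>"
    by (rule skew [OF x u_def a])
  have eu: "e \<otimes>\<^bsub>R\<^esub> u = (e \<otimes>\<^bsub>R\<^esub> x) \<otimes>\<^bsub>R\<^esub> y \<oplus>\<^bsub>R\<^esub> \<ominus>\<^bsub>R\<^esub> ksign R (p * q) (y \<otimes>\<^bsub>R\<^esub> (e \<otimes>\<^bsub>R\<^esub> x))"
  proof -
    have "e \<otimes>\<^bsub>R\<^esub> y = y \<otimes>\<^bsub>R\<^esub> e" using e_comm cl by simp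
    then have "y \<otimes>\<^bsub>R\<^esub> (e \<otimes>\<^bsub>R\<^esub> x) = e \<otimes>\<^bsub>R\<^esub> (y \<otimes>\<^bsub>R\<^esub> x)"
      using cl e_closed by (simp add: m_assoc [symmetric])
    then show ?thesis
      using cl e_closed by (simp add: u_def r_distr r_minus prod_ksign_right m_assoc)
  qed
  have 2: "dd (theta (e \<otimes>\<^bsub>R\<^esub> u) \<otimes>\<^bsub>R\<^esub> (e' \<otimes>\<^bsub>R\<^esub> a)) b = \<zero>\<^bsub>E\<^esub>"
    by (rule skew [OF e_mult_grade(1) [OF x] eu e_mult_grade(2) [OF a]])
  \<comment> \<open>As \<open>bar e = -e\<close>, the skew part of \<open>e u\<close> contains the
    symmetric part of \<open>u\<close>; the factor \<open>e'\<close> then removes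
    \<open>e\<close>.\<close>
  have 3: "theta (e \<otimes>\<^bsub>R\<^esub> u) \<otimes>\<^bsub>R\<^esub> (e' \<otimes>\<^bsub>R\<^esub> a) = u \<otimes>\<^bsub>R\<^esub> a \<oplus>\<^bsub>R\<^esub> bar u \<otimes>\<^bsub>R\<^esub> a"
  proof -
    have "bar (e \<otimes>\<^bsub>R\<^esub> u) = bar u \<otimes>\<^bsub>R\<^esub> \<ominus>\<^bsub>R\<^esub> e"
      using bar_mult [OF e_even u] by (simp add: e_skew)
    then have "theta (e \<otimes>\<^bsub>R\<^esub> u) = e \<otimes>\<^bsub>R\<^esub> u \<oplus>\<^bsub>R\<^esub> bar u \<otimes>\<^bsub>R\<^esub> e"
      using cl e_closed by (simp add: theta_def r_minus)
    then have "theta (e \<otimes>\<^bsub>R\<^esub> u) = u \<otimes>\<^bsub>R\<^esub> e \<oplus>\<^bsub>R\<^esub> bar u \<otimes>\<^bsub>R\<^esub> e"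
      using cl by (simp add: e_comm)
    then show ?thesis
      using cl e_closed e'_closed by (simp add: l_distr m_assoc e_e'_mult)
  qed
  have th: "theta u \<otimes>\<^bsub>R\<^esub> a = u \<otimes>\<^bsub>R\<^esub> a \<oplus>\<^bsub>R\<^esub> \<ominus>\<^bsub>R\<^esub> (bar u \<otimes>\<^bsub>R\<^esub> a)"
    using cl by (simp add: theta_def l_distr l_minus)
  have c: "dd (u \<otimes>\<^bsub>R\<^esub> a) b \<in> carrier E" "dd (bar u \<otimes>\<^bsub>R\<^esub> a) b \<in> carrier E"
    by (rule dd_closed [OF ua b], rule dd_closed [OF bua b])
  have "dd (u \<otimes>\<^bsub>R\<^esub> a) b \<oplus>\<^bsub>E\<^esub> \<ominus>\<^bsub>E\<^esub> dd (bar u \<otimes>\<^bsub>R\<^esub> a) b = \<zero>\<^bsub>E\<^esub>"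
    using 1 unfolding th dd_add [OF ua grade_minus [OF bua] b] dd_minus [OF bua b] .
  then have 4: "dd (u \<otimes>\<^bsub>R\<^esub> a) b = dd (bar u \<otimes>\<^bsub>R\<^esub> a) b"
    by (rule E.M.diff_zero_eq [OF c])
  have "dd (u \<otimes>\<^bsub>R\<^esub> a) b \<oplus>\<^bsub>E\<^esub> dd (bar u \<otimes>\<^bsub>R\<^esub> a) b = \<zero>\<^bsub>E\<^esub>"
    using 2 unfolding 3 dd_add [OF ua bua b] .
  then have "dd (u \<otimes>\<^bsub>R\<^esub> a) b \<oplus>\<^bsub>E\<^esub> dd (u \<otimes>\<^bsub>R\<^esub> a) b = \<zero>\<^bsub>E\<^esub>"
    by (simp only: 4)
  then show ?thesis
    using E.two_torsion_free [OF two c(1)] by (simp add: u_def)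
qed

text \<open>\<open>dd_hh\<close> with \<open>x = 1\<close> relates \<open>y a\<close>,
  \<open>bar y a\<close> and \<open>a y\<close>. By \<open>dd_commutator\<close> the left factors
  may be moved behind \<open>a\<close>; the terms with \<open>a y\<close> cancel, and
  \<open>y\<close> can pass from the second argument to the first at the price of
  \<open>bar\<close>. Moving all of \<open>b\<close> in this way leaves 1 behind.\<close>

lemma dd_one:
  assumes a: "a \<in> grade R p" and b: "b \<in> grade R q"
  shows "dd a b = dd (a \<otimes>\<^bsub>R\<^esub> bar b) \<one>\<^bsub>R\<^esub>"
proof -
  have sw: "dd (a \<otimes>\<^bsub>R\<^esub> bar y) b = dd a (y \<otimes>\<^bsub>R\<^esub> b)" if y: "y \<in> grade R q" and b: "b \<in> grade R s" for y b q s
  proof -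
    have cl: "a \<in> carrier R" "y \<in> carrier R" "bar y \<in> carrier R" "b \<in> carrier R"
      using a y b grade_closed by auto
    note yb = bar_grade [OF y]
    have comm: "dd (z \<otimes>\<^bsub>R\<^esub> a) b = ksign E (q * p) (dd (a \<otimes>\<^bsub>R\<^esub> z) b)" if z: "z \<in> grade R q" for z
    proof -
      have zc: "z \<in> carrier R" using z grade_closed by blast
      note za = prod_grade [OF z a]
      have az: "a \<otimes>\<^bsub>R\<^esub> z \<in> grade R (q + p)"
        using prod_grade [OF a z] by (simp add: add.commute)
      have "dd (z \<otimes>\<^bsub>R\<^esub> a \<oplus>\<^bsub>R\<^esub> \<ominus>\<^bsub>R\<^esub> ksign R (q * p) (a \<otimes>\<^bsub>R\<^esub> z)) b = \<zero>\<^bsub>E\<^esub>"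
        using dd_commutator [OF z a one_grade b] zc cl by simp
      then have "dd (z \<otimes>\<^bsub>R\<^esub> a) b \<oplus>\<^bsub>E\<^esub> \<ominus>\<^bsub>E\<^esub> ksign E (q * p) (dd (a \<otimes>\<^bsub>R\<^esub> z) b) = \<zero>\<^bsub>E\<^esub>"
        unfolding dd_add [OF za grade_minus [OF grade_ksign [OF az]] b]
          dd_minus [OF grade_ksign [OF az] b] dd_ksign [OF az b] .
      then show ?thesis
        by (rule E.M.diff_zero_eq [OF dd_closed [OF za b] E.M.ksign_closed [OF dd_closed [OF az b]]])
    qed
    note ya = prod_grade [OF y a] and bya = prod_grade [OF yb a]
    have c: "dd (a \<otimes>\<^bsub>R\<^esub> y) b \<in> carrier E" "dd (a \<otimes>\<^bsub>R\<^esub> bar y) b \<in> carrier E" "dd a (y \<otimes>\<^bsub>R\<^esub> b) \<in> carrier E"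
      by (rule dd_closed [OF prod_grade [OF a y] b], rule dd_closed [OF prod_grade [OF a yb] b],
          rule dd_closed [OF a prod_grade [OF y b]])
    have th: "theta (\<one>\<^bsub>R\<^esub> \<otimes>\<^bsub>R\<^esub> y) \<otimes>\<^bsub>R\<^esub> a = y \<otimes>\<^bsub>R\<^esub> a \<oplus>\<^bsub>R\<^esub> \<ominus>\<^bsub>R\<^esub> (bar y \<otimes>\<^bsub>R\<^esub> a)"
      using cl by (simp add: theta_def l_distr l_minus)
    have "dd (y \<otimes>\<^bsub>R\<^esub> a) b \<oplus>\<^bsub>E\<^esub> \<ominus>\<^bsub>E\<^esub> dd (bar y \<otimes>\<^bsub>R\<^esub> a) b =
        ksign E (p * q) (dd (a \<otimes>\<^bsub>R\<^esub> y) b \<oplus>\<^bsub>E\<^esub> \<ominus>\<^bsub>E\<^esub> dd a (y \<otimes>\<^bsub>R\<^esub> b))"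
      using dd_hh [OF one_grade y a b] cl
      unfolding th dd_add [OF ya grade_minus [OF bya] b] dd_minus [OF bya b] by simp
    then have "ksign E (q * p) (dd (a \<otimes>\<^bsub>R\<^esub> y) b) \<oplus>\<^bsub>E\<^esub> \<ominus>\<^bsub>E\<^esub> ksign E (q * p) (dd (a \<otimes>\<^bsub>R\<^esub> bar y) b) =
        ksign E (p * q) (dd (a \<otimes>\<^bsub>R\<^esub> y) b \<oplus>\<^bsub>E\<^esub> \<ominus>\<^bsub>E\<^esub> dd a (y \<otimes>\<^bsub>R\<^esub> b))"
      unfolding comm [OF y] comm [OF yb] .
    then have "ksign E (p * q) (ksign E (q * p) (dd (a \<otimes>\<^bsub>R\<^esub> y) b) \<oplus>\<^bsub>E\<^esub>
        \<ominus>\<^bsub>E\<^esub> ksign E (q * p) (dd (a \<otimes>\<^bsub>R\<^esub> bar y) b)) =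
        ksign E (p * q) (ksign E (p * q) (dd (a \<otimes>\<^bsub>R\<^esub> y) b \<oplus>\<^bsub>E\<^esub> \<ominus>\<^bsub>E\<^esub> dd a (y \<otimes>\<^bsub>R\<^esub> b)))"
      by simp
    then have "dd (a \<otimes>\<^bsub>R\<^esub> y) b \<oplus>\<^bsub>E\<^esub> \<ominus>\<^bsub>E\<^esub> dd (a \<otimes>\<^bsub>R\<^esub> bar y) b = dd (a \<otimes>\<^bsub>R\<^esub> y) b \<oplus>\<^bsub>E\<^esub> \<ominus>\<^bsub>E\<^esub> dd a (y \<otimes>\<^bsub>R\<^esub> b)"
      using c by (cases p; cases q) (simp_all add: E.M.minus_add)
    then have "\<ominus>\<^bsub>E\<^esub> dd (a \<otimes>\<^bsub>R\<^esub> bar y) b = \<ominus>\<^bsub>E\<^esub> dd a (y \<otimes>\<^bsub>R\<^esub> b)"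
      using c by simp
    then show ?thesis
      using c by (metis E.M.minus_minus)
  qed
  have "b \<in> carrier R" "a \<in> carrier R"
    using a b grade_closed by blast+
  then show ?thesis
    using sw [OF b one_grade] by simp
qed

lemma bb_formula:
  assumes "a \<in> grade R p" "b \<in> grade R q"
  shows "bb a b = tt (a \<otimes>\<^bsub>R\<^esub> b) \<oplus>\<^bsub>E\<^esub> dd (a \<otimes>\<^bsub>R\<^esub> bar b) \<one>\<^bsub>R\<^esub>"
proof -
  note ab = prod_grade [OF assms] and ab' = prod_grade [OF assms(1) bar_grade [OF assms(2)]]
  show ?thesis
    unfolding bb_dd [OF assms] dd_one [OF assms]
    by (rule E.M.a_comm [OF dd_closed [OF ab' one_grade] tt_closed [OF ab]])
qed

text \<open>Bracketing with \<open>t_12(1)\<close> carries \<open>f_11\<close> to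
  \<open>-f_21\<close> and \<open>g_11\<close> to \<open>-g_12\<close>. Leibniz on
  \<open>h_11(a, b)\<close> thus links the value sought to \<open>bb a b\<close>, while the bracket
  of \<open>t_12(1)\<close> with \<open>h_11(a, b)\<close> is known from
  \<open>B_hh_tt\<close>.\<close>

lemma B_f2_g1:
  assumes a: "a \<in> grade R p" and b: "b \<in> grade R q"
  shows "B (cf I2 a) (cg I1 b) = \<ominus>\<^bsub>E\<^esub> tt (bar (a \<otimes>\<^bsub>R\<^esub> b)) \<oplus>\<^bsub>E\<^esub> \<ominus>\<^bsub>E\<^esub> dd (a \<otimes>\<^bsub>R\<^esub> bar b) \<one>\<^bsub>R\<^esub>"
proof -
  have ne: "I1 \<noteq> I2" by simp
  have cl: "a \<in> carrier R" "b \<in> carrier R"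
    using a b grade_closed by blast+
  note ab = prod_grade [OF a b] and ab' = prod_grade [OF a bar_grade [OF b]]
  note t1 = fam.T_grade [OF ne one_grade]
  have 1: "ct I1 I2 \<one>\<^bsub>R\<^esub> \<otimes>\<^bsub>st\<^esub> cf I1 a = \<ominus>\<^bsub>st\<^esub> cf I2 a"
    using fam.T_F' [OF ne one_grade a] cl by (simp add: bar_one)
  have 2: "ct I1 I2 \<one>\<^bsub>R\<^esub> \<otimes>\<^bsub>st\<^esub> cg I1 b = \<ominus>\<^bsub>st\<^esub> cg I2 b"
    using st.skew' [OF t1 fam.G_grade [OF b]] fam.G_T [OF ne b one_grade] cl by simp
  have c: "cf I2 a \<in> carrier st" "cf I1 a \<in> carrier st" "cg I1 b \<in> carrier st" "cg I2 b \<in> carrier st"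
    by (rule fam.F_closed [OF a] fam.G_closed [OF b])+
  have "B (ct I1 I2 \<one>\<^bsub>R\<^esub>) (hh a b) = \<ominus>\<^bsub>E\<^esub> B (cf I2 a) (cg I1 b) \<oplus>\<^bsub>E\<^esub> \<ominus>\<^bsub>E\<^esub> bb a b"
    unfolding hh_def B_leibniz [OF t1 fam.F_grade [OF a] fam.G_grade [OF b]] 1 2
    using c by (simp add: B_minus)
  moreover have "B (ct I1 I2 \<one>\<^bsub>R\<^esub>) (hh a b) = \<ominus>\<^bsub>E\<^esub> tt (theta (a \<otimes>\<^bsub>R\<^esub> b))"
    using B_skew [OF t1 hh_grade [OF a b one_grade]] B_hh_tt [OF a b one_grade] cl
      theta_grade [OF ab, THEN grade_closed] by simp
  moreover have "tt (theta (a \<otimes>\<^bsub>R\<^esub> b)) = tt (a \<otimes>\<^bsub>R\<^esub> b) \<oplus>\<^bsub>E\<^esub> \<ominus>\<^bsub>E\<^esub> tt (bar (a \<otimes>\<^bsub>R\<^esub> b))"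
    unfolding theta_def tt_add [OF ab grade_minus [OF bar_grade [OF ab]]]
      tt_minus [OF bar_grade [OF ab]] ..
  ultimately have eq: "\<ominus>\<^bsub>E\<^esub> B (cf I2 a) (cg I1 b) \<oplus>\<^bsub>E\<^esub> \<ominus>\<^bsub>E\<^esub> (tt (a \<otimes>\<^bsub>R\<^esub> b) \<oplus>\<^bsub>E\<^esub> dd (a \<otimes>\<^bsub>R\<^esub> bar b) \<one>\<^bsub>R\<^esub>) =
      \<ominus>\<^bsub>E\<^esub> (tt (a \<otimes>\<^bsub>R\<^esub> b) \<oplus>\<^bsub>E\<^esub> \<ominus>\<^bsub>E\<^esub> tt (bar (a \<otimes>\<^bsub>R\<^esub> b)))"
    by (simp only: bb_formula [OF a b])
  \<comment> \<open>The summand \<open>t\<close>, which stands for \<open>tt (ab)\<close>, occurs on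
    both sides and cancels.\<close>
  have solve: "w = \<ominus>\<^bsub>E\<^esub> u \<oplus>\<^bsub>E\<^esub> \<ominus>\<^bsub>E\<^esub> v"
    if "\<ominus>\<^bsub>E\<^esub> w \<oplus>\<^bsub>E\<^esub> \<ominus>\<^bsub>E\<^esub> (t \<oplus>\<^bsub>E\<^esub> v) = \<ominus>\<^bsub>E\<^esub> (t \<oplus>\<^bsub>E\<^esub> \<ominus>\<^bsub>E\<^esub> u)"
      "w \<in> carrier E" "t \<in> carrier E" "u \<in> carrier E" "v \<in> carrier E" for w t u v
  proof -
    have "w = \<ominus>\<^bsub>E\<^esub> (\<ominus>\<^bsub>E\<^esub> w \<oplus>\<^bsub>E\<^esub> \<ominus>\<^bsub>E\<^esub> (t \<oplus>\<^bsub>E\<^esub> v)) \<oplus>\<^bsub>E\<^esub> \<ominus>\<^bsub>E\<^esub> (t \<oplus>\<^bsub>E\<^esub> v)"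
      using that(2-) by algebra
    also have "... = \<ominus>\<^bsub>E\<^esub> u \<oplus>\<^bsub>E\<^esub> \<ominus>\<^bsub>E\<^esub> v"
      unfolding that(1) using that(2-) by algebra
    finally show ?thesis .
  qed
  show ?thesis
    by (rule solve [OF eq B_closed [OF c(1,3)] tt_closed [OF ab] tt_closed [OF bar_grade [OF ab]]
          dd_closed [OF ab' one_grade]])
qed

section \<open>Normalization by a grading element\<close>

definition ss where
  "ss = hh \<one>\<^bsub>R\<^esub> \<one>\<^bsub>R\<^esub>"

lemma ss_grade: "ss \<in> grade st 0"
  using hh_grade [OF one_grade one_grade one_grade] by (simp add: ss_def)

lemma ss_closed: "ss \<in> carrier st"
  by (rule st.grade_closed [OF ss_grade])

lemma theta_one: "theta (\<one>\<^bsub>R\<^esub> \<otimes>\<^bsub>R\<^esub> \<one>\<^bsub>R\<^esub>) = \<zero>\<^bsub>R\<^esub>"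
  by (simp add: theta_def bar_one M.r_neg)

lemma gen_zero: "ct I1 I2 \<zero>\<^bsub>R\<^esub> = \<zero>\<^bsub>st\<^esub>" "cf i \<zero>\<^bsub>R\<^esub> = \<zero>\<^bsub>st\<^esub>"
  using fam.T_smult [of I1 I2 "\<zero>\<^bsub>K\<^esub>" "\<zero>\<^bsub>R\<^esub>" 0] fam.F_smult [of "\<zero>\<^bsub>K\<^esub>" "\<zero>\<^bsub>R\<^esub>" 0 i]
    fam.T_closed [of I1 I2 "\<zero>\<^bsub>R\<^esub>" 0] fam.F_closed [of "\<zero>\<^bsub>R\<^esub>" 0 i] by simp_all

text \<open>The general actions at \<open>x = y = 1\<close>, where \<open>theta\<close> vanishes
  because \<open>bar\<close> fixes 1. The generator \<open>g_11(c)\<close> is reached as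
  \<open>[g_12(c), t_21(1)]\<close>.\<close>

lemma ss_actions:
  assumes c: "c \<in> grade R r"
  shows "ss \<otimes>\<^bsub>st\<^esub> ct I1 I2 c = \<zero>\<^bsub>st\<^esub>" "ss \<otimes>\<^bsub>st\<^esub> cf i c = \<ominus>\<^bsub>st\<^esub> cf i c" "ss \<otimes>\<^bsub>st\<^esub> cg i c = cg i c"
proof -
  have ne: "I1 \<noteq> I2" "I2 \<noteq> I1" by simp_all
  have cl: "c \<in> carrier R" using c grade_closed by blast
  note o = one_grade
  have f: "cf i c \<in> carrier st" "cg i c \<in> carrier st" for i
    by (rule fam.F_closed [OF c], rule fam.G_closed [OF c])
  show t: "ss \<otimes>\<^bsub>st\<^esub> ct I1 I2 c = \<zero>\<^bsub>st\<^esub>"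
    using hh_t [OF o o c] cl by (simp add: ss_def theta_one gen_zero del: r_one l_one)
  have f1: "ss \<otimes>\<^bsub>st\<^esub> cf I1 c = \<ominus>\<^bsub>st\<^esub> cf I1 c"
    using hh_f1 [OF o o c] cl f by (simp add: ss_def theta_one [simplified] gen_zero)
  have f2: "ss \<otimes>\<^bsub>st\<^esub> cf I2 c = \<ominus>\<^bsub>st\<^esub> cf I2 c"
    using hh_f2 [OF o o c] cl by (simp add: ss_def)
  show "ss \<otimes>\<^bsub>st\<^esub> cf i c = \<ominus>\<^bsub>st\<^esub> cf i c"
    using f1 f2 by (cases i) simp_all
  have g2: "ss \<otimes>\<^bsub>st\<^esub> cg I2 c = cg I2 c" if "c \<in> grade R r" for c
    using hh_g2 [OF o o that] grade_closed [OF that] by (simp add: ss_def)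
  have t21: "ss \<otimes>\<^bsub>st\<^esub> ct I2 I1 \<one>\<^bsub>R\<^esub> = \<zero>\<^bsub>st\<^esub>"
  proof -
    have "ss \<otimes>\<^bsub>st\<^esub> ct I1 I2 \<one>\<^bsub>R\<^esub> = \<zero>\<^bsub>st\<^esub>"
      using hh_t [OF o o o] by (simp add: ss_def theta_one [simplified] gen_zero)
    then show ?thesis
      using fam.T_bar [OF ne(2) o] ss_closed fam.T_closed [OF ne(1) o]
      by (simp add: bar_one st.prod_minus_right st.M.minus_zero')
  qed
  have "cg I1 c = cg I2 c \<otimes>\<^bsub>st\<^esub> ct I2 I1 \<one>\<^bsub>R\<^esub>"
    using fam.G_T [OF ne(2) c o] cl by simp
  then have "ss \<otimes>\<^bsub>st\<^esub> cg I1 c = cg I1 c"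
    using st.leibniz [OF ss_grade fam.G_grade [OF c] fam.T_grade [OF ne(2) o]] g2 [OF c] t21 f(2) [of I2]
      f(2) [of I1] by simp
  then show "ss \<otimes>\<^bsub>st\<^esub> cg i c = cg i c"
    using g2 [OF c] by (cases i) simp_all
qed

lemma ss_t:
  assumes "i \<noteq> j" "c \<in> grade R r"
  shows "ss \<otimes>\<^bsub>st\<^esub> ct i j c = \<zero>\<^bsub>st\<^esub>"
proof -
  consider "i = I1" "j = I2" | "i = I2" "j = I1"
    using assms(1) by (cases i; cases j) auto
  then show ?thesis
  proof cases
    case 1
    then show ?thesis using ss_actions(1) [OF assms(2)] by simp
  next
    case 2
    then show ?thesis
      using ss_actions(1) [OF bar_grade [OF assms(2)]] fam.T_bar [OF _ assms(2), of I2 I1] ss_closed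
        fam.T_closed [OF _ bar_grade [OF assms(2)], of I1 I2]
      by (simp add: st.prod_minus_right st.M.minus_zero')
  qed
qed

text \<open>Leibniz with \<open>ss\<close> as first argument: \<open>ss\<close> annihilates
  \<open>t\<close> and scales \<open>f\<close> and \<open>g\<close>, so one of the two terms
  disappears and the other is the value sought up to sign.\<close>

lemma B_tf:
  assumes "i \<noteq> j" "a \<in> grade R p" "b \<in> grade R q"
  shows "B (ct i j a) (cf k b) = \<ominus>\<^bsub>E\<^esub> B ss (ct i j a \<otimes>\<^bsub>st\<^esub> cf k b)"
    "B (cg k b) (ct i j a) = B ss (cg k b \<otimes>\<^bsub>st\<^esub> ct i j a)"
proof -
  have c: "ct i j a \<in> carrier st" "cf k b \<in> carrier st" "cg k b \<in> carrier st"
    by (rule fam.T_closed [OF assms(1,2)], rule fam.F_closed [OF assms(3)], rule fam.G_closed [OF assms(3)])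
  show "B (ct i j a) (cf k b) = \<ominus>\<^bsub>E\<^esub> B ss (ct i j a \<otimes>\<^bsub>st\<^esub> cf k b)"
    unfolding B_leibniz [OF ss_grade fam.T_grade [OF assms(1,2)] fam.F_grade [OF assms(3)]]
      ss_t [OF assms(1,2)] ss_actions(2) [OF assms(3)]
    using c by (simp add: B_zero B_minus)
  show "B (cg k b) (ct i j a) = B ss (cg k b \<otimes>\<^bsub>st\<^esub> ct i j a)"
    unfolding B_leibniz [OF ss_grade fam.G_grade [OF assms(3)] fam.T_grade [OF assms(1,2)]]
      ss_t [OF assms(1,2)] ss_actions(3) [OF assms(3)]
    using c by (simp add: B_zero)
qed

text \<open>Under \<open>ss\<close> the pair of two \<open>f\<close> has total weight -2 and the
  pair of two \<open>g\<close> has weight 2. Their brackets vanish for \<open>i \<noteq> j\<close>,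
  so Leibniz gives a doubled value equal to zero.\<close>

lemma B_ff:
  assumes "i \<noteq> j" "a \<in> grade R p" "b \<in> grade R q"
  shows "B (cf i a) (cf j b) = \<zero>\<^bsub>E\<^esub>" "B (cg i a) (cg j b) = \<zero>\<^bsub>E\<^esub>"
proof -
  have c: "cf i a \<in> carrier st" "cf j b \<in> carrier st" "cg i a \<in> carrier st" "cg j b \<in> carrier st"
    by (rule fam.F_closed [OF assms(2)] fam.F_closed [OF assms(3)] fam.G_closed [OF assms(2)]
        fam.G_closed [OF assms(3)])+
  have "B ss (cf i a \<otimes>\<^bsub>st\<^esub> cf j b) = \<ominus>\<^bsub>E\<^esub> B (cf i a) (cf j b) \<oplus>\<^bsub>E\<^esub> \<ominus>\<^bsub>E\<^esub> B (cf i a) (cf j b)"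
    unfolding B_leibniz [OF ss_grade fam.F_grade [OF assms(2)] fam.F_grade [OF assms(3)]]
      ss_actions(2) [OF assms(2)] ss_actions(2) [OF assms(3)]
    using c by (simp add: B_minus)
  then have "\<ominus>\<^bsub>E\<^esub> B (cf i a) (cf j b) \<oplus>\<^bsub>E\<^esub> \<ominus>\<^bsub>E\<^esub> B (cf i a) (cf j b) = \<zero>\<^bsub>E\<^esub>"
    unfolding fam.F_F [OF assms] B_zero(2) [OF ss_closed] by (rule HOL.sym)
  then have z: "\<ominus>\<^bsub>E\<^esub> B (cf i a) (cf j b) = \<zero>\<^bsub>E\<^esub>"
    by (rule E.two_torsion_free [OF two E.M.a_inv_closed [OF B_closed [OF c(1,2)]]])
  have "B (cf i a) (cf j b) = \<ominus>\<^bsub>E\<^esub> (\<ominus>\<^bsub>E\<^esub> B (cf i a) (cf j b))"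
    using c by simp
  then show "B (cf i a) (cf j b) = \<zero>\<^bsub>E\<^esub>"
    unfolding z by (simp only: E.M.minus_zero')
  have "B ss (cg i a \<otimes>\<^bsub>st\<^esub> cg j b) = B (cg i a) (cg j b) \<oplus>\<^bsub>E\<^esub> B (cg i a) (cg j b)"
    unfolding B_leibniz [OF ss_grade fam.G_grade [OF assms(2)] fam.G_grade [OF assms(3)]]
      ss_actions(3) [OF assms(2)] ss_actions(3) [OF assms(3)]
    using c by simp
  then have "B (cg i a) (cg j b) \<oplus>\<^bsub>E\<^esub> B (cg i a) (cg j b) = \<zero>\<^bsub>E\<^esub>"
    unfolding fam.G_G [OF assms] B_zero(2) [OF ss_closed] by (rule HOL.sym)
  then show "B (cg i a) (cg j b) = \<zero>\<^bsub>E\<^esub>"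
    by (rule E.two_torsion_free [OF two B_closed [OF c(3,4)]])
qed

end

section \<open>Central extensions of the Steinberg algebra\<close>

context skew_unit
begin

abbreviation "Hat \<equiv> sto_hat K R bar"
abbreviation "be \<equiv> sto_beta K R bar"

lemma be_cocycle: "super_2cocycle K st CQ be"
  using sto_beta_cocycle by (simp add: sto_cocycle_def)

text \<open>The equations for arbitrary cocycles apply to the given one, with the quotient by
  \<open>[R,R]R\<close> as coefficient module.\<close>

sublocale be: sto_2cocycle K R bar e CQ be
  by unfold_locales (rule be_cocycle)

lemma Hat_eq: "Hat = pair_algebra st CQ (\<lambda>(x, c) (y, c'). (x \<otimes>\<^bsub>st\<^esub> y, be x y))"
  by (simp add: sto_hat_def cocycle_extension_eq)

lemma Hat_lie: "lie_superalgebra K Hat"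
  unfolding sto_hat_def
  by (rule cocycle_extension_lie [OF st.lie_superalgebra_axioms CQ.supermodule_axioms be_cocycle])

lemma Hat_simps:
  "carrier Hat = carrier st \<times> carrier CQ"
  "\<zero>\<^bsub>Hat\<^esub> = (\<zero>\<^bsub>st\<^esub>, \<zero>\<^bsub>CQ\<^esub>)"
  "(x, c) \<otimes>\<^bsub>Hat\<^esub> (y, d) = (x \<otimes>\<^bsub>st\<^esub> y, be x y)"
  "(x, c) \<oplus>\<^bsub>Hat\<^esub> (y, d) = (x \<oplus>\<^bsub>st\<^esub> y, c \<oplus>\<^bsub>CQ\<^esub> d)"
  "k \<odot>\<^bsub>Hat\<^esub> (x, c) = (k \<odot>\<^bsub>st\<^esub> x, k \<odot>\<^bsub>CQ\<^esub> c)"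
  "grade Hat p = grade st p \<times> grade CQ p"
  unfolding Hat_eq by simp_all

lemma Hat_minus: "\<lbrakk>x \<in> carrier st; c \<in> carrier CQ\<rbrakk> \<Longrightarrow> \<ominus>\<^bsub>Hat\<^esub> (x, c) = (\<ominus>\<^bsub>st\<^esub> x, \<ominus>\<^bsub>CQ\<^esub> c)"
proof -
  interpret P: supermodule_pair K st CQ ..
  show "\<lbrakk>x \<in> carrier st; c \<in> carrier CQ\<rbrakk> \<Longrightarrow> \<ominus>\<^bsub>Hat\<^esub> (x, c) = (\<ominus>\<^bsub>st\<^esub> x, \<ominus>\<^bsub>CQ\<^esub> c)"
    unfolding Hat_eq by (rule P.pair_minus)
qed

lemma be_fg:
  assumes "a \<in> grade R p" "b \<in> grade R q"
  shows "be (cf I1 a) (cg I2 b) = cp (a \<otimes>\<^bsub>R\<^esub> bar b)"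
    "be (cf I2 a) (cg I1 b) = \<ominus>\<^bsub>CQ\<^esub> cp (a \<otimes>\<^bsub>R\<^esub> bar b)"
  using sto_beta_cocycle assms unfolding sto_cocycle_def by blast+

text \<open>\<open>ss\<close> is \<open>h_11(1, 1)\<close>, a member of \<open>sto_B0\<close>, on
  which the cocycle is prescribed to vanish.\<close>

lemma be_ss:
  assumes "a \<in> homogeneous R"
  shows "be be.ss (cf i a) = \<zero>\<^bsub>CQ\<^esub>" "be be.ss (cg i a) = \<zero>\<^bsub>CQ\<^esub>"
proof -
  have "be.ss = sto_h K R bar I1 \<one>\<^bsub>R\<^esub> \<one>\<^bsub>R\<^esub>"
    by (simp add: be.ss_def hh_def sto_h_def)
  then have "be.ss \<in> sto_B0 K R bar"
    using homI [OF one_grade] unfolding sto_B0_def by blast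
  moreover have "cf i a \<in> sto_B K R bar" "cg i a \<in> sto_B K R bar"
    using assms unfolding sto_B_def by blast+
  ultimately show "be be.ss (cf i a) = \<zero>\<^bsub>CQ\<^esub>" "be be.ss (cg i a) = \<zero>\<^bsub>CQ\<^esub>"
    using sto_beta_cocycle [unfolded sto_cocycle_def, THEN conjunct2, THEN conjunct1] by simp_all
qed

text \<open>By \<open>B_tf\<close> these values reduce to values at \<open>ss\<close>, which are
  zero. This treats \<open>t_21\<close> along with \<open>t_12\<close>, although only the latter
  belongs to the spanning set.\<close>

lemma be_tf:
  assumes ij: "i \<noteq> j" and a: "a \<in> grade R p" and b: "b \<in> grade R q"
  shows "be (ct i j a) (cf j b) = \<zero>\<^bsub>CQ\<^esub>" "be (ct i j a) (cf i b) = \<zero>\<^bsub>CQ\<^esub>"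
    "be (cg i b) (ct i j a) = \<zero>\<^bsub>CQ\<^esub>" "be (cg j b) (ct i j a) = \<zero>\<^bsub>CQ\<^esub>"
proof -
  note h = homI [OF prod_grade [OF a b]] homI [OF prod_grade [OF bar_grade [OF a] b]]
    homI [OF prod_grade [OF b a]] homI [OF prod_grade [OF b bar_grade [OF a]]]
  have c: "cf j (bar a \<otimes>\<^bsub>R\<^esub> b) \<in> carrier st" "cg i (b \<otimes>\<^bsub>R\<^esub> bar a) \<in> carrier st"
    by (rule fam.F_closed [OF prod_grade [OF bar_grade [OF a] b]],
        rule fam.G_closed [OF prod_grade [OF b bar_grade [OF a]]])
  show "be (ct i j a) (cf j b) = \<zero>\<^bsub>CQ\<^esub>"
    unfolding be.B_tf(1) [OF ij a b] fam.T_F [OF ij a b] be_ss(1) [OF h(1)]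
    by (rule CQ.M.minus_zero')
  show "be (ct i j a) (cf i b) = \<zero>\<^bsub>CQ\<^esub>"
    unfolding be.B_tf(1) [OF ij a b] fam.T_F' [OF ij a b]
      be.B_minus(2) [OF be.ss_closed c(1)] be_ss(1) [OF h(2)]
    by (simp only: CQ.M.minus_zero')
  show "be (cg i b) (ct i j a) = \<zero>\<^bsub>CQ\<^esub>"
    unfolding be.B_tf(2) [OF ij a b] fam.G_T [OF ij b a] by (rule be_ss(2) [OF h(3)])
  show "be (cg j b) (ct i j a) = \<zero>\<^bsub>CQ\<^esub>"
    unfolding be.B_tf(2) [OF ij a b] fam.G_T' [OF ij b a]
      be.B_minus(2) [OF be.ss_closed c(2)] be_ss(2) [OF h(4)]
    by (simp only: CQ.M.minus_zero')
qed

lemma Hat_central_extension: "central_extension K Hat st sto_hat_proj"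
  unfolding central_extension_def
proof (intro conjI Hat_lie st.lie_superalgebra_axioms)
  show "sto_hat_proj \<in> lie_hom K Hat st"
    unfolding lie_hom_def sto_hat_proj_def by (auto simp: Hat_simps)
  show "sto_hat_proj ` carrier Hat = carrier st"
    unfolding sto_hat_proj_def Hat_simps by (force intro: CQ.M.zero_closed)
  show "{x \<in> carrier Hat. sto_hat_proj x = \<zero>\<^bsub>st\<^esub>} \<subseteq> lie_center Hat"
    unfolding lie_center_def sto_hat_proj_def by (auto simp: Hat_simps be.B_zero)
qed

end

section \<open>The cocycle of a central extension\<close>

locale sto_extension = skew_unit K R bar e
  for K :: "('k, 'n) ring_scheme" (structure)
    and R :: "('k, 'r, 'm) superalgebra_scheme" (structure)
    and bar :: "'r \<Rightarrow> 'r" and e :: 'r +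
  fixes E :: "('k, 'e) superalgebra" and \<phi> :: "'e \<Rightarrow> ('k, 'r sto_gen) lie_term set"
  assumes central_ext: "central_extension K E st \<phi>"
begin

sublocale E: lie_superalgebra K E
  using central_ext by (simp add: central_extension_def)

lemma phi_hom: "\<phi> \<in> lie_hom K E st"
  using central_ext by (simp add: central_extension_def)

lemma phi_closed [simp]: "u \<in> carrier E \<Longrightarrow> \<phi> u \<in> carrier st"
  using phi_hom by (auto simp: lie_hom_def)

lemma phi_add: "\<lbrakk>u \<in> carrier E; v \<in> carrier E\<rbrakk> \<Longrightarrow> \<phi> (u \<oplus>\<^bsub>E\<^esub> v) = \<phi> u \<oplus>\<^bsub>st\<^esub> \<phi> v"
  using phi_hom by (auto simp: lie_hom_def)

lemma phi_smult: "\<lbrakk>c \<in> carrier K; v \<in> carrier E\<rbrakk> \<Longrightarrow> \<phi> (c \<odot>\<^bsub>E\<^esub> v) = c \<odot>\<^bsub>st\<^esub> \<phi> v"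
  using phi_hom by (auto simp: lie_hom_def)

lemma phi_mult: "\<lbrakk>u \<in> carrier E; v \<in> carrier E\<rbrakk> \<Longrightarrow> \<phi> (u \<otimes>\<^bsub>E\<^esub> v) = \<phi> u \<otimes>\<^bsub>st\<^esub> \<phi> v"
  using phi_hom by (auto simp: lie_hom_def)

lemma phi_grade: "u \<in> grade E p \<Longrightarrow> \<phi> u \<in> grade st p"
  using phi_hom by (auto simp: lie_hom_def)

lemma phi_minus: "v \<in> carrier E \<Longrightarrow> \<phi> (\<ominus>\<^bsub>E\<^esub> v) = \<ominus>\<^bsub>st\<^esub> \<phi> v"
  using phi_smult [of "\<ominus>\<^bsub>K\<^esub> \<one>\<^bsub>K\<^esub>" v] by (simp add: E.smult_l_minus st.smult_l_minus)

lemma phi_zero: "\<phi> \<zero>\<^bsub>E\<^esub> = \<zero>\<^bsub>st\<^esub>"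
  using phi_smult [of "\<zero>\<^bsub>K\<^esub>" "\<zero>\<^bsub>E\<^esub>"] by simp

lemma phi_component:
  assumes "u \<in> carrier E"
  shows "\<phi> (component E p u) = component st p (\<phi> u)"
proof -
  have "\<phi> u = \<phi> (component E p u) \<oplus>\<^bsub>st\<^esub> \<phi> (component E (p + 1) u)"
    using assms E.component_sum [OF assms, of p] phi_add by (metis E.component_closed)
  then show ?thesis
    using st.component_eqI [OF phi_grade [OF E.component_grade [OF assms]]
        phi_grade [OF E.component_grade [OF assms]]] by simp
qed

text \<open>\<open>lie_center\<close> demands vanishing on one side only, and skew symmetry needs
  homogeneous arguments. As \<open>\<phi>\<close> respects degrees, the components of
  \<open>z\<close> lie in the kernel too, which gives the other side.\<close>

lemma kernel_central:
  assumes z: "z \<in> carrier E" "\<phi> z = \<zero>\<^bsub>st\<^esub>" and x: "x \<in> carrier E"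
  shows "z \<otimes>\<^bsub>E\<^esub> x = \<zero>\<^bsub>E\<^esub>" "x \<otimes>\<^bsub>E\<^esub> z = \<zero>\<^bsub>E\<^esub>"
proof -
  have L: "z \<otimes>\<^bsub>E\<^esub> x = \<zero>\<^bsub>E\<^esub>" if "z \<in> carrier E" "\<phi> z = \<zero>\<^bsub>st\<^esub>" "x \<in> carrier E" for z x
    using central_ext that unfolding central_extension_def lie_center_def by blast
  show "z \<otimes>\<^bsub>E\<^esub> x = \<zero>\<^bsub>E\<^esub>"
    by (rule L [OF assms])
  have zc: "\<phi> (component E p z) = \<zero>\<^bsub>st\<^esub>" for p
    using phi_component [OF z(1)] z(2) st.component_homogeneous [of "\<zero>\<^bsub>st\<^esub>" p] by simp
  have hom: "x \<otimes>\<^bsub>E\<^esub> component E q z = \<zero>\<^bsub>E\<^esub>" if "x \<in> grade E p" for x p q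
    using E.skew' [OF that E.component_grade [OF z(1)]]
      L [OF E.component_closed [OF z(1)] zc E.grade_closed [OF that]] by simp
  have hom': "x \<otimes>\<^bsub>E\<^esub> component E q z = \<zero>\<^bsub>E\<^esub>" for q
    using x
  proof (induction rule: E.homogeneous_induct)
    case (homogeneous p x)
    then show ?case by (rule hom)
  next
    case (add x y)
    then show ?case using z(1) by (simp add: E.prod_add_left)
  qed
  have "x \<otimes>\<^bsub>E\<^esub> z = x \<otimes>\<^bsub>E\<^esub> (component E 0 z \<oplus>\<^bsub>E\<^esub> component E 1 z)"
    using z(1) by (simp only: E.component_sum01)
  also have "... = \<zero>\<^bsub>E\<^esub>"
    using x z(1) by (simp add: E.prod_add_right hom')
  finally show "x \<otimes>\<^bsub>E\<^esub> z = \<zero>\<^bsub>E\<^esub>" .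
qed

lemma bracket_cong:
  assumes "u \<in> carrier E" "u' \<in> carrier E" "v \<in> carrier E" "v' \<in> carrier E"
    and "\<phi> u = \<phi> u'" "\<phi> v = \<phi> v'"
  shows "u \<otimes>\<^bsub>E\<^esub> v = u' \<otimes>\<^bsub>E\<^esub> v'"
proof -
  have zero: "a \<otimes>\<^bsub>E\<^esub> c = b \<otimes>\<^bsub>E\<^esub> c \<and> c \<otimes>\<^bsub>E\<^esub> a = c \<otimes>\<^bsub>E\<^esub> b"
    if "a \<in> carrier E" "b \<in> carrier E" "c \<in> carrier E" "\<phi> a = \<phi> b" for a b c
  proof -
    have k: "\<phi> (a \<oplus>\<^bsub>E\<^esub> \<ominus>\<^bsub>E\<^esub> b) = \<zero>\<^bsub>st\<^esub>" "a \<oplus>\<^bsub>E\<^esub> \<ominus>\<^bsub>E\<^esub> b \<in> carrier E"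
      using that by (simp_all add: phi_add phi_minus st.M.r_neg)
    have "a \<otimes>\<^bsub>E\<^esub> c \<oplus>\<^bsub>E\<^esub> \<ominus>\<^bsub>E\<^esub> (b \<otimes>\<^bsub>E\<^esub> c) = \<zero>\<^bsub>E\<^esub>" "c \<otimes>\<^bsub>E\<^esub> a \<oplus>\<^bsub>E\<^esub> \<ominus>\<^bsub>E\<^esub> (c \<otimes>\<^bsub>E\<^esub> b) = \<zero>\<^bsub>E\<^esub>"
      using kernel_central [OF k(2,1) that(3)] that
      by (simp_all add: E.prod_add_left E.prod_add_right E.prod_minus_left E.prod_minus_right)
    moreover have "a \<otimes>\<^bsub>E\<^esub> c \<in> carrier E" "b \<otimes>\<^bsub>E\<^esub> c \<in> carrier E" "c \<otimes>\<^bsub>E\<^esub> a \<in> carrier E"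
      "c \<otimes>\<^bsub>E\<^esub> b \<in> carrier E"
      using that E.prod_closed by blast+
    ultimately show ?thesis
      using E.M.diff_zero_eq by blast
  qed
  have "u \<otimes>\<^bsub>E\<^esub> v = u' \<otimes>\<^bsub>E\<^esub> v"
    using zero [OF assms(1,2,3,5)] by blast
  also have "... = u' \<otimes>\<^bsub>E\<^esub> v'"
    using zero [OF assms(3,4,2,6)] by blast
  finally show ?thesis .
qed

text \<open>A set-theoretic section, neither linear nor graded. By \<open>bracket_cong\<close>
  brackets of lifts do not depend on the choice.\<close>

definition lift :: "('k, 'r sto_gen) lie_term set \<Rightarrow> 'e" where
  "lift x = (SOME u. u \<in> carrier E \<and> \<phi> u = x)"

lemma lift:
  assumes "x \<in> carrier st"
  shows "lift x \<in> carrier E" "\<phi> (lift x) = x"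
proof -
  have "\<phi> ` carrier E = carrier st"
    using central_ext by (simp add: central_extension_def)
  then have "x \<in> \<phi> ` carrier E"
    using assms by (simp only:)
  then have "\<exists>u. u \<in> carrier E \<and> \<phi> u = x"
    by auto
  then have "lift x \<in> carrier E \<and> \<phi> (lift x) = x"
    unfolding lift_def by (rule someI_ex)
  then show "lift x \<in> carrier E" "\<phi> (lift x) = x" by simp_all
qed

lemma homogeneous_lift:
  assumes "x \<in> grade st p"
  obtains u where "u \<in> grade E p" "u \<in> carrier E" "\<phi> u = x"
proof -
  have x: "x \<in> carrier st"
    by (rule st.grade_closed [OF assms])
  show thesis
    using that [of "component E p (lift x)"] E.component_grade [OF lift(1) [OF x]] lift [OF x]
      phi_component [OF lift(1) [OF x]] st.component_homogeneous [OF assms] by simp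
qed

text \<open>Unlike the usual cocycle of an extension, the bracket of lifts is not corrected by a
  lift of the bracket. Its values lie in all of \<open>E\<close>, and it is bilinear without any
  linear section.\<close>

definition BB :: "('k, 'r sto_gen) lie_term set \<Rightarrow> ('k, 'r sto_gen) lie_term set \<Rightarrow> 'e" where
  "BB x y = lift x \<otimes>\<^bsub>E\<^esub> lift y"

lemma BB_phi: "\<lbrakk>u \<in> carrier E; v \<in> carrier E\<rbrakk> \<Longrightarrow> BB (\<phi> u) (\<phi> v) = u \<otimes>\<^bsub>E\<^esub> v"
  unfolding BB_def by (rule bracket_cong) (simp_all add: lift)

lemma phi_BB: "\<lbrakk>x \<in> carrier st; y \<in> carrier st\<rbrakk> \<Longrightarrow> \<phi> (BB x y) = x \<otimes>\<^bsub>st\<^esub> y"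
  by (simp add: BB_def phi_mult lift)

text \<open>With suitable lifts, homogeneous ones where degrees matter, every condition is the
  corresponding axiom of \<open>E\<close>.\<close>

lemma BB_cocycle: "super_2cocycle K st E BB"
  unfolding super_2cocycle_def
proof (intro conjI ballI allI)
  fix x y z p q r c
  {
    assume x: "x \<in> carrier st" and y: "y \<in> carrier st"
    show "BB x y \<in> carrier E"
      using x y by (simp add: BB_def lift E.prod_closed)
    define u v where "u = lift x" and "v = lift y"
    have u: "u \<in> carrier E" "\<phi> u = x" and v: "v \<in> carrier E" "\<phi> v = y"
      using x y by (simp_all add: u_def v_def lift)
    {
      assume z: "z \<in> carrier st"
      define w where "w = lift z"
      have w: "w \<in> carrier E" "\<phi> w = z"
        using z by (simp_all add: w_def lift)
      show "BB (x \<oplus>\<^bsub>st\<^esub> y) z = BB x z \<oplus>\<^bsub>E\<^esub> BB y z" "BB z (x \<oplus>\<^bsub>st\<^esub> y) = BB z x \<oplus>\<^bsub>E\<^esub> BB z y"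
        unfolding u(2) [symmetric] v(2) [symmetric] w(2) [symmetric] phi_add [OF u(1) v(1), symmetric]
        using u(1) v(1) w(1) by (simp_all add: BB_phi E.prod_add_left E.prod_add_right)
    }
    {
      assume c: "c \<in> carrier K"
      show "BB (c \<odot>\<^bsub>st\<^esub> x) y = c \<odot>\<^bsub>E\<^esub> BB x y" "BB x (c \<odot>\<^bsub>st\<^esub> y) = c \<odot>\<^bsub>E\<^esub> BB x y"
        unfolding u(2) [symmetric] v(2) [symmetric] phi_smult [OF c u(1), symmetric]
          phi_smult [OF c v(1), symmetric]
        using u(1) v(1) c by (simp_all add: BB_phi E.prod_smult_left E.prod_smult_right)
    }
  }
  assume x: "x \<in> grade st p" and y: "y \<in> grade st q"
  obtain u where u: "u \<in> grade E p" "u \<in> carrier E" "\<phi> u = x"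
    using x by (rule homogeneous_lift)
  obtain v where v: "v \<in> grade E q" "v \<in> carrier E" "\<phi> v = y"
    using y by (rule homogeneous_lift)
  show "BB x y \<in> grade E (p + q)"
    unfolding u(3) [symmetric] v(3) [symmetric] BB_phi [OF u(2) v(2)]
    by (rule E.prod_grade [OF u(1) v(1)])
  show "BB x y = \<ominus>\<^bsub>E\<^esub> (ksign E (p * q) (BB y x))"
    unfolding u(3) [symmetric] v(3) [symmetric] BB_phi [OF u(2) v(2)] BB_phi [OF v(2) u(2)]
    by (rule E.skew [OF u(1) v(1)])
  assume z: "z \<in> grade st r"
  obtain w where w: "w \<in> grade E r" "w \<in> carrier E" "\<phi> w = z"
    using z by (rule homogeneous_lift)
  note pc = E.prod_closed
  show "ksign E (p * r) (BB (x \<otimes>\<^bsub>st\<^esub> y) z) \<oplus>\<^bsub>E\<^esub> ksign E (q * p) (BB (y \<otimes>\<^bsub>st\<^esub> z) x)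
      \<oplus>\<^bsub>E\<^esub> ksign E (r * q) (BB (z \<otimes>\<^bsub>st\<^esub> x) y) = \<zero>\<^bsub>E\<^esub>"
    unfolding u(3) [symmetric] v(3) [symmetric] w(3) [symmetric] phi_mult [OF u(2) v(2), symmetric]
      phi_mult [OF v(2) w(2), symmetric] phi_mult [OF w(2) u(2), symmetric]
      BB_phi [OF pc [OF u(2) v(2)] w(2)] BB_phi [OF pc [OF v(2) w(2)] u(2)]
      BB_phi [OF pc [OF w(2) u(2)] v(2)]
    by (rule E.jacobi [OF u(1) v(1) w(1)])
qed

sublocale C: sto_2cocycle K R bar e E BB
  by unfold_locales (rule BB_cocycle)

text \<open>Two lifts agree on every bracket by \<open>bracket_cong\<close>, so it suffices to
  obtain enough elements from brackets: the generators and the elements of the kernel. Induction on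
  terms then reaches everything.\<close>

lemma lift_unique:
  assumes f: "f \<in> lie_hom K Hat E" "\<And>m. m \<in> carrier Hat \<Longrightarrow> \<phi> (f m) = fst m"
    and g: "g \<in> lie_hom K Hat E" "\<And>m. m \<in> carrier Hat \<Longrightarrow> \<phi> (g m) = fst m"
    and m: "m \<in> carrier Hat"
  shows "f m = g m"
proof -
  interpret H: lie_superalgebra K Hat by (rule Hat_lie)
  note fh = f(1) [unfolded lie_hom_def] and gh = g(1) [unfolded lie_hom_def]
  have cl: "f m \<in> carrier E" "g m \<in> carrier E" if "m \<in> carrier Hat" for m
    using fh gh that by blast+
  have br: "f (m \<otimes>\<^bsub>Hat\<^esub> m') = g (m \<otimes>\<^bsub>Hat\<^esub> m')" if "m \<in> carrier Hat" "m' \<in> carrier Hat" for m m'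
  proof -
    have "f (m \<otimes>\<^bsub>Hat\<^esub> m') = f m \<otimes>\<^bsub>E\<^esub> f m'" "g (m \<otimes>\<^bsub>Hat\<^esub> m') = g m \<otimes>\<^bsub>E\<^esub> g m'"
      using fh gh that by blast+
    then show ?thesis
      using bracket_cong [OF cl(1) cl(2) cl(1) cl(2), OF that(1) that(1) that(2) that(2)]
        f(2) g(2) that by simp
  qed
  have add: "f (m \<oplus>\<^bsub>Hat\<^esub> m') = g (m \<oplus>\<^bsub>Hat\<^esub> m')"
    if "m \<in> carrier Hat" "m' \<in> carrier Hat" "f m = g m" "f m' = g m'" for m m'
  proof -
    have "f (m \<oplus>\<^bsub>Hat\<^esub> m') = f m \<oplus>\<^bsub>E\<^esub> f m'" "g (m \<oplus>\<^bsub>Hat\<^esub> m') = g m \<oplus>\<^bsub>E\<^esub> g m'"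
      using fh gh that by blast+
    then show ?thesis using that by simp
  qed
  have sm: "f (c \<odot>\<^bsub>Hat\<^esub> m) = g (c \<odot>\<^bsub>Hat\<^esub> m)"
    if "c \<in> carrier K" "m \<in> carrier Hat" "f m = g m" for c m
  proof -
    have "f (c \<odot>\<^bsub>Hat\<^esub> m) = c \<odot>\<^bsub>E\<^esub> f m" "g (c \<odot>\<^bsub>Hat\<^esub> m) = c \<odot>\<^bsub>E\<^esub> g m"
      using fh gh that by blast+
    then show ?thesis using that by simp
  qed
  have diff: "f m = g m"
    if "m \<in> carrier Hat" "m' \<in> carrier Hat" "f (m \<oplus>\<^bsub>Hat\<^esub> m') = g (m \<oplus>\<^bsub>Hat\<^esub> m')" "f m' = g m'" for m m'
  proof -
    have "f (m \<oplus>\<^bsub>Hat\<^esub> m') = f m \<oplus>\<^bsub>E\<^esub> f m'" "g (m \<oplus>\<^bsub>Hat\<^esub> m') = g m \<oplus>\<^bsub>E\<^esub> g m'"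
      using fh gh that by blast+
    then have "f m \<oplus>\<^bsub>E\<^esub> g m' = g m \<oplus>\<^bsub>E\<^esub> g m'"
      using that by simp
    then show ?thesis
      using cl that by simp
  qed
  define Eq where "Eq x c \<longleftrightarrow> f (x, c) = g (x, c)" for x c
  have ne: "I1 \<noteq> I2" "I2 \<noteq> I1" by simp_all
  note z = CQ.M.zero_closed
  have hc: "(x, c) \<in> carrier Hat" if "x \<in> carrier st" "c \<in> carrier CQ" for x c
    using that by (simp add: Hat_simps)
  have EqB: "Eq (x \<otimes>\<^bsub>st\<^esub> y) (be x y)" if "x \<in> carrier st" "y \<in> carrier st" for x y
    using br [OF hc [OF that(1) z] hc [OF that(2) z]] by (simp add: Eq_def Hat_simps)
  \<comment> \<open>The brackets \<open>[t_ij(a), f_j1(1)]\<close> and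
    \<open>[g_1j(a), t_ji(1)]\<close> produce the generators exactly, because the cocycle vanishes
    on these pairs.\<close>
  have cfE: "Eq (cf i a) \<zero>\<^bsub>CQ\<^esub>" "Eq (cg i a) \<zero>\<^bsub>CQ\<^esub>" if a: "a \<in> grade R p" for i a p
  proof -
    obtain j where j: "i \<noteq> j" "j \<noteq> i"
      using ne by (cases i) auto
    have ac: "a \<in> carrier R" by (rule grade_closed [OF a])
    have "Eq (ct i j a \<otimes>\<^bsub>st\<^esub> cf j \<one>\<^bsub>R\<^esub>) (be (ct i j a) (cf j \<one>\<^bsub>R\<^esub>))"
      by (rule EqB [OF fam.T_closed [OF j(1) a] fam.F_closed [OF one_grade]])
    then show "Eq (cf i a) \<zero>\<^bsub>CQ\<^esub>"
      unfolding fam.T_F [OF j(1) a one_grade] be_tf(1) [OF j(1) a one_grade] using ac by simp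
    have "Eq (cg j a \<otimes>\<^bsub>st\<^esub> ct j i \<one>\<^bsub>R\<^esub>) (be (cg j a) (ct j i \<one>\<^bsub>R\<^esub>))"
      by (rule EqB [OF fam.G_closed [OF a] fam.T_closed [OF j(2) one_grade]])
    then show "Eq (cg i a) \<zero>\<^bsub>CQ\<^esub>"
      unfolding fam.G_T [OF j(2) a one_grade] be_tf(3) [OF j(2) one_grade a] using ac by simp
  qed
  have cE0: "Eq \<zero>\<^bsub>st\<^esub> (cp c)" if c: "c \<in> grade R p" for c p
  proof -
    \<comment> \<open>Chosen so that \<open>e bar x = c\<close>; then \<open>bar (e x) = -c\<close>,
      because \<open>e\<close> is central and skew.\<close>
    define x where "x = bar (be.e' \<otimes>\<^bsub>R\<^esub> c)"
    have e'c: "be.e' \<otimes>\<^bsub>R\<^esub> c \<in> grade R p"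
      by (rule be.e_mult_grade(2) [OF c])
    have x: "x \<in> grade R p" "bar x = be.e' \<otimes>\<^bsub>R\<^esub> c"
      using e'c bar_bar [OF grade_closed [OF e'c]] by (simp_all add: x_def bar_grade)
    have cl: "x \<in> carrier R" "c \<in> carrier R" "be.e' \<otimes>\<^bsub>R\<^esub> c \<in> carrier R"
      using x c e'c grade_closed by blast+
    have ex: "e \<otimes>\<^bsub>R\<^esub> bar x = c"
      using cl be.e_e'_mult(1) by (simp add: x(2))
    have bex: "bar (e \<otimes>\<^bsub>R\<^esub> x) = \<ominus>\<^bsub>R\<^esub> c"
      using bar_mult [OF e_even x(1)] cl be.e_closed e_comm [of "bar x"] ex
      by (simp add: e_skew r_minus)
    note exg = be.e_mult_grade(1) [OF x(1)]
    have t: "ct I1 I2 (e \<otimes>\<^bsub>R\<^esub> x) \<in> carrier st"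
      by (rule fam.T_closed [OF ne(1) exg])
    have cc: "cp c \<in> carrier CQ" "cp (\<ominus>\<^bsub>R\<^esub> c) = \<ominus>\<^bsub>CQ\<^esub> cp c"
      using cl by (simp_all add: cp_closed cp_hom)
    have 1: "Eq (ct I1 I2 (e \<otimes>\<^bsub>R\<^esub> x)) (cp c)"
      using EqB [OF fam.F_closed [OF e_even, where i = I1] fam.G_closed [OF x(1), where i = I2]]
      unfolding sto_F_G [OF ne(1) e_even x(1)] be_fg(1) [OF e_even x(1)] ex .
    have 2: "Eq (ct I1 I2 (e \<otimes>\<^bsub>R\<^esub> x)) (\<ominus>\<^bsub>CQ\<^esub> cp c)"
      using EqB [OF fam.F_closed [OF one_grade, where i = I1] fam.G_closed [OF exg, where i = I2]] cl be.e_closed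
      unfolding sto_F_G [OF ne(1) one_grade exg] be_fg(1) [OF one_grade exg] bex
      by (simp add: cc)
    \<comment> \<open>The element \<open>t_12(e x)\<close> arises from two brackets with central
      parts \<open>c\<close> and \<open>-c\<close>. Their difference is twice the kernel element
      sought.\<close>
    have sum: "(\<zero>\<^bsub>st\<^esub>, cp c \<oplus>\<^bsub>CQ\<^esub> cp c) \<oplus>\<^bsub>Hat\<^esub> (ct I1 I2 (e \<otimes>\<^bsub>R\<^esub> x), \<ominus>\<^bsub>CQ\<^esub> cp c) =
        (ct I1 I2 (e \<otimes>\<^bsub>R\<^esub> x), cp c)"
      using t cc by (simp add: Hat_simps CQ.M.a_assoc CQ.M.r_neg)
    have "f (\<zero>\<^bsub>st\<^esub>, cp c \<oplus>\<^bsub>CQ\<^esub> cp c) = g (\<zero>\<^bsub>st\<^esub>, cp c \<oplus>\<^bsub>CQ\<^esub> cp c)"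
      by (rule diff [of _ "(ct I1 I2 (e \<otimes>\<^bsub>R\<^esub> x), \<ominus>\<^bsub>CQ\<^esub> cp c)"], unfold sum)
        (use 1 2 t cc in \<open>simp_all add: Eq_def hc\<close>)
    then have "f (be.half \<odot>\<^bsub>Hat\<^esub> (\<zero>\<^bsub>st\<^esub>, cp c \<oplus>\<^bsub>CQ\<^esub> cp c)) = g (be.half \<odot>\<^bsub>Hat\<^esub> (\<zero>\<^bsub>st\<^esub>, cp c \<oplus>\<^bsub>CQ\<^esub> cp c))"
      by (intro sm be.half_closed hc) (simp_all add: cc)
    then show ?thesis
      using be.half_double [OF cc(1)] be.half_closed by (simp add: Eq_def Hat_simps)
  qed
  have Eq_add: "Eq (x \<oplus>\<^bsub>st\<^esub> y) (c \<oplus>\<^bsub>CQ\<^esub> d)"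
    if "Eq x c" "Eq y d" "x \<in> carrier st" "y \<in> carrier st" "c \<in> carrier CQ" "d \<in> carrier CQ"
    for x y c d
    using add [OF hc hc, of x c y d] that by (simp add: Eq_def Hat_simps)
  have cE: "Eq \<zero>\<^bsub>st\<^esub> c" if c: "c \<in> carrier CQ" for c
  proof -
    obtain r where r: "r \<in> carrier R" "c = cp r"
      using c by (rule CQ.Q_cases)
    have "Eq \<zero>\<^bsub>st\<^esub> (cp r)"
      using r(1)
    proof (induction rule: homogeneous_induct)
      case (homogeneous p x)
      then show ?case by (rule cE0)
    next
      case (add x y)
      then show ?case
        using Eq_add [of "\<zero>\<^bsub>st\<^esub>" "cp x" "\<zero>\<^bsub>st\<^esub>" "cp y"] by (simp add: cp_hom cp_closed)
    qed
    then show ?thesis by (simp add: r(2))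
  qed
  \<comment> \<open>Since the lifts agree on the kernel, the central component may be replaced by
    any other.\<close>
  have change: "Eq x d" if "Eq x c" "x \<in> carrier st" "c \<in> carrier CQ" "d \<in> carrier CQ" for x c d
  proof -
    have "Eq (x \<oplus>\<^bsub>st\<^esub> \<zero>\<^bsub>st\<^esub>) (c \<oplus>\<^bsub>CQ\<^esub> (\<ominus>\<^bsub>CQ\<^esub> c \<oplus>\<^bsub>CQ\<^esub> d))"
      by (rule Eq_add [OF that(1) cE]) (use that in simp_all)
    moreover have "c \<oplus>\<^bsub>CQ\<^esub> (\<ominus>\<^bsub>CQ\<^esub> c \<oplus>\<^bsub>CQ\<^esub> d) = d"
      using that by algebra
    ultimately show ?thesis using that by simp
  qed
  \<comment> \<open>The bracket producing \<open>t_ij(a)\<close> carries a central part that need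
    not vanish, which \<open>change\<close> removes.\<close>
  have tE: "Eq (ct i j a) \<zero>\<^bsub>CQ\<^esub>" if ij: "i \<noteq> j" and a: "a \<in> grade R p" for i j a p
  proof -
    have ac: "a \<in> carrier R" by (rule grade_closed [OF a])
    note g1 = fam.F_closed [OF a, where i = i] fam.G_closed [OF one_grade, where i = j]
    have "Eq (cf i a \<otimes>\<^bsub>st\<^esub> cg j \<one>\<^bsub>R\<^esub>) (be (cf i a) (cg j \<one>\<^bsub>R\<^esub>))"
      by (rule EqB [OF g1])
    then have "Eq (ct i j a) (be (cf i a) (cg j \<one>\<^bsub>R\<^esub>))"
      unfolding sto_F_G [OF ij a one_grade] using ac by simp
    then show ?thesis
      by (rule change [OF _ fam.T_closed [OF ij a] be.B_closed [OF g1] z])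
  qed
  have "Eq (sto.cls t) \<zero>\<^bsub>CQ\<^esub>" if "t \<in> sto.tms" for t
    using that
  proof (induction rule: lie_terms.induct)
    case (1 x p)
    then consider i j a where "x = Tg i j a" "i \<noteq> j" "a \<in> grade R p"
      | i a where "x = Fg i a" "a \<in> grade R (1 + p)" | i a where "x = Gg i a" "a \<in> grade R (1 + p)"
      unfolding sto_gens_def by blast
    then show ?case
      using tE cfE by cases (simp_all add: sto_gen_class_def)
  next
    case 2
    show ?case
      using cE [OF z] by (simp add: sto.P_zero [symmetric])
  next
    case (3 s t)
    then show ?case
      using Eq_add [OF 3(3,4)] by (simp add: sto.cls_add [symmetric] sto.cls_closed)
  next
    case (4 c t)
    then show ?case
      using sm [OF 4(1) hc [OF sto.cls_closed [OF 4(2)] z]]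
      by (simp add: sto.cls_scale [symmetric] Eq_def Hat_simps)
  next
    case (5 s t)
    note c = sto.cls_closed [OF 5(1)] sto.cls_closed [OF 5(2)]
    show ?case
      using change [OF EqB [OF c] st.prod_closed [OF c] be.B_closed [OF c] z] 5
      by (simp add: sto.cls_br)
  qed
  moreover obtain x c where xc: "m = (x, c)" "x \<in> carrier st" "c \<in> carrier CQ"
    using m by (auto simp: Hat_simps)
  moreover obtain t where "t \<in> sto.tms" "x = sto.cls t"
    using xc(2) by (rule sto.P_cases)
  ultimately have "Eq x c"
    using change [OF _ xc(2) z xc(3)] by blast
  then show ?thesis
    by (simp add: Eq_def xc(1))
qed

end

section \<open>The map induced by the defect on the quotient by \<open>[R,R]R\<close>\<close>

context sto_2cocycle
begin

lemma tt_grade: "z \<in> grade R p \<Longrightarrow> tt z \<in> grade E p"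
proof -
  assume z: "z \<in> grade R p"
  have "bb \<one>\<^bsub>R\<^esub> z \<in> grade E ((1 + 0) + (1 + p))" "bb e (e' \<otimes>\<^bsub>R\<^esub> z) \<in> grade E ((1 + 0) + (1 + p))"
    by (rule B_grade [OF fam.F_grade [OF one_grade] fam.G_grade [OF z]],
        rule B_grade [OF fam.F_grade [OF e_even] fam.G_grade [OF e_mult_grade(2) [OF z]]])
  then have "bb \<one>\<^bsub>R\<^esub> z \<in> grade E p" "bb e (e' \<otimes>\<^bsub>R\<^esub> z) \<in> grade E p"
    by (simp_all add: ac_simps)
  then show ?thesis
    unfolding tt_def by (intro E.grade_smult E.grade_add half_closed)
qed

text \<open>The map \<open>x \<mapsto> dd x 1\<close>, formed on components because
  \<open>dd\<close> is known to be additive only within one degree.\<close>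

definition chat :: "'r \<Rightarrow> 'e" where
  "chat x = dd (component R 0 x) \<one>\<^bsub>R\<^esub> \<oplus>\<^bsub>E\<^esub> dd (component R 1 x) \<one>\<^bsub>R\<^esub>"

lemma dd_comp_closed: "x \<in> carrier R \<Longrightarrow> dd (component R p x) \<one>\<^bsub>R\<^esub> \<in> carrier E"
  by (rule dd_closed [OF component_grade one_grade])

lemma chat_closed [simp]: "x \<in> carrier R \<Longrightarrow> chat x \<in> carrier E"
  by (simp add: chat_def dd_comp_closed)

lemma chat_add:
  assumes "x \<in> carrier R" "y \<in> carrier R"
  shows "chat (x \<oplus>\<^bsub>R\<^esub> y) = chat x \<oplus>\<^bsub>E\<^esub> chat y"
  using assms dd_add [OF component_grade component_grade one_grade]
  by (simp add: chat_def component_add dd_comp_closed E.M.a_ac)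

lemma chat_smult:
  assumes "k \<in> carrier K" "x \<in> carrier R"
  shows "chat (k \<odot>\<^bsub>R\<^esub> x) = k \<odot>\<^bsub>E\<^esub> chat x"
  using assms dd_smult [OF _ component_grade one_grade]
  by (simp add: chat_def component_smult dd_comp_closed E.smult_r_distr)

lemma chat_minus: "x \<in> carrier R \<Longrightarrow> chat (\<ominus>\<^bsub>R\<^esub> x) = \<ominus>\<^bsub>E\<^esub> chat x"
  using chat_smult [of "\<ominus>\<^bsub>K\<^esub> \<one>\<^bsub>K\<^esub>" x] by (simp add: smult_l_minus E.smult_l_minus)

lemma chat_homogeneous:
  assumes "x \<in> grade R p"
  shows "chat x = dd x \<one>\<^bsub>R\<^esub>"
proof -
  have "dd \<zero>\<^bsub>R\<^esub> \<one>\<^bsub>R\<^esub> = \<zero>\<^bsub>E\<^esub>"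
    using dd_smult [of "\<zero>\<^bsub>K\<^esub>" "\<zero>\<^bsub>R\<^esub>" 0 "\<one>\<^bsub>R\<^esub>" 0] one_grade dd_closed [of "\<zero>\<^bsub>R\<^esub>" 0 "\<one>\<^bsub>R\<^esub>" 0] by simp
  then show ?thesis
    using assms dd_closed [OF assms one_grade]
    by (cases p) (simp_all add: chat_def component_homogeneous component_other [of x 0 1]
        component_other [of x 1 0])
qed

lemma chat_grade: "x \<in> grade R p \<Longrightarrow> chat x \<in> grade E p"
proof -
  assume x: "x \<in> grade R p"
  have "bb x \<one>\<^bsub>R\<^esub> \<in> grade E ((1 + p) + (1 + 0))"
    by (rule B_grade [OF fam.F_grade [OF x] fam.G_grade [OF one_grade]])
  then have "bb x \<one>\<^bsub>R\<^esub> \<in> grade E p"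
    by (simp add: ac_simps)
  then show ?thesis
    using tt_grade [OF x] grade_closed [OF x] unfolding chat_homogeneous [OF x] dd_def
    by (simp add: E.grade_add E.grade_minus)
qed

text \<open>\<open>dd_commutator\<close> treats a homogeneous last factor \<open>c\<close>; the two
  components of \<open>c\<close> give the general case. So \<open>chat\<close> depends only on the
  class modulo \<open>[R,R]R\<close>.\<close>

lemma chat_comm_ideal:
  assumes "x \<in> CI"
  shows "chat x = \<zero>\<^bsub>E\<^esub>"
proof -
  have "x \<in> {x \<in> carrier R. chat x = \<zero>\<^bsub>E\<^esub>}"
    using assms
  proof (rule comm_ideal_induct)
    have "chat \<zero>\<^bsub>R\<^esub> = \<zero>\<^bsub>E\<^esub>"
      using chat_smult [of "\<zero>\<^bsub>K\<^esub>" "\<zero>\<^bsub>R\<^esub>"] by simp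
    then show "submodule {x \<in> carrier R. chat x = \<zero>\<^bsub>E\<^esub>} K R"
      by (intro submoduleI) (auto simp: chat_add chat_smult chat_minus E.M.minus_zero')
    show "((a \<otimes>\<^bsub>R\<^esub> b) \<ominus>\<^bsub>R\<^esub> ksign R (p * q) (b \<otimes>\<^bsub>R\<^esub> a)) \<otimes>\<^bsub>R\<^esub> c \<in> {x \<in> carrier R. chat x = \<zero>\<^bsub>E\<^esub>}"
      if a: "a \<in> grade R p" and b: "b \<in> grade R q" and c: "c \<in> carrier R" for a b c p q
    proof -
      define u where "u = (a \<otimes>\<^bsub>R\<^esub> b) \<ominus>\<^bsub>R\<^esub> ksign R (p * q) (b \<otimes>\<^bsub>R\<^esub> a)"
      have u: "u \<in> grade R (p + q)"
        using supercommutator_grade [OF a b] by (simp add: u_def)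
      have uc: "u \<in> carrier R"
        by (rule grade_closed [OF u])
      have z: "chat (u \<otimes>\<^bsub>R\<^esub> component R r c) = \<zero>\<^bsub>E\<^esub>" for r
        using dd_commutator [OF a b component_grade [OF c] one_grade]
          chat_homogeneous [OF prod_grade [OF u component_grade [OF c]]]
        by (simp add: u_def a_minus_def)
      have "u \<otimes>\<^bsub>R\<^esub> c = u \<otimes>\<^bsub>R\<^esub> component R 0 c \<oplus>\<^bsub>R\<^esub> u \<otimes>\<^bsub>R\<^esub> component R 1 c"
        using uc c prod_add_right [symmetric] by (simp add: component_sum01)
      then have "chat (u \<otimes>\<^bsub>R\<^esub> c) = \<zero>\<^bsub>E\<^esub>"
        using z uc c by (simp add: chat_add)
      then show ?thesis
        using uc c by (simp add: u_def)
    qed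
  qed
  then show ?thesis by simp
qed

lemma chat_cp_eq:
  assumes "x \<in> carrier R" "y \<in> carrier R" "cp x = cp y"
  shows "chat x = chat y"
proof -
  have "\<exists>z\<in>CI. x = y \<oplus>\<^bsub>R\<^esub> z"
    using assms(3) CQ.pr_eq_iff [OF assms(1,2)] by iprover
  then obtain z where "z \<in> CI" "x = y \<oplus>\<^bsub>R\<^esub> z"
    by blast
  then show ?thesis
    using assms(2) CQ.sub_closed(1) chat_comm_ideal by (simp add: chat_add subsetD)
qed

end

section \<open>Normalized lifts of the generators\<close>

context sto_extension
begin

text \<open>The lifts of the generators.  The element \<open>ss\<close> acts by $-1$ on $f_{i1}(a)$ and by $1$ on
  $g_{1i}(a)$, so bracketing with it normalizes their lifts.\<close>

definition et :: "two \<Rightarrow> two \<Rightarrow> 'r \<Rightarrow> 'e" where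
  "et i j a = (if i = I1 then C.tt a else \<ominus>\<^bsub>E\<^esub> C.tt (bar a))"

definition ef :: "two \<Rightarrow> 'r \<Rightarrow> 'e" where
  "ef i a = \<ominus>\<^bsub>E\<^esub> BB C.ss (cf i a)"

definition eg :: "two \<Rightarrow> 'r \<Rightarrow> 'e" where
  "eg i a = BB C.ss (cg i a)"

lemma et_grade: "a \<in> grade R p \<Longrightarrow> et i j a \<in> grade E p"
  by (simp add: et_def C.tt_grade E.grade_minus bar_grade)

lemma ef_grade: "a \<in> grade R p \<Longrightarrow> ef i a \<in> grade E (1 + p)"
  using C.B_grade [OF C.ss_grade fam.F_grade, of a p i] by (simp add: ef_def E.grade_minus)

lemma eg_grade: "a \<in> grade R p \<Longrightarrow> eg i a \<in> grade E (1 + p)"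
  using C.B_grade [OF C.ss_grade fam.G_grade, of a p i] by (simp add: eg_def)

lemma et_closed: "a \<in> grade R p \<Longrightarrow> et i j a \<in> carrier E"
  by (rule E.grade_closed [OF et_grade])

lemma ef_closed: "a \<in> grade R p \<Longrightarrow> ef i a \<in> carrier E"
  by (rule E.grade_closed [OF ef_grade])

lemma eg_closed: "a \<in> grade R p \<Longrightarrow> eg i a \<in> carrier E"
  by (rule E.grade_closed [OF eg_grade])

lemma phi_bb: "\<lbrakk>a \<in> grade R p; b \<in> grade R q\<rbrakk> \<Longrightarrow> \<phi> (BB (cf I1 a) (cg I2 b)) = ct I1 I2 (a \<otimes>\<^bsub>R\<^esub> b)"
  using phi_BB [OF fam.F_closed fam.G_closed, of a p b q I1 I2] sto_F_G [of I1 I2 a p b q] by simp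

text \<open>Both summands in \<open>tt\<close> are brackets lying over \<open>t_12(a)\<close>, one
  from the factorization \<open>1 a\<close> and one from \<open>e (e' a)\<close>; halving their sum
  keeps the projection.\<close>

lemma phi_tt:
  assumes a: "a \<in> grade R p"
  shows "\<phi> (C.tt a) = ct I1 I2 a"
proof -
  have ac: "a \<in> carrier R" by (rule grade_closed [OF a])
  note e'a = C.e_mult_grade(2) [OF a]
  have c: "BB (cf I1 \<one>\<^bsub>R\<^esub>) (cg I2 a) \<in> carrier E" "BB (cf I1 e) (cg I2 (C.e' \<otimes>\<^bsub>R\<^esub> a)) \<in> carrier E"
    by (rule C.bb_closed [OF one_grade a], rule C.bb_closed [OF e_even e'a])
  have "\<phi> (C.tt a) = C.half \<odot>\<^bsub>st\<^esub> (ct I1 I2 a \<oplus>\<^bsub>st\<^esub> ct I1 I2 a)"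
    using c C.half_closed ac
    by (simp add: C.tt_def phi_smult phi_add phi_bb [OF one_grade a] phi_bb [OF e_even e'a]
        C.e_e'_mult)
  also have "... = ct I1 I2 a"
    unfolding C.half_def by (rule st.inv_two_double [OF two fam.T_closed [OF _ a]]) simp
  finally show ?thesis .
qed

lemma phi_gens:
  assumes a: "a \<in> grade R p"
  shows "i \<noteq> j \<Longrightarrow> \<phi> (et i j a) = ct i j a" "\<phi> (ef i a) = cf i a" "\<phi> (eg i a) = cg i a"
proof -
  have c: "cf i a \<in> carrier st" "cg i a \<in> carrier st"
    by (rule fam.F_closed [OF a], rule fam.G_closed [OF a])
  show "\<phi> (ef i a) = cf i a"
    using c C.ss_closed C.ss_actions(2) [OF a]
    by (simp add: ef_def phi_minus phi_BB C.B_closed)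
  show "\<phi> (eg i a) = cg i a"
    using c C.ss_closed C.ss_actions(3) [OF a] by (simp add: eg_def phi_BB)
  assume ij: "i \<noteq> j"
  then consider "i = I1" "j = I2" | "i = I2" "j = I1"
    by (cases i; cases j) auto
  then show "\<phi> (et i j a) = ct i j a"
  proof cases
    case 1
    then show ?thesis by (simp add: et_def phi_tt [OF a])
  next
    case 2
    then show ?thesis
      using fam.T_bar [of I2 I1 a p] a
      by (simp add: et_def phi_minus phi_tt [OF bar_grade [OF a]] C.tt_closed [OF bar_grade [OF a]])
  qed
qed

text \<open>A bracket of lifts is a value of \<open>BB\<close> at their images, so the relations are
  instances of \<open>B_tf\<close>, \<open>B_ff\<close> and the formulas for \<open>f\<close> and
  \<open>g\<close>. Normalization by \<open>ss\<close> is what makes the relations with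
  \<open>t\<close> strict; only the relation between \<open>f\<close> and \<open>g\<close> retains
  the defect.\<close>

lemma e_relations:
  assumes ij: "i \<noteq> j" and a: "a \<in> grade R p" and b: "b \<in> grade R q"
  shows "et i j a \<otimes>\<^bsub>E\<^esub> ef j b = ef i (a \<otimes>\<^bsub>R\<^esub> b)"
    "et i j a \<otimes>\<^bsub>E\<^esub> ef i b = \<ominus>\<^bsub>E\<^esub> ef j (bar a \<otimes>\<^bsub>R\<^esub> b)"
    "eg i a \<otimes>\<^bsub>E\<^esub> et i j b = eg j (a \<otimes>\<^bsub>R\<^esub> b)"
    "eg j a \<otimes>\<^bsub>E\<^esub> et i j b = \<ominus>\<^bsub>E\<^esub> eg i (a \<otimes>\<^bsub>R\<^esub> bar b)"
    "ef i a \<otimes>\<^bsub>E\<^esub> ef j b = \<zero>\<^bsub>E\<^esub>" "eg i a \<otimes>\<^bsub>E\<^esub> eg j b = \<zero>\<^bsub>E\<^esub>"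
    "ef i a \<otimes>\<^bsub>E\<^esub> eg j b = et i j (a \<otimes>\<^bsub>R\<^esub> b) \<oplus>\<^bsub>E\<^esub>
      C.chat (if i = I1 then a \<otimes>\<^bsub>R\<^esub> bar b else \<ominus>\<^bsub>R\<^esub> (a \<otimes>\<^bsub>R\<^esub> bar b))"
proof -
  note ab = prod_grade [OF a b] and bab = prod_grade [OF bar_grade [OF a] b]
    and abb = prod_grade [OF a bar_grade [OF b]]
  have br: "u \<otimes>\<^bsub>E\<^esub> v = BB (\<phi> u) (\<phi> v)" if "u \<in> carrier E" "v \<in> carrier E" for u v
    by (simp only: BB_phi [OF that])
  have c: "cf j (bar a \<otimes>\<^bsub>R\<^esub> b) \<in> carrier st" "cg i (a \<otimes>\<^bsub>R\<^esub> bar b) \<in> carrier st"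
    by (rule fam.F_closed [OF bab], rule fam.G_closed [OF abb])
  show "et i j a \<otimes>\<^bsub>E\<^esub> ef j b = ef i (a \<otimes>\<^bsub>R\<^esub> b)"
    unfolding br [OF et_closed [OF a] ef_closed [OF b]] phi_gens(1) [OF a ij] phi_gens(2) [OF b]
      C.B_tf(1) [OF ij a b] fam.T_F [OF ij a b]
    unfolding ef_def ..
  show "et i j a \<otimes>\<^bsub>E\<^esub> ef i b = \<ominus>\<^bsub>E\<^esub> ef j (bar a \<otimes>\<^bsub>R\<^esub> b)"
    unfolding br [OF et_closed [OF a] ef_closed [OF b]] phi_gens(1) [OF a ij] phi_gens(2) [OF b]
      C.B_tf(1) [OF ij a b] fam.T_F' [OF ij a b]
    unfolding ef_def C.B_minus(2) [OF C.ss_closed c(1)] ..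
  show "eg i a \<otimes>\<^bsub>E\<^esub> et i j b = eg j (a \<otimes>\<^bsub>R\<^esub> b)"
    unfolding br [OF eg_closed [OF a] et_closed [OF b]] phi_gens(1) [OF b ij] phi_gens(3) [OF a]
      C.B_tf(2) [OF ij b a] fam.G_T [OF ij a b]
    unfolding eg_def ..
  show "eg j a \<otimes>\<^bsub>E\<^esub> et i j b = \<ominus>\<^bsub>E\<^esub> eg i (a \<otimes>\<^bsub>R\<^esub> bar b)"
    unfolding br [OF eg_closed [OF a] et_closed [OF b]] phi_gens(1) [OF b ij] phi_gens(3) [OF a]
      C.B_tf(2) [OF ij b a] fam.G_T' [OF ij a b]
    unfolding eg_def C.B_minus(2) [OF C.ss_closed c(2)] ..
  show "ef i a \<otimes>\<^bsub>E\<^esub> ef j b = \<zero>\<^bsub>E\<^esub>"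
    unfolding br [OF ef_closed [OF a] ef_closed [OF b]] phi_gens(2) [OF a] phi_gens(2) [OF b]
    by (rule C.B_ff(1) [OF ij a b])
  show "eg i a \<otimes>\<^bsub>E\<^esub> eg j b = \<zero>\<^bsub>E\<^esub>"
    unfolding br [OF eg_closed [OF a] eg_closed [OF b]] phi_gens(3) [OF a] phi_gens(3) [OF b]
    by (rule C.B_ff(2) [OF ij a b])
  have fg: "ef i a \<otimes>\<^bsub>E\<^esub> eg j b = BB (cf i a) (cg j b)"
    unfolding br [OF ef_closed [OF a] eg_closed [OF b]] phi_gens(2) [OF a] phi_gens(3) [OF b] ..
  consider "i = I1" "j = I2" | "i = I2" "j = I1"
    using ij by (cases i; cases j) auto
  then show "ef i a \<otimes>\<^bsub>E\<^esub> eg j b = et i j (a \<otimes>\<^bsub>R\<^esub> b) \<oplus>\<^bsub>E\<^esub>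
      C.chat (if i = I1 then a \<otimes>\<^bsub>R\<^esub> bar b else \<ominus>\<^bsub>R\<^esub> (a \<otimes>\<^bsub>R\<^esub> bar b))"
  proof cases
    case 1
    then show ?thesis
      unfolding fg by (simp add: C.bb_formula [OF a b] et_def C.chat_homogeneous [OF abb])
  next
    case 2
    then show ?thesis
      using grade_closed [OF abb]
      unfolding fg by (simp add: C.B_f2_g1 [OF a b] et_def C.chat_minus C.chat_homogeneous [OF abb])
  qed
qed

section \<open>Comparison in the product of the two extensions\<close>

definition PP where
  "PP = pair_algebra Hat E (\<lambda>(x, c) (y, d). (x \<otimes>\<^bsub>Hat\<^esub> y, c \<otimes>\<^bsub>E\<^esub> d))"

lemma PP_lie: "lie_superalgebra K PP"
  unfolding PP_def by (rule product_lie [OF Hat_lie E.lie_superalgebra_axioms])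

lemma PP_simps:
  "carrier PP = carrier Hat \<times> carrier E"
  "\<zero>\<^bsub>PP\<^esub> = ((\<zero>\<^bsub>st\<^esub>, \<zero>\<^bsub>CQ\<^esub>), \<zero>\<^bsub>E\<^esub>)"
  "((x, c), u) \<otimes>\<^bsub>PP\<^esub> ((y, d), v) = ((x \<otimes>\<^bsub>st\<^esub> y, be x y), u \<otimes>\<^bsub>E\<^esub> v)"
  "((x, c), u) \<oplus>\<^bsub>PP\<^esub> ((y, d), v) = ((x \<oplus>\<^bsub>st\<^esub> y, c \<oplus>\<^bsub>CQ\<^esub> d), u \<oplus>\<^bsub>E\<^esub> v)"
  "k \<odot>\<^bsub>PP\<^esub> ((x, c), u) = ((k \<odot>\<^bsub>st\<^esub> x, k \<odot>\<^bsub>CQ\<^esub> c), k \<odot>\<^bsub>E\<^esub> u)"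
  "grade PP p = (grade st p \<times> grade CQ p) \<times> grade E p"
  unfolding PP_def by (simp_all add: Hat_simps)

lemma PP_minus:
  assumes "x \<in> carrier st" "c \<in> carrier CQ" "u \<in> carrier E"
  shows "\<ominus>\<^bsub>PP\<^esub> ((x, c), u) = ((\<ominus>\<^bsub>st\<^esub> x, \<ominus>\<^bsub>CQ\<^esub> c), \<ominus>\<^bsub>E\<^esub> u)"
proof -
  interpret H: lie_superalgebra K Hat by (rule Hat_lie)
  interpret P: supermodule_pair K Hat E ..
  show ?thesis
    unfolding PP_def using assms by (subst P.pair_minus) (simp_all add: Hat_simps Hat_minus)
qed

abbreviation "pt i j a \<equiv> ((ct i j a, \<zero>\<^bsub>CQ\<^esub>), et i j a)"
abbreviation "pf i a \<equiv> ((cf i a, \<zero>\<^bsub>CQ\<^esub>), ef i a)"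
abbreviation "pg i a \<equiv> ((cg i a, \<zero>\<^bsub>CQ\<^esub>), eg i a)"

lemma et_add: "\<lbrakk>a \<in> grade R p; b \<in> grade R p\<rbrakk> \<Longrightarrow> et i j (a \<oplus>\<^bsub>R\<^esub> b) = et i j a \<oplus>\<^bsub>E\<^esub> et i j b"
  using C.tt_closed [OF bar_grade [of a p]] C.tt_closed [OF bar_grade [of b p]]
    C.tt_add [of a p b] C.tt_add [OF bar_grade [of a p] bar_grade [of b p]]
  by (simp add: et_def bar_add grade_closed E.M.minus_add)

lemma et_smult:
  assumes "c \<in> carrier K" "a \<in> grade R p"
  shows "et i j (c \<odot>\<^bsub>R\<^esub> a) = c \<odot>\<^bsub>E\<^esub> et i j a"
  using assms C.tt_closed [OF bar_grade [OF assms(2)]] C.tt_smult [OF assms]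
    C.tt_smult [OF assms(1) bar_grade [OF assms(2)]]
  by (simp add: et_def bar_smult grade_closed E.smult_r_minus)

text \<open>The relations of a family evaluate the given cocycle only at pairs where it vanishes, so
  the generators of the first extension can be taken with central part zero. The second component is
  covered by \<open>e_relations\<close>.\<close>

lemma sto_family_PP: "sto_family K R bar PP pt pf pg"
proof (intro sto_family.intro sto_family_axioms.intro superinvolution_axioms
    lie_superalgebra.pre_lie [OF PP_lie])
  fix i j :: two and a b p q c
  have z: "\<zero>\<^bsub>CQ\<^esub> \<in> grade CQ r" for r
    by (rule CQ.grade_zero)
  {
    assume a: "a \<in> grade R p"
    show "pf i a \<in> grade PP (1 + p)" "pg i a \<in> grade PP (1 + p)"
      using fam.F_grade [OF a] fam.G_grade [OF a] ef_grade [OF a] eg_grade [OF a] z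
      by (simp_all add: PP_simps)
    assume "i \<noteq> j"
    then show "pt i j a \<in> grade PP p"
      using fam.T_grade a et_grade [OF a] z by (simp add: PP_simps)
  }
  {
    assume a: "a \<in> grade R p" and b: "b \<in> grade R p"
    show "pf i (a \<oplus>\<^bsub>R\<^esub> b) = pf i a \<oplus>\<^bsub>PP\<^esub> pf i b" "pg i (a \<oplus>\<^bsub>R\<^esub> b) = pg i a \<oplus>\<^bsub>PP\<^esub> pg i b"
      using a b C.ss_closed fam.F_closed fam.G_closed
      by (simp_all add: PP_simps fam.F_add fam.G_add ef_def eg_def C.B_add E.M.minus_add)
    assume "i \<noteq> j"
    then show "pt i j (a \<oplus>\<^bsub>R\<^esub> b) = pt i j a \<oplus>\<^bsub>PP\<^esub> pt i j b"
      using a b by (simp add: PP_simps fam.T_add et_add)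
  }
  {
    assume a: "a \<in> grade R p" and c: "c \<in> carrier K"
    show "pf i (c \<odot>\<^bsub>R\<^esub> a) = c \<odot>\<^bsub>PP\<^esub> pf i a" "pg i (c \<odot>\<^bsub>R\<^esub> a) = c \<odot>\<^bsub>PP\<^esub> pg i a"
      using a c C.ss_closed fam.F_closed fam.G_closed
      by (simp_all add: PP_simps fam.F_smult fam.G_smult ef_def eg_def C.B_smult E.smult_r_minus)
    assume "i \<noteq> j"
    then show "pt i j (c \<odot>\<^bsub>R\<^esub> a) = c \<odot>\<^bsub>PP\<^esub> pt i j a"
      using a c by (simp add: PP_simps fam.T_smult et_smult)
  }
  assume ij: "i \<noteq> j"
  {
    assume a: "a \<in> grade R p"
    note ba = bar_grade [OF a]
    have ji: "j \<noteq> i" using ij by simp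
    have "et i j a = \<ominus>\<^bsub>E\<^esub> et j i (bar a)"
    proof -
      consider "i = I1" "j = I2" | "i = I2" "j = I1"
        using ij by (cases i; cases j) auto
      then show ?thesis
        using C.tt_closed [OF a] bar_bar [OF grade_closed [OF a]] by cases (simp_all add: et_def)
    qed
    then show "pt i j a = \<ominus>\<^bsub>PP\<^esub> (pt j i (bar a))"
      using fam.T_bar [OF ij a]
      unfolding PP_minus [OF fam.T_closed [OF ji ba] CQ.M.zero_closed et_closed [OF ba]]
        CQ.M.minus_zero' by simp
  }
  assume a: "a \<in> grade R p" and b: "b \<in> grade R q"
  note ab = prod_grade [OF a b] and bab = prod_grade [OF bar_grade [OF a] b]
    and abb = prod_grade [OF a bar_grade [OF b]]
  show "pt i j a \<otimes>\<^bsub>PP\<^esub> pf j b = pf i (a \<otimes>\<^bsub>R\<^esub> b)"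
    by (simp only: PP_simps fam.T_F [OF ij a b] be_tf(1) [OF ij a b] e_relations(1) [OF ij a b])
  show "pt i j a \<otimes>\<^bsub>PP\<^esub> pf i b = \<ominus>\<^bsub>PP\<^esub> (pf j (bar a \<otimes>\<^bsub>R\<^esub> b))"
    unfolding PP_minus [OF fam.F_closed [OF bab] CQ.M.zero_closed ef_closed [OF bab]]
    by (simp only: PP_simps fam.T_F' [OF ij a b] be_tf(2) [OF ij a b] e_relations(2) [OF ij a b]
        CQ.M.minus_zero')
  show "pg i a \<otimes>\<^bsub>PP\<^esub> pt i j b = pg j (a \<otimes>\<^bsub>R\<^esub> b)"
    by (simp only: PP_simps fam.G_T [OF ij a b] be_tf(3) [OF ij b a] e_relations(3) [OF ij a b])
  show "pg j a \<otimes>\<^bsub>PP\<^esub> pt i j b = \<ominus>\<^bsub>PP\<^esub> (pg i (a \<otimes>\<^bsub>R\<^esub> bar b))"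
    unfolding PP_minus [OF fam.G_closed [OF abb] CQ.M.zero_closed eg_closed [OF abb]]
    by (simp only: PP_simps fam.G_T' [OF ij a b] be_tf(4) [OF ij b a] e_relations(4) [OF ij a b]
        CQ.M.minus_zero')
  show "pf i a \<otimes>\<^bsub>PP\<^esub> pf j b = \<zero>\<^bsub>PP\<^esub>"
    by (simp only: PP_simps fam.F_F [OF ij a b] be.B_ff(1) [OF ij a b] e_relations(5) [OF ij a b])
  show "pg i a \<otimes>\<^bsub>PP\<^esub> pg j b = \<zero>\<^bsub>PP\<^esub>"
    by (simp only: PP_simps fam.G_G [OF ij a b] be.B_ff(2) [OF ij a b] e_relations(6) [OF ij a b])
qed

text \<open>Both components miss the relation by images of the same \<open>x\<close>, once under the
  projection to the quotient and once under \<open>chat\<close>. This coupling is what makes the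
  later correspondence single-valued.\<close>

lemma PP_F_G:
  assumes ij: "i \<noteq> j" and a: "a \<in> grade R p" and b: "b \<in> grade R q"
  shows "\<exists>x\<in>carrier R. pf i a \<otimes>\<^bsub>PP\<^esub> pg j b = pt i j (a \<otimes>\<^bsub>R\<^esub> b) \<oplus>\<^bsub>PP\<^esub> ((\<zero>\<^bsub>st\<^esub>, cp x), C.chat x)"
proof -
  define x where "x = (if i = I1 then a \<otimes>\<^bsub>R\<^esub> bar b else \<ominus>\<^bsub>R\<^esub> (a \<otimes>\<^bsub>R\<^esub> bar b))"
  have abb: "a \<otimes>\<^bsub>R\<^esub> bar b \<in> carrier R"
    by (rule grade_closed [OF prod_grade [OF a bar_grade [OF b]]])
  have x: "x \<in> carrier R"
    using abb by (simp add: x_def)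
  consider "i = I1" "j = I2" | "i = I2" "j = I1"
    using ij by (cases i; cases j) auto
  then have "be (cf i a) (cg j b) = cp x"
    using be_fg [OF a b] abb by cases (simp_all add: x_def cp_hom)
  then have "pf i a \<otimes>\<^bsub>PP\<^esub> pg j b = pt i j (a \<otimes>\<^bsub>R\<^esub> b) \<oplus>\<^bsub>PP\<^esub> ((\<zero>\<^bsub>st\<^esub>, cp x), C.chat x)"
    using sto_F_G [OF ij a b] e_relations(7) [OF ij a b] fam.T_closed [OF ij prod_grade [OF a b]]
      cp_closed [OF x]
    by (simp add: PP_simps x_def)
  then show ?thesis using x by blast
qed

interpretation PP: lie_superalgebra K PP
  by (rule PP_lie)

interpretation pfam: sto_family K R bar PP pt pf pg
  by (rule sto_family_PP)

abbreviation "pz x \<equiv> ((\<zero>\<^bsub>st\<^esub>, cp x), C.chat x)"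

text \<open>On homogeneous \<open>x\<close>, \<open>chat x\<close> is a difference of two elements
  over \<open>t_12(x)\<close>, so it lies in the kernel.\<close>

lemma phi_chat:
  assumes "x \<in> carrier R"
  shows "\<phi> (C.chat x) = \<zero>\<^bsub>st\<^esub>"
  using assms
proof (induction rule: homogeneous_induct)
  case (homogeneous p x)
  have xc: "x \<in> carrier R"
    by (rule grade_closed [OF homogeneous])
  have t: "ct I1 I2 x \<in> carrier st"
    by (rule fam.T_closed [OF _ homogeneous]) simp
  show ?case
    using xc t C.bb_closed [OF homogeneous one_grade] C.tt_closed [OF homogeneous]
    by (simp add: C.chat_homogeneous [OF homogeneous] C.dd_def phi_add phi_minus
        phi_bb [OF homogeneous one_grade] phi_tt [OF homogeneous] st.M.r_neg)
next
  case (add x y)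
  then show ?case by (simp add: C.chat_add phi_add)
qed

lemma pz_closed: "x \<in> carrier R \<Longrightarrow> pz x \<in> carrier PP"
  by (simp add: PP_simps Hat_simps cp_closed)

lemma pz_submodule: "submodule (pz ` carrier R) K PP"
proof (rule PP.submoduleI)
  show "pz ` carrier R \<subseteq> carrier PP"
    using pz_closed by blast
  have "cp \<zero>\<^bsub>R\<^esub> = \<zero>\<^bsub>CQ\<^esub>" "C.chat \<zero>\<^bsub>R\<^esub> = \<zero>\<^bsub>E\<^esub>"
    using C.chat_smult [of "\<zero>\<^bsub>K\<^esub>" "\<zero>\<^bsub>R\<^esub>"] by (simp_all add: CQ.Q_zero)
  then have "\<zero>\<^bsub>PP\<^esub> = pz \<zero>\<^bsub>R\<^esub>"
    by (simp add: PP_simps)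
  then show "\<zero>\<^bsub>PP\<^esub> \<in> pz ` carrier R"
    by blast
  show "\<ominus>\<^bsub>PP\<^esub> u \<in> pz ` carrier R" if "u \<in> pz ` carrier R" for u
  proof -
    obtain x where x: "x \<in> carrier R" "u = pz x" using \<open>u \<in> pz ` carrier R\<close> by blast
    then have "\<ominus>\<^bsub>PP\<^esub> u = pz (\<ominus>\<^bsub>R\<^esub> x)"
      by (simp add: PP_minus cp_closed cp_hom C.chat_minus st.M.minus_zero')
    then show ?thesis using x by blast
  qed
  show "u \<oplus>\<^bsub>PP\<^esub> v \<in> pz ` carrier R" if "u \<in> pz ` carrier R" "v \<in> pz ` carrier R" for u v
  proof -
    obtain x y where x: "x \<in> carrier R" "u = pz x" "y \<in> carrier R" "v = pz y"
      using \<open>u \<in> pz ` carrier R\<close> \<open>v \<in> pz ` carrier R\<close> by blast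
    then have "u \<oplus>\<^bsub>PP\<^esub> v = pz (x \<oplus>\<^bsub>R\<^esub> y)"
      by (simp add: PP_simps cp_hom C.chat_add)
    then show ?thesis using x by blast
  qed
  show "k \<odot>\<^bsub>PP\<^esub> u \<in> pz ` carrier R" if "k \<in> carrier K" "u \<in> pz ` carrier R" for k u
  proof -
    obtain x where x: "x \<in> carrier R" "u = pz x" using \<open>u \<in> pz ` carrier R\<close> by blast
    then have "k \<odot>\<^bsub>PP\<^esub> u = pz (k \<odot>\<^bsub>R\<^esub> x)"
      using \<open>k \<in> carrier K\<close> by (simp add: PP_simps CQ.pr_smult C.chat_smult)
    then show ?thesis using x that(1) by blast
  qed
qed

text \<open>In the first extension the bracket ignores the central part; in the second
  \<open>chat x\<close> lies in the kernel of \<open>\<phi>\<close>, which is central.\<close>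

lemma pz_central:
  assumes "x \<in> carrier R" "u \<in> carrier PP"
  shows "pz x \<otimes>\<^bsub>PP\<^esub> u = \<zero>\<^bsub>PP\<^esub>" "u \<otimes>\<^bsub>PP\<^esub> pz x = \<zero>\<^bsub>PP\<^esub>"
proof -
  obtain y d v where u: "u = ((y, d), v)" "y \<in> carrier st" "v \<in> carrier E"
    using assms(2) by (auto simp: PP_simps Hat_simps)
  show "pz x \<otimes>\<^bsub>PP\<^esub> u = \<zero>\<^bsub>PP\<^esub>" "u \<otimes>\<^bsub>PP\<^esub> pz x = \<zero>\<^bsub>PP\<^esub>"
    using u assms(1) kernel_central [OF C.chat_closed [OF assms(1)] phi_chat [OF assms(1)] u(3)]
    by (simp_all add: PP_simps be.B_zero)
qed

abbreviation "ev \<equiv> eval_term PP pfam.gmap"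

lemma ev_closed: "t \<in> sto.tms \<Longrightarrow> ev t \<in> carrier PP"
  by (rule pfam.L.eval_closed [OF pfam.gmap_grade])

text \<open>Here the central submodule for evaluation is the image of \<open>pz\<close>, and
  \<open>PP_F_G\<close> supplies the only relation that is not strict.\<close>

lemma ev_cong:
  assumes "s \<in> sto.tms" "t \<in> sto.tms" "sto.cls s = sto.cls t"
  shows "\<exists>x\<in>carrier R. ev s = ev t \<oplus>\<^bsub>PP\<^esub> pz x"
proof -
  have "lie_cong K (sto_gens R) (sto_rels K R bar) s t"
    using assms sto.cls_eq_iff by simp
  then have "\<exists>z\<in>pz ` carrier R. ev s = ev t \<oplus>\<^bsub>PP\<^esub> z"
  proof (rule pfam.eval_cong_sto [OF pz_submodule, rotated 2])
    show "z \<otimes>\<^bsub>PP\<^esub> x = \<zero>\<^bsub>PP\<^esub> \<and> x \<otimes>\<^bsub>PP\<^esub> z = \<zero>\<^bsub>PP\<^esub>" if "z \<in> pz ` carrier R" "x \<in> carrier PP" for z x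
      using that pz_central by blast
    show "\<exists>z\<in>pz ` carrier R. pf i a \<otimes>\<^bsub>PP\<^esub> pg j b = pt i j (a \<otimes>\<^bsub>R\<^esub> b) \<oplus>\<^bsub>PP\<^esub> z"
      if "i \<noteq> j" "a \<in> grade R p" "b \<in> grade R q" for i j a b p q
      using PP_F_G [OF that] by blast
  qed
  then show ?thesis by blast
qed

lemma ev_proj:
  assumes "t \<in> sto.tms"
  shows "fst (fst (ev t)) = sto.cls t" "\<phi> (snd (ev t)) = sto.cls t"
proof -
  have split: "\<exists>x c u. ev t = ((x, c), u) \<and> x \<in> carrier st \<and> u \<in> carrier E" if "t \<in> sto.tms" for t
    using ev_closed [OF that] by (auto simp: PP_simps Hat_simps)
  have "fst (fst (ev t)) = sto.cls t \<and> \<phi> (snd (ev t)) = sto.cls t"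
    using assms
  proof (induction rule: lie_terms.induct)
    case (1 x p)
    then consider i j a where "x = Tg i j a" "i \<noteq> j" "a \<in> grade R p"
      | i a where "x = Fg i a" "a \<in> grade R (1 + p)" | i a where "x = Gg i a" "a \<in> grade R (1 + p)"
      unfolding sto_gens_def by blast
    then show ?case
      using phi_gens by cases (simp_all add: sto_gen_class_def)
  next
    case 2
    show ?case by (simp add: PP_simps sto.P_zero [symmetric] phi_zero)
  next
    case (3 s t)
    then show ?case
      using split [OF 3(1)] split [OF 3(2)]
      by (auto simp: PP_simps phi_add sto.cls_add [symmetric])
  next
    case (4 c t)
    then show ?case
      using split [OF 4(2)] by (auto simp: PP_simps phi_smult sto.cls_scale [symmetric])
  next
    case (5 s t)
    then show ?case
      using split [OF 5(1)] split [OF 5(2)]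
      by (auto simp: PP_simps phi_mult sto.cls_br [symmetric])
  qed
  then show "fst (fst (ev t)) = sto.cls t" "\<phi> (snd (ev t)) = sto.cls t" by simp_all
qed

text \<open>The lift is constructed as a relation: a term \<open>t\<close> is evaluated simultaneously in the two
  extensions, which is well defined up to the elements \<open>pz x\<close>.\<close>

definition graph where
  "graph m u \<longleftrightarrow> (\<exists>t\<in>sto.tms. \<exists>x\<in>carrier R. (m, u) = ev t \<oplus>\<^bsub>PP\<^esub> pz x)"

lemma graphE:
  assumes "graph m u"
  obtains t x where "t \<in> sto.tms" "x \<in> carrier R" "(m, u) = ev t \<oplus>\<^bsub>PP\<^esub> pz x"
  using assms unfolding graph_def by (elim bexE) (rule that)

lemma graph_closed: "graph m u \<Longrightarrow> m \<in> carrier Hat \<and> u \<in> carrier E"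
proof -
  assume "graph m u"
  then obtain t x where "t \<in> sto.tms" "x \<in> carrier R" "(m, u) = ev t \<oplus>\<^bsub>PP\<^esub> pz x"
    by (rule graphE)
  then have "(m, u) \<in> carrier PP"
    using PP.M.a_closed [OF ev_closed pz_closed] by (simp only:)
  then show ?thesis by (simp add: PP_simps)
qed

lemma graph_total_grade:
  assumes "x \<in> grade st p" "c \<in> grade CQ p"
  shows "\<exists>u\<in>grade E p. graph (x, c) u"
proof -
  obtain t where t: "lie_term_deg K (sto_gens R) t p" "t \<in> sto.tms" "x = sto.cls t"
    using assms(1) by (rule sto.P_grade_cases)
  have "ev t \<in> grade PP p"
    by (rule pfam.L.eval_grade [OF pfam.gmap_grade t(1)])
  then obtain y d u where evt: "ev t = ((y, d), u)" and g: "d \<in> grade CQ p" "u \<in> grade E p"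
    by (cases "ev t") (auto simp: PP_simps)
  have y: "y = x"
    using ev_proj(1) [OF t(2)] by (simp add: evt t(3))
  \<comment> \<open>Evaluation of \<open>t\<close> already has the right projection to
    \<open>st\<close>. The discrepancy of the central parts is homogeneous, so it is the class of a
    homogeneous \<open>r\<close>, and adding \<open>pz r\<close> corrects it without leaving degree
    \<open>p\<close>.\<close>
  have "c \<oplus>\<^bsub>CQ\<^esub> \<ominus>\<^bsub>CQ\<^esub> d \<in> grade CQ p"
    by (intro CQ.grade_add CQ.grade_minus assms(2) g(1))
  then obtain r where r: "r \<in> grade R p" "c \<oplus>\<^bsub>CQ\<^esub> \<ominus>\<^bsub>CQ\<^esub> d = cp r"
    unfolding CQ.Q_grade by auto
  have cl: "c \<in> carrier CQ" "d \<in> carrier CQ" "x \<in> carrier st"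
    using CQ.grade_closed [OF assms(2)] CQ.grade_closed [OF g(1)] st.grade_closed [OF assms(1)] by auto
  have "d \<oplus>\<^bsub>CQ\<^esub> cp r = c"
    unfolding r(2) [symmetric] using cl by algebra
  then have "((x, c), u \<oplus>\<^bsub>E\<^esub> C.chat r) = ev t \<oplus>\<^bsub>PP\<^esub> pz r"
    using cl by (simp add: evt y PP_simps)
  then have "graph (x, c) (u \<oplus>\<^bsub>E\<^esub> C.chat r)"
    unfolding graph_def using t(2) grade_closed [OF r(1)] by blast
  moreover have "u \<oplus>\<^bsub>E\<^esub> C.chat r \<in> grade E p"
    by (intro E.grade_add g(2) C.chat_grade r(1))
  ultimately show ?thesis by blast
qed

lemma graph_add:
  assumes "graph m u" "graph n v"
  shows "graph (m \<oplus>\<^bsub>Hat\<^esub> n) (u \<oplus>\<^bsub>E\<^esub> v)"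
proof -
  obtain t x where t: "t \<in> sto.tms" "x \<in> carrier R" "(m, u) = ev t \<oplus>\<^bsub>PP\<^esub> pz x"
    using assms(1) by (rule graphE)
  obtain s y where s: "s \<in> sto.tms" "y \<in> carrier R" "(n, v) = ev s \<oplus>\<^bsub>PP\<^esub> pz y"
    using assms(2) by (rule graphE)
  have "(m \<oplus>\<^bsub>Hat\<^esub> n, u \<oplus>\<^bsub>E\<^esub> v) = (m, u) \<oplus>\<^bsub>PP\<^esub> (n, v)"
    by (simp add: PP_def)
  also have "... = (ev t \<oplus>\<^bsub>PP\<^esub> ev s) \<oplus>\<^bsub>PP\<^esub> (pz x \<oplus>\<^bsub>PP\<^esub> pz y)"
    unfolding t(3) s(3)
    by (rule PP.M.four_swap [OF ev_closed [OF t(1)] pz_closed [OF t(2)] ev_closed [OF s(1)]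
          pz_closed [OF s(2)]])
  also have "pz x \<oplus>\<^bsub>PP\<^esub> pz y = pz (x \<oplus>\<^bsub>R\<^esub> y)"
    using t(2) s(2) by (simp add: PP_simps cp_hom C.chat_add)
  finally have "(m \<oplus>\<^bsub>Hat\<^esub> n, u \<oplus>\<^bsub>E\<^esub> v) = ev (LAdd t s) \<oplus>\<^bsub>PP\<^esub> pz (x \<oplus>\<^bsub>R\<^esub> y)"
    by simp
  moreover have "LAdd t s \<in> sto.tms" "x \<oplus>\<^bsub>R\<^esub> y \<in> carrier R"
    using t s by (auto intro: lie_terms.intros)
  ultimately show ?thesis
    unfolding graph_def by blast
qed

lemma graph_smult:
  assumes "k \<in> carrier K" "graph m u"
  shows "graph (k \<odot>\<^bsub>Hat\<^esub> m) (k \<odot>\<^bsub>E\<^esub> u)"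
proof -
  obtain t x where t: "t \<in> sto.tms" "x \<in> carrier R" "(m, u) = ev t \<oplus>\<^bsub>PP\<^esub> pz x"
    using assms(2) by (rule graphE)
  have "(k \<odot>\<^bsub>Hat\<^esub> m, k \<odot>\<^bsub>E\<^esub> u) = k \<odot>\<^bsub>PP\<^esub> (m, u)"
    by (simp add: PP_def)
  also have "... = k \<odot>\<^bsub>PP\<^esub> ev t \<oplus>\<^bsub>PP\<^esub> k \<odot>\<^bsub>PP\<^esub> pz x"
    unfolding t(3) by (rule PP.smult_r_distr [OF assms(1) ev_closed [OF t(1)] pz_closed [OF t(2)]])
  also have "k \<odot>\<^bsub>PP\<^esub> pz x = pz (k \<odot>\<^bsub>R\<^esub> x)"
    using t(2) assms(1) by (simp add: PP_simps CQ.pr_smult C.chat_smult)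
  finally have "(k \<odot>\<^bsub>Hat\<^esub> m, k \<odot>\<^bsub>E\<^esub> u) = ev (LScale k t) \<oplus>\<^bsub>PP\<^esub> pz (k \<odot>\<^bsub>R\<^esub> x)"
    by simp
  moreover have "LScale k t \<in> sto.tms" "k \<odot>\<^bsub>R\<^esub> x \<in> carrier R"
    using t assms(1) by (auto intro: lie_terms.intros)
  ultimately show ?thesis
    unfolding graph_def by blast
qed

text \<open>Brackets with the central corrections vanish, so the product is the value of the bracket
  term with correction zero.\<close>

lemma graph_mult:
  assumes "graph m u" "graph n v"
  shows "graph (m \<otimes>\<^bsub>Hat\<^esub> n) (u \<otimes>\<^bsub>E\<^esub> v)"
proof -
  obtain t x where t: "t \<in> sto.tms" "x \<in> carrier R" "(m, u) = ev t \<oplus>\<^bsub>PP\<^esub> pz x"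
    using assms(1) by (rule graphE)
  obtain s y where s: "s \<in> sto.tms" "y \<in> carrier R" "(n, v) = ev s \<oplus>\<^bsub>PP\<^esub> pz y"
    using assms(2) by (rule graphE)
  note c = ev_closed [OF t(1)] pz_closed [OF t(2)] ev_closed [OF s(1)] pz_closed [OF s(2)]
  have "(m \<otimes>\<^bsub>Hat\<^esub> n, u \<otimes>\<^bsub>E\<^esub> v) = (m, u) \<otimes>\<^bsub>PP\<^esub> (n, v)"
    by (simp add: PP_def)
  also have "... = ev t \<otimes>\<^bsub>PP\<^esub> ev s"
    unfolding t(3) s(3) PP.prod_add_left [OF c(1,2) PP.M.a_closed [OF c(3,4)]]
      PP.prod_add_right [OF c(3,4,1)] pz_central(2) [OF s(2) c(1)]
      pz_central(1) [OF t(2) PP.M.a_closed [OF c(3,4)]]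
    using PP.prod_closed [OF c(1,3)] by simp
  finally have "(m \<otimes>\<^bsub>Hat\<^esub> n, u \<otimes>\<^bsub>E\<^esub> v) = ev (LBr t s) \<oplus>\<^bsub>PP\<^esub> pz \<zero>\<^bsub>R\<^esub>"
    using PP.prod_closed [OF c(1,3)] C.chat_smult [of "\<zero>\<^bsub>K\<^esub>" "\<zero>\<^bsub>R\<^esub>"]
    by (simp add: CQ.Q_zero [symmetric] PP_simps(2) [symmetric])
  moreover have "LBr t s \<in> sto.tms"
    using t s by (auto intro: lie_terms.intros)
  ultimately show ?thesis
    unfolding graph_def using M.zero_closed by blast
qed

text \<open>Two terms over the same \<open>m\<close> are congruent, so their values differ by some
  \<open>pz r\<close>. The first extension then forces \<open>r + x\<close> and \<open>y\<close>
  into the same class modulo \<open>[R,R]R\<close>, and \<open>chat\<close> takes equal values on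
  them.\<close>

lemma graph_functional:
  assumes "graph m u" "graph m v"
  shows "u = v"
proof -
  obtain t x where t: "t \<in> sto.tms" "x \<in> carrier R" "(m, u) = ev t \<oplus>\<^bsub>PP\<^esub> pz x"
    using assms(1) by (rule graphE)
  obtain s y where s: "s \<in> sto.tms" "y \<in> carrier R" "(m, v) = ev s \<oplus>\<^bsub>PP\<^esub> pz y"
    using assms(2) by (rule graphE)
  obtain a c w where a: "ev t = ((a, c), w)" "a \<in> carrier st" "c \<in> carrier CQ" "w \<in> carrier E"
    using ev_closed [OF t(1)] by (auto simp: PP_simps Hat_simps)
  obtain b d z where b: "ev s = ((b, d), z)" "b \<in> carrier st" "d \<in> carrier CQ" "z \<in> carrier E"
    using ev_closed [OF s(1)] by (auto simp: PP_simps Hat_simps)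
  have m: "m = (a, c \<oplus>\<^bsub>CQ\<^esub> cp x)" "m = (b, d \<oplus>\<^bsub>CQ\<^esub> cp y)" "u = w \<oplus>\<^bsub>E\<^esub> C.chat x" "v = z \<oplus>\<^bsub>E\<^esub> C.chat y"
    using t(3) s(3) a b by (simp_all add: PP_simps)
  have "sto.cls t = sto.cls s"
    using ev_proj(1) [OF t(1)] ev_proj(1) [OF s(1)] m(1,2) by (simp add: a(1) b(1))
  then obtain r where r: "r \<in> carrier R" "ev t = ev s \<oplus>\<^bsub>PP\<^esub> pz r"
    using ev_cong [OF t(1) s(1)] by blast
  have cd: "c = d \<oplus>\<^bsub>CQ\<^esub> cp r" "w = z \<oplus>\<^bsub>E\<^esub> C.chat r"
    using r(2) by (simp_all add: a(1) b(1) PP_simps)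
  have "d \<oplus>\<^bsub>CQ\<^esub> (cp r \<oplus>\<^bsub>CQ\<^esub> cp x) = d \<oplus>\<^bsub>CQ\<^esub> cp y"
    using m(1,2) b(3) cp_closed [OF r(1)] cp_closed [OF t(2)] by (simp add: cd(1) CQ.M.a_assoc)
  then have "cp (r \<oplus>\<^bsub>R\<^esub> x) = cp y"
    using b(3) cp_closed [OF r(1)] cp_closed [OF t(2)] cp_closed [OF s(2)] r(1) t(2)
    by (simp add: cp_hom)
  then have "C.chat (r \<oplus>\<^bsub>R\<^esub> x) = C.chat y"
    by (intro C.chat_cp_eq) (simp_all add: r t s)
  then have "C.chat r \<oplus>\<^bsub>E\<^esub> C.chat x = C.chat y"
    using r(1) t(2) by (simp add: C.chat_add)
  then show ?thesis
    using b(4) r(1) t(2) by (simp add: m(3,4) cd(2) E.M.a_assoc)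
qed

text \<open>Being total, single-valued and compatible with all operations, the relation is the graph
  of a homomorphism. Totality follows from the homogeneous case, which also provides the
  degrees.\<close>

lemma lift_exists: "\<exists>f\<in>lie_hom K Hat E. \<forall>m\<in>carrier Hat. \<phi> (f m) = fst m"
proof -
  interpret H: lie_superalgebra K Hat by (rule Hat_lie)
  define f where "f m = (THE u. graph m u)" for m
  have f: "f m = u" if "graph m u" for m u
    unfolding f_def using that graph_functional by blast
  have total: "\<exists>u. graph m u" if "m \<in> carrier Hat" for m
    using that
  proof (induction rule: H.homogeneous_induct)
    case (homogeneous p m)
    then show ?case
      using graph_total_grade [of "fst m" p "snd m"] by (cases m) (auto simp: Hat_simps)
  next
    case (add m n)
    then show ?case using graph_add by blast
  qed
  have gf: "graph m (f m)" if "m \<in> carrier Hat" for m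
    using total [OF that] f by blast
  have "f \<in> lie_hom K Hat E"
    unfolding lie_hom_def
  proof (intro CollectI conjI funcsetI ballI allI)
    fix x y c p
    {
      assume x: "x \<in> carrier Hat"
      show "f x \<in> carrier E"
        using graph_closed [OF gf [OF x]] by blast
      {
        assume y: "y \<in> carrier Hat"
        show "f (x \<oplus>\<^bsub>Hat\<^esub> y) = f x \<oplus>\<^bsub>E\<^esub> f y" "f (x \<otimes>\<^bsub>Hat\<^esub> y) = f x \<otimes>\<^bsub>E\<^esub> f y"
          by (rule f [OF graph_add [OF gf [OF x] gf [OF y]]] f [OF graph_mult [OF gf [OF x] gf [OF y]]])+
      }
      assume c: "c \<in> carrier K"
      show "f (c \<odot>\<^bsub>Hat\<^esub> x) = c \<odot>\<^bsub>E\<^esub> f x"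
        by (rule f [OF graph_smult [OF c gf [OF x]]])
    }
    assume x: "x \<in> grade Hat p"
    then obtain u where "u \<in> grade E p" "graph x u"
      using graph_total_grade [of "fst x" p "snd x"] by (cases x) (auto simp: Hat_simps)
    then show "f x \<in> grade E p"
      using f by simp
  qed
  moreover have "\<phi> (f m) = fst m" if "m \<in> carrier Hat" for m
  proof -
    obtain t x where t: "t \<in> sto.tms" "x \<in> carrier R" "(m, f m) = ev t \<oplus>\<^bsub>PP\<^esub> pz x"
      by (rule graphE [OF gf [OF \<open>m \<in> carrier Hat\<close>]])
    obtain a c w where a: "ev t = ((a, c), w)" "a \<in> carrier st" "w \<in> carrier E"
      using ev_closed [OF t(1)] by (auto simp: PP_simps Hat_simps)
    have "fst (fst (m, f m)) = a" "snd (m, f m) = w \<oplus>\<^bsub>E\<^esub> C.chat x"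
      unfolding t(3) using a(2) by (simp_all add: a(1) PP_simps)
    then have "fst m = a" "f m = w \<oplus>\<^bsub>E\<^esub> C.chat x"
      by (simp_all only: fst_conv snd_conv)
    moreover have "\<phi> w = a"
      using ev_proj [OF t(1)] by (simp add: a(1))
    ultimately show ?thesis
      using a t(2) by (simp add: phi_add phi_chat)
  qed
  ultimately show ?thesis by blast
qed

end

section \<open>Universality\<close>

theorem (in skew_unit) sto_hat_universal:
  "universal_central_extension TYPE('e) K Hat st sto_hat_proj"
  unfolding universal_central_extension_def
proof (intro conjI allI impI Hat_central_extension)
  fix E :: "('k, 'e) superalgebra" and \<phi>
  assume "central_extension K E st \<phi>"
  then interpret X: sto_extension K R bar e E \<phi>
    by unfold_locales
  obtain f where f: "f \<in> lie_hom K Hat E" "\<forall>m\<in>carrier Hat. \<phi> (f m) = fst m"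
    using X.lift_exists by blast
  show "\<exists>f \<in> lie_hom K Hat E. (\<forall>x\<in>carrier Hat. \<phi> (f x) = sto_hat_proj x) \<and>
      (\<forall>f' \<in> lie_hom K Hat E. (\<forall>x\<in>carrier Hat. \<phi> (f' x) = sto_hat_proj x) \<longrightarrow>
        (\<forall>x\<in>carrier Hat. f' x = f x))"
    using f X.lift_unique by (intro bexI [of _ f]) (auto simp: sto_hat_proj_def)
qed

theorem theorem6p6:
  fixes K :: "('k, 'n) ring_scheme"
    and R :: "('k, 'r, 'm) superalgebra_scheme"
    and bar :: "'r \<Rightarrow> 'r"
    and e :: 'r
  assumes two_unit: "\<one>\<^bsub>K\<^esub> \<oplus>\<^bsub>K\<^esub> \<one>\<^bsub>K\<^esub> \<in> Units K"
    and R_bar: "superinvolution K R bar"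
    and e_homogeneous: "e \<in> homogeneous R"
    and e_bar: "bar e = \<ominus>\<^bsub>R\<^esub> e"
    and e_central: "\<forall>a\<in>carrier R. e \<otimes>\<^bsub>R\<^esub> a = a \<otimes>\<^bsub>R\<^esub> e"
    and e_unit: "e \<in> Units R"
  shows "universal_central_extension TYPE('e) K (sto_hat K R bar) (sto K R bar) sto_hat_proj"
proof -
  interpret superinvolution K R bar by (rule R_bar)
  obtain p where e: "e \<in> grade R p"
    using e_homogeneous by (auto simp: homogeneous_def)
  have ec: "e \<in> carrier R"
    by (rule grade_closed [OF e])
  have "\<exists>u. skew_unit K R bar u"
  proof (cases "p = 0")
    case True
    then have "skew_unit K R bar e"
      using two_unit e e_bar e_central e_unit by unfold_locales simp_all
    then show ?thesis ..
  next
    case False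
    then have p: "p = 1"
      by simp
    have "skew_unit K R bar (e \<otimes>\<^bsub>R\<^esub> e)"
    proof unfold_locales
      show "e \<otimes>\<^bsub>R\<^esub> e \<in> grade R 0"
        using prod_grade [OF e e] by simp
      \<comment> \<open>For odd \<open>e\<close> the sign rule of \<open>bar\<close> supplies the
        minus: the product of the two factors \<open>-e\<close> is \<open>e e\<close>, and reversing
        two odd elements negates it.\<close>
      show "bar (e \<otimes>\<^bsub>R\<^esub> e) = \<ominus>\<^bsub>R\<^esub> (e \<otimes>\<^bsub>R\<^esub> e)"
        using bar_mult [OF e e] ec by (simp add: p e_bar l_minus r_minus)
      show "e \<otimes>\<^bsub>R\<^esub> e \<otimes>\<^bsub>R\<^esub> a = a \<otimes>\<^bsub>R\<^esub> (e \<otimes>\<^bsub>R\<^esub> e)" if "a \<in> carrier R" for a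
        using that ec e_central by (metis m_assoc)
      show "e \<otimes>\<^bsub>R\<^esub> e \<in> Units R"
        using e_unit by simp
    qed (rule two_unit)
    then show ?thesis ..
  qed
  then obtain u where "skew_unit K R bar u" ..
  then show ?thesis
    by (rule skew_unit.sto_hat_universal)
qed

end
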